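(* If there is some $x\in(1/2,1)$ such that Node-Weighted APSP in directed or undirected $n$-node graphs can be solved in time $O(n^{2+x-\epsilon})$ for some $\epsilon>0$, then $n^{1-x}$-row weight $(n,n^x)$-Min-Plus Product can be solved in time $O(n^{2+x-\epsilon'})$ for some $\epsilon'>0$.
   Context: $d$-row weight $(n,D)$-Min-Plus Product: given an $n\times D$ integer matrix $A$ and a $D\times n$ integer matrix $B$ such that every row of $A$ and every column of $B$ has at most $d$ distinct entries, compute $C[i,j]=\min_k(A[i,k]+B[k,j])$. Node-Weighted APSP: given a graph with node weights $w$, compute all distances where a path $(v_0,\dots,v_\ell)$ has weight $w(v_1)+\dots+w(v_\ell)$. Integers are polynomially bounded in $n$; word-RAM with $O(\log n)$-bit words. *)

theory Defs
  imports Complex_Main "HOL-Library.Landau_Symbols"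
begin

section \<open>The word RAM\<close>

text \<open>
  A machine with \<open>w\<close>-bit words. Registers and memory cells hold naturals below \<open>2 ^ w\<close>, arithmetic
  is modulo \<open>2 ^ w\<close>, memory is addressed by words, and every instruction takes one step. A program
  is a finite list of instructions; the machine halts when the program counter leaves the list.
  The machine is deterministic.
\<close>

datatype binop = ADD | SUB | MUL | DIV | MOD | AND | OR | XOR | SHL | SHR

fun eval_binop :: "nat \<Rightarrow> binop \<Rightarrow> nat \<Rightarrow> nat \<Rightarrow> nat" where
  "eval_binop w ADD a b = take_bit w (a + b)"
| "eval_binop w SUB a b = nat (take_bit w (int a - int b))"
| "eval_binop w MUL a b = take_bit w (a * b)"
| "eval_binop w DIV a b = a div b"
| "eval_binop w MOD a b = a mod b"
| "eval_binop w AND a b = Bit_Operations.and a b"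
| "eval_binop w OR a b = Bit_Operations.or a b"
| "eval_binop w XOR a b = Bit_Operations.xor a b"
| "eval_binop w SHL a b = take_bit w (push_bit b a)"
| "eval_binop w SHR a b = drop_bit b a"

datatype instr =
    SetConst nat nat
  | BinOp binop nat nat nat
  | Load nat nat
  | Store nat nat
  | Jump nat
  | JumpEq nat nat nat
  | JumpLess nat nat nat

text \<open>A state consists of the program counter, the registers and the memory.\<close>

type_synonym state = "nat \<times> (nat \<Rightarrow> nat) \<times> (nat \<Rightarrow> nat)"

fun exec :: "nat \<Rightarrow> instr \<Rightarrow> state \<Rightarrow> state" where
  "exec w (SetConst r a) (pc, R, M) = (Suc pc, R(r := take_bit w a), M)"
| "exec w (BinOp f r s t) (pc, R, M) = (Suc pc, R(r := eval_binop w f (R s) (R t)), M)"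
| "exec w (Load r s) (pc, R, M) = (Suc pc, R(r := M (R s)), M)"
| "exec w (Store r s) (pc, R, M) = (Suc pc, R, M(R r := R s))"
| "exec w (Jump l) (pc, R, M) = (l, R, M)"
| "exec w (JumpEq r s l) (pc, R, M) = (if R r = R s then l else Suc pc, R, M)"
| "exec w (JumpLess r s l) (pc, R, M) = (if R r < R s then l else Suc pc, R, M)"

definition halted :: "instr list \<Rightarrow> state \<Rightarrow> bool" where
  "halted P s \<longleftrightarrow> length P \<le> fst s"

definition step :: "nat \<Rightarrow> instr list \<Rightarrow> state \<Rightarrow> state" where
  "step w P s = (if halted P s then s else exec w (P ! fst s) s)"

definition memory :: "state \<Rightarrow> nat \<Rightarrow> nat" where
  "memory s = snd (snd s)"

text \<open>
  Inputs are lists of integers, placed at addresses \<open>0, 1, \<dots>\<close> in two's complement; the registers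
  and the rest of the memory are initially zero. Outputs are read from addresses \<open>0, 1, \<dots>\<close> as
  signed words, where the word \<open>2 ^ (w - 1)\<close> (the smallest signed word) is reserved for the value
  infinity, represented by \<^const>\<open>None\<close>.
\<close>

definition initial_state :: "nat \<Rightarrow> int list \<Rightarrow> state" where
  "initial_state w xs =
     (0, \<lambda>_. 0, \<lambda>a. if a < length xs then nat (take_bit w (xs ! a)) else 0)"

definition decode :: "nat \<Rightarrow> nat \<Rightarrow> int option" where
  "decode w v = (if v = 2 ^ (w - 1) then None else Some (signed_take_bit (w - 1) (int v)))"

definition word_size :: "nat \<Rightarrow> nat \<Rightarrow> nat" where
  "word_size k n = k * nat \<lceil>log 2 (real n + 2)\<rceil>"

text \<open>
  A problem is a set of triples consisting of the size parameter \<open>n\<close> of an instance, its input and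
  its output. An algorithm may choose the constant factor \<open>k\<close> of the word size, but the same one
  for all \<open>n\<close>. Outputs have to be exact, so a word size too small for them is of no use.
\<close>

type_synonym problem = "(nat \<times> int list \<times> int option list) set"

definition solvable_in_time :: "problem \<Rightarrow> (nat \<Rightarrow> real) \<Rightarrow> bool" where
  "solvable_in_time Q f \<longleftrightarrow>
     (\<exists>P k T. k \<ge> 1 \<and> (\<lambda>n. real (T n)) \<in> O(f) \<and>
        (\<forall>(n, xs, ys) \<in> Q.
           let w = word_size k n; s = (step w P ^^ T n) (initial_state w xs)
           in halted P s \<and> (\<forall>i < length ys. decode w (memory s i) = ys ! i)))"

text \<open>
  For a problem about polynomially bounded integers, \<open>Q c\<close> consists of the instances whose integers
  are at most \<open>n ^ c\<close> in absolute value. The running time must be attained for every constant \<open>c\<close>.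
\<close>

definition poly_bounded_solvable_in_time :: "(nat \<Rightarrow> problem) \<Rightarrow> (nat \<Rightarrow> real) \<Rightarrow> bool" where
  "poly_bounded_solvable_in_time Q f \<longleftrightarrow> (\<forall>c. solvable_in_time (Q c) f)"


section \<open>Node-Weighted APSP\<close>

definition paths :: "(nat \<times> nat) set \<Rightarrow> nat \<Rightarrow> nat \<Rightarrow> nat list set" where
  "paths E u v =
     {p. p \<noteq> [] \<and> hd p = u \<and> last p = v \<and> successively (\<lambda>a b. (a, b) \<in> E) p}"

definition path_weight :: "(nat \<Rightarrow> int) \<Rightarrow> nat list \<Rightarrow> int" where
  "path_weight wt p = (\<Sum>v\<leftarrow>tl p. wt v)"

text \<open>
  Paths may repeat nodes. The infimum is an attained minimum in the absence of negative cycles.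
\<close>

definition distance :: "(nat \<times> nat) set \<Rightarrow> (nat \<Rightarrow> int) \<Rightarrow> nat \<Rightarrow> nat \<Rightarrow> int option" where
  "distance E wt u v =
     (if paths E u v = {} then None else Some (INF p \<in> paths E u v. path_weight wt p))"

definition no_negative_cycle :: "(nat \<times> nat) set \<Rightarrow> (nat \<Rightarrow> int) \<Rightarrow> bool" where
  "no_negative_cycle E wt \<longleftrightarrow> (\<forall>u. \<forall>p \<in> paths E u u. path_weight wt p \<ge> 0)"

definition directed_graph :: "nat \<Rightarrow> (nat \<times> nat) set \<Rightarrow> bool" where
  "directed_graph n E \<longleftrightarrow> E \<subseteq> {..<n} \<times> {..<n} \<and> irrefl E"

text \<open>An undirected edge is represented by the two corresponding arcs.\<close>

definition undirected_graph :: "nat \<Rightarrow> (nat \<times> nat) set \<Rightarrow> bool" where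
  "undirected_graph n E \<longleftrightarrow> directed_graph n E \<and> sym E"

definition apsp_input :: "nat \<Rightarrow> (nat \<times> nat) set \<Rightarrow> (nat \<Rightarrow> int) \<Rightarrow> int list" where
  "apsp_input n E wt =
     int n # map wt [0..<n] @ [of_bool ((u, v) \<in> E). u \<leftarrow> [0..<n], v \<leftarrow> [0..<n]]"

definition apsp_output :: "nat \<Rightarrow> (nat \<times> nat) set \<Rightarrow> (nat \<Rightarrow> int) \<Rightarrow> int option list" where
  "apsp_output n E wt = [distance E wt u v. u \<leftarrow> [0..<n], v \<leftarrow> [0..<n]]"

definition node_weighted_apsp ::
  "(nat \<Rightarrow> (nat \<times> nat) set \<Rightarrow> bool) \<Rightarrow> nat \<Rightarrow> problem" where
  "node_weighted_apsp is_graph c =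
     {(n, apsp_input n E wt, apsp_output n E wt) | n E wt.
        n \<ge> 1 \<and> is_graph n E \<and> (\<forall>v<n. \<bar>wt v\<bar> \<le> int n ^ c) \<and> no_negative_cycle E wt}"


section \<open>Min-Plus Product\<close>

definition min_plus :: "nat \<Rightarrow> (nat \<Rightarrow> nat \<Rightarrow> int) \<Rightarrow> (nat \<Rightarrow> nat \<Rightarrow> int) \<Rightarrow> nat \<Rightarrow> nat \<Rightarrow> int" where
  "min_plus D A B i j = Min ((\<lambda>k. A i k + B k j) ` {..<D})"

definition min_plus_input ::
  "nat \<Rightarrow> nat \<Rightarrow> (nat \<Rightarrow> nat \<Rightarrow> int) \<Rightarrow> (nat \<Rightarrow> nat \<Rightarrow> int) \<Rightarrow> int list" where
  "min_plus_input n D A B =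
     int n # int D # [A i k. i \<leftarrow> [0..<n], k \<leftarrow> [0..<D]] @ [B k j. k \<leftarrow> [0..<D], j \<leftarrow> [0..<n]]"

definition min_plus_output ::
  "nat \<Rightarrow> nat \<Rightarrow> (nat \<Rightarrow> nat \<Rightarrow> int) \<Rightarrow> (nat \<Rightarrow> nat \<Rightarrow> int) \<Rightarrow> int option list" where
  "min_plus_output n D A B = [Some (min_plus D A B i j). i \<leftarrow> [0..<n], j \<leftarrow> [0..<n]]"

text \<open>
  The parameters \<open>d\<close> and \<open>D\<close> are functions of \<open>n\<close>. A non-integral inner dimension is rounded down.
\<close>

definition row_weight_min_plus ::
  "(nat \<Rightarrow> real) \<Rightarrow> (nat \<Rightarrow> real) \<Rightarrow> nat \<Rightarrow> problem" where
  "row_weight_min_plus d D c =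
     {(n, min_plus_input n m A B, min_plus_output n m A B) | n m A B.
        n \<ge> 1 \<and> m = nat \<lfloor>D n\<rfloor> \<and>
        (\<forall>i<n. \<forall>k<m. \<bar>A i k\<bar> \<le> int n ^ c) \<and>
        (\<forall>k<m. \<forall>j<n. \<bar>B k j\<bar> \<le> int n ^ c) \<and>
        (\<forall>i<n. real (card ((\<lambda>k. A i k) ` {..<m})) \<le> d n) \<and>
        (\<forall>j<n. real (card ((\<lambda>k. B k j) ` {..<m})) \<le> d n)}"

end

theory Submission
  imports Defs
begin

text \<open>
  An undirected graph is a symmetric digraph, so it suffices to use an algorithm for undirected graphs.
  Shift the entries to be non-negative and compute the products \<open>C\<^sub>l\<close> of the matrices without their
  \<open>l\<close> lowest bits, for decreasing \<open>l\<close>. Since \<open>C\<^sub>l\<close> lies between \<open>2 C\<^sub>l\<^sub>+\<^sub>1\<close> and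
  \<open>2 C\<^sub>l\<^sub>+\<^sub>1 + 2\<close>, it is enough to find, for each of the three targets \<open>Y = 2 C\<^sub>l\<^sub>+\<^sub>1 + t\<close>, a
  sum \<open>A i k + B k j \<le> Y i j\<close> whenever some sum is equal to \<open>Y i j\<close>.

  For a column \<open>j\<close> consider the pairs \<open>(i, k)\<close> such that \<open>Y i j - A i k\<close> is one of the at most \<open>d\<close>
  values in this column. If fewer than \<open>n D / g\<close> of them are uncovered, they are enumerated; otherwise
  \<open>j\<close> becomes a pivot and covers them, which happens at most \<open>g\<close> times. Rows are treated in the
  same way. If \<open>(i, k)\<close> is covered by a pivot column \<open>r\<close> and \<open>(j, k)\<close> by a pivot row \<open>s\<close>, then
  \<open>A i k = Y i r - v\<close> and \<open>B k j = Y s j - v'\<close>, so the sum is determined by \<open>v + v'\<close>: it is a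
  distance in a graph with four layers, the inner ones being the pairs \<open>(v, k)\<close> and \<open>(v', k)\<close> with
  node weights \<open>- v\<close> and \<open>- v'\<close> up to a constant. As \<open>d D \<le> n\<close>, this graph has \<open>O(n)\<close> nodes.

  The time per target is \<open>n\<^sup>2 d + n\<^sup>2 D / g\<close> and \<open>g\<^sup>2\<close> calls of the shortest path algorithm, which
  for \<open>g\<close> a small power of \<open>n\<close> is polynomially smaller than \<open>n\<^sup>2 D\<close>; the first term is where
  \<open>x > 1 / 2\<close> is used.
\<close>

subsection \<open>A structured language and its compiler\<close>

text \<open>Covering looks at values only: the value complementing \<open>A i k\<close> must occur
  somewhere in the pivot column, not necessarily at position \<open>k\<close>. Hence every value of
  the pivot gets a node for each of the \<open>D\<close> positions, and a path through position
  \<open>k\<close> always yields a genuine sum \<open>A i k + B k j\<close>. Stored candidates are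
  therefore never below the minimum, and only upper bounds have to be proved.

  Undirected edges allow walks that turn back. Every node on an edge has weight close to
  \<open>M\<close>, and \<open>M\<close> is so large compared with the values that four steps cost
  more than \<open>3 * M\<close>, whereas three steps forward cost at most that; three is also the
  least number of steps across the layers.

  A pivot is chosen only if it removes at least \<open>n D / g\<close> of the \<open>n D\<close>
  pairs, which bounds the number of pivots by \<open>g\<close>.

  The machine model adds an obstacle of its own: the shortest path program is only known to be
  correct for its own word size, while the tables require longer words. It is simulated step by step
  with masked arithmetic, its memory being one row of an array.\<close>

text \<open>Registers and arrays are named by numbers, and \<open>Rd t a b c d\<close> is the cell \<open>(a, b, c, d)\<close> of
  array \<open>t\<close>. The operators \<open>Plus\<close>, \<open>Minus\<close> and \<open>Times\<close> are those of natural numbers and may be used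
  only if the result fits into a word, whereas \<open>Bin\<close> gives access to the machine operations.\<close>

type_synonym index = "nat \<times> nat \<times> nat \<times> nat \<times> nat"
type_synonym store = "(nat \<Rightarrow> nat) \<times> (index \<Rightarrow> nat)"

text \<open>Cells are mostly written \<open>(t, r)\<close> with the remaining index \<open>r\<close>
  left whole; splitting quantified tuples into components would stop such facts from
  matching.\<close>

declare split_paired_All [simp del] split_paired_Ex [simp del]

datatype exp =
    Con nat
  | Var nat
  | Bin binop exp exp
  | Plus exp exp
  | Minus exp exp
  | Times exp exp
  | Rd nat exp exp exp exp

datatype cond = Lt exp exp | Eq exp exp

datatype com =
    Skip
  | Assign nat exp
  | Write nat exp exp exp exp exp
  | Seq com com  (infixr \<open>;;\<close> 60)
  | Branch cond com com
  | Loop cond com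

fun modified :: "com \<Rightarrow> nat set" where
  "modified Skip = {}"
| "modified (Assign x e) = {x}"
| "modified (Write t a b c d e) = {}"
| "modified (c1 ;; c2) = modified c1 \<union> modified c2"
| "modified (Branch b c1 c2) = modified c1 \<union> modified c2"
| "modified (Loop b c) = modified c"

fun written :: "com \<Rightarrow> nat set" where
  "written Skip = {}"
| "written (Assign x e) = {}"
| "written (Write t a b c d e) = {t}"
| "written (c1 ;; c2) = written c1 \<union> written c2"
| "written (Branch b c1 c2) = written c1 \<union> written c2"
| "written (Loop b c) = written c"

fun exp_vars :: "exp \<Rightarrow> nat set" where
  "exp_vars (Con a) = {}"
| "exp_vars (Var x) = {x}"
| "exp_vars (Bin f a b) = exp_vars a \<union> exp_vars b"
| "exp_vars (Plus a b) = exp_vars a \<union> exp_vars b"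
| "exp_vars (Minus a b) = exp_vars a \<union> exp_vars b"
| "exp_vars (Times a b) = exp_vars a \<union> exp_vars b"
| "exp_vars (Rd t a b c d) = exp_vars a \<union> exp_vars b \<union> exp_vars c \<union> exp_vars d"

fun cond_vars :: "cond \<Rightarrow> nat set" where
  "cond_vars (Lt a b) = exp_vars a \<union> exp_vars b"
| "cond_vars (Eq a b) = exp_vars a \<union> exp_vars b"

fun com_vars :: "com \<Rightarrow> nat set" where
  "com_vars Skip = {}"
| "com_vars (Assign x e) = insert x (exp_vars e)"
| "com_vars (Write t a b c d e) =
     exp_vars a \<union> exp_vars b \<union> exp_vars c \<union> exp_vars d \<union> exp_vars e"
| "com_vars (c1 ;; c2) = com_vars c1 \<union> com_vars c2"
| "com_vars (Branch b c1 c2) = cond_vars b \<union> com_vars c1 \<union> com_vars c2"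
| "com_vars (Loop b c) = cond_vars b \<union> com_vars c"

text \<open>Array access presupposes the base in register 0. Singling out the code that uses arrays
  allows \<open>prepare\<close>, which computes this base, to be compiled by the same
  compiler.\<close>

fun exp_arrays :: "exp \<Rightarrow> bool" where
  "exp_arrays (Con a) = False"
| "exp_arrays (Var x) = False"
| "exp_arrays (Bin f a b) = (exp_arrays a \<or> exp_arrays b)"
| "exp_arrays (Plus a b) = (exp_arrays a \<or> exp_arrays b)"
| "exp_arrays (Minus a b) = (exp_arrays a \<or> exp_arrays b)"
| "exp_arrays (Times a b) = (exp_arrays a \<or> exp_arrays b)"
| "exp_arrays (Rd t a b c d) = True"

fun cond_arrays :: "cond \<Rightarrow> bool" where
  "cond_arrays (Lt a b) = (exp_arrays a \<or> exp_arrays b)"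
| "cond_arrays (Eq a b) = (exp_arrays a \<or> exp_arrays b)"

fun com_arrays :: "com \<Rightarrow> bool" where
  "com_arrays Skip = False"
| "com_arrays (Assign x e) = exp_arrays e"
| "com_arrays (Write t a b c d e) = True"
| "com_arrays (c1 ;; c2) = (com_arrays c1 \<or> com_arrays c2)"
| "com_arrays (Branch b c1 c2) = (cond_arrays b \<or> com_arrays c1 \<or> com_arrays c2)"
| "com_arrays (Loop b c) = (cond_arrays b \<or> com_arrays c)"

fun comp_exp :: "exp \<Rightarrow> nat \<Rightarrow> instr list" where
  "comp_exp (Con a) r = [SetConst r a]"
| "comp_exp (Var x) r = [BinOp OR r x x]"
| "comp_exp (Bin f a b) r = comp_exp a r @ comp_exp b (Suc r) @ [BinOp f r r (Suc r)]"
| "comp_exp (Plus a b) r = comp_exp a r @ comp_exp b (Suc r) @ [BinOp ADD r r (Suc r)]"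
| "comp_exp (Minus a b) r = comp_exp a r @ comp_exp b (Suc r) @ [BinOp SUB r r (Suc r)]"
| "comp_exp (Times a b) r = comp_exp a r @ comp_exp b (Suc r) @ [BinOp MUL r r (Suc r)]"
| "comp_exp (Rd t a b c d) r =
     [SetConst r t] @
     [BinOp MUL r r 0] @ comp_exp a (Suc r) @ [BinOp ADD r r (Suc r)] @
     [BinOp MUL r r 0] @ comp_exp b (Suc r) @ [BinOp ADD r r (Suc r)] @
     [BinOp MUL r r 0] @ comp_exp c (Suc r) @ [BinOp ADD r r (Suc r)] @
     [BinOp MUL r r 0] @ comp_exp d (Suc r) @ [BinOp ADD r r (Suc r)] @ [Load r r]"

text \<open>Horner's rule with the base in register 0: the address is the number with digits
  \<open>t\<close>, \<open>a\<close>, \<open>b\<close>, \<open>c\<close>, \<open>d\<close>. The same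
  code stands inside \<open>comp_exp\<close>, where a load follows.\<close>

definition comp_addr :: "nat \<Rightarrow> exp \<Rightarrow> exp \<Rightarrow> exp \<Rightarrow> exp \<Rightarrow> nat \<Rightarrow> instr list" where
  "comp_addr t a b c d r =
     [SetConst r t] @
     [BinOp MUL r r 0] @ comp_exp a (Suc r) @ [BinOp ADD r r (Suc r)] @
     [BinOp MUL r r 0] @ comp_exp b (Suc r) @ [BinOp ADD r r (Suc r)] @
     [BinOp MUL r r 0] @ comp_exp c (Suc r) @ [BinOp ADD r r (Suc r)] @
     [BinOp MUL r r 0] @ comp_exp d (Suc r) @ [BinOp ADD r r (Suc r)]"

fun comp_cond :: "cond \<Rightarrow> nat \<Rightarrow> instr list" where
  "comp_cond (Lt a b) r = comp_exp a r @ comp_exp b (Suc r)"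
| "comp_cond (Eq a b) r = comp_exp a r @ comp_exp b (Suc r)"

fun cond_jump :: "cond \<Rightarrow> nat \<Rightarrow> nat \<Rightarrow> instr" where
  "cond_jump (Lt a b) r l = JumpLess r (Suc r) l"
| "cond_jump (Eq a b) r l = JumpEq r (Suc r) l"

text \<open>The length of the code does not depend on where it is placed, so forward jump targets
  can be computed before the code in between is generated.\<close>

fun comp_len :: "nat \<Rightarrow> com \<Rightarrow> nat" where
  "comp_len r Skip = 0"
| "comp_len r (Assign x e) = length (comp_exp e r) + 1"
| "comp_len r (Write t a b c d e) =
     length (comp_addr t a b c d r) + length (comp_exp e (Suc r)) + 1"
| "comp_len r (c1 ;; c2) = comp_len r c1 + comp_len r c2"
| "comp_len r (Branch b c1 c2) =
     length (comp_cond b r) + 2 + comp_len r c1 + comp_len r c2"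
| "comp_len r (Loop b c) = length (comp_cond b r) + 3 + comp_len r c"

text \<open>Jumps are absolute, so the compiler receives the address \<open>pc\<close> of the first instruction.
  Registers from \<open>r\<close> on are scratch space; register 0 holds the base of the addressing scheme.\<close>

fun comp_com :: "nat \<Rightarrow> nat \<Rightarrow> com \<Rightarrow> instr list" where
  "comp_com r pc Skip = []"
| "comp_com r pc (Assign x e) = comp_exp e r @ [BinOp OR x r r]"
| "comp_com r pc (Write t a b c d e) =
     comp_addr t a b c d r @ comp_exp e (Suc r) @ [Store r (Suc r)]"
| "comp_com r pc (c1 ;; c2) = comp_com r pc c1 @ comp_com r (pc + comp_len r c1) c2"
| "comp_com r pc (Branch b c1 c2) =
     comp_cond b r
     @ [cond_jump b r (pc + length (comp_cond b r) + 2 + comp_len r c2)]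
     @ comp_com r (pc + length (comp_cond b r) + 1) c2
     @ [Jump (pc + length (comp_cond b r) + 2 + comp_len r c2 + comp_len r c1)]
     @ comp_com r (pc + length (comp_cond b r) + 2 + comp_len r c2) c1"
| "comp_com r pc (Loop b c) =
     comp_cond b r
     @ [cond_jump b r (pc + length (comp_cond b r) + 2)]
     @ [Jump (pc + length (comp_cond b r) + 3 + comp_len r c)]
     @ comp_com r (pc + length (comp_cond b r) + 2) c
     @ [Jump pc]"

lemma length_comp_com [simp]: "length (comp_com r pc c) = comp_len r c"
  by (induction c arbitrary: pc) auto

text \<open>The five components of an index, each below \<open>Z\<close>, are packed into a single
  address, which has to fit into a word.\<close>

locale word_machine =
  fixes w Z :: nat
  assumes Z_power: "Z ^ 5 \<le> 2 ^ w"
begin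

section \<open>Semantics with overflow conditions and costs\<close>

fun ev :: "exp \<Rightarrow> store \<Rightarrow> nat" where
  "ev (Con a) s = a"
| "ev (Var x) s = fst s x"
| "ev (Bin f a b) s = eval_binop w f (ev a s) (ev b s)"
| "ev (Plus a b) s = ev a s + ev b s"
| "ev (Minus a b) s = ev a s - ev b s"
| "ev (Times a b) s = ev a s * ev b s"
| "ev (Rd t a b c d) s = snd s (t, ev a s, ev b s, ev c s, ev d s)"

fun ok :: "exp \<Rightarrow> store \<Rightarrow> bool" where
  "ok (Con a) s \<longleftrightarrow> a < 2 ^ w"
| "ok (Var x) s \<longleftrightarrow> True"
| "ok (Bin f a b) s \<longleftrightarrow> ok a s \<and> ok b s"
| "ok (Plus a b) s \<longleftrightarrow> ok a s \<and> ok b s \<and> ev a s + ev b s < 2 ^ w"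
| "ok (Minus a b) s \<longleftrightarrow> ok a s \<and> ok b s \<and> ev b s \<le> ev a s \<and> ev a s < 2 ^ w"
| "ok (Times a b) s \<longleftrightarrow> ok a s \<and> ok b s \<and> ev a s * ev b s < 2 ^ w"
| "ok (Rd t a b c d) s \<longleftrightarrow> ok a s \<and> ok b s \<and> ok c s \<and> ok d s \<and>
     t < Z \<and> ev a s < Z \<and> ev b s < Z \<and> ev c s < Z \<and> ev d s < Z"

fun ev_cond :: "cond \<Rightarrow> store \<Rightarrow> bool" where
  "ev_cond (Lt a b) s \<longleftrightarrow> ev a s < ev b s"
| "ev_cond (Eq a b) s \<longleftrightarrow> ev a s = ev b s"

fun ok_cond :: "cond \<Rightarrow> store \<Rightarrow> bool" where
  "ok_cond (Lt a b) s \<longleftrightarrow> ok a s \<and> ok b s"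
| "ok_cond (Eq a b) s \<longleftrightarrow> ok a s \<and> ok b s"

definition set_reg :: "nat \<Rightarrow> nat \<Rightarrow> store \<Rightarrow> store" where
  "set_reg x a s = ((fst s)(x := a), snd s)"

definition set_cell :: "index \<Rightarrow> nat \<Rightarrow> store \<Rightarrow> store" where
  "set_cell i a s = (fst s, (snd s)(i := a))"

lemma fst_set_reg [simp]: "fst (set_reg x a s) = (fst s)(x := a)"
  and snd_set_reg [simp]: "snd (set_reg x a s) = snd s"
  and fst_set_cell [simp]: "fst (set_cell i a s) = fst s"
  and snd_set_cell [simp]: "snd (set_cell i a s) = (snd s)(i := a)"
  by (auto simp: set_reg_def set_cell_def)

text \<open>A test or an elementary command costs one unit whatever the size of its expressions,
  which is bounded by the program text and enters only through \<open>slowdown\<close>. No rule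
  applies if an \<open>ok\<close> condition fails, so an execution certifies the absence of
  overflow.\<close>

inductive big_step :: "com \<Rightarrow> store \<Rightarrow> nat \<Rightarrow> store \<Rightarrow> bool" where
  Skip: "big_step Skip s 1 s"
| Assign: "ok e s \<Longrightarrow> big_step (Assign x e) s 1 (set_reg x (ev e s) s)"
| Write: "ok (Rd t a b c d) s \<Longrightarrow> ok e s \<Longrightarrow>
    big_step (Write t a b c d e) s 1
      (set_cell (t, ev a s, ev b s, ev c s, ev d s) (ev e s) s)"
| Seq: "big_step c1 s t1 s1 \<Longrightarrow> big_step c2 s1 t2 s2 \<Longrightarrow> big_step (c1 ;; c2) s (t1 + t2) s2"
| Branch_True: "ok_cond b s \<Longrightarrow> ev_cond b s \<Longrightarrow> big_step c1 s t s1 \<Longrightarrow>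
    big_step (Branch b c1 c2) s (t + 1) s1"
| Branch_False: "ok_cond b s \<Longrightarrow> \<not> ev_cond b s \<Longrightarrow> big_step c2 s t s1 \<Longrightarrow>
    big_step (Branch b c1 c2) s (t + 1) s1"
| Loop_True: "ok_cond b s \<Longrightarrow> ev_cond b s \<Longrightarrow> big_step c s t1 s1 \<Longrightarrow>
    big_step (Loop b c) s1 t2 s2 \<Longrightarrow> big_step (Loop b c) s (t1 + t2 + 1) s2"
| Loop_False: "ok_cond b s \<Longrightarrow> \<not> ev_cond b s \<Longrightarrow> big_step (Loop b c) s 1 s"

definition agree :: "nat set \<Rightarrow> nat set \<Rightarrow> store \<Rightarrow> store \<Rightarrow> bool" where
  "agree X Y s s' \<longleftrightarrow> (\<forall>x. x \<notin> X \<longrightarrow> fst s' x = fst s x) \<and>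
     (\<forall>t i. t \<notin> Y \<longrightarrow> snd s' (t, i) = snd s (t, i))"

lemma agree_reg: "agree X Y s s' \<Longrightarrow> x \<notin> X \<Longrightarrow> fst s' x = fst s x"
  and agree_cell: "agree X Y s s' \<Longrightarrow> t \<notin> Y \<Longrightarrow> snd s' (t, i) = snd s (t, i)"
  unfolding agree_def by blast+

lemma agree_refl [simp]: "agree X Y s s"
  by (auto simp: agree_def)

lemma agree_trans: "agree X Y s s' \<Longrightarrow> agree X' Y' s' s'' \<Longrightarrow> agree (X \<union> X') (Y \<union> Y') s s''"
  by (auto simp: agree_def)

lemma agree_mono: "agree X Y s s' \<Longrightarrow> X \<subseteq> X' \<Longrightarrow> Y \<subseteq> Y' \<Longrightarrow> agree X' Y' s s'"
  by (auto simp: agree_def)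

lemma big_step_agree: "big_step c s t s' \<Longrightarrow> agree (modified c) (written c) s s'"
  by (induction rule: big_step.induct) (auto simp: agree_def)

end

context word_machine begin

subsection \<open>Compiler correctness\<close>

definition enc :: "index \<Rightarrow> nat" where
  "enc = (\<lambda>(t, a, b, c, d). (((t * Z + a) * Z + b) * Z + c) * Z + d)"

definition small :: "index \<Rightarrow> bool" where
  "small = (\<lambda>(t, a, b, c, d). t < Z \<and> a < Z \<and> b < Z \<and> c < Z \<and> d < Z)"

lemma digit_less: "x < Z ^ m \<Longrightarrow> a < Z \<Longrightarrow> x * Z + a < Z ^ Suc m" for x a :: nat
proof -
  assume *: "x < Z ^ m" "a < Z"
  have "Suc x * Z \<le> Z ^ m * Z" using * by (intro mult_right_mono) auto
  then show ?thesis using * by (simp add: mult.commute)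
qed

lemma enc_inj: "small i \<Longrightarrow> small j \<Longrightarrow> enc i = enc j \<Longrightarrow> i = j"
proof -
  have *: "x = y \<and> a = b" if "x * Z + a = y * Z + b" "a < Z" "b < Z" for x y a b
  proof -
    have "x = (x * Z + a) div Z" using that(2) by simp
    also have "\<dots> = (y * Z + b) div Z" by (simp only: that(1))
    also have "\<dots> = y" using that(3) by simp
    finally have "x = y" .
    with that(1) show ?thesis by simp
  qed
  assume sm: "small i" "small j" and eq: "enc i = enc j"
  obtain t a b c d where i: "i = (t, a, b, c, d)" by (cases i)
  obtain t' a' b' c' d' where j: "j = (t', a', b', c', d')" by (cases j)
  have lt: "a < Z" "b < Z" "c < Z" "d < Z" "a' < Z" "b' < Z" "c' < Z" "d' < Z"
    using sm by (simp_all add: i j small_def)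
  from eq have "(((t * Z + a) * Z + b) * Z + c) * Z + d = (((t' * Z + a') * Z + b') * Z + c') * Z + d'"
    by (simp only: i j enc_def prod.case)
  note e1 = *[OF this lt(4,8)]
  note e2 = *[OF conjunct1[OF e1] lt(3,7)]
  note e3 = *[OF conjunct1[OF e2] lt(2,6)]
  note e4 = *[OF conjunct1[OF e3] lt(1,5)]
  show "i = j" unfolding i j
    by (simp only: prod.inject conjunct2[OF e1] conjunct2[OF e2] conjunct2[OF e3] e4)
qed

text \<open>Registers from \<open>r\<close> on are scratch space, and only small indices have an
  address of their own; on everything else the machine may deviate from the store.\<close>

definition rel :: "nat \<Rightarrow> store \<Rightarrow> (nat \<Rightarrow> nat) \<times> (nat \<Rightarrow> nat) \<Rightarrow> bool" where
  "rel r s RM \<longleftrightarrow> (\<forall>x<r. fst RM x = fst s x) \<and> (\<forall>i. small i \<longrightarrow> snd RM (enc i) = snd s i)"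

fun straight :: "instr \<Rightarrow> bool" where
  "straight (Jump l) = False"
| "straight (JumpEq r s l) = False"
| "straight (JumpLess r s l) = False"
| "straight _ = True"

text \<open>The program counter 0 is a dummy, since straight-line instructions act on registers and
  memory independently of it.\<close>

definition block :: "instr list \<Rightarrow> (nat \<Rightarrow> nat) \<times> (nat \<Rightarrow> nat) \<Rightarrow> (nat \<Rightarrow> nat) \<times> (nat \<Rightarrow> nat)" where
  "block is = fold (\<lambda>i s. snd (exec w i (0, s))) is"

lemma block_simps [simp]:
  "block [] s = s"
  "block (is @ js) s = block js (block is s)"
  "block (i # is) s = block is (snd (exec w i (0, s)))"
  by (auto simp: block_def)

lemma step_straight:
  "straight i \<Longrightarrow> exec w i (pc, s) = (Suc pc, snd (exec w i (0, s)))"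
  by (cases i; cases s; simp)

lemma steps_block:
  assumes "list_all straight is" "P = pre @ is @ post"
  shows "(step w P ^^ length is) (length pre, s) = (length pre + length is, block is s)"
  using assms
proof (induction "is" arbitrary: pre s)
  case (Cons i "is")
  have "step w P (length pre, s) = (Suc (length pre), snd (exec w i (0, s)))"
    using Cons.prems step_straight[of i "length pre" s] by (simp add: step_def halted_def nth_append)
  moreover have "(step w P ^^ length is) (length (pre @ [i]), snd (exec w i (0, s))) =
      (length (pre @ [i]) + length is, block is (snd (exec w i (0, s))))"
    using Cons.prems by (intro Cons.IH) auto
  ultimately show ?case
    by (simp add: funpow_swap1)
qed simp

lemma straight_comp_exp [simp]: "list_all straight (comp_exp e r)"
  by (induction e arbitrary: r) auto

lemma comp_exp_Rd: "comp_exp (Rd t a b c d) r = comp_addr t a b c d r @ [Load r r]"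
  by (simp add: comp_addr_def)

lemma straight_comp_addr [simp]: "list_all straight (comp_addr t a b c d r)"
  by (simp add: comp_addr_def)

lemma straight_comp_cond [simp]: "list_all straight (comp_cond b r)"
  by (cases b) auto

text \<open>That registers below the target survive is what permits the second operand to be
  evaluated in the next register while the first one waits.\<close>

definition computes :: "instr list \<Rightarrow> nat \<Rightarrow> nat \<Rightarrow> store \<Rightarrow> nat \<Rightarrow> bool" where
  "computes is r0 r s v \<longleftrightarrow> (\<forall>RM. rel r0 s RM \<longrightarrow>
     (\<exists>R'. block is RM = (R', snd RM) \<and> R' r = v \<and> (\<forall>x<r. R' x = fst RM x)))"

lemma computes_append:
  assumes "computes is r0 r s a" "computes js r0 (Suc r) s b" "r0 \<le> r"
    and "\<And>R M. R r = a \<Longrightarrow> R (Suc r) = b \<Longrightarrow> exec w i (0, R, M) = (Suc 0, R(r := v), M)"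
  shows "computes (is @ js @ [i]) r0 r s v"
  unfolding computes_def
proof (intro allI impI)
  fix RM assume rl: "rel r0 s RM"
  obtain R1 where R1: "block is RM = (R1, snd RM)" "R1 r = a" "\<forall>x<r. R1 x = fst RM x"
    using assms(1) rl unfolding computes_def by blast
  have "rel r0 s (R1, snd RM)" using rl R1 assms(3) by (auto simp: rel_def)
  then obtain R2 where R2: "block js (R1, snd RM) = (R2, snd RM)" "R2 (Suc r) = b"
     "\<forall>x<Suc r. R2 x = R1 x"
    using assms(2) unfolding computes_def by fastforce
  show "\<exists>R'. block (is @ js @ [i]) RM = (R', snd RM) \<and> R' r = v \<and> (\<forall>x<r. R' x = fst RM x)"
    using R1 R2 assms(4)[of R2] by auto
qed

lemma take_bit_less: "a < 2 ^ w \<Longrightarrow> take_bit w a = a" for a :: nat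
  by (simp add: take_bit_nat_eq_self)

text \<open>One more digit of the address. A prefix of \<open>m\<close> digits is below
  \<open>Z ^ m\<close>, and \<open>m < 5\<close> keeps the longer prefix below \<open>Z ^ 5\<close>,
  so neither machine operation wraps around.\<close>

lemma computes_horner:
  assumes "computes is r0 r s x" "computes js r0 (Suc r) s a" "r0 \<le> r" "0 < r0"
    and "x < Z ^ m" "a < Z" "m < 5" "fst s 0 = Z"
  shows "computes (is @ [BinOp MUL r r 0] @ js @ [BinOp ADD r r (Suc r)]) r0 r s (x * Z + a)"
proof -
  have "x * Z + a < Z ^ Suc m" using digit_less assms by simp
  also have "\<dots> \<le> Z ^ 5" using assms by (intro power_increasing) auto
  finally have lt: "x * Z + a < 2 ^ w" using Z_power by linarith
  have 1: "computes (is @ [BinOp MUL r r 0]) r0 r s (x * Z)"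
    unfolding computes_def
  proof (intro allI impI)
    fix RM assume rl: "rel r0 s RM"
    obtain R1 where R1: "block is RM = (R1, snd RM)" "R1 r = x" "\<forall>x<r. R1 x = fst RM x"
      using assms(1) rl unfolding computes_def by blast
    have "R1 0 = Z" using R1 rl assms by (auto simp: rel_def)
    then show "\<exists>R'. block (is @ [BinOp MUL r r 0]) RM = (R', snd RM) \<and> R' r = x * Z \<and> (\<forall>x<r. R' x = fst RM x)"
      using R1 lt by (auto simp: take_bit_less)
  qed
  have "computes ((is @ [BinOp MUL r r 0]) @ js @ [BinOp ADD r r (Suc r)]) r0 r s (x * Z + a)"
    by (rule computes_append[OF 1 assms(2) assms(3)]) (use lt in \<open>auto simp: take_bit_less\<close>)
  then show ?thesis by simp
qed

lemma computes_comp_addr: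
  assumes "\<And>r. r0 \<le> r \<Longrightarrow> computes (comp_exp a r) r0 r s (ev a s)"
    and "\<And>r. r0 \<le> r \<Longrightarrow> computes (comp_exp b r) r0 r s (ev b s)"
    and "\<And>r. r0 \<le> r \<Longrightarrow> computes (comp_exp c r) r0 r s (ev c s)"
    and "\<And>r. r0 \<le> r \<Longrightarrow> computes (comp_exp d r) r0 r s (ev d s)"
    and "ok (Rd t a b c d) s" "fst s 0 = Z" "r0 \<le> r" "0 < r0"
  shows "computes (comp_addr t a b c d r) r0 r s (enc (t, ev a s, ev b s, ev c s, ev d s))"
proof -
  have "t < Z ^ 1" using assms by simp
  have "Z > 0" using assms by simp
  then have "Z \<le> Z ^ 5" by (intro self_le_power) auto
  then have "t < 2 ^ w" using Z_power assms(5) by auto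
  then have 0: "computes [SetConst r t] r0 r s t"
    by (auto simp: computes_def take_bit_less)
  note 1 = computes_horner[OF 0 assms(1)[of "Suc r"] assms(7,8) \<open>t < Z ^ 1\<close>]
  have 1: "computes ([SetConst r t] @ [BinOp MUL r r 0] @ comp_exp a (Suc r) @ [BinOp ADD r r (Suc r)])
       r0 r s (t * Z + ev a s)" 
    using assms by (intro 1) auto
  have l1: "t * Z + ev a s < Z ^ 2" using digit_less[of t 1 "ev a s"] assms by (simp add: numeral_2_eq_2)
  note 2 = computes_horner[OF 1 assms(2)[of "Suc r"] assms(7,8) l1, unfolded append_assoc]
  have l2: "(t * Z + ev a s) * Z + ev b s < Z ^ 3"
    using digit_less[OF l1, of "ev b s"] assms by (simp add: numeral_3_eq_3 numeral_2_eq_2)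
  note 3 = computes_horner[OF 2 assms(3)[of "Suc r"] assms(7,8) l2, unfolded append_assoc]
  have l3: "((t * Z + ev a s) * Z + ev b s) * Z + ev c s < Z ^ 4"
    using digit_less[OF l2, of "ev c s"] assms by (simp add: eval_nat_numeral)
  note 4 = computes_horner[OF 3 assms(4)[of "Suc r"] assms(7,8) l3, unfolded append_assoc]
  show ?thesis unfolding comp_addr_def enc_def prod.case
    using assms by (intro 4) auto
qed

lemma computes_comp_exp:
  assumes "ok e s" "exp_vars e \<subseteq> {..<r0}" "exp_arrays e \<Longrightarrow> fst s 0 = Z" "r0 \<le> r" "0 < r0"
  shows "computes (comp_exp e r) r0 r s (ev e s)"
  using assms
proof (induction e arbitrary: r)
  case (Con a)
  then show ?case by (auto simp: computes_def take_bit_less)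
next
  case (Var x)
  then show ?case by (auto simp: computes_def rel_def)
next
  case (Bin f a b)
  show ?case unfolding comp_exp.simps ev.simps
    by (rule computes_append[OF Bin.IH(1) Bin.IH(2)]) (use Bin.prems in auto)
next
  case (Plus a b)
  show ?case unfolding comp_exp.simps ev.simps
    by (rule computes_append[OF Plus.IH(1) Plus.IH(2)]) (use Plus.prems in \<open>auto simp: take_bit_less\<close>)
next
  case (Minus a b)
  \<comment> \<open>Without a borrow, modular subtraction is the difference of natural
    numbers.\<close>
  have "nat (take_bit w (int x - int y)) = x - y" if "y \<le> x" "x < 2 ^ w" for x y :: nat
  proof -
    have "int x - int y = int (x - y)" using that by simp
    moreover have "take_bit w (x - y) = x - y" using that by (intro take_bit_less) auto
    ultimately show ?thesis by (simp add: of_nat_take_bit[symmetric] del: of_nat_diff)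
  qed
  then show ?case unfolding comp_exp.simps ev.simps
    by (intro computes_append[OF Minus.IH(1) Minus.IH(2)]) (use Minus.prems in auto)
next
  case (Times a b)
  show ?case unfolding comp_exp.simps ev.simps
    by (rule computes_append[OF Times.IH(1) Times.IH(2)]) (use Times.prems in \<open>auto simp: take_bit_less\<close>)
next
  case (Rd t a b c d)
  have 1: "computes (comp_addr t a b c d r) r0 r s (enc (t, ev a s, ev b s, ev c s, ev d s))"
    by (rule computes_comp_addr) (use Rd in auto)
  let ?i = "(t, ev a s, ev b s, ev c s, ev d s)"
  have sm: "small ?i" using Rd.prems by (simp add: small_def)
  show ?case unfolding comp_exp_Rd computes_def ev.simps
  proof (intro allI impI)
    fix RM assume rl: "rel r0 s RM"
    obtain R' where R': "block (comp_addr t a b c d r) RM = (R', snd RM)" "R' r = enc ?i"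
      "\<forall>x<r. R' x = fst RM x"
      using 1 rl unfolding computes_def by blast
    have "snd RM (enc ?i) = snd s ?i" using rl sm unfolding rel_def by blast
    then show "\<exists>R''. block (comp_addr t a b c d r @ [Load r r]) RM = (R'', snd RM) \<and>
       R'' r = snd s ?i \<and> (\<forall>x<r. R'' x = fst RM x)"
      using R' by (intro exI[of _ "R'(r := snd s ?i)"]) simp
  qed
qed

lemma computes_addr:
  assumes "ok (Rd t a b c d) s" "exp_vars (Rd t a b c d) \<subseteq> {..<r0}" "fst s 0 = Z" "r0 \<le> r" "0 < r0"
  shows "computes (comp_addr t a b c d r) r0 r s (enc (t, ev a s, ev b s, ev c s, ev d s))"
  by (rule computes_comp_addr; (rule computes_comp_exp)?) (use assms in auto)

lemma computes_pair:
  assumes "computes is r0 r s a" "computes js r0 (Suc r) s b" "r0 \<le> r" "rel r0 s RM"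
  obtains R' where "block (is @ js) RM = (R', snd RM)" "R' r = a" "R' (Suc r) = b" 
    "rel r0 s (R', snd RM)"
proof -
  obtain R1 where R1: "block is RM = (R1, snd RM)" "R1 r = a" "\<forall>x<r. R1 x = fst RM x"
    using assms unfolding computes_def by blast
  have "rel r0 s (R1, snd RM)" using assms(4) R1 assms(3) by (auto simp: rel_def)
  then obtain R2 where R2: "block js (R1, snd RM) = (R2, snd RM)" "R2 (Suc r) = b"
     "\<forall>x<Suc r. R2 x = R1 x"
    using assms(2) unfolding computes_def by fastforce
  show ?thesis using that[of R2] R1 R2 assms(3,4) by (auto simp: rel_def)
qed

section \<open>Correctness and running time of compiled commands\<close>

lemma cond_jump_correct:
  assumes "ok_cond b s" "cond_vars b \<subseteq> {..<r}" "cond_arrays b \<Longrightarrow> fst s 0 = Z" "0 < r"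
    and "rel r s RM" "P = pre @ comp_cond b r @ [cond_jump b r l] @ post"
  obtains R' where
    "(step w P ^^ (length (comp_cond b r) + 1)) (length pre, RM) =
       (if ev_cond b s then l else length pre + length (comp_cond b r) + 1, R', snd RM)"
    "rel r s (R', snd RM)"
proof -
  obtain x y where b: "b = Lt x y \<or> b = Eq x y" by (cases b) auto
  then have cc: "comp_cond b r = comp_exp x r @ comp_exp y (Suc r)" by auto
  have "computes (comp_exp x r) r r s (ev x s)" "computes (comp_exp y (Suc r)) r (Suc r) s (ev y s)"
    using b assms by (auto intro!: computes_comp_exp)
  then obtain R' where R': "block (comp_cond b r) RM = (R', snd RM)" "R' r = ev x s" "R' (Suc r) = ev y s" 
    "rel r s (R', snd RM)"
    unfolding cc using computes_pair[of _ r r s "ev x s"] assms(5) by blast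
  have 1: "(step w P ^^ length (comp_cond b r)) (length pre, RM) =
       (length pre + length (comp_cond b r), R', snd RM)"
    using steps_block[of "comp_cond b r" P pre, OF _ assms(6)] R' by simp
  have "step w P (length pre + length (comp_cond b r), R', snd RM) =
     (if ev_cond b s then l else length pre + length (comp_cond b r) + 1, R', snd RM)"
    using b R' unfolding assms(6) by (auto simp: step_def halted_def nth_append)
  then show ?thesis using that[of R'] 1 R' by simp
qed

text \<open>Instructions per unit of cost. The contributions of subcommands are added instead of
  maximised, so that one factor bounds every branch and every round of a loop.\<close>

fun slowdown :: "nat \<Rightarrow> com \<Rightarrow> nat" where
  "slowdown r Skip = 0"
| "slowdown r (Assign x e) = length (comp_exp e r) + 1"
| "slowdown r (Write t a b c d e) = length (comp_addr t a b c d r) + length (comp_exp e (Suc r)) + 1"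
| "slowdown r (c1 ;; c2) = slowdown r c1 + slowdown r c2"
| "slowdown r (Branch b c1 c2) = length (comp_cond b r) + 2 + slowdown r c1 + slowdown r c2"
| "slowdown r (Loop b c) = length (comp_cond b r) + 2 + slowdown r c"

definition reaches :: "instr list \<Rightarrow> nat \<Rightarrow> state \<Rightarrow> state \<Rightarrow> bool" where
  "reaches P t s s' \<longleftrightarrow> (\<exists>t'\<le>t. (step w P ^^ t') s = s')"

lemma reaches_trans: "reaches P t s s' \<Longrightarrow> reaches P t' s' s'' \<Longrightarrow> reaches P (t + t') s s''"
proof -
  assume "reaches P t s s'" "reaches P t' s' s''"
  then obtain u u' where "u \<le> t" "(step w P ^^ u) s = s'" "u' \<le> t'" "(step w P ^^ u') s' = s''"
    unfolding reaches_def by blast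
  then show ?thesis unfolding reaches_def by (intro exI[of _ "u' + u"]) (simp add: funpow_add)
qed

lemma reaches_mono: "reaches P t s s' \<Longrightarrow> t \<le> t' \<Longrightarrow> reaches P t' s s'"
  unfolding reaches_def using le_trans by blast

lemma reaches_eq: "(step w P ^^ t) s = s' \<Longrightarrow> reaches P t s s'"
  unfolding reaches_def by blast

lemma reaches_jump: "P = pre @ [Jump l] @ post \<Longrightarrow> reaches P 1 (length pre, s) (l, s)"
  by (cases s, rule reaches_eq) (auto simp: step_def halted_def nth_append)

text \<open>The premise on register 0 passes from one command to the next because code with array
  access may not modify that register. Only an upper bound on the number of steps is claimed, as the
  branches of a test differ in length.\<close>

theorem comp_com_correct:
  assumes "big_step c s t s'" "P = pre @ comp_com r (length pre) c @ post"
    and "rel r s RM" "com_vars c \<subseteq> {..<r}" "0 < r"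
    and "com_arrays c \<Longrightarrow> fst s 0 = Z \<and> 0 \<notin> modified c"
  shows "\<exists>RM'. rel r s' RM' \<and>
     reaches P (slowdown r c * t) (length pre, RM) (length pre + comp_len r c, RM')"
  using assms
proof (induction arbitrary: pre post RM rule: big_step.induct)
  case (Skip s)
  then show ?case by (intro exI[of _ RM]) (simp add: reaches_def)
next
  case (Assign e s x)
  have "computes (comp_exp e r) r r s (ev e s)" using Assign by (intro computes_comp_exp) auto
  then obtain R' where R': "block (comp_exp e r) RM = (R', snd RM)" "R' r = ev e s" "\<forall>x<r. R' x = fst RM x"
    using Assign unfolding computes_def by blast
  have "(step w P ^^ length (comp_exp e r @ [BinOp OR x r r])) (length pre, RM) =
    (length pre + length (comp_exp e r @ [BinOp OR x r r]), block (comp_exp e r @ [BinOp OR x r r]) RM)"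
    using Assign by (intro steps_block) auto
  then show ?case using R' Assign.prems
    by (intro exI[of _ "(R'(x := ev e s), snd RM)"] conjI reaches_eq) (auto simp: rel_def)
next
  case (Write t a b c d s e)
  have "computes (comp_addr t a b c d r) r r s (enc (t, ev a s, ev b s, ev c s, ev d s))"
    using Write by (intro computes_addr) auto
  moreover have "computes (comp_exp e (Suc r)) r (Suc r) s (ev e s)"
    using Write by (intro computes_comp_exp) auto
  ultimately obtain R' where R': "block (comp_addr t a b c d r @ comp_exp e (Suc r)) RM = (R', snd RM)"
     "R' r = enc (t, ev a s, ev b s, ev c s, ev d s)" "R' (Suc r) = ev e s" 
    "rel r s (R', snd RM)"
    using computes_pair[of _ r r s _ _ "ev e s"] Write.prems by blast
  have 1: "(step w P ^^ length (comp_addr t a b c d r @ comp_exp e (Suc r) @ [Store r (Suc r)])) (length pre, RM) =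
    (length pre + length (comp_addr t a b c d r @ comp_exp e (Suc r) @ [Store r (Suc r)]),
     block (comp_addr t a b c d r @ comp_exp e (Suc r) @ [Store r (Suc r)]) RM)"
    using Write.prems by (intro steps_block) auto
  have sm: "small (t, ev a s, ev b s, ev c s, ev d s)" using Write.hyps by (simp add: small_def)
  \<comment> \<open>\<open>enc\<close> is injective on small indices, so the machine changes no cell
    but the intended one.\<close>
  have "rel r (set_cell (t, ev a s, ev b s, ev c s, ev d s) (ev e s) s)
    (R', (snd RM)(enc (t, ev a s, ev b s, ev c s, ev d s) := ev e s))"
    using R'(4) enc_inj[OF _ sm] by (auto simp: rel_def)
  moreover have "block (comp_addr t a b c d r @ comp_exp e (Suc r) @ [Store r (Suc r)]) RM =
     (R', (snd RM)(enc (t, ev a s, ev b s, ev c s, ev d s) := ev e s))"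
    using R' by simp
  ultimately show ?case using 1
    by (intro exI[of _ "(R', (snd RM)(enc (t, ev a s, ev b s, ev c s, ev d s) := ev e s))"] conjI reaches_eq) auto
next
  case (Seq c1 s t1 s1 c2 t2 s2)
  obtain RM1 where 1: "rel r s1 RM1" 
     "reaches P (slowdown r c1 * t1) (length pre, RM) (length pre + comp_len r c1, RM1)"
    using Seq.IH(1)[of pre "comp_com r (length pre + comp_len r c1) c2 @ post" RM] Seq.prems by auto
  have "com_arrays c2 \<Longrightarrow> fst s1 0 = Z"
    using Seq.prems big_step_agree[OF Seq.hyps(1)] by (auto simp: agree_def)
  then obtain RM2 where 2: "rel r s2 RM2" 
     "reaches P (slowdown r c2 * t2) (length pre + comp_len r c1, RM1) (length pre + comp_len r c1 + comp_len r c2, RM2)"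
    using Seq.IH(2)[of "pre @ comp_com r (length pre) c1" post RM1] Seq.prems 1(1) by auto
  have "reaches P (slowdown r c1 * t1 + slowdown r c2 * t2) (length pre, RM) (length pre + comp_len r c1 + comp_len r c2, RM2)"
    using reaches_trans[OF 1(2) 2(2)] .
  then show ?case using 2 by (intro exI[of _ RM2]) (auto simp: add.assoc algebra_simps elim!: reaches_mono)
next
  case (Branch_True b s c1 t s1 c2)
  let ?lb = "length (comp_cond b r)"
  let ?pc1 = "length pre + ?lb + 2 + comp_len r c2"
  obtain R' where R': "(step w P ^^ (?lb + 1)) (length pre, RM) = (?pc1, R', snd RM)"
    "rel r s (R', snd RM)"
    by (rule cond_jump_correct[of b s r RM P pre ?pc1 "comp_com r (length pre + length (comp_cond b r) + 1) c2
     @ [Jump (length pre + length (comp_cond b r) + 2 + comp_len r c2 + comp_len r c1)]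
     @ comp_com r (length pre + length (comp_cond b r) + 2 + comp_len r c2) c1 @ post", unfolded if_P[OF Branch_True.hyps(2)]])
      (use Branch_True in auto)
  let ?pre = "pre @ comp_cond b r @ [cond_jump b r ?pc1] @ comp_com r (length pre + length (comp_cond b r) + 1) c2
     @ [Jump (length pre + length (comp_cond b r) + 2 + comp_len r c2 + comp_len r c1)]"
  have l: "length ?pre = ?pc1" by simp
  have "\<exists>RM'. rel r s1 RM' \<and>
     reaches P (slowdown r c1 * t) (length ?pre, R', snd RM) (length ?pre + comp_len r c1, RM')"
    by (rule Branch_True.IH[OF _ R'(2)]) (use Branch_True.prems in \<open>auto simp: add.assoc\<close>)
  then obtain RM1 where 1: "rel r s1 RM1"
    "reaches P (slowdown r c1 * t) (?pc1, R', snd RM) (?pc1 + comp_len r c1, RM1)"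
    unfolding l by blast
  have "reaches P ((?lb + 1) + slowdown r c1 * t) (length pre, RM) (?pc1 + comp_len r c1, RM1)"
    using reaches_trans[OF reaches_eq[OF R'(1)] 1(2)] .
  then show ?case using 1(1) by (intro exI[of _ RM1]) (auto simp: algebra_simps elim!: reaches_mono)
next
  case (Branch_False b s c2 t s1 c1)
  let ?lb = "length (comp_cond b r)"
  let ?pc1 = "length pre + ?lb + 2 + comp_len r c2"
  obtain R' where R': "(step w P ^^ (?lb + 1)) (length pre, RM) = (length pre + ?lb + 1, R', snd RM)"
    "rel r s (R', snd RM)"
    by (rule cond_jump_correct[of b s r RM P pre ?pc1 "comp_com r (length pre + length (comp_cond b r) + 1) c2
     @ [Jump (length pre + length (comp_cond b r) + 2 + comp_len r c2 + comp_len r c1)]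
     @ comp_com r (length pre + length (comp_cond b r) + 2 + comp_len r c2) c1 @ post", unfolded if_not_P[OF Branch_False.hyps(2)]])
      (use Branch_False in auto)
  let ?pre = "pre @ comp_cond b r @ [cond_jump b r ?pc1]"
  have l: "length ?pre = length pre + ?lb + 1" by simp
  have "\<exists>RM'. rel r s1 RM' \<and>
     reaches P (slowdown r c2 * t) (length ?pre, R', snd RM) (length ?pre + comp_len r c2, RM')"
    by (rule Branch_False.IH[OF _ R'(2)]) (use Branch_False.prems in \<open>auto simp: add.assoc\<close>)
  then obtain RM1 where 1: "rel r s1 RM1"
    "reaches P (slowdown r c2 * t) (length pre + ?lb + 1, R', snd RM) (length pre + ?lb + 1 + comp_len r c2, RM1)"
    unfolding l by blast
  have 2: "reaches P 1 (length pre + ?lb + 1 + comp_len r c2, RM1) (?pc1 + comp_len r c1, RM1)"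
    using reaches_jump[of P "pre @ comp_cond b r @ [cond_jump b r ?pc1] @ comp_com r (length pre + ?lb + 1) c2" 
       "?pc1 + comp_len r c1" "comp_com r ?pc1 c1 @ post" RM1] Branch_False.prems by (auto simp: add.assoc)
  have "reaches P ((?lb + 1) + (slowdown r c2 * t + 1)) (length pre, RM) (?pc1 + comp_len r c1, RM1)"
    using reaches_trans[OF reaches_eq[OF R'(1)] reaches_trans[OF 1(2) 2]] .
  then show ?case using 1(1) by (intro exI[of _ RM1]) (auto simp: algebra_simps elim!: reaches_mono)
next
  case (Loop_True b s c t1 s1 t2 s2)
  let ?lb = "length (comp_cond b r)"
  let ?pc1 = "length pre + ?lb + 2"
  let ?end = "length pre + ?lb + 3 + comp_len r c"
  obtain R' where R': "(step w P ^^ (?lb + 1)) (length pre, RM) = (?pc1, R', snd RM)"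
    "rel r s (R', snd RM)"
    by (rule cond_jump_correct[of b s r RM P pre ?pc1 "[Jump ?end] @ comp_com r ?pc1 c @ [Jump (length pre)] @ post", unfolded if_P[OF Loop_True.hyps(2)]])
      (use Loop_True in auto)
  let ?pre = "pre @ comp_cond b r @ [cond_jump b r ?pc1] @ [Jump ?end]"
  have l: "length ?pre = ?pc1" by simp
  have "\<exists>RM'. rel r s1 RM' \<and>
     reaches P (slowdown r c * t1) (length ?pre, R', snd RM) (length ?pre + comp_len r c, RM')"
    by (rule Loop_True.IH(1)[OF _ R'(2)]) (use Loop_True.prems in \<open>auto simp: add.assoc\<close>)
  then obtain RM1 where 1: "rel r s1 RM1"
    "reaches P (slowdown r c * t1) (?pc1, R', snd RM) (?pc1 + comp_len r c, RM1)"
    unfolding l by blast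
  have 2: "reaches P 1 (?pc1 + comp_len r c, RM1) (length pre, RM1)"
    using reaches_jump[of P "pre @ comp_cond b r @ [cond_jump b r ?pc1] @ [Jump ?end] @ comp_com r ?pc1 c" 
       "length pre" "post" RM1] Loop_True.prems by (auto simp: add.assoc)
  have "com_arrays (Loop b c) \<Longrightarrow> fst s1 0 = Z"
    using Loop_True.prems big_step_agree[OF Loop_True.hyps(3)] by (auto simp: agree_def)
  then obtain RM2 where 3: "rel r s2 RM2"
    "reaches P (slowdown r (Loop b c) * t2) (length pre, RM1) (length pre + comp_len r (Loop b c), RM2)"
    using Loop_True.IH(2)[of pre post RM1] 1 Loop_True.prems by auto
  have "reaches P ((?lb + 1) + (slowdown r c * t1 + (1 + slowdown r (Loop b c) * t2))) (length pre, RM) (length pre + comp_len r (Loop b c), RM2)"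
    using reaches_trans[OF reaches_eq[OF R'(1)] reaches_trans[OF 1(2) reaches_trans[OF 2 3(2)]]] .
  then show ?case using 3(1) by (intro exI[of _ RM2] conjI) (auto simp: algebra_simps elim!: reaches_mono)
next
  case (Loop_False b s c)
  let ?lb = "length (comp_cond b r)"
  let ?pc1 = "length pre + ?lb + 2"
  let ?end = "length pre + ?lb + 3 + comp_len r c"
  obtain R' where R': "(step w P ^^ (?lb + 1)) (length pre, RM) = (length pre + ?lb + 1, R', snd RM)"
    "rel r s (R', snd RM)"
    by (rule cond_jump_correct[of b s r RM P pre ?pc1 "[Jump ?end] @ comp_com r ?pc1 c @ [Jump (length pre)] @ post", unfolded if_not_P[OF Loop_False.hyps(2)]])
      (use Loop_False in auto)
  have 2: "reaches P 1 (length pre + ?lb + 1, (R', snd RM)) (?end, (R', snd RM))"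
    using reaches_jump[of P "pre @ comp_cond b r @ [cond_jump b r ?pc1]" 
       ?end "comp_com r ?pc1 c @ [Jump (length pre)] @ post" "(R', snd RM)"] Loop_False.prems by (auto simp: add.assoc)
  have "reaches P ((?lb + 1) + 1) (length pre, RM) (?end, (R', snd RM))"
    using reaches_trans[OF reaches_eq[OF R'(1)] 2] .
  then show ?case using R' by (intro exI[of _ "(R', snd RM)"] conjI) (auto simp: algebra_simps elim!: reaches_mono)
qed

end

definition For :: "nat \<Rightarrow> exp \<Rightarrow> com \<Rightarrow> com" where
  "For x e c = Assign x (Con 0) ;; Loop (Lt (Var x) e) (c ;; Assign x (Plus (Var x) (Con 1)))"

lemma modified_For [simp]: "modified (For x e c) = insert x (modified c)"
  and written_For [simp]: "written (For x e c) = written c"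
  by (auto simp: For_def)

context word_machine begin

subsection \<open>Weakest preconditions with costs\<close>

text \<open>Total correctness: a run must exist, and a run exists only without overflow. The cost is
  an argument of \<open>Q\<close>, so time bounds and results are proved together.\<close>

definition wp :: "com \<Rightarrow> store \<Rightarrow> (store \<Rightarrow> nat \<Rightarrow> bool) \<Rightarrow> bool" where
  "wp c s Q \<longleftrightarrow> (\<exists>t s'. big_step c s t s' \<and> Q s' t)"

lemma wp_Skip: "Q s 1 \<Longrightarrow> wp Skip s Q"
  unfolding wp_def using big_step.Skip by blast

lemma wp_Assign: "ok e s \<Longrightarrow> Q (set_reg x (ev e s) s) 1 \<Longrightarrow> wp (Assign x e) s Q"
  unfolding wp_def using big_step.Assign by blast

lemma wp_Write:
  "ok (Rd t a b c d) s \<Longrightarrow> ok e s \<Longrightarrow>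
   Q (set_cell (t, ev a s, ev b s, ev c s, ev d s) (ev e s) s) 1 \<Longrightarrow> wp (Write t a b c d e) s Q"
  unfolding wp_def using big_step.Write by blast

lemma wp_Seq: "wp c1 s (\<lambda>s1 t1. wp c2 s1 (\<lambda>s2 t2. Q s2 (t1 + t2))) \<Longrightarrow> wp (c1 ;; c2) s Q"
  unfolding wp_def using big_step.Seq by blast

lemma wp_Branch:
  "ok_cond b s \<Longrightarrow> (ev_cond b s \<Longrightarrow> wp c1 s (\<lambda>s t. Q s (t + 1))) \<Longrightarrow>
   (\<not> ev_cond b s \<Longrightarrow> wp c2 s (\<lambda>s t. Q s (t + 1))) \<Longrightarrow> wp (Branch b c1 c2) s Q"
  unfolding wp_def using big_step.Branch_True big_step.Branch_False by metis

text \<open>The syntactic frame comes for free with every consequence, so specifications mention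
  only what a command is meant to change.\<close>

lemma wp_conseq: 
  assumes "wp c s Q'" "\<And>s' t. agree (modified c) (written c) s s' \<Longrightarrow> Q' s' t \<Longrightarrow> Q s' t"
  shows "wp c s Q"
  using assms big_step_agree unfolding wp_def by blast

text \<open>The bound \<open>e\<close> is evaluated anew in every round and must therefore keep the
  value \<open>N\<close>. Increment and test add 2 per round, the initial assignment and the last
  test another 2. The frame \<open>X\<close>, \<open>Y\<close> is relative to the store before the
  loop, so the invariant does not have to repeat what stays fixed.\<close>

lemma wp_For:
  assumes init: "I 0 (set_reg x 0 s0)"
    and x: "x \<notin> modified c" "x \<in> X" "modified c \<subseteq> X" "written c \<subseteq> Y"
    and bound: "\<And>i s. i \<le> N \<Longrightarrow> agree X Y s0 s \<Longrightarrow> fst s x = i \<Longrightarrow>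
       I i s \<Longrightarrow> ok e s \<and> ev e s = N"
    and body: "\<And>i s. i < N \<Longrightarrow> agree X Y s0 s \<Longrightarrow> fst s x = i \<Longrightarrow>
       I i s \<Longrightarrow> wp c s (\<lambda>s' t. t \<le> T i \<and> I (Suc i) (set_reg x (Suc i) s'))"
    and N: "N < 2 ^ w"
    and fin: "\<And>s t. agree X Y s0 s \<Longrightarrow> fst s x = N \<Longrightarrow>
       I N s \<Longrightarrow> t \<le> (\<Sum>i<N. T i + 2) + 2 \<Longrightarrow> Q s t"
  shows "wp (For x e c) s0 Q"
proof -
  let ?b = "Lt (Var x) e" and ?c = "c ;; Assign x (Plus (Var x) (Con 1))"
  \<comment> \<open>A round can only take place if \<open>N\<close> is positive; then the word size
    is positive and the constant 1 fits.\<close>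
  have w1: "(1::nat) < 2 ^ w \<or> N = 0" using N by (cases "w = 0") auto
  have loop: "\<exists>t s'. big_step (Loop ?b ?c) s t s' \<and> t \<le> (\<Sum>i\<in>{i..<N}. T i + 2) + 1 \<and>
        agree X Y s0 s' \<and> fst s' x = N \<and> I N s'"
    if "i \<le> N" "agree X Y s0 s" "fst s x = i" "I i s" for i s
    using that
  proof (induction "N - i" arbitrary: i s)
    case 0
    then have "i = N" by simp
    have "big_step (Loop ?b ?c) s 1 s"
      by (rule big_step.Loop_False) (use bound[OF 0(2-5)] 0 \<open>i = N\<close> in auto)
    then show ?case using 0 \<open>i = N\<close> by (intro exI[of _ 1] exI[of _ s] conjI) auto
  next
    case (Suc m)
    then have i: "i < N" by simp
    from body[OF i Suc.prems(2-)] obtain t1 s1 where 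
      1: "big_step c s t1 s1" "t1 \<le> T i" "I (Suc i) (set_reg x (Suc i) s1)"
      unfolding wp_def by auto
    note ag = big_step_agree[OF 1(1)]
    have x1: "fst s1 x = i" using ag x Suc.prems by (auto simp: agree_def)
    let ?s2 = "set_reg x (Suc i) s1"
    have "big_step (Assign x (Plus (Var x) (Con 1))) s1 1 (set_reg x (ev (Plus (Var x) (Con 1)) s1) s1)"
      using i N w1 x1 by (intro big_step.Assign) auto
    from big_step.Seq[OF 1(1) this] have 2: "big_step ?c s (t1 + 1) ?s2" by (simp add: x1)
    have ag2: "agree X Y s0 ?s2"
      using agree_mono[OF agree_trans[OF Suc.prems(2) ag], of X Y] x by (auto simp: agree_def)
    have m: "m = N - Suc i" "Suc i \<le> N" using Suc.hyps(2) by simp_all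
    have "fst ?s2 x = Suc i" by simp
    from Suc.hyps(1)[OF m ag2 this 1(3)]
    obtain t2 s' where 3: "big_step (Loop ?b ?c) ?s2 t2 s'" "t2 \<le> (\<Sum>i\<in>{Suc i..<N}. T i + 2) + 1"
        "agree X Y s0 s'" "fst s' x = N" "I N s'" by blast
    have "big_step (Loop ?b ?c) s (t1 + 1 + t2 + 1) s'"
      using bound[OF Suc.prems] i Suc.prems(3) by (intro big_step.Loop_True[OF _ _ 2 3(1)]) auto
    moreover have "t1 + 1 + t2 + 1 \<le> (\<Sum>i\<in>{i..<N}. T i + 2) + 1"
      using 1(2) 3(2) i by (simp add: sum.atLeast_Suc_lessThan)
    ultimately show ?case using 3 by blast
  qed
  have "agree X Y s0 (set_reg x 0 s0)" using x(2) by (auto simp: agree_def)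
  from loop[OF _ this _ init] obtain t s' where 
    1: "big_step (Loop ?b ?c) (set_reg x 0 s0) t s'" "t \<le> (\<Sum>i\<in>{0..<N}. T i + 2) + 1"
        "agree X Y s0 s'" "fst s' x = N" "I N s'" by auto
  have "(0::nat) < 2 ^ w" by simp
  then have "big_step (Assign x (Con 0)) s0 1 (set_reg x 0 s0)" using big_step.Assign[of "Con 0" s0 x] by simp
  then have "big_step (For x e c) s0 (1 + t) s'" unfolding For_def using 1(1) big_step.Seq by blast
  moreover have "Q s' (1 + t)" by (rule fin[OF 1(3-5)]) (use 1(2) in \<open>simp add: lessThan_atLeast0\<close>)
  ultimately show ?thesis unfolding wp_def by blast
qed

end

subsection \<open>Simulation of a word RAM with smaller words\<close>

fun instr_regs :: "instr \<Rightarrow> nat set" where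
  "instr_regs (SetConst r a) = {r}"
| "instr_regs (BinOp f r s t) = {r, s, t}"
| "instr_regs (Load r s) = {r, s}"
| "instr_regs (Store r s) = {r, s}"
| "instr_regs (Jump l) = {}"
| "instr_regs (JumpEq r s l) = {r, s}"
| "instr_regs (JumpLess r s l) = {r, s}"

fun instr_const :: "instr \<Rightarrow> nat" where
  "instr_const (SetConst r a) = a"
| "instr_const _ = 0"

text \<open>Register 40 holds the simulated program counter and register \<open>41 + q\<close> the simulated
  register \<open>q\<close>. Register 8 holds the mask of the smaller word size, and the simulated memory is the
  row of array 9 selected by register 24.\<close>

fun sim_instr :: "nat \<Rightarrow> nat \<Rightarrow> instr \<Rightarrow> com" where
  "sim_instr len pc (SetConst r a) =
     Assign (41 + r) (Bin AND (Con a) (Var 8)) ;; Assign 40 (Con (Suc pc))"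
| "sim_instr len pc (BinOp f r s t) =
     Assign (41 + r) (Bin AND (Bin f (Var (41 + s)) (Var (41 + t))) (Var 8)) ;;
     Assign 40 (Con (Suc pc))"
| "sim_instr len pc (Load r s) =
     Assign (41 + r) (Rd 9 (Var 24) (Var (41 + s)) (Con 0) (Con 0)) ;; Assign 40 (Con (Suc pc))"
| "sim_instr len pc (Store r s) =
     Write 9 (Var 24) (Var (41 + r)) (Con 0) (Con 0) (Var (41 + s)) ;; Assign 40 (Con (Suc pc))"
| "sim_instr len pc (Jump l) = Skip ;; Assign 40 (Con (min l len))"
| "sim_instr len pc (JumpEq r s l) =
     Branch (Eq (Var (41 + r)) (Var (41 + s)))
       (Assign 40 (Con (min l len))) (Assign 40 (Con (Suc pc)))"
| "sim_instr len pc (JumpLess r s l) =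
     Branch (Lt (Var (41 + r)) (Var (41 + s)))
       (Assign 40 (Con (min l len))) (Assign 40 (Con (Suc pc)))"

text \<open>The structured language has no computed jumps, so the simulated program counter is
  compared with every position in turn. The resulting factor is the length of the program, a
  constant.\<close>

fun sim_chain :: "nat \<Rightarrow> nat \<Rightarrow> instr list \<Rightarrow> com" where
  "sim_chain len pc [] = Skip"
| "sim_chain len pc (i # is) =
     Branch (Eq (Var 40) (Con pc)) (sim_instr len pc i) (sim_chain len (Suc pc) is)"

text \<open>The simulated machine has to start with zero registers in every call, while its memory
  lies in a row that no earlier call has touched.\<close>

fun clear_regs :: "nat \<Rightarrow> com" where
  "clear_regs 0 = Skip"
| "clear_regs (Suc m) = clear_regs m ;; Assign (41 + m) (Con 0)"

definition sim_loop :: "instr list \<Rightarrow> com" where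
  "sim_loop P = Loop (Lt (Var 40) (Con (length P))) (sim_chain (length P) 0 P)"

definition sim :: "nat \<Rightarrow> instr list \<Rightarrow> com" where
  "sim m P = clear_regs m ;; Assign 40 (Con 0) ;; sim_loop P"

lemma modified_sim_instr: "modified (sim_instr len pc i) \<subseteq> {40..}"
  by (cases i) auto

lemma written_sim_instr: "written (sim_instr len pc i) \<subseteq> {9}"
  by (cases i) auto

lemma modified_sim_chain: "modified (sim_chain len pc is) \<subseteq> {40..}"
proof (induction "is" arbitrary: pc)
  case (Cons i "is")
  then show ?case using modified_sim_instr[of len pc i] by simp
qed simp

lemma written_sim_chain: "written (sim_chain len pc is) \<subseteq> {9}"
proof (induction "is" arbitrary: pc)
  case (Cons i "is")
  then show ?case using written_sim_instr[of len pc i] by simp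
qed simp

lemma modified_clear_regs: "modified (clear_regs m) \<subseteq> {40..}"
  by (induction m) auto

lemma written_clear_regs: "written (clear_regs m) = {}"
  by (induction m) auto

lemma modified_sim: "modified (sim m P) \<subseteq> {40..}"
  and written_sim: "written (sim m P) \<subseteq> {9}"
  using modified_sim_chain[of "length P" 0 P] written_sim_chain[of "length P" 0 P]
    modified_clear_regs[of m] written_clear_regs[of m]
  by (auto simp: sim_def sim_loop_def)

lemma com_vars_sim_instr:
  "instr_regs i \<subseteq> {..<m} \<Longrightarrow> com_vars (sim_instr len pc i) \<subseteq> {..<41 + m}"
  by (cases i) auto

lemma com_vars_sim_chain:
  "\<forall>i\<in>set is. instr_regs i \<subseteq> {..<m} \<Longrightarrow> com_vars (sim_chain len pc is) \<subseteq> {..<41 + m}"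
proof (induction "is" arbitrary: pc)
  case (Cons i "is")
  have "com_vars (sim_instr len pc i) \<subseteq> {..<41 + m}" using Cons.prems by (intro com_vars_sim_instr) auto
  moreover have "com_vars (sim_chain len (Suc pc) is) \<subseteq> {..<41 + m}" using Cons by auto
  ultimately show ?case by auto
qed simp

lemma com_vars_clear_regs: "com_vars (clear_regs k) \<subseteq> {..<41 + k}"
  by (induction k) auto

lemma com_vars_sim:
  assumes "\<forall>i\<in>set P. instr_regs i \<subseteq> {..<m}"
  shows "com_vars (sim m P) \<subseteq> {..<41 + m}"
  using com_vars_sim_chain[OF assms, of "length P" 0] com_vars_clear_regs[of m]
  by (auto simp: sim_def sim_loop_def)

section \<open>Narrow arithmetic on wide words and correctness of the simulation\<close>

lemma eval_binop_less:
  assumes "a < 2 ^ v" "b < 2 ^ v" shows "eval_binop v f a b < 2 ^ v"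
proof (cases f)
  case SUB
  have "0 \<le> take_bit v (int a - int b)" "take_bit v (int a - int b) < 2 ^ v" by simp_all
  then show ?thesis using SUB by (simp add: nat_less_iff)
next
  case DIV
  then show ?thesis using assms by (auto intro: le_less_trans[OF div_le_dividend])
next
  case MOD
  then show ?thesis using assms by (auto intro: le_less_trans[OF mod_less_eq_dividend])
next
  case AND
  then have "take_bit v (eval_binop v f a b) = eval_binop v f a b"
    using assms by (simp add: take_bit_nat_eq_self)
  then show ?thesis by (simp add: take_bit_nat_eq_self_iff)
next
  case OR
  then have "take_bit v (eval_binop v f a b) = eval_binop v f a b"
    using assms by (simp add: take_bit_nat_eq_self)
  then show ?thesis by (simp add: take_bit_nat_eq_self_iff)
next
  case XOR
  then have "take_bit v (eval_binop v f a b) = eval_binop v f a b"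
    using assms by (simp add: take_bit_nat_eq_self)
  then show ?thesis by (simp add: take_bit_nat_eq_self_iff)
next
  case SHR
  then show ?thesis using assms by (auto simp: drop_bit_eq_div intro: le_less_trans[OF div_le_dividend])
qed simp_all

text \<open>Sums, differences, products and left shifts commute with truncation, and the remaining
  operations do not leave the range of \<open>v\<close>-bit operands; hence masking after each
  operation suffices.\<close>

lemma eval_binop_narrow:
  assumes "a < 2 ^ v" "b < 2 ^ v" "v \<le> w"
  shows "take_bit v (eval_binop w f a b) = eval_binop v f a b"
proof (cases f)
  case SUB
  have "int (take_bit v (nat (take_bit w (int a - int b)))) = take_bit v (int a - int b)"
    using assms(3) by (simp add: of_nat_take_bit min_def)
  then show ?thesis using SUB by (metis eval_binop.simps(2) nat_int)
next
  case DIV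
  then have "eval_binop v f a b < 2 ^ v" using assms eval_binop_less by blast
  then show ?thesis using DIV by (simp add: take_bit_nat_eq_self)
next
  case MOD
  then have "eval_binop v f a b < 2 ^ v" using assms eval_binop_less by blast
  then show ?thesis using MOD by (simp add: take_bit_nat_eq_self)
next
  case SHR
  then have "eval_binop v f a b < 2 ^ v" using assms eval_binop_less by blast
  then show ?thesis using SHR by (simp add: take_bit_nat_eq_self)
qed (use assms in \<open>simp_all add: min_def take_bit_nat_eq_self\<close>)

text \<open>A simulated address is a \<open>v\<close>-bit word and becomes a component of an index,
  whence \<open>2 ^ v \<le> Z\<close>. The bounds on \<open>instr_const\<close> and on the length
  let the constants of the simulating code fit into the wide words.\<close>

locale simulator = word_machine +
  fixes v m :: nat and P :: "instr list"
  assumes v_le: "v \<le> w" and v_Z: "2 ^ v \<le> Z" and Z9: "9 < Z"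
    and regs: "\<And>i. i \<in> set P \<Longrightarrow> instr_regs i \<subseteq> {..<m}"
    and const_less: "\<And>i. i \<in> set P \<Longrightarrow> instr_const i < 2 ^ w"
    and len: "length P < 2 ^ w"
begin

text \<open>All halted states are represented by the position \<open>length P\<close>, since jump
  targets of \<open>P\<close> are arbitrary numbers. \<open>H\<close> keeps the rows of array 9 that
  belong to other calls.\<close>

definition sim_rel :: "(index \<Rightarrow> nat) \<Rightarrow> nat \<Rightarrow> store \<Rightarrow> state \<Rightarrow> bool" where
  "sim_rel H cl s st \<longleftrightarrow> fst s 40 = min (fst st) (length P) \<and>
     (\<forall>q<m. fst s (41 + q) = fst (snd st) q) \<and> (\<forall>a<Z. snd s (9, cl, a, 0, 0) = snd (snd st) a) \<and>
     (\<forall>q. fst (snd st) q < 2 ^ v) \<and> (\<forall>a. snd (snd st) a < 2 ^ v) \<and>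
     fst s 8 = mask v \<and> fst s 24 = cl \<and> cl < Z \<and>
     (\<forall>c i. c \<noteq> cl \<longrightarrow> snd s (9, c, i) = H (9, c, i))"

lemma sim_instr_correct:
  assumes "sim_rel H cl s (pc, R, M)" "pc < length P" "P ! pc = i"
  shows "wp (sim_instr (length P) pc i) s (\<lambda>s' t. t \<le> 2 \<and> sim_rel H cl s' (exec v i (pc, R, M)))"
proof -
  have i: "i \<in> set P" using assms by auto
  note regs' = regs[OF i] and const' = const_less[OF i]
  have w0: "(0::nat) < 2 ^ w" by simp
  have pcw: "Suc pc < 2 ^ w \<and> pc < 2 ^ w" using assms(2) len by simp
  have ml: "min l (length P) < 2 ^ w" for l using len by simp
  have Z0: "0 < Z" using Z9 by simp
  have R: "fst s (41 + q) = R q" if "q < m" for q using assms(1) that by (simp add: sim_rel_def)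
  have Rv: "R q < 2 ^ v" "R q < Z" for q
    using assms(1) v_Z order_less_le_trans by (fastforce simp: sim_rel_def)+
  have Mv: "M a < 2 ^ v" for a using assms(1) by (simp add: sim_rel_def)
  have s8: "fst s 8 = mask v" "fst s 24 = cl" "cl < Z" using assms(1) by (auto simp: sim_rel_def)
  show ?thesis
  proof (cases i)
    case (SetConst r a)
    show ?thesis unfolding SetConst sim_instr.simps
      apply (intro wp_Seq wp_Assign)
      using assms regs' const' pcw s8 SetConst
      by (auto simp: sim_rel_def take_bit_eq_mask[symmetric])
  next
    case (BinOp f r p q)
    have lt: "r < m" "p < m" "q < m" using regs' BinOp by auto
    have e: "and (eval_binop w f (R p) (R q)) (mask v) = eval_binop v f (R p) (R q)"
      unfolding take_bit_eq_mask[symmetric] by (rule eval_binop_narrow[OF Rv(1) Rv(1) v_le])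
    show ?thesis unfolding BinOp sim_instr.simps
      apply (intro wp_Seq wp_Assign)
      using assms pcw s8 lt eval_binop_less[OF Rv(1) Rv(1)]
      by (auto simp: sim_rel_def e R)
  next
    case (Load r p)
    have lt: "r < m" "p < m" using regs' Load by auto
    show ?thesis unfolding Load sim_instr.simps
      apply (intro wp_Seq wp_Assign)
      using assms pcw s8 lt Rv Z9 Z0 Mv
      by (auto simp: sim_rel_def R)
  next
    case (Store r p)
    have lt: "r < m" "p < m" using regs' Store by auto
    show ?thesis unfolding Store sim_instr.simps
      apply (intro wp_Seq wp_Write wp_Assign)
      using assms pcw s8 lt Rv Z9 Z0 Mv
      by (auto simp: sim_rel_def R)
  next
    case (Jump l)
    show ?thesis unfolding Jump sim_instr.simps
      apply (intro wp_Seq wp_Skip wp_Assign)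
      using assms ml
      by (auto simp: sim_rel_def R)
  next
    case (JumpEq r p l)
    have lt: "r < m" "p < m" using regs' JumpEq by auto
    show ?thesis unfolding JumpEq sim_instr.simps
      apply (intro wp_Branch wp_Assign)
      using assms ml lt pcw
      by (auto simp: sim_rel_def R)
  next
    case (JumpLess r p l)
    have lt: "r < m" "p < m" using regs' JumpLess by auto
    show ?thesis unfolding JumpLess sim_instr.simps
      apply (intro wp_Branch wp_Assign)
      using assms ml lt pcw
      by (auto simp: sim_rel_def R)
  qed
qed

lemma sim_chain_correct:
  assumes "sim_rel H cl s (pc, R, M)" "pc < length P" "drop k P = is" "k \<le> pc"
  shows "wp (sim_chain (length P) k is) s
    (\<lambda>s' t. t \<le> length is + 2 \<and> sim_rel H cl s' (exec v (P ! pc) (pc, R, M)))"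
  using assms(3,4)
proof (induction "is" arbitrary: k)
  case Nil
  then show ?case using assms(2) by simp
next
  case (Cons i "is")
  have i: "i = P ! k" and d: "drop (Suc k) P = is" using Cons.prems
    by (metis nth_via_drop, metis drop_Suc list.sel(3) tl_drop)
  have 40: "fst s 40 = pc" using assms by (simp add: sim_rel_def)
  show ?case unfolding sim_chain.simps
  proof (rule wp_Branch)
    show "ok_cond (Eq (Var 40) (Con k)) s" using Cons.prems assms(2) len by simp
    assume "ev_cond (Eq (Var 40) (Con k)) s"
    then have "k = pc" using 40 by simp
    then show "wp (sim_instr (length P) k i) s
     (\<lambda>s' t. t + 1 \<le> length (i # is) + 2 \<and> sim_rel H cl s' (exec v (P ! pc) (pc, R, M)))"
      using sim_instr_correct[OF assms(1,2) refl] i by (auto elim!: wp_conseq)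
  next
    assume "\<not> ev_cond (Eq (Var 40) (Con k)) s"
    then have "Suc k \<le> pc" using 40 Cons.prems by simp
    from Cons.IH[OF d this] show "wp (sim_chain (length P) (Suc k) is) s
     (\<lambda>s' t. t + 1 \<le> length (i # is) + 2 \<and> sim_rel H cl s' (exec v (P ! pc) (pc, R, M)))"
      by (auto elim!: wp_conseq)
  qed
qed

text \<open>If the simulated run halts before \<open>T\<close> steps, its state is a fixed point of
  \<open>step\<close> from then on, and the loop ends early with the same final state.\<close>

lemma sim_loop_correct:
  assumes "sim_rel H cl s st" "halted P ((step v P ^^ T) st)"
  shows "wp (sim_loop P) s
    (\<lambda>s' t. t \<le> T * (length P + 3) + 1 \<and> sim_rel H cl s' ((step v P ^^ T) st))"
  using assms
proof (induction T arbitrary: s st)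
  case 0
  then have "big_step (sim_loop P) s 1 s" unfolding sim_loop_def
    using len by (intro big_step.Loop_False) (auto simp: sim_rel_def halted_def)
  then show ?case using 0 unfolding wp_def by fastforce
next
  case (Suc T)
  obtain pc R M where st: "st = (pc, R, M)" by (cases st)
  show ?case
  proof (cases "halted P st")
    case True
    have "(step v P ^^ T) st = st" for T by (induction T) (use True in \<open>auto simp: step_def\<close>)
    note fix_st = this
    have "big_step (sim_loop P) s 1 s" unfolding sim_loop_def
      using len Suc.prems(1) True by (intro big_step.Loop_False) (auto simp: sim_rel_def halted_def)
    then show ?thesis using Suc.prems(1) unfolding wp_def fix_st by fastforce
  next
    case False
    then have pc: "pc < length P" by (simp add: st halted_def)
    have st': "step v P st = exec v (P ! pc) (pc, R, M)" using False by (simp add: step_def st)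
    have "wp (sim_chain (length P) 0 P) s
       (\<lambda>s' t. t \<le> length P + 2 \<and> sim_rel H cl s' (step v P st))"
      unfolding st' by (rule sim_chain_correct) (use Suc.prems(1) pc st in auto)
    then obtain t1 s1 where 1: "big_step (sim_chain (length P) 0 P) s t1 s1" "t1 \<le> length P + 2"
      "sim_rel H cl s1 (step v P st)"
      unfolding wp_def by blast
    have h: "halted P ((step v P ^^ T) (step v P st))" using Suc.prems(2) by (simp add: funpow_swap1)
    obtain t2 s2 where 2: "big_step (sim_loop P) s1 t2 s2" "t2 \<le> T * (length P + 3) + 1"
      "sim_rel H cl s2 ((step v P ^^ T) (step v P st))"
      using Suc.IH[OF 1(3) h] unfolding wp_def by auto
    have "big_step (sim_loop P) s (t1 + t2 + 1) s2" unfolding sim_loop_def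
      using Suc.prems(1) pc len
      by (intro big_step.Loop_True[OF _ _ 1(1) 2(1)[unfolded sim_loop_def]]) (auto simp: sim_rel_def st)
    then show ?thesis unfolding wp_def using 1 2
      by (intro exI[of _ "t1 + t2 + 1"] exI[of _ s2]) (simp add: funpow_swap1)
  qed
qed

lemma clear_regs_correct:
  "wp (clear_regs k) s (\<lambda>s' t. t \<le> k + 1 \<and> snd s' = snd s \<and> (\<forall>q<k. fst s' (41 + q) = 0) \<and>
     (\<forall>x<41. fst s' x = fst s x))"
proof (induction k)
  case 0
  then show ?case by (auto intro!: wp_Skip)
next
  case (Suc k)
  show ?case unfolding clear_regs.simps
    by (rule wp_Seq, rule wp_conseq[OF Suc], rule wp_Assign) (auto simp: less_Suc_eq)
qed

text \<open>That all cells remain \<open>v\<close>-bit words matters when the distances are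
  decoded.\<close>

theorem sim_correct:
  assumes "\<And>a. a < Z \<Longrightarrow> snd s (9, cl, a, 0, 0) = snd (snd (initial_state v xs)) a"
    and "fst s 8 = mask v" "fst s 24 = cl" "cl < Z"
    and "halted P ((step v P ^^ T) (initial_state v xs))"
  shows "wp (sim m P) s (\<lambda>s' t. t \<le> m + 3 + T * (length P + 3) \<and>
    (\<forall>a<Z. snd s' (9, cl, a, 0, 0) = memory ((step v P ^^ T) (initial_state v xs)) a \<and>
        snd s' (9, cl, a, 0, 0) < 2 ^ v) \<and>
    (\<forall>c i. c \<noteq> cl \<longrightarrow> snd s' (9, c, i) = snd s (9, c, i)))"
proof -
  have lt: "nat (take_bit v x) < 2 ^ v" for x :: int
  proof -
    have "0 \<le> take_bit v x" "take_bit v x < 2 ^ v" by simp_all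
    then show ?thesis by (simp add: nat_less_iff)
  qed
  have rel0: "sim_rel (snd s) cl s1 (initial_state v xs)"
    if "snd s1 = snd s" "fst s1 40 = 0" "\<And>q. q < m \<Longrightarrow> fst s1 (41 + q) = 0"
      "fst s1 8 = mask v" "fst s1 24 = cl" for s1
    using assms that lt by (auto simp: sim_rel_def initial_state_def)
  show ?thesis unfolding sim_def
    apply (rule wp_Seq, rule wp_conseq[OF clear_regs_correct], rule wp_Seq, rule wp_Assign)
     apply simp
    apply (rule wp_conseq[OF sim_loop_correct[OF rel0 assms(5)]])
    using assms(2-) by (auto simp: sim_rel_def memory_def)
qed

end

subsection \<open>Input and output lists\<close>

lemma length_grid: "length (concat (map (\<lambda>x. map (f x) [0..<b]) [0..<a])) = a * b"
  by (induction a) auto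

lemma nth_grid:
  "x < a \<Longrightarrow> y < b \<Longrightarrow> concat (map (\<lambda>x. map (f x) [0..<b]) [0..<a]) ! (x * b + y) = f x y"
proof (induction a)
  case (Suc a)
  show ?case
  proof (cases "x < a")
    case True
    have "Suc x * b \<le> a * b" using True by (intro mult_right_mono) auto
    then have "x * b + y < a * b" using Suc.prems by simp
    then show ?thesis using Suc True by (simp add: nth_append length_grid)
  next
    case False
    then have "x = a" using Suc.prems by simp
    then show ?thesis using Suc.prems by (simp add: nth_append length_grid)
  qed
qed simp

lemma grid_index_less: "x < a \<Longrightarrow> y < b \<Longrightarrow> x * b + y < a * b" for x y a b :: nat
proof -
  assume *: "x < a" "y < b"
  have "Suc x * b \<le> a * b" using * by (intro mult_right_mono) auto
  then show ?thesis using * by simp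
qed

lemma grid_index_inj:
  "x * b + y = x' * b + y' \<Longrightarrow> y < b \<Longrightarrow> y' < b \<Longrightarrow> x = x' \<and> y = y'" for x y b :: nat
proof -
  assume *: "x * b + y = x' * b + y'" "y < b" "y' < b"
  have "x = (x * b + y) div b" using *(2) by simp
  also have "\<dots> = (x' * b + y') div b" by (simp only: *(1))
  also have "\<dots> = x'" using *(3) by simp
  finally have "x = x'" .
  with *(1) show ?thesis by simp
qed

lemma length_apsp_input: "length (apsp_input N E wt) = 1 + N + N * N"
  unfolding apsp_input_def by (simp add: length_grid)

lemma nth_apsp_input:
  "apsp_input N E wt ! 0 = int N"
  "x < N \<Longrightarrow> apsp_input N E wt ! (1 + x) = wt x"
  "x < N \<Longrightarrow> y < N \<Longrightarrow> apsp_input N E wt ! (1 + N + (x * N + y)) = of_bool ((x, y) \<in> E)"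
  unfolding apsp_input_def by (simp_all add: nth_append nth_grid)

lemma length_apsp_output: "length (apsp_output N E wt) = N * N"
  unfolding apsp_output_def by (simp add: length_grid)

lemma nth_apsp_output:
  "x < N \<Longrightarrow> y < N \<Longrightarrow> apsp_output N E wt ! (x * N + y) = distance E wt x y"
  unfolding apsp_output_def by (simp add: nth_grid)

lemma length_min_plus_input: "length (min_plus_input n D A B) = 2 + 2 * (n * D)"
  unfolding min_plus_input_def by (simp add: length_grid)

lemma nth_min_plus_input:
  "min_plus_input n D A B ! 0 = int n"
  "min_plus_input n D A B ! 1 = int D"
  "i < n \<Longrightarrow> k < D \<Longrightarrow> min_plus_input n D A B ! (2 + (i * D + k)) = A i k"
  "k < D \<Longrightarrow> j < n \<Longrightarrow> min_plus_input n D A B ! (2 + n * D + (k * n + j)) = B k j"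
  unfolding min_plus_input_def
  by (simp_all add: nth_append nth_grid length_grid grid_index_less)

lemma length_min_plus_output: "length (min_plus_output n D A B) = n * n"
  unfolding min_plus_output_def by (simp add: length_grid)

lemma nth_min_plus_output:
  "i < n \<Longrightarrow> j < n \<Longrightarrow> min_plus_output n D A B ! (i * n + j) = Some (min_plus D A B i j)"
  unfolding min_plus_output_def by (simp add: nth_grid)

subsection \<open>The layered graph\<close>

text \<open>There may be infinitely many walks, but their weights are natural numbers, so the
  infimum in \<open>distance\<close> is a minimum.\<close>

lemma distance_attained:
  assumes "\<And>p. p \<in> paths E u v \<Longrightarrow> 0 \<le> path_weight wt p" "p \<in> paths E u v"
  obtains q where "q \<in> paths E u v" "distance E wt u v = Some (path_weight wt q)"
    "\<And>p. p \<in> paths E u v \<Longrightarrow> path_weight wt q \<le> path_weight wt p"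
proof -
  obtain q where q: "q \<in> paths E u v"
    "\<And>p. p \<in> paths E u v \<Longrightarrow> nat (path_weight wt q) \<le> nat (path_weight wt p)"
    using ex_has_least_nat[of "\<lambda>p. p \<in> paths E u v" p "\<lambda>p. nat (path_weight wt p)"] assms(2) by blast
  have le: "path_weight wt q \<le> path_weight wt p" if "p \<in> paths E u v" for p
    using q(2)[OF that] assms(1)[OF that] by simp
  have "(INF p \<in> paths E u v. path_weight wt p) = path_weight wt q"
    by (rule cInf_eq_minimum) (use q le in auto)
  then have "distance E wt u v = Some (path_weight wt q)" using q(1) by (auto simp: distance_def)
  then show ?thesis using that q(1) le by blast
qed

text \<open>Blocks of \<open>n\<close> numbers hold the four layers, so \<open>x div n\<close> is
  the layer of \<open>x\<close>; the inner blocks have room because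
  \<open>m \<sigma> * D \<le> n\<close>. Side 0 belongs to the pivot column and side 1 to the pivot
  row; nodes from \<open>4 * n\<close> on are isolated.\<close>

locale gadget =
  fixes n D V M N :: nat and m :: "nat \<Rightarrow> nat" and val :: "nat \<Rightarrow> nat \<Rightarrow> nat"
    and link :: "nat \<Rightarrow> nat \<Rightarrow> nat \<Rightarrow> nat \<Rightarrow> bool"
  assumes n: "0 < n" and D: "0 < D" and mD: "\<And>\<sigma>. \<sigma> < 2 \<Longrightarrow> m \<sigma> * D \<le> n"
    and val_le: "\<And>\<sigma> u. \<sigma> < 2 \<Longrightarrow> u < m \<sigma> \<Longrightarrow> val \<sigma> u \<le> V" and M: "4 * V < M" and N: "4 * n \<le> N"
begin

definition left :: "(nat \<times> nat) set" where
  "left = {(i, n + (u * D + k)) | i u k. i < n \<and> u < m 0 \<and> k < D \<and> link 0 i u k}"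

text \<open>Every value of one pivot is joined with every value of the other, but only at the same
  position \<open>k\<close>; this is what ties the two halves of a sum together.\<close>

definition middle :: "(nat \<times> nat) set" where
  "middle = {(n + (u * D + k), 2 * n + (u' * D + k)) | u u' k. u < m 0 \<and> u' < m 1 \<and> k < D}"

definition right :: "(nat \<times> nat) set" where
  "right = {(2 * n + (u * D + k), 3 * n + j) | j u k. j < n \<and> u < m 1 \<and> k < D \<and> link 1 j u k}"

definition arcs :: "(nat \<times> nat) set" where
  "arcs = left \<union> middle \<union> right"

definition edges :: "(nat \<times> nat) set" where
  "edges = arcs \<union> arcs\<inverse>"

text \<open>The first node of a path is not counted, so crossing the layers directly costs
  \<open>3 * M - val 0 u - val 1 u'\<close>: a large total of the two values becomes a short path.
  Inner slots without a pair get weight 0 and lie on no edge.\<close>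

definition wt :: "nat \<Rightarrow> nat" where
  "wt x = (if x < n \<or> 3 * n \<le> x \<and> x < 4 * n then M
     else if n \<le> x \<and> x < n + m 0 * D then M - val 0 ((x - n) div D)
     else if 2 * n \<le> x \<and> x < 2 * n + m 1 * D then M - val 1 ((x - 2 * n) div D)
     else 0)"

lemma idx_less: "\<sigma> < 2 \<Longrightarrow> u < m \<sigma> \<Longrightarrow> k < D \<Longrightarrow> u * D + k < m \<sigma> * D \<and> u * D + k < n"
  using grid_index_less[of u "m \<sigma>" k D] mD[of \<sigma>] by simp

lemma wt_simps:
  "i < n \<Longrightarrow> wt i = M"
  "i < n \<Longrightarrow> wt (3 * n + i) = M"
  "u < m 0 \<Longrightarrow> k < D \<Longrightarrow> wt (n + (u * D + k)) = M - val 0 u"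
  "u < m 1 \<Longrightarrow> k < D \<Longrightarrow> wt (2 * n + (u * D + k)) = M - val 1 u"
  using idx_less[of 0 u k] idx_less[of 1 u k] mD[of 0] mD[of 1] by (auto simp: wt_def)

text \<open>Consecutive layers give irreflexivity, and later the least length of a path
  across.\<close>

lemma layer:
  assumes "(x, y) \<in> arcs" shows "y div n = Suc (x div n)" "x < 4 * n" "y < 4 * n"
proof -
  have d: "(n + z) div n = 1" "(2 * n + z) div n = 2" "(3 * n + z) div n = 3" if "z < n" for z
  proof -
    have "n \<noteq> 0" using n by simp
    then show "(n + z) div n = 1" "(2 * n + z) div n = 2" "(3 * n + z) div n = 3" 
      using that by simp_all
  qed
  show "y div n = Suc (x div n)" "x < 4 * n" "y < 4 * n"
    using assms idx_less[of 0] idx_less[of 1] unfolding arcs_def left_def middle_def right_def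
    by (fastforce simp: d)+
qed

text \<open>An end point of an edge is an outer node or an inner node of an actual pair, so the
  slots of weight zero do not occur.\<close>

lemma wt_ge:
  assumes "(x, y) \<in> edges" shows "M - V \<le> wt y"
proof -
  have "y < n \<or> (\<exists>u<m 0. \<exists>k<D. y = n + (u * D + k)) \<or> (\<exists>u<m 1. \<exists>k<D. y = 2 * n + (u * D + k)) \<or>
     (\<exists>j<n. y = 3 * n + j)"
    using assms unfolding edges_def arcs_def left_def middle_def right_def by blast
  then show ?thesis using val_le[of 0] val_le[of 1] by (auto simp: wt_simps diff_le_mono2)
qed

lemma undirected: "undirected_graph N edges"
proof -
  have "x \<noteq> y" if "(x, y) \<in> arcs" for x y using layer[OF that] by auto
  moreover have "x < N \<and> y < N" if "(x, y) \<in> arcs" for x y using layer[OF that] N by auto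
  ultimately show ?thesis
    unfolding undirected_graph_def directed_graph_def edges_def by (fastforce simp: irrefl_def sym_def)
qed

lemma path_weight_nonneg: "0 \<le> path_weight (\<lambda>x. int (wt x)) p"
  unfolding path_weight_def by (intro sum_list_nonneg) auto

lemma no_negative_cycle: "no_negative_cycle edges (\<lambda>x. int (wt x))"
  unfolding no_negative_cycle_def using path_weight_nonneg by blast

lemma wt_le: "wt x \<le> M" by (auto simp: wt_def)

lemma long_path:
  "successively (\<lambda>a b. (a, b) \<in> edges) p \<Longrightarrow>
   path_weight (\<lambda>x. int (wt x)) p \<ge> int (length (tl p)) * (int M - int V)"
proof (induction p rule: induct_list012)
  case (3 x y zs)
  have "int M - int V \<le> int (wt y)" using 3(3) wt_ge[of x y] by simp
  moreover have "path_weight (\<lambda>x. int (wt x)) (y # zs) \<ge> int (length zs) * (int M - int V)"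
    using 3 by simp
  ultimately show ?case by (simp add: path_weight_def algebra_simps)
qed (auto simp: path_weight_def)

text \<open>Only an inequality, because other values or positions may give a shorter path between
  the same end points.\<close>

lemma distance_upper:
  assumes "link 0 i u k" "link 1 j u' k" "i < n" "j < n" "k < D" "u < m 0" "u' < m 1"
  shows "\<exists>d. distance edges (\<lambda>x. int (wt x)) i (3 * n + j) = Some (int d) \<and>
    d + val 0 u + val 1 u' \<le> 3 * M"
proof -
  let ?p = "[i, n + (u * D + k), 2 * n + (u' * D + k), 3 * n + j]"
  have "(i, n + (u * D + k)) \<in> arcs" using assms unfolding arcs_def left_def by blast
  moreover have "(n + (u * D + k), 2 * n + (u' * D + k)) \<in> arcs"
    using assms unfolding arcs_def middle_def by blast
  moreover have "(2 * n + (u' * D + k), 3 * n + j) \<in> arcs" using assms unfolding arcs_def right_def by blast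
  ultimately have p: "?p \<in> paths edges i (3 * n + j)" by (simp add: paths_def edges_def)
  have v: "val 0 u \<le> M" "val 1 u' \<le> M" using val_le[of 0 u] val_le[of 1 u'] assms M by simp_all
  have pw: "path_weight (\<lambda>x. int (wt x)) ?p = int (M - val 0 u) + int (M - val 1 u') + int M"
    using assms by (simp add: path_weight_def wt_simps)
  obtain q where q: "distance edges (\<lambda>x. int (wt x)) i (3 * n + j) = Some (path_weight (\<lambda>x. int (wt x)) q)"
    "path_weight (\<lambda>x. int (wt x)) q \<le> path_weight (\<lambda>x. int (wt x)) ?p"
    using distance_attained[OF path_weight_nonneg p] p by metis
  show ?thesis using q path_weight_nonneg[of q] pw v
    by (intro exI[of _ "nat (path_weight (\<lambda>x. int (wt x)) q)"]) simp
qed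

text \<open>A walk of four or more steps weighs at least \<open>4 * (M - V)\<close>, more than
  \<open>3 * M\<close> because \<open>M > 4 * V\<close>. Fewer than three steps cannot climb three
  layers, so the walk has exactly three, all of them forward, and the middle arc forces the same
  \<open>k\<close> on both sides.\<close>

lemma distance_lower:
  assumes "distance edges (\<lambda>x. int (wt x)) i (3 * n + j) = Some (int d)" "d \<le> 3 * M" "i < n" "j < n"
  shows "\<exists>k u u'. k < D \<and> u < m 0 \<and> u' < m 1 \<and> link 0 i u k \<and> link 1 j u' k \<and>
     d + val 0 u + val 1 u' = 3 * M"
proof -
  have "paths edges i (3 * n + j) \<noteq> {}" using assms by (auto simp: distance_def split: if_splits)
  then obtain p where p: "p \<in> paths edges i (3 * n + j)" "path_weight (\<lambda>x. int (wt x)) p = int d"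
    using distance_attained[OF path_weight_nonneg] assms(1) by (metis ex_in_conv option.inject)
  have sc: "successively (\<lambda>a b. (a, b) \<in> edges) p" and hd: "p \<noteq> []" "hd p = i" and lst: "last p = 3 * n + j"
    using p by (auto simp: paths_def)
  have "length (tl p) < 4"
  proof (rule ccontr)
    assume "\<not> ?thesis"
    then have "4 * (int M - int V) \<le> int (length (tl p)) * (int M - int V)"
      using M by (intro mult_right_mono) auto
    also have "\<dots> \<le> int d" using long_path[OF sc] p by simp
    finally show False using assms(2) M by simp
  qed
  have dv: "i div n = 0" "(3 * n + j) div n = 3" using assms n by simp_all
  have st: "y div n = Suc (x div n) \<or> x div n = Suc (y div n)" if "(x, y) \<in> edges" for x y
    using that layer unfolding edges_def by blast
  have fw: "(x, y) \<in> arcs" if "(x, y) \<in> edges" "y div n = Suc (x div n)" for x y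
    using that layer(1)[of y x] unfolding edges_def by auto
  obtain a b where ab: "p = [i, a, b, 3 * n + j]"
  proof -
    obtain rest where r: "p = i # rest" using hd by (cases p) auto
    then have "length rest < 4" using \<open>length (tl p) < 4\<close> by simp
    then consider "rest = []" | x where "rest = [x]" | x y where "rest = [x, y]" | x y z where "rest = [x, y, z]"
      by (auto simp: eval_nat_numeral less_Suc_eq length_Suc_conv)
    then show thesis
    proof cases
      case 1
      then show ?thesis using lst r dv by auto
    next
      case 2
      then show ?thesis using lst r dv sc st[of i x] by auto
    next
      case 3
      then show ?thesis using lst r dv sc st[of i x] st[of x y] by auto
    next
      case 4
      then show ?thesis using lst r that by auto
    qed
  qed
  have e: "(i, a) \<in> edges" "(a, b) \<in> edges" "(b, 3 * n + j) \<in> edges" using sc ab by auto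
  have "a div n = 1" "b div n = 2" using st[OF e(1)] st[OF e(2)] st[OF e(3)] dv by auto
  then have arc: "(i, a) \<in> arcs" "(a, b) \<in> arcs" "(b, 3 * n + j) \<in> arcs"
    using fw e dv by auto
  have ge: "n \<le> a" "2 * n \<le> b"
    using \<open>a div n = 1\<close> \<open>b div n = 2\<close> div_less_iff_less_mult[OF n, of a 1]
      div_less_iff_less_mult[OF n, of b 2] by auto
  have "b < 3 * n" using \<open>b div n = 2\<close> div_less_iff_less_mult[OF n, of b 3] by simp
  have "(i, a) \<in> left" using arc(1) assms(3) unfolding arcs_def middle_def right_def by auto
  then obtain u k where u: "a = n + (u * D + k)" "u < m 0" "k < D" "link 0 i u k"
    unfolding left_def by auto
  have "(a, b) \<in> middle" using arc(2) ge \<open>b < 3 * n\<close> unfolding arcs_def left_def right_def by auto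
  then obtain u1 u' k1 where u': "a = n + (u1 * D + k1)" "b = 2 * n + (u' * D + k1)" "u1 < m 0" "u' < m 1" "k1 < D"
    unfolding middle_def by auto
  have k1: "k1 = k" using u u' grid_index_inj[of u D k u1 k1] by simp
  have "(b, 3 * n + j) \<in> right" using arc(3) ge idx_less[of 0] idx_less[of 1] assms
    unfolding arcs_def left_def middle_def by fastforce
  then obtain j2 u2 k2 where u2: "b = 2 * n + (u2 * D + k2)" "j2 = j" "u2 < m 1" "k2 < D" "link 1 j2 u2 k2"
    unfolding right_def by auto
  have "u2 = u' \<and> k2 = k" using u2 u' k1 grid_index_inj[of u2 D k2 u' k1] by simp
  moreover have "int d = int (M - val 0 u) + int (M - val 1 u') + int M"
    using p(2) u u' k1 assms unfolding ab by (simp add: path_weight_def wt_simps)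
  moreover have "val 0 u \<le> M" "val 1 u' \<le> M" using val_le[of 0 u] val_le[of 1 u'] u u' M by simp_all
  ultimately show ?thesis using u u' u2
    by (intro exI[of _ k] exI[of _ u] exI[of _ u']) auto
qed

end

subsection \<open>Tables of one phase\<close>

text \<open>
  The two matrices are treated symmetrically: \<open>f 0 i k\<close> stands for \<open>A i k\<close> and \<open>f 1 j k\<close> for
  \<open>B k j\<close>. Registers: 0 base of the addresses, 1 \<open>n\<close>, 2 \<open>D\<close>, 3 \<open>g\<close>, 4 logarithm of \<open>n\<close>, 5 number of
  levels, 6 shift of the entries, 7 largest node weight, 8 word mask of the simulated machine, 9 number
  of nodes, 10 level, 11 \<open>t\<close>, 13 number of dropped bits, 14 number of the phase, 15 \<open>i\<close>, 16 \<open>j\<close>, 17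
  \<open>k\<close>, 18 and 29 index of a value, 19 a value, 20 \<open>Y i j\<close>, 21 number of uncovered pairs, 22 number of
  pivots, 23 index of a position, 24 number of calls so far, 25 and 26 the pivots of a call, 27 and 28
  their indices, 30 to 32 temporary, from 40 on the simulated machine.

  Arrays: 0 input and output, 1 shifted entries, 2 number of occurrences of a value in a row, 3 their
  positions, 4 distinct values of a row, 5 their number, 6 result of the previous level, 7 pivots, 8
  their number, 9 memory of the simulated machine, 10 current sums. The tables 2 to 5, 7 and 8 are
  indexed by the phase and the matrix, and array 9 by the call, so no table is ever cleared.
\<close>

definition opp :: "nat \<Rightarrow> nat" where
  "opp \<sigma> = (if \<sigma> = 0 then 1 else 0)"

lemma opp_simps [simp]: "opp \<sigma> < 2" "opp 0 = 1" "opp 1 = 0" "opp (Suc 0) = 0"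
  by (simp_all add: opp_def)

definition psE :: "nat \<Rightarrow> exp" where
  "psE \<sigma> = Plus (Times (Con 2) (Var 14)) (Con \<sigma>)"

definition fE :: "nat \<Rightarrow> exp \<Rightarrow> exp \<Rightarrow> exp" where
  "fE \<sigma> i k = Bin SHR (Rd 1 (Con \<sigma>) i k (Con 0)) (Var 13)"

definition yE :: "nat \<Rightarrow> exp \<Rightarrow> exp \<Rightarrow> exp" where
  "yE \<sigma> i j = Plus (Times (Con 2)
     (Rd 6 (if \<sigma> = 0 then i else j) (if \<sigma> = 0 then j else i) (Con 0) (Con 0))) (Var 11)"

definition nvE :: "nat \<Rightarrow> exp \<Rightarrow> exp" where
  "nvE \<sigma> i = Rd 5 (psE \<sigma>) i (Con 0) (Con 0)"

definition valE :: "nat \<Rightarrow> exp \<Rightarrow> exp \<Rightarrow> exp" where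
  "valE \<sigma> i u = Rd 4 (psE \<sigma>) i u (Con 0)"

definition cntE :: "nat \<Rightarrow> exp \<Rightarrow> exp \<Rightarrow> exp" where
  "cntE \<sigma> i v = Rd 2 (psE \<sigma>) i v (Con 0)"

definition improve :: "nat \<Rightarrow> exp \<Rightarrow> exp \<Rightarrow> nat \<Rightarrow> com" where
  "improve \<sigma> i j z =
     Branch (Lt (Var z) (Rd 10 (if \<sigma> = 0 then i else j) (if \<sigma> = 0 then j else i) (Con 0) (Con 0)))
       (Write 10 (if \<sigma> = 0 then i else j) (if \<sigma> = 0 then j else i) (Con 0) (Con 0) (Var z)) Skip"

definition build :: "nat \<Rightarrow> com" where
  "build \<sigma> = For 15 (Var 1) (For 17 (Var 2)
     (Assign 30 (fE \<sigma> (Var 15) (Var 17)) ;;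
      Assign 31 (cntE \<sigma> (Var 15) (Var 30)) ;;
      Write 3 (psE \<sigma>) (Var 15) (Var 30) (Var 31) (Var 17) ;;
      Write 2 (psE \<sigma>) (Var 15) (Var 30) (Con 0) (Plus (Var 31) (Con 1)) ;;
      Branch (Eq (Var 31) (Con 0))
        (Assign 32 (nvE \<sigma> (Var 15)) ;;
         Write 4 (psE \<sigma>) (Var 15) (Var 32) (Con 0) (Var 30) ;;
         Write 5 (psE \<sigma>) (Var 15) (Con 0) (Con 0) (Plus (Var 32) (Con 1)))
        Skip))"

definition scan :: "nat \<Rightarrow> com \<Rightarrow> com" where
  "scan \<sigma> c = For 15 (Var 1)
     (Assign 20 (yE \<sigma> (Var 15) (Var 16)) ;;
      For 18 (nvE (opp \<sigma>) (Var 16))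
        (Assign 19 (valE (opp \<sigma>) (Var 16) (Var 18)) ;; Branch (Lt (Var 20) (Var 19)) Skip c))"

lemma modified_scan [simp]: "modified (scan \<sigma> c) = {15, 18, 19, 20} \<union> modified c"
  and written_scan [simp]: "written (scan \<sigma> c) = written c"
  and modified_build [simp]: "modified (build \<sigma>) = {15, 17, 30, 31, 32}"
  and written_build [simp]: "written (build \<sigma>) = {2, 3, 4, 5}"
  and modified_improve [simp]: "modified (improve \<sigma> i j z) = {}"
  and written_improve [simp]: "written (improve \<sigma> i j z) = {10}"
  by (auto simp: scan_def build_def improve_def)

text \<open>Lists are described by the image of an initial segment: the order is immaterial, and as
  the length equals the cardinality, the entries are distinct. Counters exist for all
  \<open>v\<close>, being zero for values that do not occur.\<close>

definition row :: "(index \<Rightarrow> nat) \<Rightarrow> nat \<Rightarrow> (nat \<Rightarrow> nat) \<Rightarrow> nat \<Rightarrow> nat \<Rightarrow> bool" where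
  "row H ps h i m \<longleftrightarrow>
     H (5, ps, i, 0, 0) = card (h ` {..<m}) \<and>
     (\<lambda>u. H (4, ps, i, u, 0)) ` {..<card (h ` {..<m})} = h ` {..<m} \<and>
     (\<forall>v. H (2, ps, i, v, 0) = card {k. k < m \<and> h k = v}) \<and>
     (\<forall>v. (\<lambda>e. H (3, ps, i, v, e)) ` {..<card {k. k < m \<and> h k = v}} = {k. k < m \<and> h k = v})"

lemma row_0:
  assumes "H (5, ps, i, 0, 0) = 0" "\<And>v. H (2, ps, i, v, 0) = 0" shows "row H ps h i 0"
  using assms by (simp add: row_def)

lemma row_cong:
  assumes "\<And>t r. t \<in> {2, 3, 4, 5} \<Longrightarrow> H' (t, ps, i, r) = H (t, ps, i, r)"
  shows "row H' ps h i m = row H ps h i m"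
  using assms by (simp add: row_def)

text \<open>\<open>H1\<close> and \<open>H2\<close> are the writes of the body of
  \<open>build\<close>. The old counter is zero exactly at the first occurrence of a value, which is
  when the value joins the list of distinct values.\<close>

lemma row_Suc:
  assumes r: "row H ps h i k" and c: "c = card {k'. k' < k \<and> h k' = h k}"
    and nn: "nn = card (h ` {..<k})"
    and H1: "H1 = H((3, ps, i, h k, c) := k, (2, ps, i, h k, 0) := c + 1)"
    and H2: "H2 = (if c = 0 then H1((4, ps, i, nn, 0) := h k, (5, ps, i, 0, 0) := nn + 1) else H1)"
  shows "row H2 ps h i (Suc k)"
proof -
  have s: "{k'. k' < Suc k \<and> h k' = x} =
      (if x = h k then insert k {k'. k' < k \<and> h k' = x} else {k'. k' < k \<and> h k' = x})" for x
    by (auto simp: less_Suc_eq)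
  have im: "h ` {..<Suc k} = insert (h k) (h ` {..<k})" by (auto simp: lessThan_Suc)
  have c0: "c = 0 \<longleftrightarrow> h k \<notin> h ` {..<k}" unfolding c
    by (auto simp: card_eq_0_iff) (metis imageI lessThan_iff)
  have cnt: "H2 (2, ps, i, v, 0) = card {k'. k' < Suc k \<and> h k' = v}" for v
    using r unfolding s H2 H1 c by (auto simp: row_def)
  have pos: "(\<lambda>e. H2 (3, ps, i, v, e)) ` {..<card {k'. k' < Suc k \<and> h k' = v}} = {k'. k' < Suc k \<and> h k' = v}" for v
  proof (cases "v = h k")
    case True
    have "card {k'. k' < Suc k \<and> h k' = v} = Suc c" unfolding s c using True by simp
    moreover have "(\<lambda>e. H2 (3, ps, i, v, e)) ` {..<Suc c} =
       insert (H2 (3, ps, i, v, c)) ((\<lambda>e. H2 (3, ps, i, v, e)) ` {..<c})"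
      by (simp add: lessThan_Suc)
    moreover have "(\<lambda>e. H2 (3, ps, i, v, e)) ` {..<c} = (\<lambda>e. H (3, ps, i, v, e)) ` {..<c}"
      by (rule image_cong) (auto simp: H2 H1)
    moreover have "H2 (3, ps, i, v, c) = k" using True by (simp add: H2 H1)
    ultimately show ?thesis using r True unfolding s c by (simp add: row_def)
  next
    case False
    then have e: "(\<lambda>e. H2 (3, ps, i, v, e)) = (\<lambda>e. H (3, ps, i, v, e))" by (auto simp: H2 H1)
    show ?thesis using r False unfolding s e by (simp add: row_def)
  qed
  have nv: "H2 (5, ps, i, 0, 0) = card (h ` {..<Suc k}) \<and>
     (\<lambda>u. H2 (4, ps, i, u, 0)) ` {..<card (h ` {..<Suc k})} = h ` {..<Suc k}"
  proof (cases "c = 0")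
    case True
    then have cd: "card (h ` {..<Suc k}) = Suc nn" using c0 unfolding im nn by simp
    have "(\<lambda>u. H2 (4, ps, i, u, 0)) ` {..<Suc nn} =
       insert (H2 (4, ps, i, nn, 0)) ((\<lambda>u. H2 (4, ps, i, u, 0)) ` {..<nn})"
      by (simp add: lessThan_Suc)
    moreover have "(\<lambda>u. H2 (4, ps, i, u, 0)) ` {..<nn} = (\<lambda>u. H (4, ps, i, u, 0)) ` {..<nn}"
      by (rule image_cong) (auto simp: H2 H1)
    ultimately have "(\<lambda>u. H2 (4, ps, i, u, 0)) ` {..<Suc nn} = insert (h k) (h ` {..<k})"
      using r True nn by (simp add: row_def H2)
    then show ?thesis using True unfolding cd by (simp add: H2 im)
  next
    case False
    then have "h ` {..<Suc k} = h ` {..<k}" using c0 im by auto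
    then show ?thesis using r False by (simp add: row_def H2 H1)
  qed
  show ?thesis using cnt pos nv by (simp add: row_def)
qed

text \<open>One phase treats one target \<open>Y\<close> at one level; \<open>sh\<close> bits are
  dropped and \<open>ph\<close> stamps the tables. \<open>Y\<close> is arbitrary here: that one of
  three targets hits the minimum is a matter of the levels.\<close>

locale phase = word_machine +
  fixes n D g d ph sh t :: nat and f :: "nat \<Rightarrow> nat \<Rightarrow> nat \<Rightarrow> nat" and Y :: "nat \<Rightarrow> nat \<Rightarrow> nat"
  assumes n0: "0 < n" and D0: "0 < D" and g0: "0 < g"
    and nZ: "n < Z" and DZ: "D < Z" and gZ: "g < Z" and phZ: "2 * ph + 1 < Z" and Z100: "100 < Z"
    and f_less: "\<And>\<sigma> i k. \<sigma> < 2 \<Longrightarrow> i < n \<Longrightarrow> k < D \<Longrightarrow> f \<sigma> i k < Z"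
    and Y_less: "\<And>i j. i < n \<Longrightarrow> j < n \<Longrightarrow> Y i j < Z"
    and card_f: "\<And>\<sigma> i. \<sigma> < 2 \<Longrightarrow> i < n \<Longrightarrow> card (f \<sigma> i ` {..<D}) \<le> d"
begin

definition ys :: "nat \<Rightarrow> nat \<Rightarrow> nat \<Rightarrow> nat" where
  "ys \<sigma> i j = (if \<sigma> = 0 then Y i j else Y j i)"

definition env :: "store \<Rightarrow> bool" where
  "env s \<longleftrightarrow> fst s 1 = n \<and> fst s 2 = D \<and> fst s 3 = g \<and> fst s 11 = t \<and> fst s 13 = sh \<and>
     fst s 14 = ph \<and>
     (\<forall>\<sigma><2. \<forall>i<n. \<forall>k<D. drop_bit sh (snd s (1, \<sigma>, i, k, 0)) = f \<sigma> i k) \<and>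
     (\<forall>i<n. \<forall>j<n. 2 * snd s (6, i, j, 0, 0) + t = Y i j)"

lemma env_set_reg [simp]: "x \<notin> {1, 2, 3, 11, 13, 14} \<Longrightarrow> env (set_reg x a s) = env s"
  by (simp add: env_def)

lemma env_set_cell [simp]: "tg \<notin> {1, 6} \<Longrightarrow> env (set_cell (tg, r) a s) = env s"
  by (simp add: env_def)

lemma env_agree:
  assumes "env s" "agree X Y' s s'" "X \<inter> {1, 2, 3, 11, 13, 14} = {}" "Y' \<inter> {1, 6} = {}"
  shows "env s'"
proof -
  have "fst s' x = fst s x" if "x \<in> {1, 2, 3, 11, 13, 14}" for x
    using assms that by (intro agree_reg) auto
  moreover have "snd s' (x, r) = snd s (x, r)" if "x \<in> {1, 6}" for x r
    using assms that by (intro agree_cell) auto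
  ultimately show ?thesis using assms(1) by (simp add: env_def)
qed

lemma Z_le: "Z * Z * Z * Z \<le> 2 ^ w" "Z * Z * Z \<le> 2 ^ w" "Z * Z \<le> 2 ^ w" "Z \<le> 2 ^ w"
proof -
  have "Z ^ k \<le> 2 ^ w" if "k \<le> 5" for k
    using power_increasing[OF that, of Z] Z100 Z_power by linarith
  from this[of 4] this[of 3] this[of 2] this[of 1]
  show "Z * Z * Z * Z \<le> 2 ^ w" "Z * Z * Z \<le> 2 ^ w" "Z * Z \<le> 2 ^ w" "Z \<le> 2 ^ w"
    by (simp_all add: eval_nat_numeral mult.assoc)
qed

lemma lessW: "a < Z \<Longrightarrow> a < 2 ^ w" "a < Z \<Longrightarrow> b < Z \<Longrightarrow> a * b < 2 ^ w"
  "a < Z \<Longrightarrow> b < Z \<Longrightarrow> a + b < 2 ^ w" for a b :: nat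
proof -
  show "a < Z \<Longrightarrow> a < 2 ^ w" using Z_le by linarith
  assume ab: "a < Z" "b < Z"
  then have "a * b \<le> Z * b" by (intro mult_right_mono) auto
  also have "\<dots> < Z * Z" using ab by (intro mult_strict_left_mono) auto
  finally show "a * b < 2 ^ w" using Z_le by linarith
  have "2 * Z \<le> Z * Z" using Z100 by (intro mult_right_mono) auto
  then show "a + b < 2 ^ w" using ab Z_le by linarith
qed

lemma con_less [simp]: "a \<le> 100 \<Longrightarrow> a < 2 ^ w" "a \<le> 100 \<Longrightarrow> a < Z" for a :: nat
  using Z100 Z_le by linarith+

lemma one_less [simp]: "Suc 0 < 2 ^ w" "Suc 0 < Z" "0 < Z"
  using Z100 lessW(1)[of "Suc 0"] by linarith+

lemma psE [simp]:
  assumes "env s" "\<sigma> < 2"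
  shows "ev (psE \<sigma>) s = 2 * ph + \<sigma>" "ok (psE \<sigma>) s" "2 * ph + \<sigma> < Z"
  using assms phZ lessW(1)[of "2 * ph + \<sigma>"] lessW(1)[of \<sigma>] by (auto simp: psE_def env_def)

lemma fE [simp]:
  assumes "env s" "\<sigma> < 2" "ok a s" "ok b s" "ev a s < n" "ev b s < D"
  shows "ev (fE \<sigma> a b) s = f \<sigma> (ev a s) (ev b s)" "ok (fE \<sigma> a b) s"
  using assms nZ DZ by (auto simp: fE_def env_def)

lemma yE [simp]:
  assumes "env s" "ok a s" "ok b s" "ev a s < n" "ev b s < n"
  shows "ev (yE \<sigma> a b) s = ys \<sigma> (ev a s) (ev b s)" "ok (yE \<sigma> a b) s"
proof -
  have e: "2 * snd s (6, i, j, 0, 0) + t = Y i j" if "i < n" "j < n" for i j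
    using assms(1) that by (simp add: env_def)
  have l: "Y i j < 2 ^ w" if "i < n" "j < n" for i j using Y_less[OF that] lessW by blast
  have t: "fst s 11 = t" using assms(1) by (simp add: env_def)
  have l2: "2 * snd s (6, i, j, 0, 0) + t < 2 ^ w" "2 * snd s (6, i, j, 0, 0) < 2 ^ w"
    if "i < n" "j < n" for i j using e[OF that] l[OF that] by simp_all
  let ?i = "ev a s" and ?j = "ev b s"
  show "ev (yE \<sigma> a b) s = ys \<sigma> ?i ?j"
    using assms t e[of ?i ?j] e[of ?j ?i] by (simp add: yE_def ys_def)
  show "ok (yE \<sigma> a b) s"
    using assms t l2[of ?i ?j] l2[of ?j ?i] nZ by (simp add: yE_def)
qed

lemma nvE [simp]:
  assumes "env s" "\<sigma> < 2" "ok a s" "ev a s < Z"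
  shows "ev (nvE \<sigma> a) s = snd s (5, 2 * ph + \<sigma>, ev a s, 0, 0)" "ok (nvE \<sigma> a) s"
  using assms by (auto simp: nvE_def)

lemma valE [simp]:
  assumes "env s" "\<sigma> < 2" "ok a s" "ok b s" "ev a s < Z" "ev b s < Z"
  shows "ev (valE \<sigma> a b) s = snd s (4, 2 * ph + \<sigma>, ev a s, ev b s, 0)" "ok (valE \<sigma> a b) s"
  using assms by (auto simp: valE_def)

lemma cntE [simp]:
  assumes "env s" "\<sigma> < 2" "ok a s" "ok b s" "ev a s < Z" "ev b s < Z"
  shows "ev (cntE \<sigma> a b) s = snd s (2, 2 * ph + \<sigma>, ev a s, ev b s, 0)" "ok (cntE \<sigma> a b) s"
  using assms by (auto simp: cntE_def)

lemma ys_less: "i < n \<Longrightarrow> j < n \<Longrightarrow> ys \<sigma> i j < Z"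
  using Y_less by (simp add: ys_def)

lemma card_f_D: "card (f \<sigma> i ` {..<D}) \<le> D"
  using card_image_le[of "{..<D}" "f \<sigma> i"] by simp

definition cur_index :: "nat \<Rightarrow> nat \<Rightarrow> nat \<Rightarrow> index" where
  "cur_index \<sigma> i j = (10, if \<sigma> = 0 then i else j, if \<sigma> = 0 then j else i, 0, 0)"

lemma wp_improve:
  assumes "ok a s" "ok b s" "ev a s = i" "ev b s = j" "i < Z" "j < Z"
    and "Q (set_cell (cur_index \<sigma> i j) (min (snd s (cur_index \<sigma> i j)) (fst s z)) s) 2"
  shows "wp (improve \<sigma> a b z) s Q"
proof -
  have triv: "set_cell x (snd s x) s = s" for x by (simp add: set_cell_def)
  show ?thesis unfolding improve_def
  proof (rule wp_Branch)
    let ?b = "Lt (Var z) (Rd 10 (if \<sigma> = 0 then a else b) (if \<sigma> = 0 then b else a) (Con 0) (Con 0))"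
    show "ok_cond ?b s" using assms by simp
    have e: "ev_cond ?b s \<longleftrightarrow> fst s z < snd s (cur_index \<sigma> i j)"
      using assms by (simp add: cur_index_def)
    { assume "ev_cond ?b s"
      then have "min (snd s (cur_index \<sigma> i j)) (fst s z) = fst s z" using e by simp
      then show "wp (Write 10 (if \<sigma> = 0 then a else b) (if \<sigma> = 0 then b else a) (Con 0) (Con 0) (Var z)) s
         (\<lambda>s t. Q s (t + 1))"
        using assms by (intro wp_Write) (auto simp: cur_index_def numeral_2_eq_2) }
    { assume "\<not> ev_cond ?b s"
      then have "min (snd s (cur_index \<sigma> i j)) (fst s z) = snd s (cur_index \<sigma> i j)" using e by simp
      then show "wp Skip s (\<lambda>s t. Q s (t + 1))"
        using assms(7) by (intro wp_Skip) (simp add: triv numeral_2_eq_2) }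
  qed
qed

text \<open>\<open>fresh\<close> stands in for clearing: rows of zeros are correct tables for no
  entries at all, and \<open>row_Suc\<close> extends them by one entry at a time.\<close>

lemma build_correct:
  assumes env: "env s0" and \<sigma>: "\<sigma> < 2"
    and fresh: "\<And>i r. snd s0 (5, 2 * ph + \<sigma>, i, r) = 0" "\<And>i r. snd s0 (2, 2 * ph + \<sigma>, i, r) = 0"
  shows "wp (build \<sigma>) s0 (\<lambda>s t. t \<le> n * (D * 10 + 4) + 2 \<and>
    (\<forall>i<n. row (snd s) (2 * ph + \<sigma>) (f \<sigma> i) i D) \<and>
    (\<forall>tg ps r. ps \<noteq> 2 * ph + \<sigma> \<longrightarrow> snd s (tg, ps, r) = snd s0 (tg, ps, r)))"
proof -
  let ?ps = "2 * ph + \<sigma>"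
  define I where "I i k s \<longleftrightarrow>
    (\<forall>i'<n. row (snd s) ?ps (f \<sigma> i') i' (if i' < i then D else if i' = i then k else 0)) \<and>
    (\<forall>tg ps r. ps \<noteq> ?ps \<longrightarrow> snd s (tg, ps, r) = snd s0 (tg, ps, r))" for i k and s :: store
  have I_reg [simp]: "I i k (set_reg x a s) = I i k s" for i k x a s by (simp add: I_def)
  have next_row: "I i D s = I (Suc i) 0 s" for i s
    unfolding I_def by (auto simp: less_Suc_eq intro!: arg_cong2[where f = conj] all_cong)
  let ?X = "{15, 17, 30, 31, 32}" and ?W = "{2, 3, 4, 5}"
  have w: "n < 2 ^ w" "D < 2 ^ w" using nZ DZ lessW by blast+
  show ?thesis unfolding build_def
  proof (rule wp_For[where N = n and I = "\<lambda>i. I i 0" and T = "\<lambda>_. D * 10 + 2" and X = ?X and Y = ?W])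
    show "I 0 0 (set_reg 15 0 s0)" using fresh by (simp add: I_def row_0)
    fix i s assume i: "i < n" and ag: "agree ?X ?W s0 s" and i15: "fst s 15 = i" and I: "I i 0 s"
    show "wp (For 17 (Var 2)
     (Assign 30 (fE \<sigma> (Var 15) (Var 17)) ;; Assign 31 (cntE \<sigma> (Var 15) (Var 30)) ;;
      Write 3 (psE \<sigma>) (Var 15) (Var 30) (Var 31) (Var 17) ;;
      Write 2 (psE \<sigma>) (Var 15) (Var 30) (Con 0) (Plus (Var 31) (Con 1)) ;;
      Branch (Eq (Var 31) (Con 0)) (Assign 32 (nvE \<sigma> (Var 15)) ;;
         Write 4 (psE \<sigma>) (Var 15) (Var 32) (Con 0) (Var 30) ;;
         Write 5 (psE \<sigma>) (Var 15) (Con 0) (Con 0) (Plus (Var 32) (Con 1))) Skip)) s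
      (\<lambda>s' t. t \<le> D * 10 + 2 \<and> I (Suc i) 0 (set_reg 15 (Suc i) s'))"
    proof (rule wp_For[where N = D and I = "I i" and T = "\<lambda>_. 8" and X = "{17, 30, 31, 32}" and Y = ?W])
      fix k s' assume k: "k < D" and ag': "agree {17, 30, 31, 32} ?W s s'" and k17: "fst s' 17 = k" and I: "I i k s'"
      have es: "env s'" using env_agree[OF env_agree[OF env ag] ag'] by simp
      have i15': "fst s' 15 = i" using agree_reg[OF ag'] i15 by simp
      let ?v = "f \<sigma> i k" 
      let ?c = "snd s' (2, ?ps, i, ?v, 0)" and ?nn = "snd s' (5, ?ps, i, 0, 0)"
      have r: "row (snd s') ?ps (f \<sigma> i) i k" using I i by (auto simp: I_def)
      have c: "?c = card {k'. k' < k \<and> f \<sigma> i k' = ?v}" and nn: "?nn = card (f \<sigma> i ` {..<k})"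
        using r by (simp_all add: row_def)
      have "card {k'. k' < k \<and> f \<sigma> i k' = ?v} \<le> card {..<k}" by (intro card_mono) auto
      then have cD: "?c < D" using c k by simp
      have "card (f \<sigma> i ` {..<k}) \<le> card {..<k}" by (intro card_image_le) auto
      then have nD: "?nn < D" using nn k by simp
      have lts: "i < Z" "k < Z" "?v < Z" "?c < Z" "?nn < Z" "Suc ?c < 2 ^ w" "Suc ?nn < 2 ^ w" 
        "?v < 2 ^ w" "k < 2 ^ w"
        using i k nZ DZ cD nD w(2) f_less[OF \<sigma> i k] lessW(1)[of ?v] lessW(1)[of k] by linarith+
      let ?H1 = "(snd s')((3, ?ps, i, ?v, ?c) := k, (2, ?ps, i, ?v, 0) := ?c + 1)"
      let ?H2 = "if ?c = 0 then ?H1((4, ?ps, i, ?nn, 0) := ?v, (5, ?ps, i, 0, 0) := ?nn + 1) else ?H1"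
      have r2: "row ?H2 ?ps (f \<sigma> i) i (Suc k)" by (rule row_Suc[OF r c nn refl refl])
      have "row ?H2 ?ps (f \<sigma> i') i' m = row (snd s') ?ps (f \<sigma> i') i' m" if "i' \<noteq> i" for i' m
        by (rule row_cong) (use that in auto)
      then have I2: "I i (Suc k) s2" if "snd s2 = ?H2" for s2
        using I r2 unfolding I_def that by auto
      show "wp (Assign 30 (fE \<sigma> (Var 15) (Var 17)) ;; Assign 31 (cntE \<sigma> (Var 15) (Var 30)) ;;
        Write 3 (psE \<sigma>) (Var 15) (Var 30) (Var 31) (Var 17) ;;
        Write 2 (psE \<sigma>) (Var 15) (Var 30) (Con 0) (Plus (Var 31) (Con 1)) ;;
        Branch (Eq (Var 31) (Con 0)) (Assign 32 (nvE \<sigma> (Var 15)) ;;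
           Write 4 (psE \<sigma>) (Var 15) (Var 32) (Con 0) (Var 30) ;;
           Write 5 (psE \<sigma>) (Var 15) (Con 0) (Con 0) (Plus (Var 32) (Con 1))) Skip) s'
        (\<lambda>s' t. t \<le> 8 \<and> I i (Suc k) (set_reg 17 (Suc k) s'))"
        unfolding I_reg
        by (intro wp_Seq wp_Assign wp_Write wp_Branch wp_Skip conjI I2)
          (use i k lts es \<sigma> i15' k17 in simp_all)
    next
      fix k s' assume ag': "agree {17, 30, 31, 32} ?W s s'"
      have es: "env s'" using env_agree[OF env_agree[OF env ag] ag'] by simp
      then show "ok (Var 2) s' \<and> ev (Var 2) s' = D" by (simp add: env_def)
    qed (use I w in \<open>auto simp: next_row\<close>)
  next
    fix i s assume ag: "agree ?X ?W s0 s"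
    then show "ok (Var 1) s \<and> ev (Var 1) s = n" using env_agree[OF env ag] by (simp add: env_def)
  next
    fix s t assume "I n 0 s" "t \<le> (\<Sum>i<n. D * 10 + 2 + 2) + 2"
    then show "t \<le> n * (D * 10 + 4) + 2 \<and>
    (\<forall>i<n. row (snd s) (2 * ph + \<sigma>) (f \<sigma> i) i D) \<and>
    (\<forall>tg ps r. ps \<noteq> 2 * ph + \<sigma> \<longrightarrow> snd s (tg, ps, r) = snd s0 (tg, ps, r))"
      by (auto simp: I_def algebra_simps)
  qed (use w in auto)
qed

text \<open>Counting, enumerating, covering and drawing arcs all fix an index \<open>j\<close> of
  the other matrix and run, for every \<open>i\<close>, through the distinct values of
  \<open>j\<close>. Values above the target are skipped, as no natural number complements them.
  \<open>J i u\<close> is the invariant before value \<open>u\<close> in row \<open>i\<close>; by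
  \<open>ins\<close> it ignores the registers of the loop itself.\<close>

lemma wp_scan:
  assumes env: "env s0" and \<sigma>: "\<sigma> < 2" and j: "fst s0 16 = j" "j < n"
    and mm: "snd s0 (5, 2 * ph + (opp \<sigma>), j, 0, 0) = mm" "mm \<le> D"
    and bb: "\<And>u. u < mm \<Longrightarrow> snd s0 (4, 2 * ph + (opp \<sigma>), j, u, 0) = bb u"
    and mods: "modified c \<subseteq> X" "X \<inter> {1, 2, 3, 11, 13, 14, 15, 16, 18, 19, 20} = {}"
    and wr: "written c \<subseteq> W" "W \<inter> {1, 4, 5, 6} = {}"
    and ins: "\<And>i u s x a. x \<in> {15, 18, 19, 20} \<Longrightarrow> J i u (set_reg x a s) = J i u s"
    and init: "J 0 0 s0"
    and body: "\<And>i u s. i < n \<Longrightarrow> u < mm \<Longrightarrow> agree (X \<union> {15, 18, 19, 20}) W s0 s \<Longrightarrow> env s \<Longrightarrow>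
       fst s 15 = i \<Longrightarrow> fst s 16 = j \<Longrightarrow> fst s 18 = u \<Longrightarrow> fst s 19 = bb u \<Longrightarrow> fst s 20 = ys \<sigma> i j \<Longrightarrow>
       bb u \<le> ys \<sigma> i j \<Longrightarrow> J i u s \<Longrightarrow> wp c s (\<lambda>s' t. t \<le> T i u \<and> J i (Suc u) s')"
    and skip: "\<And>i u s. i < n \<Longrightarrow> u < mm \<Longrightarrow> \<not> bb u \<le> ys \<sigma> i j \<Longrightarrow> J i u s \<Longrightarrow> J i (Suc u) s"
    and nxt: "\<And>i s. i < n \<Longrightarrow> J i mm s \<Longrightarrow> J (Suc i) 0 s"
    and fin: "\<And>s t. agree (X \<union> {15, 18, 19, 20}) W s0 s \<Longrightarrow> J n 0 s \<Longrightarrow>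
       t \<le> (\<Sum>i<n. (\<Sum>u<mm. T i u + 5) + 5) + 2 \<Longrightarrow> Q s t"
  shows "wp (scan \<sigma> c) s0 Q"
  unfolding scan_def
proof (rule wp_For[where N = n and I = "\<lambda>i. J i 0" and T = "\<lambda>i. (\<Sum>u<mm. T i u + 5) + 3"
      and X = "X \<union> {15, 18, 19, 20}" and Y = W])
  have w: "n < 2 ^ w" "D < 2 ^ w" using nZ DZ lessW by blast+
  then show "n < 2 ^ w" by simp
  show "J 0 0 (set_reg 15 0 s0)" using ins init by simp
  have \<sigma>': "opp \<sigma> < 2" by simp
  {
    fix i s assume ag: "agree (X \<union> {15, 18, 19, 20}) W s0 s"
    have es: "env s" by (rule env_agree[OF env ag]) (use mods wr in auto)
    then show "ok (Var 1) s \<and> ev (Var 1) s = n" by (simp add: env_def)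
  next
    fix i s assume i: "i < n" and ag: "agree (X \<union> {15, 18, 19, 20}) W s0 s" and i15: "fst s 15 = i"
      and J: "J i 0 s"
    have es: "env s" by (rule env_agree[OF env ag]) (use mods wr in auto)
    have j16: "fst s 16 = j" using agree_reg[OF ag, of 16] mods j by auto
    let ?s1 = "set_reg 20 (ys \<sigma> i j) s"
    have inner: "wp (For 18 (nvE (opp \<sigma>) (Var 16))
        (Assign 19 (valE (opp \<sigma>) (Var 16) (Var 18)) ;; Branch (Lt (Var 20) (Var 19)) Skip c)) ?s1
      (\<lambda>s' t. t \<le> (\<Sum>u<mm. T i u + 5) + 2 \<and> J (Suc i) 0 s')"
    proof (rule wp_For[where N = mm and I = "J i" and T = "\<lambda>u. T i u + 3" and X = "X \<union> {18, 19}" and Y = W])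
      show "mm < 2 ^ w" using w mm by linarith
      show "J i 0 (set_reg 18 0 ?s1)" using ins J by simp
      {
        fix u s' assume ag': "agree (X \<union> {18, 19}) W ?s1 s'"
        have ag2: "agree (X \<union> {15, 18, 19, 20}) W s0 s'"
        proof -
          have "agree {20} {} s ?s1" by (simp add: agree_def)
          from agree_trans[OF ag agree_trans[OF this ag']] show ?thesis by (rule agree_mono) auto
        qed
        have es': "env s'" by (rule env_agree[OF env ag2]) (use mods wr in auto)
        have r: "fst s' 16 = j" "fst s' 15 = i" "fst s' 20 = ys \<sigma> i j"
          using agree_reg[OF ag', of 16] agree_reg[OF ag', of 15] agree_reg[OF ag', of 20] mods(2) j16 i15 by auto
        have nv: "snd s' (5, 2 * ph + (opp \<sigma>), j, 0, 0) = mm"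
          using agree_cell[OF ag2, of 5] wr(2) mm by auto
        have vl: "snd s' (4, 2 * ph + (opp \<sigma>), j, u, 0) = bb u" if "u < mm" for u
          using agree_cell[OF ag2, of 4] wr(2) bb that by auto
        note ag2 es' r nv vl
      } note facts = this
      {
        fix u s' assume ag': "agree (X \<union> {18, 19}) W ?s1 s'"
        show "ok (nvE (opp \<sigma>) (Var 16)) s' \<and> ev (nvE (opp \<sigma>) (Var 16)) s' = mm"
          using facts[OF ag'] \<sigma>' j(2) nZ by simp
      next
        fix u s' assume u: "u < mm" and ag': "agree (X \<union> {18, 19}) W ?s1 s'" and u18: "fst s' 18 = u"
          and J: "J i u s'"
        note F = facts[OF ag']
        have lt: "u < Z" "j < Z" using u mm DZ j nZ by linarith+
        let ?s2 = "set_reg 19 (bb u) s'"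
        have e: "ev (valE (opp \<sigma>) (Var 16) (Var 18)) s' = bb u" "ok (valE (opp \<sigma>) (Var 16) (Var 18)) s'"
          using F lt \<sigma>' u18 u by simp_all
        have ag2: "agree (X \<union> {15, 18, 19, 20}) W s0 ?s2"
        proof -
          have "agree {19} {} s' ?s2" by (simp add: agree_def)
          from agree_trans[OF F(1) this] show ?thesis by (rule agree_mono) auto
        qed
        show "wp (Assign 19 (valE (opp \<sigma>) (Var 16) (Var 18)) ;; Branch (Lt (Var 20) (Var 19)) Skip c) s'
           (\<lambda>s' t. t \<le> T i u + 3 \<and> J i (Suc u) (set_reg 18 (Suc u) s'))"
        proof (rule wp_Seq, rule wp_Assign[OF e(2)], unfold e(1), rule wp_Branch)
          show "ok_cond (Lt (Var 20) (Var 19)) ?s2" by simp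
          assume "ev_cond (Lt (Var 20) (Var 19)) ?s2"
          then have "\<not> bb u \<le> ys \<sigma> i j" using F by simp
          then have "J i (Suc u) ?s2" using skip[OF i u] J ins by simp
          then show "wp Skip ?s2 (\<lambda>s t. 1 + (t + 1) \<le> T i u + 3 \<and> J i (Suc u) (set_reg 18 (Suc u) s))"
            by (intro wp_Skip) (simp add: ins)
        next
          assume "\<not> ev_cond (Lt (Var 20) (Var 19)) ?s2"
          then have "bb u \<le> ys \<sigma> i j" using F by simp
          then have "wp c ?s2 (\<lambda>s' t. t \<le> T i u \<and> J i (Suc u) s')"
            by (intro body[OF i u ag2]) (use F u18 J ins in simp_all)
          then show "wp c ?s2 (\<lambda>s t. 1 + (t + 1) \<le> T i u + 3 \<and> J i (Suc u) (set_reg 18 (Suc u) s))"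
            by (rule wp_conseq) (simp add: ins)
        qed
      next
        fix s' t assume "J i mm s'" "t \<le> (\<Sum>i'<mm. T i i' + 3 + 2) + 2"
        then show "t \<le> (\<Sum>u<mm. T i u + 5) + 2 \<and> J (Suc i) 0 s'"
          using nxt[OF i] by (simp add: ac_simps)
      }
    qed (use mods wr in auto)
    have e: "ev (yE \<sigma> (Var 15) (Var 16)) s = ys \<sigma> i j" "ok (yE \<sigma> (Var 15) (Var 16)) s"
      using es i15 i j16 j by simp_all
    show "wp (Assign 20 (yE \<sigma> (Var 15) (Var 16)) ;; For 18 (nvE (opp \<sigma>) (Var 16))
        (Assign 19 (valE (opp \<sigma>) (Var 16) (Var 18)) ;; Branch (Lt (Var 20) (Var 19)) Skip c)) s
        (\<lambda>s' t. t \<le> (\<Sum>u<mm. T i u + 5) + 3 \<and> J (Suc i) 0 (set_reg 15 (Suc i) s'))"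
      by (rule wp_Seq, rule wp_Assign[OF e(2)], unfold e(1), rule wp_conseq[OF inner]) (simp add: ins)
  next
    fix s t assume "agree (X \<union> {15, 18, 19, 20}) W s0 s" "J n 0 s"
      "t \<le> (\<Sum>i<n. (\<Sum>u<mm. T i u + 5) + 3 + 2) + 2"
    then show "Q s t" by (intro fin) (simp_all add: ac_simps)
  }
qed (use mods wr in auto)

end

subsection \<open>Enumerating light columns and covering by pivots\<close>

definition count :: "nat \<Rightarrow> com" where
  "count \<sigma> = Assign 21 (Con 0) ;;
     scan \<sigma> (Assign 21 (Plus (Var 21) (cntE \<sigma> (Var 15) (Minus (Var 20) (Var 19)))))"

definition enumerate_light :: "nat \<Rightarrow> com" where
  "enumerate_light \<sigma> = scan \<sigma>
     (Assign 30 (Minus (Var 20) (Var 19)) ;;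
      For 23 (cntE \<sigma> (Var 15) (Var 30))
        (Assign 17 (Rd 3 (psE \<sigma>) (Var 15) (Var 30) (Var 23)) ;;
         Branch (Eq (fE (opp \<sigma>) (Var 16) (Var 17)) (Var 19)) (improve \<sigma> (Var 15) (Var 16) 20) Skip))"

text \<open>Setting the counters of the covered pairs to zero makes later columns skip them.\<close>

definition cover :: "nat \<Rightarrow> com" where
  "cover \<sigma> = Write 7 (psE \<sigma>) (Var 22) (Con 0) (Con 0) (Var 16) ;;
     Assign 22 (Plus (Var 22) (Con 1)) ;;
     scan \<sigma> (Write 2 (psE \<sigma>) (Var 15) (Minus (Var 20) (Var 19)) (Con 0) (Con 0))"

text \<open>Comparing \<open>S * g\<close> with \<open>n * D\<close>, where \<open>S\<close> is the
  number of uncovered pairs, is the test for a light \<open>j\<close> without a division.\<close>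

definition pass :: "nat \<Rightarrow> com" where
  "pass \<sigma> = Assign 22 (Con 0) ;;
     For 16 (Var 1)
       (count \<sigma> ;;
        Branch (Lt (Times (Var 21) (Var 3)) (Times (Var 1) (Var 2))) (enumerate_light \<sigma>) (cover \<sigma>)) ;;
     Write 8 (psE \<sigma>) (Con 0) (Con 0) (Con 0) (Var 22)"

lemma modified_pass_parts [simp]:
  "modified (count \<sigma>) = {15, 18, 19, 20, 21}"
  "modified (enumerate_light \<sigma>) = {15, 17, 18, 19, 20, 23, 30}"
  "modified (cover \<sigma>) = {15, 18, 19, 20, 22}"
  "modified (pass \<sigma>) = {15, 16, 17, 18, 19, 20, 21, 22, 23, 30}"
  by (auto simp: count_def enumerate_light_def cover_def pass_def)

lemma written_pass_parts [simp]:
  "written (count \<sigma>) = {}"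
  "written (enumerate_light \<sigma>) = {10}"
  "written (cover \<sigma>) = {2, 7}"
  "written (pass \<sigma>) = {2, 7, 8, 10}"
  by (auto simp: count_def enumerate_light_def cover_def pass_def)

text \<open>Distinct values \<open>bb u\<close> complement to distinct counters
  \<open>y - bb u\<close>, so the amount counted is exactly the amount removed when these counters
  are set to zero.\<close>

lemma cover_sum:
  fixes c c' bb :: "nat \<Rightarrow> nat"
  assumes fin: "finite S" and out: "\<And>v. v \<notin> S \<Longrightarrow> c v = 0" and inj: "inj_on bb {..<mm}"
    and c': "\<And>v. c' v = (if \<exists>u<mm. bb u \<le> y \<and> v = y - bb u then 0 else c v)"
  shows "(\<Sum>v\<in>S. c' v) + (\<Sum>u<mm. if bb u \<le> y then c (y - bb u) else 0) = (\<Sum>v\<in>S. c v)"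
proof -
  let ?U = "{u. u < mm \<and> bb u \<le> y}" and ?V = "(\<lambda>u. y - bb u) ` {u. u < mm \<and> bb u \<le> y}"
  have fU: "finite ?U" by simp
  have inj': "inj_on (\<lambda>u. y - bb u) ?U"
  proof (rule inj_onI)
    fix u u' assume *: "u \<in> ?U" "u' \<in> ?U" "y - bb u = y - bb u'"
    have "bb u = y - (y - bb u)" using *(1) by simp
    also have "\<dots> = y - (y - bb u')" by (simp only: *(3))
    also have "\<dots> = bb u'" using *(2) by simp
    finally have "bb u = bb u'" .
    then show "u = u'" using *(1,2) inj_onD[OF inj, of u u'] by simp
  qed
  have "(\<Sum>u<mm. if bb u \<le> y then c (y - bb u) else 0) = (\<Sum>u\<in>?U. c (y - bb u))"
    by (rule sum.mono_neutral_cong_right) auto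
  also have "\<dots> = (\<Sum>v\<in>?V. c v)" using inj' by (simp add: sum.reindex)
  also have "\<dots> = (\<Sum>v\<in>S \<inter> ?V. c v)"
  proof (rule sum.mono_neutral_right)
    show "\<forall>v\<in>?V - S \<inter> ?V. c v = 0"
    proof
      fix v assume "v \<in> ?V - S \<inter> ?V"
      then have "v \<notin> S" by blast
      then show "c v = 0" by (rule out)
    qed
  qed (use fU in auto)
  finally have 1: "(\<Sum>u<mm. if bb u \<le> y then c (y - bb u) else 0) = (\<Sum>v\<in>S \<inter> ?V. c v)" .
  have "(\<Sum>v\<in>S. c' v) = (\<Sum>v\<in>S - ?V. c v)"
  proof (rule sum.mono_neutral_cong_right)
    show "\<forall>v\<in>S - (S - ?V). c' v = 0" unfolding c' by auto
    fix v assume "v \<in> S - ?V"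
    then show "c' v = c v" unfolding c' by auto
  qed (use fin in auto)
  moreover have "(\<Sum>v\<in>S. c v) = (\<Sum>v\<in>S - ?V. c v) + (\<Sum>v\<in>S \<inter> ?V. c v)"
    using sum.Int_Diff[OF fin, of c ?V] by simp
  ultimately show ?thesis using 1 by simp
qed

lemma sum_card_image_fibres:
  assumes "finite A" shows "(\<Sum>y\<in>h ` A. card {x \<in> A. h x = y}) = card A"
proof -
  have "card A = (\<Sum>x\<in>A. 1)" by simp
  also have "\<dots> = (\<Sum>y\<in>h ` A. \<Sum>x\<in>{x \<in> A. h x = y}. 1)" using assms by (rule sum.image_gen)
  finally show ?thesis by simp
qed

section \<open>Invariants and costs of one pass\<close>

context phase begin

definition vals_ok :: "nat \<Rightarrow> store \<Rightarrow> bool" where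
  "vals_ok \<tau> s \<longleftrightarrow> (\<forall>i<n. snd s (5, 2 * ph + \<tau>, i, 0, 0) = card (f \<tau> i ` {..<D}) \<and>
     (\<lambda>u. snd s (4, 2 * ph + \<tau>, i, u, 0)) ` {..<card (f \<tau> i ` {..<D})} = f \<tau> i ` {..<D})"

definition pos_ok :: "nat \<Rightarrow> store \<Rightarrow> bool" where
  "pos_ok \<tau> s \<longleftrightarrow> (\<forall>i<n. \<forall>v.
     (\<lambda>e. snd s (3, 2 * ph + \<tau>, i, v, e)) ` {..<card {k. k < D \<and> f \<tau> i k = v}} = {k. k < D \<and> f \<tau> i k = v})"

definition full :: "nat \<Rightarrow> nat \<Rightarrow> nat \<Rightarrow> nat" where
  "full \<tau> i v = card {k. k < D \<and> f \<tau> i k = v}"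

definition cnt :: "nat \<Rightarrow> store \<Rightarrow> nat \<Rightarrow> nat \<Rightarrow> nat" where
  "cnt \<tau> s i v = snd s (2, 2 * ph + \<tau>, i, v, 0)"

text \<open>Stored values are sums of actual entries and thus never below the minimum; this leaves
  only upper bounds to be shown.\<close>

definition sums_ok :: "store \<Rightarrow> bool" where
  "sums_ok s \<longleftrightarrow> (\<forall>i<n. \<forall>j<n. \<exists>k<D. snd s (10, i, j, 0, 0) = f 0 i k + f 1 j k)"

definition below :: "store \<Rightarrow> store \<Rightarrow> bool" where
  "below s s0 \<longleftrightarrow> (\<forall>r. snd s (10, r) \<le> snd s0 (10, r))"

lemma vals_ok_agree: "vals_ok \<tau> s \<Longrightarrow> agree X W s s' \<Longrightarrow> W \<inter> {4, 5} = {} \<Longrightarrow> vals_ok \<tau> s'"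
proof -
  assume a: "vals_ok \<tau> s" "agree X W s s'" "W \<inter> {4, 5} = {}"
  have "snd s' (4, r) = snd s (4, r)" "snd s' (5, r) = snd s (5, r)" for r
    using agree_cell[OF a(2)] a(3) by auto
  then show ?thesis using a(1) by (simp add: vals_ok_def)
qed

lemma pos_ok_agree: "pos_ok \<tau> s \<Longrightarrow> agree X W s s' \<Longrightarrow> 3 \<notin> W \<Longrightarrow> pos_ok \<tau> s'"
  by (simp add: pos_ok_def agree_cell)

lemma full_le: "full \<tau> i v \<le> D"
  using card_mono[of "{..<D}" "{k. k < D \<and> f \<tau> i k = v}"] by (auto simp: full_def)

lemma sums_ok_improve:
  assumes "sums_ok s" "\<sigma> < 2" "i < n" "j < n" "k < D" "f \<sigma> i k + f (opp \<sigma>) j k = y"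
  shows "sums_ok (set_cell (cur_index \<sigma> i j) (min (snd s (cur_index \<sigma> i j)) y) s)"
proof -
  have "\<exists>k<D. snd (set_cell (cur_index \<sigma> i j) (min (snd s (cur_index \<sigma> i j)) y) s) (10, i', j', 0, 0) = f 0 i' k + f 1 j' k"
    if ij: "i' < n" "j' < n" for i' j'
  proof (cases "(10, i', j', 0, 0) = cur_index \<sigma> i j")
    case True
    show ?thesis
    proof (cases "snd s (cur_index \<sigma> i j) \<le> y")
      case le: True
      then show ?thesis using assms(1) ij unfolding sums_ok_def True[symmetric] by simp
    next
      case False
      have "f 0 i' k + f 1 j' k = y" using True assms
        by (cases "\<sigma> = 0") (auto simp: cur_index_def less_2_cases_iff)
      then show ?thesis using False assms(5) unfolding True[symmetric] by auto
    qed
  next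
    case False
    then show ?thesis using assms(1) ij unfolding sums_ok_def by auto
  qed
  then show ?thesis by (simp add: sums_ok_def)
qed

lemma below_improve: "below s s0 \<Longrightarrow> below (set_cell x (min (snd s x) y) s) s0"
  unfolding below_def by (auto simp: min_le_iff_disj)

lemma sums_below_reg [simp]:
  "sums_ok (set_reg x a s) = sums_ok s" "below (set_reg x a s) s0 = below s s0"
  by (simp_all add: sums_ok_def below_def)

lemma cur_index_10: "cur_index \<sigma> i j = (10, snd (cur_index \<sigma> i j))"
  by (simp add: cur_index_def)

text \<open>The uncovered positions in row \<open>i\<close> that the \<open>u\<close>-th value of
  \<open>j\<close> complements. Their total over \<open>i\<close> and \<open>u\<close> decides
  whether \<open>j\<close> is light, bounds the enumeration, and is what covering removes.\<close>

definition hits :: "nat \<Rightarrow> store \<Rightarrow> nat \<Rightarrow> nat \<Rightarrow> nat \<Rightarrow> nat" where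
  "hits \<sigma> s j i u = (let b = snd s (4, 2 * ph + (opp \<sigma>), j, u, 0) in
     if b \<le> ys \<sigma> i j then cnt \<sigma> s i (ys \<sigma> i j - b) else 0)"

lemma count_correct:
  assumes env: "env s0" and \<sigma>: "\<sigma> < 2" and j: "fst s0 16 = j" "j < n" and vals: "vals_ok (opp \<sigma>) s0"
    and le: "\<And>i v. i < n \<Longrightarrow> cnt \<sigma> s0 i v \<le> D"
  shows "wp (count \<sigma>) s0 (\<lambda>s t. t \<le> n * (d * 6 + 5) + 3 \<and> snd s = snd s0 \<and>
    fst s 21 = (\<Sum>i<n. \<Sum>u<card (f (opp \<sigma>) j ` {..<D}). hits \<sigma> s0 j i u))"
proof -
  let ?mm = "card (f (opp \<sigma>) j ` {..<D})" and ?bb = "\<lambda>u. snd s0 (4, 2 * ph + (opp \<sigma>), j, u, 0)"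
  let ?c = "hits \<sigma> s0 j"
  define J where "J i u s \<longleftrightarrow> fst s 21 = (\<Sum>i<i. \<Sum>u<?mm. ?c i u) + (\<Sum>u<u. ?c i u) \<and> snd s = snd s0"
    for i u and s :: store
  have mm: "snd s0 (5, 2 * ph + (opp \<sigma>), j, 0, 0) = ?mm" "?mm \<le> D" "?mm \<le> d"
    using vals j card_f_D card_f[of "opp \<sigma>" j] by (simp_all add: vals_ok_def)
  have cD: "?c i u \<le> D" if "i < n" for i u using le[OF that] by (simp add: hits_def Let_def)
  show ?thesis unfolding count_def
  proof (rule wp_Seq, rule wp_Assign)
    show "ok (Con 0) s0" by simp
    show "wp (scan \<sigma> (Assign 21 (Plus (Var 21) (cntE \<sigma> (Var 15) (Minus (Var 20) (Var 19))))))
       (set_reg 21 (ev (Con 0) s0) s0)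
       (\<lambda>s2 t2. 1 + t2 \<le> n * (d * 6 + 5) + 3 \<and> snd s2 = snd s0 \<and>
           fst s2 21 = (\<Sum>i<n. \<Sum>u<?mm. ?c i u))"
    proof (rule wp_scan[where J = J and T = "\<lambda>_ _. 1" and mm = ?mm and bb = ?bb and j = j and X = "{21}" and W = "{}"])
      show "J 0 0 (set_reg 21 (ev (Con 0) s0) s0)" by (simp add: J_def)
      fix i u s assume a: "i < n" "u < ?mm" "env s" "fst s 15 = i" "fst s 16 = j" "fst s 18 = u"
        "fst s 19 = ?bb u" "fst s 20 = ys \<sigma> i j" "?bb u \<le> ys \<sigma> i j" "J i u s"
      have s21: "fst s 21 = (\<Sum>i<i. \<Sum>u<?mm. ?c i u) + (\<Sum>u<u. ?c i u)" and sn: "snd s = snd s0"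
        using a(10) by (simp_all add: J_def)
      have hit: "?c i u = snd s0 (2, 2 * ph + \<sigma>, i, ys \<sigma> i j - ?bb u, 0)"
        using a by (simp add: hits_def cnt_def)
      \<comment> \<open>The accumulated count stays within \<open>n * D * D\<close>, hence below
        \<open>Z ^ 3\<close>, so the addition cannot overflow.\<close>
      have "(\<Sum>i<i. \<Sum>u<?mm. ?c i u) \<le> (\<Sum>i<i. ?mm * D)"
        using a cD by (intro sum_mono order_trans[OF sum_bounded_above[where K = D]]) auto
      moreover have "(\<Sum>u<u. ?c i u) + ?c i u \<le> ?mm * D"
      proof -
        have "(\<Sum>u<u. ?c i u) + ?c i u = (\<Sum>u<Suc u. ?c i u)" by simp
        also have "\<dots> \<le> Suc u * D"
          using a cD by (intro order_trans[OF sum_bounded_above[where K = D]]) auto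
        also have "\<dots> \<le> ?mm * D" using a by (intro mult_right_mono) auto
        finally show ?thesis .
      qed
      ultimately have "fst s 21 + ?c i u \<le> Suc i * (?mm * D)" unfolding s21 by simp
      also have "\<dots> \<le> n * (D * D)" using a mm by (intro mult_mono) auto
      also have "\<dots> < Z * (Z * Z)"
        using nZ DZ n0 D0 by (intro mult_strict_mono) auto
      also have "\<dots> \<le> 2 ^ w" using Z_le by (simp add: mult.assoc)
      finally have lt: "fst s 21 + ?c i u < 2 ^ w" .
      have "ys \<sigma> i j < Z" using ys_less a j by simp
      then have yl: "ys \<sigma> i j < 2 ^ w" "ys \<sigma> i j - ?bb u < Z" "i < Z" using lessW a nZ by auto
      show "wp (Assign 21 (Plus (Var 21) (cntE \<sigma> (Var 15) (Minus (Var 20) (Var 19))))) s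
         (\<lambda>s' t. t \<le> 1 \<and> J i (Suc u) s')"
        by (rule wp_Assign) (use a yl lt hit sn \<sigma> s21 in \<open>simp_all add: J_def\<close>)
    next
      fix s and t :: nat assume Jn: "J n 0 s" and t: "t \<le> (\<Sum>i<n. (\<Sum>u<?mm. 1 + 5) + 5) + 2"
      have "(\<Sum>i<n. (\<Sum>u<?mm. 1 + 5) + 5) = n * (?mm * 6 + 5)" by simp
      moreover have "n * (?mm * 6 + 5) \<le> n * (d * 6 + 5)" using mm by (intro mult_left_mono) auto
      ultimately have "t \<le> n * (d * 6 + 5) + 2" using t by linarith
      then show "1 + t \<le> n * (d * 6 + 5) + 3 \<and> snd s = snd s0 \<and>
           fst s 21 = (\<Sum>i<n. \<Sum>u<?mm. ?c i u)"
        using Jn by (simp add: J_def)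
    qed (use env \<sigma> j mm in \<open>auto simp: J_def hits_def Let_def\<close>)
  qed
qed

text \<open>Covering only resets counters, so a counter is still complete or zero, and a nonzero one
  gives the length of an intact list of positions. This list provides the \<open>k\<close> at which
  the entry of row \<open>i\<close> complements a value of \<open>j\<close>; the test whether
  \<open>j\<close> has this value at \<open>k\<close> makes the sum equal to the target.\<close>

lemma enumerate_light_correct:
  assumes env: "env s0" and \<sigma>: "\<sigma> < 2" and j: "fst s0 16 = j" "j < n"
    and vals: "vals_ok (opp \<sigma>) s0" and pos: "pos_ok \<sigma> s0" and sums: "sums_ok s0"
    and cnt: "\<And>i v. i < n \<Longrightarrow> cnt \<sigma> s0 i v = full \<sigma> i v \<or> cnt \<sigma> s0 i v = 0"
  shows "wp (enumerate_light \<sigma>) s0 (\<lambda>s t.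
    t \<le> 6 * (\<Sum>i<n. \<Sum>u<card (f (opp \<sigma>) j ` {..<D}). hits \<sigma> s0 j i u) + n * (d * 8 + 5) + 2 \<and>
    sums_ok s \<and> below s s0 \<and>
    (\<forall>i<n. \<forall>k<D. f \<sigma> i k + f (opp \<sigma>) j k = ys \<sigma> i j \<longrightarrow> cnt \<sigma> s0 i (f \<sigma> i k) \<noteq> 0 \<longrightarrow>
       snd s (cur_index \<sigma> i j) \<le> ys \<sigma> i j))"
proof -
  let ?mm = "card (f (opp \<sigma>) j ` {..<D})" and ?bb = "\<lambda>u. snd s0 (4, 2 * ph + (opp \<sigma>), j, u, 0)"
  let ?c = "hits \<sigma> s0 j"
  have mm: "snd s0 (5, 2 * ph + (opp \<sigma>), j, 0, 0) = ?mm" "?mm \<le> D" "?mm \<le> d"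
    "?bb ` {..<?mm} = f (opp \<sigma>) j ` {..<D}"
    using vals j card_f_D card_f[of "opp \<sigma>" j] by (simp_all add: vals_ok_def)
  define J where "J i u s \<longleftrightarrow> sums_ok s \<and> below s s0 \<and>
     (\<forall>i'<n. \<forall>u'<?mm. i' < i \<or> i' = i \<and> u' < u \<longrightarrow> ?bb u' \<le> ys \<sigma> i' j \<longrightarrow>
       (\<forall>k<D. f \<sigma> i' k = ys \<sigma> i' j - ?bb u' \<longrightarrow> f (opp \<sigma>) j k = ?bb u' \<longrightarrow> cnt \<sigma> s0 i' (f \<sigma> i' k) \<noteq> 0 \<longrightarrow>
         snd s (cur_index \<sigma> i' j) \<le> ys \<sigma> i' j))"
    for i u and s :: store
  have J_reg [simp]: "J i u (set_reg x a s) = J i u s" for i u x a s by (simp add: J_def)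
  have J_improve: "J i u (set_cell x (min (snd s x) y) s)"
    if "J i u s" "sums_ok (set_cell x (min (snd s x) y) s)" for i u x y s
    using that below_improve[of s s0 x y] unfolding J_def by (auto simp: min_le_iff_disj)
  show ?thesis unfolding enumerate_light_def
  proof (rule wp_scan[where J = J and T = "\<lambda>i u. 6 * ?c i u + 3" and mm = ?mm and bb = ?bb and j = j
        and X = "{17, 23, 30}" and W = "{10}"])
    show "J 0 0 s0" using sums by (simp add: J_def below_def)
    fix i u s assume a: "i < n" "u < ?mm" and ag: "agree ({17, 23, 30} \<union> {15, 18, 19, 20}) {10} s0 s"
      and es: "env s" and r: "fst s 15 = i" "fst s 16 = j" "fst s 18 = u"
        "fst s 19 = ?bb u" "fst s 20 = ys \<sigma> i j" and b: "?bb u \<le> ys \<sigma> i j" and J: "J i u s"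
    let ?y = "ys \<sigma> i j" let ?v = "?y - ?bb u"
    have hit: "?c i u = cnt \<sigma> s0 i ?v" using b by (simp add: hits_def)
    have "?y < Z" using ys_less a j by simp
    then have yl: "?y < 2 ^ w" "?v < Z" "i < Z" "j < Z" using lessW a nZ j by auto
    have hD: "?c i u \<le> D" using cnt[OF a(1), of ?v] full_le[of \<sigma> i ?v] hit by auto
    let ?s1 = "set_reg 30 ?v s"
    have inner: "wp (For 23 (cntE \<sigma> (Var 15) (Var 30))
        (Assign 17 (Rd 3 (psE \<sigma>) (Var 15) (Var 30) (Var 23)) ;;
         Branch (Eq (fE (opp \<sigma>) (Var 16) (Var 17)) (Var 19)) (improve \<sigma> (Var 15) (Var 16) 20) Skip)) ?s1
        (\<lambda>s' t. 1 + t \<le> 6 * ?c i u + 3 \<and> J i (Suc u) s')"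
    proof (rule wp_For[where N = "?c i u" and T = "\<lambda>_. 4" and X = "{17, 23}" and Y = "{10}" and
          I = "\<lambda>e s. J i u s \<and> (\<forall>e'<e. f (opp \<sigma>) j (snd s0 (3, 2 * ph + \<sigma>, i, ?v, e')) = ?bb u \<longrightarrow>
             snd s (cur_index \<sigma> i j) \<le> ?y)"])
      show "?c i u < 2 ^ w" using hD DZ lessW(1)[of "?c i u"] by linarith
      have facts: "env s'" "fst s' 15 = i" "fst s' 16 = j" "fst s' 19 = ?bb u" "fst s' 20 = ?y" "fst s' 30 = ?v"
         "snd s' (2, r) = snd s0 (2, r)" "snd s' (3, r) = snd s0 (3, r)"
        if ag': "agree {17, 23} {10} ?s1 s'" for s' r
      proof -
        show "env s'" by (rule env_agree[OF _ ag']) (use es in auto)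
        show "fst s' 15 = i" "fst s' 16 = j" "fst s' 19 = ?bb u" "fst s' 20 = ?y" "fst s' 30 = ?v"
          using agree_reg[OF ag'] r by simp_all
        show "snd s' (2, r) = snd s0 (2, r)" "snd s' (3, r) = snd s0 (3, r)"
          using agree_cell[OF ag'] agree_cell[OF ag] by simp_all
      qed
      {
        fix e s' assume ag': "agree {17, 23} {10} ?s1 s'"
        show "ok (cntE \<sigma> (Var 15) (Var 30)) s' \<and> ev (cntE \<sigma> (Var 15) (Var 30)) s' = ?c i u"
          using facts[OF ag'] \<sigma> yl hit by (simp add: cnt_def)
      next
        fix e s' assume e: "e < ?c i u" and ag': "agree {17, 23} {10} ?s1 s'" and e23: "fst s' 23 = e"
          and I: "J i u s' \<and> (\<forall>e'<e. f (opp \<sigma>) j (snd s0 (3, 2 * ph + \<sigma>, i, ?v, e')) = ?bb u \<longrightarrow>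
             snd s' (cur_index \<sigma> i j) \<le> ?y)"
        note F = facts[OF ag']
        let ?k = "snd s0 (3, 2 * ph + \<sigma>, i, ?v, e)"
        \<comment> \<open>A round takes place, so the counter is not zero and hence
          complete.\<close>
        have "cnt \<sigma> s0 i ?v = full \<sigma> i ?v" using cnt[OF a(1), of ?v] e hit by auto
        then have "e < card {k. k < D \<and> f \<sigma> i k = ?v}" using e hit by (simp add: full_def)
        then have "?k \<in> {k. k < D \<and> f \<sigma> i k = ?v}"
          using pos a(1) unfolding pos_ok_def by blast
        then have k: "?k < D" "f \<sigma> i ?k = ?v" by auto
        have eZ: "e < Z" using e hD DZ by linarith
        have e3: "ev (Rd 3 (psE \<sigma>) (Var 15) (Var 30) (Var 23)) s' = ?k" "ok (Rd 3 (psE \<sigma>) (Var 15) (Var 30) (Var 23)) s'"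
          using F \<sigma> yl eZ e23 by simp_all
        let ?s2 = "set_reg 17 ?k s'"
        have e4: "ev (fE (opp \<sigma>) (Var 16) (Var 17)) ?s2 = f (opp \<sigma>) j ?k" "ok (fE (opp \<sigma>) (Var 16) (Var 17)) ?s2"
          using F \<sigma> j k by simp_all
        show "wp (Assign 17 (Rd 3 (psE \<sigma>) (Var 15) (Var 30) (Var 23)) ;;
         Branch (Eq (fE (opp \<sigma>) (Var 16) (Var 17)) (Var 19)) (improve \<sigma> (Var 15) (Var 16) 20) Skip) s'
         (\<lambda>s'' t. t \<le> 4 \<and> J i u (set_reg 23 (Suc e) s'') \<and>
           (\<forall>e'<Suc e. f (opp \<sigma>) j (snd s0 (3, 2 * ph + \<sigma>, i, ?v, e')) = ?bb u \<longrightarrow>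
             snd (set_reg 23 (Suc e) s'') (cur_index \<sigma> i j) \<le> ?y))"
        proof (rule wp_Seq, rule wp_Assign[OF e3(2)], unfold e3(1), rule wp_Branch)
          show "ok_cond (Eq (fE (opp \<sigma>) (Var 16) (Var 17)) (Var 19)) ?s2" using e4 by simp
          assume "ev_cond (Eq (fE (opp \<sigma>) (Var 16) (Var 17)) (Var 19)) ?s2"
          then have fb: "f (opp \<sigma>) j ?k = ?bb u" using e4 F by simp
          then have sm: "f \<sigma> i ?k + f (opp \<sigma>) j ?k = ?y" using k b by simp
          have "sums_ok ?s2" using I by (simp add: J_def)
          note so = sums_ok_improve[OF this \<sigma> a(1) j(2) k(1) sm]
          have "J i u ?s2" using I by simp
          note Jn = J_improve[OF this so]
          show "wp (improve \<sigma> (Var 15) (Var 16) 20) ?s2 (\<lambda>s'' t. 1 + (t + 1) \<le> 4 \<and> J i u (set_reg 23 (Suc e) s'') \<and>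
           (\<forall>e'<Suc e. f (opp \<sigma>) j (snd s0 (3, 2 * ph + \<sigma>, i, ?v, e')) = ?bb u \<longrightarrow>
             snd (set_reg 23 (Suc e) s'') (cur_index \<sigma> i j) \<le> ?y))"
            by (rule wp_improve[where i = i and j = j]) (use F yl Jn I in \<open>auto simp: less_Suc_eq\<close>)
        next
          assume "\<not> ev_cond (Eq (fE (opp \<sigma>) (Var 16) (Var 17)) (Var 19)) ?s2"
          then have fb: "f (opp \<sigma>) j ?k \<noteq> ?bb u" using e4 F by simp
          show "wp Skip ?s2 (\<lambda>s'' t. 1 + (t + 1) \<le> 4 \<and> J i u (set_reg 23 (Suc e) s'') \<and>
           (\<forall>e'<Suc e. f (opp \<sigma>) j (snd s0 (3, 2 * ph + \<sigma>, i, ?v, e')) = ?bb u \<longrightarrow>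
             snd (set_reg 23 (Suc e) s'') (cur_index \<sigma> i j) \<le> ?y))"
            by (rule wp_Skip) (use I fb in \<open>auto simp: less_Suc_eq\<close>)
        qed
      next
        fix s' and t' :: nat assume ag': "agree {17, 23} {10} ?s1 s'" and t': "t' \<le> (\<Sum>i'<?c i u. 4 + 2) + 2"
          and I: "J i u s' \<and> (\<forall>e'<?c i u. f (opp \<sigma>) j (snd s0 (3, 2 * ph + \<sigma>, i, ?v, e')) = ?bb u \<longrightarrow>
             snd s' (cur_index \<sigma> i j) \<le> ?y)"
        have "snd s' (cur_index \<sigma> i j) \<le> ?y"
          if k: "k < D" "f \<sigma> i k = ?v" "f (opp \<sigma>) j k = ?bb u" "cnt \<sigma> s0 i (f \<sigma> i k) \<noteq> 0" for k
        proof -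
          have "?c i u = card {k. k < D \<and> f \<sigma> i k = ?v}"
            using cnt[OF a(1), of ?v] k hit by (simp add: full_def)
          then have "k \<in> (\<lambda>e. snd s0 (3, 2 * ph + \<sigma>, i, ?v, e)) ` {..<?c i u}"
            using pos a(1) k unfolding pos_ok_def by auto
          then show ?thesis using I k(3) by auto
        qed
        then have "J i (Suc u) s'" using I unfolding J_def by (auto simp: less_Suc_eq)
        then show "1 + t' \<le> 6 * ?c i u + 3 \<and> J i (Suc u) s'" using t' by simp
      }
    qed (use J in auto)
    show "wp (Assign 30 (Minus (Var 20) (Var 19)) ;; For 23 (cntE \<sigma> (Var 15) (Var 30))
        (Assign 17 (Rd 3 (psE \<sigma>) (Var 15) (Var 30) (Var 23)) ;;
         Branch (Eq (fE (opp \<sigma>) (Var 16) (Var 17)) (Var 19)) (improve \<sigma> (Var 15) (Var 16) 20) Skip)) s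
       (\<lambda>s' t. t \<le> 6 * ?c i u + 3 \<and> J i (Suc u) s')"
      by (rule wp_Seq, rule wp_Assign) (use r b yl inner in simp_all)
  next
    fix s and t :: nat assume Jn: "J n 0 s" and t: "t \<le> (\<Sum>i<n. (\<Sum>u<?mm. 6 * ?c i u + 3 + 5) + 5) + 2"
    have "(\<Sum>i<n. (\<Sum>u<?mm. 6 * ?c i u + 3 + 5) + 5) =
       6 * (\<Sum>i<n. \<Sum>u<?mm. ?c i u) + n * (?mm * 8 + 5)"
      by (simp add: sum.distrib sum_distrib_left algebra_simps)
    moreover have "n * (?mm * 8 + 5) \<le> n * (d * 8 + 5)" using mm by (intro mult_left_mono) auto
    ultimately have "t \<le> 6 * (\<Sum>i<n. \<Sum>u<?mm. ?c i u) + n * (d * 8 + 5) + 2" using t by linarith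
    moreover have "snd s (cur_index \<sigma> i j) \<le> ys \<sigma> i j"
      if k: "i < n" "k < D" "f \<sigma> i k + f (opp \<sigma>) j k = ys \<sigma> i j" "cnt \<sigma> s0 i (f \<sigma> i k) \<noteq> 0" for i k
    proof -
      \<comment> \<open>The entry of \<open>j\<close> at \<open>k\<close> is in the list of values
        of \<open>j\<close>, and its complement is the entry of row \<open>i\<close> at
        \<open>k\<close>, so \<open>k\<close> was met in the corresponding list of
        positions.\<close>
      have "f (opp \<sigma>) j k \<in> ?bb ` {..<?mm}" using mm k by auto
      then obtain u where "u < ?mm" "?bb u = f (opp \<sigma>) j k" by auto
      moreover from this k have "?bb u \<le> ys \<sigma> i j" "f \<sigma> i k = ys \<sigma> i j - ?bb u" by auto
      ultimately show ?thesis using Jn k unfolding J_def by auto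
    qed
    ultimately show "t \<le> 6 * (\<Sum>i<n. \<Sum>u<?mm. ?c i u) + n * (d * 8 + 5) + 2 \<and>
      sums_ok s \<and> below s s0 \<and>
      (\<forall>i<n. \<forall>k<D. f \<sigma> i k + f (opp \<sigma>) j k = ys \<sigma> i j \<longrightarrow> cnt \<sigma> s0 i (f \<sigma> i k) \<noteq> 0 \<longrightarrow>
       snd s (cur_index \<sigma> i j) \<le> ys \<sigma> i j)"
      using Jn unfolding J_def by blast
  qed (use env \<sigma> j mm in \<open>auto simp: J_def less_Suc_eq\<close>)
qed

text \<open>Besides the counters only the list of pivots changes, at its end; the lists of values
  and positions remain available.\<close>

lemma cover_correct:
  assumes env: "env s0" and \<sigma>: "\<sigma> < 2" and j: "fst s0 16 = j" "j < n"
    and vals: "vals_ok (opp \<sigma>) s0" and np: "fst s0 22 = np" "np < Z"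
  shows "wp (cover \<sigma>) s0 (\<lambda>s t. t \<le> n * (d * 6 + 5) + 4 \<and> fst s 22 = Suc np \<and>
    (\<forall>i<n. \<forall>v. cnt \<sigma> s i v = (if \<exists>u<card (f (opp \<sigma>) j ` {..<D}).
        snd s0 (4, 2 * ph + (opp \<sigma>), j, u, 0) \<le> ys \<sigma> i j \<and> v = ys \<sigma> i j - snd s0 (4, 2 * ph + (opp \<sigma>), j, u, 0)
        then 0 else cnt \<sigma> s0 i v)) \<and>
    (\<forall>tg ps r. ps \<noteq> 2 * ph + \<sigma> \<longrightarrow> snd s (tg, ps, r) = snd s0 (tg, ps, r)) \<and>
    (\<forall>q. snd s (7, 2 * ph + \<sigma>, q, 0, 0) = (if q = np then j else snd s0 (7, 2 * ph + \<sigma>, q, 0, 0))))"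
proof -
  let ?mm = "card (f (opp \<sigma>) j ` {..<D})" and ?bb = "\<lambda>u. snd s0 (4, 2 * ph + (opp \<sigma>), j, u, 0)"
  have mm: "snd s0 (5, 2 * ph + (opp \<sigma>), j, 0, 0) = ?mm" "?mm \<le> D" "?mm \<le> d"
    using vals j card_f_D card_f[of "opp \<sigma>" j] by (simp_all add: vals_ok_def)
  define J where "J i u s \<longleftrightarrow> fst s 22 = Suc np \<and>
    (\<forall>i'<n. \<forall>v. cnt \<sigma> s i' v = (if \<exists>u'<?mm. (i' < i \<or> i' = i \<and> u' < u) \<and>
        ?bb u' \<le> ys \<sigma> i' j \<and> v = ys \<sigma> i' j - ?bb u' then 0 else cnt \<sigma> s0 i' v)) \<and>
    (\<forall>tg ps r. ps \<noteq> 2 * ph + \<sigma> \<longrightarrow> snd s (tg, ps, r) = snd s0 (tg, ps, r)) \<and>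
    (\<forall>q. snd s (7, 2 * ph + \<sigma>, q, 0, 0) = (if q = np then j else snd s0 (7, 2 * ph + \<sigma>, q, 0, 0)))"
    for i u and s :: store
  let ?s1 = "set_reg 22 (Suc np) (set_cell (7, 2 * ph + \<sigma>, np, 0, 0) j s0)"
  have main: "wp (scan \<sigma> (Write 2 (psE \<sigma>) (Var 15) (Minus (Var 20) (Var 19)) (Con 0) (Con 0))) ?s1
     (\<lambda>s t. t \<le> n * (d * 6 + 5) + 2 \<and> J n 0 s)"
  proof (rule wp_scan[where J = J and T = "\<lambda>_ _. 1" and mm = ?mm and bb = ?bb and j = j and X = "{}" and W = "{2}"])
    show "J 0 0 ?s1" by (auto simp: J_def cnt_def)
    fix i u s assume a: "i < n" "u < ?mm" "env s" "fst s 15 = i" "fst s 16 = j" "fst s 18 = u"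
        "fst s 19 = ?bb u" "fst s 20 = ys \<sigma> i j" "?bb u \<le> ys \<sigma> i j" and J: "J i u s"
    have "ys \<sigma> i j < Z" using ys_less a j by simp
    then have yl: "ys \<sigma> i j < 2 ^ w" "ys \<sigma> i j - ?bb u < Z" "i < Z" using lessW a nZ by auto
    have "J i (Suc u) (set_cell (2, 2 * ph + \<sigma>, i, ys \<sigma> i j - ?bb u, 0) 0 s)"
      using J a(1,2,9) unfolding J_def by (auto simp: cnt_def less_Suc_eq)
    then show "wp (Write 2 (psE \<sigma>) (Var 15) (Minus (Var 20) (Var 19)) (Con 0) (Con 0)) s
       (\<lambda>s' t. t \<le> 1 \<and> J i (Suc u) s')"
      by (intro wp_Write) (use a yl \<sigma> in simp_all)
  next
    fix i u s assume b: "\<not> ?bb u \<le> ys \<sigma> i j" and J: "J i u s"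
    have "(\<exists>u'<?mm. (i' < i \<or> i' = i \<and> u' < Suc u) \<and> ?bb u' \<le> ys \<sigma> i' j \<and> v = ys \<sigma> i' j - ?bb u') \<longleftrightarrow>
       (\<exists>u'<?mm. (i' < i \<or> i' = i \<and> u' < u) \<and> ?bb u' \<le> ys \<sigma> i' j \<and> v = ys \<sigma> i' j - ?bb u')" for i' v
      using b by (auto simp: less_Suc_eq)
    then show "J i (Suc u) s" using J unfolding J_def by simp
  next
    fix i s assume i: "i < n" and "J i ?mm s"
    then show "J (Suc i) 0 s" unfolding J_def by (auto simp: less_Suc_eq)
  next
    fix s and t :: nat assume Jn: "J n 0 s" and t: "t \<le> (\<Sum>i<n. (\<Sum>u<?mm. 1 + 5) + 5) + 2"
    have "(\<Sum>i<n. (\<Sum>u<?mm. 1 + 5) + 5) = n * (?mm * 6 + 5)" by simp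
    moreover have "n * (?mm * 6 + 5) \<le> n * (d * 6 + 5)" using mm by (intro mult_left_mono) auto
    ultimately have "t \<le> n * (d * 6 + 5) + 2" using t by linarith
    then show "t \<le> n * (d * 6 + 5) + 2 \<and> J n 0 s" using Jn by simp
  qed (use env \<sigma> j mm in \<open>auto simp: J_def cnt_def\<close>)
  let ?S1 = "set_cell (7, ev (psE \<sigma>) s0, ev (Var 22) s0, ev (Con 0) s0, ev (Con 0) s0) (ev (Var 16) s0) s0"
  have st: "set_reg 22 (ev (Plus (Var 22) (Con 1)) ?S1) ?S1 = ?s1" using env \<sigma> np j by simp
  have "Suc np < 2 ^ w" using np lessW(3)[of np 1] by simp
  then show ?thesis unfolding cover_def
    apply -
    apply (rule wp_Seq, rule wp_Write)
      apply (use env \<sigma> np j nZ in simp)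
     apply simp
    apply (rule wp_Seq, rule wp_Assign)
     apply (use np in simp)
    apply (unfold st)
    apply (rule wp_conseq[OF main])
    apply (simp add: J_def)
    done
qed

text \<open>The pivot may have the complementing value \<open>b\<close> at any position. Coverage is
  thus a property of the value \<open>v\<close> in row \<open>i\<close>, and one counter per value
  is enough to record it.\<close>

definition covered :: "nat \<Rightarrow> store \<Rightarrow> nat \<Rightarrow> nat \<Rightarrow> nat \<Rightarrow> bool" where
  "covered \<sigma> s np i v \<longleftrightarrow> (\<exists>q<np. \<exists>b\<in>f (opp \<sigma>) (snd s (7, 2 * ph + \<sigma>, q, 0, 0)) ` {..<D}.
     v + b = ys \<sigma> i (snd s (7, 2 * ph + \<sigma>, q, 0, 0)))"

lemma covered_mono:
  assumes "covered \<sigma> s np i v" "np \<le> np'"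
    "\<And>q. q < np \<Longrightarrow> snd s' (7, 2 * ph + \<sigma>, q, 0, 0) = snd s (7, 2 * ph + \<sigma>, q, 0, 0)"
  shows "covered \<sigma> s' np' i v"
proof -
  obtain q b where "q < np" "b \<in> f (opp \<sigma>) (snd s (7, 2 * ph + \<sigma>, q, 0, 0)) ` {..<D}"
    "v + b = ys \<sigma> i (snd s (7, 2 * ph + \<sigma>, q, 0, 0))"
    using assms(1) unfolding covered_def by blast
  then show ?thesis unfolding covered_def using assms(2) assms(3)[of q]
    by (intro exI[of _ q] conjI bexI[of _ b]) simp_all
qed

text \<open>The third conjunct is the potential: every pivot accounts for \<open>n * D\<close>, and
  \<open>g\<close> times the sum of the counters drops by at least that much when a heavy
  \<open>j\<close> is covered. It bounds the number of pivots by \<open>g\<close>. By the conjunct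
  on \<open>j' < j\<close>, a sum equal to the target has been matched by a stored value or left to
  the pivots.\<close>

definition pass_inv :: "nat \<Rightarrow> store \<Rightarrow> nat \<Rightarrow> store \<Rightarrow> bool" where
  "pass_inv \<sigma> s0 j s \<longleftrightarrow>
     (\<forall>i<n. \<forall>v. cnt \<sigma> s i v = full \<sigma> i v \<or> cnt \<sigma> s i v = 0 \<and> covered \<sigma> s (fst s 22) i v) \<and>
     (\<forall>q<fst s 22. snd s (7, 2 * ph + \<sigma>, q, 0, 0) < n) \<and>
     fst s 22 * (n * D) + g * (\<Sum>i<n. \<Sum>v\<in>f \<sigma> i ` {..<D}. cnt \<sigma> s i v) \<le> g * (n * D) \<and>
     sums_ok s \<and> below s s0 \<and>
     (\<forall>i<n. \<forall>j'<j. \<forall>k<D. f \<sigma> i k + f (opp \<sigma>) j' k = ys \<sigma> i j' \<longrightarrow>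
        snd s (cur_index \<sigma> i j') \<le> ys \<sigma> i j' \<or> covered \<sigma> s (fst s 22) i (f \<sigma> i k)) \<and>
     (\<forall>tg ps r. tg \<noteq> 10 \<longrightarrow> ps \<noteq> 2 * ph + \<sigma> \<longrightarrow> snd s (tg, ps, r) = snd s0 (tg, ps, r))"

lemma pass_inv_cong:
  assumes "snd s' = snd s" "fst s' 22 = fst s 22" shows "pass_inv \<sigma> s0 j s' = pass_inv \<sigma> s0 j s"
  using assms by (simp add: pass_inv_def cnt_def covered_def sums_ok_def below_def)

lemma pass_inv_reg [simp]: "x \<noteq> 22 \<Longrightarrow> pass_inv \<sigma> s0 j (set_reg x a s) = pass_inv \<sigma> s0 j s"
  by (rule pass_inv_cong) auto

lemma pass_inv_np: "pass_inv \<sigma> s0 j s \<Longrightarrow> fst s 22 \<le> g"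
proof -
  assume "pass_inv \<sigma> s0 j s"
  then have "fst s 22 * (n * D) \<le> g * (n * D)" unfolding pass_inv_def by linarith
  then show ?thesis using n0 D0 by simp
qed

lemma pass_step:
  assumes env: "env s" and \<sigma>: "\<sigma> < 2" and j: "fst s 16 = j" "j < n"
    and vals: "vals_ok (opp \<sigma>) s" and pos: "pos_ok \<sigma> s" and inv: "pass_inv \<sigma> s0 j s"
  shows "wp (count \<sigma> ;;
     Branch (Lt (Times (Var 21) (Var 3)) (Times (Var 1) (Var 2))) (enumerate_light \<sigma>) (cover \<sigma>)) s
     (\<lambda>s' t. t \<le> n * (14 * d + 10) + 6 * (n * D div g) + 10 \<and> pass_inv \<sigma> s0 (Suc j) s')"
proof -
  let ?mm = "card (f (opp \<sigma>) j ` {..<D})" and ?bb = "\<lambda>u. snd s (4, 2 * ph + opp \<sigma>, j, u, 0)"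
  let ?np = "fst s 22"
  define S where "S = (\<Sum>i<n. \<Sum>u<?mm. hits \<sigma> s j i u)"
  define cn' where "cn' i v = (if \<exists>u<?mm. ?bb u \<le> ys \<sigma> i j \<and> v = ys \<sigma> i j - ?bb u then 0 else cnt \<sigma> s i v)" for i v
  have bb: "?bb ` {..<?mm} = f (opp \<sigma>) j ` {..<D}" using vals j by (simp add: vals_ok_def)
  \<comment> \<open>The list is as long as the number of values in it, so it has no repetitions, as
    \<open>cover_sum\<close> requires.\<close>
  have inj: "inj_on ?bb {..<?mm}" by (rule eq_card_imp_inj_on) (simp_all add: bb)
  have a: "cnt \<sigma> s i v = full \<sigma> i v \<or> cnt \<sigma> s i v = 0 \<and> covered \<sigma> s ?np i v" if "i < n" for i v
    using inv that by (simp add: pass_inv_def)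
  have out: "cnt \<sigma> s i v = 0" if "i < n" "v \<notin> f \<sigma> i ` {..<D}" for i v
  proof -
    have "{k. k < D \<and> f \<sigma> i k = v} = {}" using that(2) by auto
    then show ?thesis using a[OF that(1), of v] by (simp only: full_def card.empty) auto
  qed
  have row: "(\<Sum>v\<in>f \<sigma> i ` {..<D}. cn' i v) + (\<Sum>u<?mm. hits \<sigma> s j i u) = (\<Sum>v\<in>f \<sigma> i ` {..<D}. cnt \<sigma> s i v)"
    if "i < n" for i
    unfolding hits_def Let_def
    by (rule cover_sum[OF _ out[OF that] inj]) (simp_all add: cn'_def)
  have "(\<Sum>i<n. (\<Sum>v\<in>f \<sigma> i ` {..<D}. cn' i v) + (\<Sum>u<?mm. hits \<sigma> s j i u)) =
     (\<Sum>i<n. \<Sum>v\<in>f \<sigma> i ` {..<D}. cnt \<sigma> s i v)"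
    by (rule sum.cong) (simp_all add: row)
  then have tot: "(\<Sum>i<n. \<Sum>v\<in>f \<sigma> i ` {..<D}. cn' i v) + S = (\<Sum>i<n. \<Sum>v\<in>f \<sigma> i ` {..<D}. cnt \<sigma> s i v)"
    unfolding S_def by (simp add: sum.distrib)
  have pot: "?np * (n * D) + g * (\<Sum>i<n. \<Sum>v\<in>f \<sigma> i ` {..<D}. cnt \<sigma> s i v) \<le> g * (n * D)"
    using inv by (simp add: pass_inv_def)
  then have "g * (\<Sum>i<n. \<Sum>v\<in>f \<sigma> i ` {..<D}. cnt \<sigma> s i v) \<le> g * (n * D)" by linarith
  then have SnD: "S \<le> n * D" using tot g0 by simp
  have nDZ: "n * D < Z * Z" using nZ DZ n0 by (intro mult_strict_mono) auto
  \<comment> \<open>The potential bounds \<open>S\<close> by \<open>n * D\<close>, so both products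
    of the test fit into a word.\<close>
  have "S * g \<le> n * D * g" using SnD by simp
  also have "\<dots> < Z * Z * Z" by (rule mult_strict_mono[OF nDZ gZ]) (use g0 nDZ in auto)
  also have "\<dots> \<le> 2 ^ w" using Z_le by simp
  finally have Sg: "S * g < 2 ^ w" .
  have nDw: "n * D < 2 ^ w" using nDZ Z_le by linarith
  have npZ: "?np < Z" using pass_inv_np[OF inv] gZ by linarith
  have cntD: "cnt \<sigma> s i v \<le> D" if "i < n" for i v using a[OF that, of v] full_le[of \<sigma> i v] by auto
  note regs = env[unfolded env_def]
  show ?thesis
  proof (rule wp_Seq, rule wp_conseq[OF count_correct[OF env \<sigma> j vals cntD]], assumption, elim conjE)
    fix s1 t1 assume ag: "agree (modified (count \<sigma>)) (written (count \<sigma>)) s s1"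
      and t1: "t1 \<le> n * (d * 6 + 5) + 3" and s1: "snd s1 = snd s"
      and "fst s1 21 = (\<Sum>i<n. \<Sum>u<?mm. hits \<sigma> s j i u)"
    then have s21: "fst s1 21 = S" by (simp add: S_def)
    have e1: "env s1" by (rule env_agree[OF env ag]) auto
    have j1: "fst s1 16 = j" and np1: "fst s1 22 = ?np" using agree_reg[OF ag] j by simp_all
    have vals1: "vals_ok (opp \<sigma>) s1" using vals s1 by (simp add: vals_ok_def)
    have pos1: "pos_ok \<sigma> s1" using pos s1 by (simp add: pos_ok_def)
    have inv1: "pass_inv \<sigma> s0 j s1" using inv pass_inv_cong[OF s1 np1] by simp
    have cnt1: "cnt \<sigma> s1 = cnt \<sigma> s" using s1 by (simp add: cnt_def fun_eq_iff)
    have hits1: "hits \<sigma> s1 j' i u = hits \<sigma> s j' i u" for j' i u by (simp only: hits_def s1 cnt1)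
    have e1': "fst s1 1 = n" "fst s1 2 = D" "fst s1 3 = g" using e1 by (simp_all add: env_def)
    show "wp (Branch (Lt (Times (Var 21) (Var 3)) (Times (Var 1) (Var 2))) (enumerate_light \<sigma>) (cover \<sigma>)) s1
       (\<lambda>s2 t2. t1 + t2 \<le> n * (14 * d + 10) + 6 * (n * D div g) + 10 \<and> pass_inv \<sigma> s0 (Suc j) s2)"
    proof (rule wp_Branch)
      show "ok_cond (Lt (Times (Var 21) (Var 3)) (Times (Var 1) (Var 2))) s1"
        using s21 e1' Sg nDw by simp
      assume "ev_cond (Lt (Times (Var 21) (Var 3)) (Times (Var 1) (Var 2))) s1"
      then have "S * g < n * D" using s21 e1' by simp
      then have Sdiv: "S \<le> n * D div g" using g0 by (simp add: less_eq_div_iff_mult_less_eq)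
      have sums1: "sums_ok s1" using inv1 by (simp add: pass_inv_def)
      have c1: "cnt \<sigma> s1 i v = full \<sigma> i v \<or> cnt \<sigma> s1 i v = 0" if "i < n" for i v
        using a[OF that, of v] cnt1 by auto
      show "wp (enumerate_light \<sigma>) s1
        (\<lambda>s2 t. t1 + (t + 1) \<le> n * (14 * d + 10) + 6 * (n * D div g) + 10 \<and> pass_inv \<sigma> s0 (Suc j) s2)"
      proof (rule wp_conseq[OF enumerate_light_correct[OF e1 \<sigma> j1 j(2) vals1 pos1 sums1 c1]], assumption, elim conjE)
        fix s2 t2 assume ag2: "agree (modified (enumerate_light \<sigma>)) (written (enumerate_light \<sigma>)) s1 s2"
          and t2: "t2 \<le> 6 * (\<Sum>i<n. \<Sum>u<?mm. hits \<sigma> s1 j i u) + n * (d * 8 + 5) + 2"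
          and so: "sums_ok s2" and be: "below s2 s1"
          and comp: "\<forall>i<n. \<forall>k<D. f \<sigma> i k + f (opp \<sigma>) j k = ys \<sigma> i j \<longrightarrow> cnt \<sigma> s1 i (f \<sigma> i k) \<noteq> 0 \<longrightarrow>
             snd s2 (cur_index \<sigma> i j) \<le> ys \<sigma> i j"
        have same: "snd s2 (tg, r) = snd s (tg, r)" if "tg \<noteq> 10" for tg r
          using agree_cell[OF ag2, of tg r] that s1 by simp
        have np2: "fst s2 22 = ?np" using agree_reg[OF ag2, of 22] np1 by simp
        have cnt2: "cnt \<sigma> s2 = cnt \<sigma> s" using same by (simp add: cnt_def fun_eq_iff)
        have cov2: "covered \<sigma> s2 = covered \<sigma> s" using same by (simp add: covered_def fun_eq_iff)
        have cov_new: "snd s2 (cur_index \<sigma> i j') \<le> ys \<sigma> i j' \<or> covered \<sigma> s2 (fst s2 22) i (f \<sigma> i k)"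
          if h: "i < n" "j' < Suc j" "k < D" "f \<sigma> i k + f (opp \<sigma>) j' k = ys \<sigma> i j'" for i j' k
        proof (cases "j' = j")
          case True
          \<comment> \<open>\<open>k\<close> itself is an occurrence, so a complete counter is
            positive and a zero counter must stem from a pivot.\<close>
          have "{k'. k' < D \<and> f \<sigma> i k' = f \<sigma> i k} \<noteq> {}" using h by auto
          then have "full \<sigma> i (f \<sigma> i k) \<noteq> 0" by (simp add: full_def card_eq_0_iff)
          then show ?thesis using a[OF h(1), of "f \<sigma> i k"] comp h True cnt1 np2 cov2 by auto
        next
          case False
          then have "snd s (cur_index \<sigma> i j') \<le> ys \<sigma> i j' \<or> covered \<sigma> s ?np i (f \<sigma> i k)"
            using inv h by (simp add: pass_inv_def)
          moreover have "snd s2 (cur_index \<sigma> i j') \<le> snd s (cur_index \<sigma> i j')"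
            using be s1 cur_index_10[of \<sigma> i j'] unfolding below_def by metis
          ultimately show ?thesis using np2 cov2 by auto
        qed
        have "below s2 s0" using be inv1 unfolding below_def pass_inv_def using order_trans by blast
        then have "pass_inv \<sigma> s0 (Suc j) s2"
          using inv cov_new so same unfolding pass_inv_def by (simp add: np2 cnt2 cov2)
        moreover have "t1 + (t2 + 1) \<le> n * (14 * d + 10) + 6 * (n * D div g) + 10"
          using t1 t2 Sdiv unfolding hits1 S_def[symmetric] by (simp add: algebra_simps)
        ultimately show "t1 + (t2 + 1) \<le> n * (14 * d + 10) + 6 * (n * D div g) + 10 \<and> pass_inv \<sigma> s0 (Suc j) s2"
          by blast
      qed
    next
      assume "\<not> ev_cond (Lt (Times (Var 21) (Var 3)) (Times (Var 1) (Var 2))) s1"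
      then have heavy: "n * D \<le> S * g" using s21 e1' by simp
      show "wp (cover \<sigma>) s1
        (\<lambda>s2 t. t1 + (t + 1) \<le> n * (14 * d + 10) + 6 * (n * D div g) + 10 \<and> pass_inv \<sigma> s0 (Suc j) s2)"
      proof (rule wp_conseq[OF cover_correct[OF e1 \<sigma> j1 j(2) vals1 np1 npZ]], elim conjE)
        fix s2 t2 assume ag2: "agree (modified (cover \<sigma>)) (written (cover \<sigma>)) s1 s2"
          and t2: "t2 \<le> n * (d * 6 + 5) + 4" and np2: "fst s2 22 = Suc ?np"
          and c2: "\<forall>i<n. \<forall>v. cnt \<sigma> s2 i v = (if \<exists>u<?mm. snd s1 (4, 2 * ph + opp \<sigma>, j, u, 0) \<le> ys \<sigma> i j \<and>
             v = ys \<sigma> i j - snd s1 (4, 2 * ph + opp \<sigma>, j, u, 0) then 0 else cnt \<sigma> s1 i v)"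
          and oth: "\<forall>tg ps r. ps \<noteq> 2 * ph + \<sigma> \<longrightarrow> snd s2 (tg, ps, r) = snd s1 (tg, ps, r)"
          and piv: "\<forall>q. snd s2 (7, 2 * ph + \<sigma>, q, 0, 0) = (if q = ?np then j else snd s1 (7, 2 * ph + \<sigma>, q, 0, 0))"
        have cn2: "cnt \<sigma> s2 i v = cn' i v" if "i < n" for i v
          using c2 that unfolding s1 cnt1 cn'_def by blast
        have same: "snd s2 (10, r) = snd s (10, r)" for r
          using agree_cell[OF ag2, of 10 r] s1 by simp
        have cov: "covered \<sigma> s2 (Suc ?np) i v" if "covered \<sigma> s ?np i v" for i v
          by (rule covered_mono[OF that]) (use piv s1 in auto)
        have cov_j: "covered \<sigma> s2 (Suc ?np) i v" if "b \<in> f (opp \<sigma>) j ` {..<D}" "v + b = ys \<sigma> i j" for i v b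
          unfolding covered_def using that piv by (intro exI[of _ ?np] conjI bexI[of _ b]) simp_all
        have 1: "cnt \<sigma> s2 i v = full \<sigma> i v \<or> cnt \<sigma> s2 i v = 0 \<and> covered \<sigma> s2 (Suc ?np) i v" if "i < n" for i v
        proof (cases "\<exists>u<?mm. ?bb u \<le> ys \<sigma> i j \<and> v = ys \<sigma> i j - ?bb u")
          case True
          then obtain u where u: "u < ?mm" "?bb u \<le> ys \<sigma> i j" "v = ys \<sigma> i j - ?bb u" by blast
          have "?bb u \<in> f (opp \<sigma>) j ` {..<D}" using u(1) bb by blast
          then have "covered \<sigma> s2 (Suc ?np) i v" using u by (intro cov_j) auto
          moreover have "cnt \<sigma> s2 i v = 0" unfolding cn2[OF that] cn'_def using True by (simp only: if_True)
          ultimately show ?thesis by blast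
        next
          case False
          have "cnt \<sigma> s2 i v = cnt \<sigma> s i v" unfolding cn2[OF that] cn'_def using False by (simp only: if_False)
          then show ?thesis using a[OF that, of v] cov by auto
        qed
        have 2: "snd s2 (7, 2 * ph + \<sigma>, q, 0, 0) < n" if "q < Suc ?np" for q
          using that piv j inv s1 unfolding pass_inv_def by auto
        have "(\<Sum>i<n. \<Sum>v\<in>f \<sigma> i ` {..<D}. cnt \<sigma> s2 i v) = (\<Sum>i<n. \<Sum>v\<in>f \<sigma> i ` {..<D}. cn' i v)"
          by (intro sum.cong) (auto simp: cn2)
        \<comment> \<open>The sum of the counters, weighted with \<open>g\<close>, loses
          \<open>S * g\<close>. As \<open>j\<close> is heavy, this is at least the
          \<open>n * D\<close> that the new pivot adds.\<close>
        then have "g * (\<Sum>i<n. \<Sum>v\<in>f \<sigma> i ` {..<D}. cnt \<sigma> s i v) =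
            g * (\<Sum>i<n. \<Sum>v\<in>f \<sigma> i ` {..<D}. cnt \<sigma> s2 i v) + S * g"
          using tot by (simp add: algebra_simps flip: tot)
        then have 3: "Suc ?np * (n * D) + g * (\<Sum>i<n. \<Sum>v\<in>f \<sigma> i ` {..<D}. cnt \<sigma> s2 i v) \<le> g * (n * D)"
          using pot heavy by simp
        have 4: "snd s2 (cur_index \<sigma> i j') \<le> ys \<sigma> i j' \<or> covered \<sigma> s2 (Suc ?np) i (f \<sigma> i k)"
          if h: "i < n" "j' < Suc j" "k < D" "f \<sigma> i k + f (opp \<sigma>) j' k = ys \<sigma> i j'" for i j' k
        proof (cases "j' = j")
          case True
          then show ?thesis using h cov_j[of "f (opp \<sigma>) j k" "f \<sigma> i k" i] by auto
        next
          case False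
          then have "snd s (cur_index \<sigma> i j') \<le> ys \<sigma> i j' \<or> covered \<sigma> s ?np i (f \<sigma> i k)"
            using inv h by (simp add: pass_inv_def)
          moreover have "snd s2 (cur_index \<sigma> i j') = snd s (cur_index \<sigma> i j')"
            using same cur_index_10[of \<sigma> i j'] by metis
          ultimately show ?thesis using cov by auto
        qed
        have 5: "sums_ok s2" "below s2 s0"
          using inv same unfolding pass_inv_def sums_ok_def below_def by simp_all
        have 6: "snd s2 (tg, ps, r) = snd s0 (tg, ps, r)" if "tg \<noteq> 10" "ps \<noteq> 2 * ph + \<sigma>" for tg ps r
          using oth inv s1 that unfolding pass_inv_def by simp
        have "pass_inv \<sigma> s0 (Suc j) s2"
          using 1 2 3 4 5 6 unfolding pass_inv_def np2 by blast
        moreover have "t1 + (t2 + 1) \<le> n * (14 * d + 10) + 6 * (n * D div g) + 10"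
          using t1 t2 by (simp add: algebra_simps)
        ultimately show "t1 + (t2 + 1) \<le> n * (14 * d + 10) + 6 * (n * D div g) + 10 \<and> pass_inv \<sigma> s0 (Suc j) s2"
          by blast
      qed
    qed
  qed
qed

lemma pass_correct:
  assumes env: "env s0" and \<sigma>: "\<sigma> < 2" and vals: "vals_ok (opp \<sigma>) s0" and pos: "pos_ok \<sigma> s0"
    and sums: "sums_ok s0" and cnt0: "\<And>i v. i < n \<Longrightarrow> cnt \<sigma> s0 i v = full \<sigma> i v"
  shows "wp (pass \<sigma>) s0 (\<lambda>s t. t \<le> n * (n * (14 * d + 10) + 6 * (n * D div g) + 12) + 4 \<and>
     sums_ok s \<and> below s s0 \<and>
     (\<exists>np\<le>g. snd s (8, 2 * ph + \<sigma>, 0, 0, 0) = np \<and> (\<forall>q<np. snd s (7, 2 * ph + \<sigma>, q, 0, 0) < n) \<and>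
       (\<forall>i<n. \<forall>j<n. \<forall>k<D. f \<sigma> i k + f (opp \<sigma>) j k = ys \<sigma> i j \<longrightarrow>
          snd s (cur_index \<sigma> i j) \<le> ys \<sigma> i j \<or> covered \<sigma> s np i (f \<sigma> i k))) \<and>
     (\<forall>tg ps r. tg \<noteq> 10 \<longrightarrow> ps \<noteq> 2 * ph + \<sigma> \<longrightarrow> snd s (tg, ps, r) = snd s0 (tg, ps, r)))"
proof -
  let ?s1 = "set_reg 22 0 s0" and ?X = "{15, 16, 17, 18, 19, 20, 21, 22, 23, 30}" and ?W = "{2, 7, 10}"
  let ?T = "n * (14 * d + 10) + 6 * (n * D div g) + 10"
  let ?body = "count \<sigma> ;; Branch (Lt (Times (Var 21) (Var 3)) (Times (Var 1) (Var 2))) (enumerate_light \<sigma>) (cover \<sigma>)"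
  \<comment> \<open>All counters are complete at the start and every position has one value, so a
    row contributes \<open>D\<close> and the potential starts at \<open>g * (n * D)\<close>.\<close>
  have "(\<Sum>v\<in>f \<sigma> i ` {..<D}. cnt \<sigma> s0 i v) = D" if "i < n" for i
  proof -
    have "(\<Sum>v\<in>f \<sigma> i ` {..<D}. cnt \<sigma> s0 i v) = (\<Sum>v\<in>f \<sigma> i ` {..<D}. card {k \<in> {..<D}. f \<sigma> i k = v})"
      using cnt0[OF that] by (simp add: full_def)
    also have "\<dots> = card {..<D}" using sum_card_image_fibres[of "{..<D}" "f \<sigma> i"] by simp
    finally show ?thesis by simp
  qed
  then have "(\<Sum>i<n. \<Sum>v\<in>f \<sigma> i ` {..<D}. cnt \<sigma> s0 i v) = n * D" by simp
  then have init: "pass_inv \<sigma> s0 0 (set_reg 16 0 ?s1)"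
    using sums cnt0 by (simp add: pass_inv_def cnt_def below_def)
  have loop: "wp (For 16 (Var 1) ?body) ?s1 (\<lambda>s t. t \<le> n * (?T + 2) + 2 \<and> pass_inv \<sigma> s0 n s)"
  proof (rule wp_For[where N = n and T = "\<lambda>_. ?T" and I = "pass_inv \<sigma> s0" and X = ?X and Y = ?W, OF init])
    show "n < 2 ^ w" using nZ lessW by blast
    fix j s assume ag: "agree ?X ?W ?s1 s"
    have es: "env s" by (rule env_agree[OF _ ag]) (use env in auto)
    show "ok (Var 1) s \<and> ev (Var 1) s = n" using es by (simp add: env_def)
    assume j: "j < n" "fst s 16 = j" and inv: "pass_inv \<sigma> s0 j s"
    have v: "vals_ok (opp \<sigma>) s" by (rule vals_ok_agree[OF _ ag]) (use vals in \<open>auto simp: vals_ok_def\<close>)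
    have p: "pos_ok \<sigma> s" by (rule pos_ok_agree[OF _ ag]) (use pos in \<open>auto simp: pos_ok_def\<close>)
    show "wp ?body s (\<lambda>s' t. t \<le> ?T \<and> pass_inv \<sigma> s0 (Suc j) (set_reg 16 (Suc j) s'))"
      by (rule wp_conseq[OF pass_step[OF es \<sigma> j(2,1) v p inv]]) auto
  qed auto
  show ?thesis unfolding pass_def
  proof (rule wp_Seq, rule wp_Assign, simp, rule wp_Seq, unfold ev.simps, rule wp_conseq[OF loop], elim conjE)
    fix s1 t1 assume ag: "agree (modified (For 16 (Var 1) ?body)) (written (For 16 (Var 1) ?body)) ?s1 s1"
      and t1: "t1 \<le> n * (?T + 2) + 2" and inv: "pass_inv \<sigma> s0 n s1"
    have e1: "env s1" by (rule env_agree[OF _ ag]) (use env in auto)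
    note np = pass_inv_np[OF inv]
    let ?s2 = "set_cell (8, 2 * ph + \<sigma>, 0, 0, 0) (fst s1 22) s1"
    have cov: "covered \<sigma> ?s2 = covered \<sigma> s1" by (simp add: covered_def fun_eq_iff)
    have cur: "snd ?s2 (10, r) = snd s1 (10, r)" for r by simp
    have cur': "snd ?s2 (cur_index \<sigma> i j) = snd s1 (cur_index \<sigma> i j)" for i j
      using cur cur_index_10[of \<sigma> i j] by metis
    have post: "sums_ok ?s2 \<and> below ?s2 s0 \<and>
     (\<exists>np\<le>g. snd ?s2 (8, 2 * ph + \<sigma>, 0, 0, 0) = np \<and> (\<forall>q<np. snd ?s2 (7, 2 * ph + \<sigma>, q, 0, 0) < n) \<and>
       (\<forall>i<n. \<forall>j<n. \<forall>k<D. f \<sigma> i k + f (opp \<sigma>) j k = ys \<sigma> i j \<longrightarrow>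
          snd ?s2 (cur_index \<sigma> i j) \<le> ys \<sigma> i j \<or> covered \<sigma> ?s2 np i (f \<sigma> i k))) \<and>
     (\<forall>tg ps r. tg \<noteq> 10 \<longrightarrow> ps \<noteq> 2 * ph + \<sigma> \<longrightarrow> snd ?s2 (tg, ps, r) = snd s0 (tg, ps, r))"
      unfolding cur' cov using inv np unfolding pass_inv_def
      by (intro conjI exI[of _ "fst s1 22"]) (simp_all add: sums_ok_def below_def)
    have "1 + (t1 + 1) \<le> n * (n * (14 * d + 10) + 6 * (n * D div g) + 12) + 4" using t1 by (simp add: ac_simps)
    with post show "wp (Write 8 (psE \<sigma>) (Con 0) (Con 0) (Con 0) (Var 22)) s1
       (\<lambda>s2 t2. 1 + (t1 + t2) \<le> n * (n * (14 * d + 10) + 6 * (n * D div g) + 12) + 4 \<and>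
         sums_ok s2 \<and> below s2 s0 \<and>
     (\<exists>np\<le>g. snd s2 (8, 2 * ph + \<sigma>, 0, 0, 0) = np \<and> (\<forall>q<np. snd s2 (7, 2 * ph + \<sigma>, q, 0, 0) < n) \<and>
       (\<forall>i<n. \<forall>j<n. \<forall>k<D. f \<sigma> i k + f (opp \<sigma>) j k = ys \<sigma> i j \<longrightarrow>
          snd s2 (cur_index \<sigma> i j) \<le> ys \<sigma> i j \<or> covered \<sigma> s2 np i (f \<sigma> i k))) \<and>
     (\<forall>tg ps r. tg \<noteq> 10 \<longrightarrow> ps \<noteq> 2 * ph + \<sigma> \<longrightarrow> snd s2 (tg, ps, r) = snd s0 (tg, ps, r)))"
      by (intro wp_Write) (use e1 \<sigma> in simp_all)
  qed
qed

end

subsection \<open>Calling the shortest path program\<close>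

definition innerE :: "nat \<Rightarrow> nat \<Rightarrow> exp" where
  "innerE \<sigma> u = Plus (Times (Con (Suc \<sigma>)) (Var 1)) (Plus (Times (Var u) (Var 2)) (Var 17))"

definition outerE :: "nat \<Rightarrow> exp" where
  "outerE \<sigma> = Plus (Times (Con (3 * \<sigma>)) (Var 1)) (Var 15)"

definition cellE :: "exp \<Rightarrow> exp \<Rightarrow> exp" where
  "cellE a b = Plus (Plus (Con 1) (Var 9)) (Plus (Times a (Var 9)) b)"

definition set_arc :: "exp \<Rightarrow> exp \<Rightarrow> com" where
  "set_arc a b = Write 9 (Var 24) (cellE a b) (Con 0) (Con 0) (Con 1) ;;
     Write 9 (Var 24) (cellE b a) (Con 0) (Con 0) (Con 1)"

definition set_weight :: "exp \<Rightarrow> exp \<Rightarrow> com" where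
  "set_weight a e = Write 9 (Var 24) (Plus (Con 1) a) (Con 0) (Con 0) e"

text \<open>Both sides are drawn from the outer layer inwards, the last layer playing the part of
  the first one on side 1; edges being undirected, the direction does not matter.\<close>

definition half_graph :: "nat \<Rightarrow> com" where
  "half_graph \<sigma> = Assign 16 (Var (25 + \<sigma>)) ;;
     For 15 (Var 1) (set_weight (outerE \<sigma>) (Var 7)) ;;
     For 18 (nvE (opp \<sigma>) (Var 16))
       (Assign 19 (valE (opp \<sigma>) (Var 16) (Var 18)) ;;
        For 17 (Var 2) (set_weight (innerE \<sigma> 18) (Minus (Var 7) (Var 19)))) ;;
     scan \<sigma> (For 17 (Var 2)
       (Branch (Eq (Plus (fE \<sigma> (Var 15) (Var 17)) (Var 19)) (Var 20))
          (set_arc (outerE \<sigma>) (innerE \<sigma> 18)) Skip))"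

definition middle_graph :: com where
  "middle_graph = For 18 (nvE 1 (Var 25)) (For 29 (nvE 0 (Var 26)) (For 17 (Var 2)
     (set_arc (innerE 0 18) (innerE 1 29))))"

text \<open>If both links hold at \<open>k\<close>, then the targets at the two pivots,
  \<open>Y i r + Y s j\<close>, exceed the sum at \<open>k\<close> by the total of the two values,
  and a distance of at most \<open>3 * M\<close> is \<open>3 * M\<close> minus such a total; this
  gives the formula for the candidate. Everything above \<open>3 * M\<close>, the code of infinity
  included, means that no \<open>k\<close> has links on both sides.\<close>

definition read_back :: com where
  "read_back = For 15 (Var 1) (For 16 (Var 1)
     (Assign 30 (Rd 9 (Var 24)
        (Plus (Times (Var 15) (Var 9)) (Plus (Times (Con 3) (Var 1)) (Var 16))) (Con 0) (Con 0)) ;;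
      Branch (Lt (Times (Con 3) (Var 7)) (Var 30)) Skip
        (Assign 31 (Minus (Plus (Var 30) (Plus (yE 0 (Var 15) (Var 25)) (yE 0 (Var 26) (Var 16))))
           (Times (Con 3) (Var 7))) ;;
         improve 0 (Var 15) (Var 16) 31)))"

definition call_com :: "nat \<Rightarrow> instr list \<Rightarrow> com" where
  "call_com mr P = Assign 25 (Rd 7 (psE 0) (Var 27) (Con 0) (Con 0)) ;;
     Assign 26 (Rd 7 (psE 1) (Var 28) (Con 0) (Con 0)) ;;
     Write 9 (Var 24) (Con 0) (Con 0) (Con 0) (Var 9) ;;
     half_graph 0 ;; half_graph 1 ;; middle_graph ;; sim mr P ;; read_back ;;
     Assign 24 (Plus (Var 24) (Con 1))"

section \<open>One call: drawing the graph, running the solver, reading the distances\<close>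

lemma modified_call_parts [simp]:
  "modified (set_arc a b) = {}"
  "modified (set_weight a b) = {}"
  "modified (half_graph \<sigma>) = {15, 16, 17, 18, 19, 20}"
  "modified middle_graph = {17, 18, 29}"
  "modified read_back = {15, 16, 30, 31}"
  by (auto simp: set_arc_def set_weight_def half_graph_def middle_graph_def read_back_def)

lemma written_call_parts [simp]:
  "written (set_arc a b) = {9}"
  "written (set_weight a e) = {9}"
  "written (half_graph \<sigma>) = {9}"
  "written middle_graph = {9}"
  "written read_back = {10}"
  by (auto simp: set_arc_def set_weight_def half_graph_def middle_graph_def read_back_def)

text \<open>Distances that matter are at most \<open>3 * M\<close>, and
  \<open>3 * M < 2 ^ (v - 1)\<close> makes them non-negative signed words different from the code of
  infinity. The solver is assumed for this one number \<open>N\<close> of nodes and for natural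
  weights up to \<open>M\<close>.\<close>

locale call = phase + simulator w Z v mr P + gadget n D V M N m val link for v mr P V M N m val link +
  fixes cl TT :: nat and pv :: "nat \<Rightarrow> nat"
  assumes clZ: "cl < Z" and pv_less: "\<And>\<sigma>. \<sigma> < 2 \<Longrightarrow> pv \<sigma> < n"
    and link: "\<And>\<sigma> i u k. link \<sigma> i u k \<longleftrightarrow> f \<sigma> i k + val \<sigma> u = ys \<sigma> i (pv \<sigma>)"
    and m_le: "\<And>\<sigma>. \<sigma> < 2 \<Longrightarrow> m \<sigma> \<le> D"
    and M3: "3 * M < 2 ^ (v - 1)" and NZ: "1 + N + N * N < Z" and Nv: "N < 2 ^ v" and v0: "0 < v"
    and solver: "\<And>E wt. undirected_graph N E \<Longrightarrow> (\<And>x. wt x \<le> M) \<Longrightarrow> no_negative_cycle E (\<lambda>x. int (wt x)) \<Longrightarrow>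
       halted P ((step v P ^^ TT) (initial_state v (apsp_input N E (\<lambda>x. int (wt x))))) \<and>
       (\<forall>i<N * N. decode v (memory ((step v P ^^ TT) (initial_state v (apsp_input N E (\<lambda>x. int (wt x))))) i) =
          apsp_output N E (\<lambda>x. int (wt x)) ! i)"
begin

definition env2 :: "store \<Rightarrow> bool" where
  "env2 s \<longleftrightarrow> env s \<and> fst s 7 = M \<and> fst s 8 = mask v \<and> fst s 9 = N \<and> fst s 24 = cl \<and>
     fst s 25 = pv 0 \<and> fst s 26 = pv 1 \<and>
     (\<forall>\<sigma><2. snd s (5, 2 * ph + opp \<sigma>, pv \<sigma>, 0, 0) = m \<sigma> \<and>
        (\<forall>u<m \<sigma>. snd s (4, 2 * ph + opp \<sigma>, pv \<sigma>, u, 0) = val \<sigma> u))"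

lemma env2_agree:
  assumes "env2 s" "agree X W s s'" "X \<inter> {1, 2, 3, 7, 8, 9, 11, 13, 14, 24, 25, 26} = {}" "W \<inter> {1, 4, 5, 6} = {}"
  shows "env2 s'"
proof -
  have "env s'" by (rule env_agree[OF _ assms(2)]) (use assms in \<open>auto simp: env2_def\<close>)
  moreover have "fst s' x = fst s x" if "x \<in> {7, 8, 9, 24, 25, 26}" for x
    using assms that by (intro agree_reg) auto
  moreover have "snd s' (x, r) = snd s (x, r)" if "x \<in> {4, 5}" for x r
    using assms that by (intro agree_cell) auto
  ultimately show ?thesis using assms(1) by (simp add: env2_def)
qed

text \<open>The memory image of a partially written input: the weights of nodes in \<open>X\<close>
  and the arcs in \<open>A\<close> are present, and the rest is still zero.\<close>

definition mem :: "nat set \<Rightarrow> (nat \<times> nat) set \<Rightarrow> nat \<Rightarrow> nat" where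
  "mem X A a = (if a = 0 then N else if a \<le> N then (if a - 1 \<in> X then wt (a - 1) else 0)
     else if \<exists>x y. (x, y) \<in> A \<and> a = 1 + N + (x * N + y) then 1 else 0)"

definition region :: "(index \<Rightarrow> nat) \<Rightarrow> nat set \<Rightarrow> (nat \<times> nat) set \<Rightarrow> store \<Rightarrow> bool" where
  "region H X A s \<longleftrightarrow> (\<forall>a. snd s (9, cl, a, 0, 0) = mem X A a) \<and>
     (\<forall>c r. c \<noteq> cl \<longrightarrow> snd s (9, c, r) = H (9, c, r))"

lemma region_reg [simp]: "region H X A (set_reg x a s) = region H X A s"
  by (simp add: region_def)

lemma region_weight:
  "region H X A s \<Longrightarrow> x < N \<Longrightarrow> region H (insert x X) A (set_cell (9, cl, Suc x, 0, 0) (wt x) s)"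
  by (auto simp: region_def mem_def)

lemma region_arc:
  assumes "region H X A s"
  shows "region H X (insert (x, y) A) (set_cell (9, cl, 1 + N + (x * N + y), 0, 0) 1 s)"
proof -
  have "snd (set_cell (9, cl, 1 + N + (x * N + y), 0, 0) 1 s) (9, cl, a, 0, 0) = mem X (insert (x, y) A) a" for a
  proof (cases "a = 1 + N + (x * N + y)")
    case True
    then show ?thesis by (auto simp: mem_def)
  next
    case False
    have "snd s (9, cl, a, 0, 0) = mem X A a" using assms by (simp add: region_def)
    also have "\<dots> = mem X (insert (x, y) A) a" using False unfolding mem_def by auto
    finally show ?thesis using False by simp
  qed
  then show ?thesis using assms by (simp add: region_def)
qed

lemma small_bounds:
  "n \<le> N" "N < Z" "M < Z" "3 * M < Z" "3 * M < 2 ^ v" "N * N < 2 ^ w" "1 + N + N * N < 2 ^ w" "M < 2 ^ w" "4 * n \<le> N"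
proof -
  have "(2::nat) ^ (v - 1) \<le> 2 ^ v" by (rule power_increasing) auto
  then show *: "3 * M < 2 ^ v" using M3 by linarith
  then show "3 * M < Z" "M < Z" using v_Z by linarith+
  show "n \<le> N" "4 * n \<le> N" using N by auto
  show "N < Z" using NZ by linarith
  show "N * N < 2 ^ w" "1 + N + N * N < 2 ^ w" using NZ Z_le by linarith+
  show "M < 2 ^ w" using \<open>M < Z\<close> lessW by blast
qed

lemma cell_less: "x < N \<Longrightarrow> y < N \<Longrightarrow> 1 + N + (x * N + y) < Z \<and> x * N < 2 ^ w \<and> x * N + y < 2 ^ w \<and>
   1 + N + (x * N + y) < 2 ^ w"
proof -
  assume "x < N" "y < N"
  then have "x * N + y < N * N" by (rule grid_index_less)
  then show ?thesis using NZ small_bounds by linarith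
qed

lemma wp_set_arc:
  assumes "region H X A s" "env2 s" "x < N" "y < N"
    and a: "\<And>s'. fst s' = fst s \<Longrightarrow> ok a s' \<and> ev a s' = x"
    and b: "\<And>s'. fst s' = fst s \<Longrightarrow> ok b s' \<and> ev b s' = y"
    and Q: "\<And>s'. region H X (insert (y, x) (insert (x, y) A)) s' \<Longrightarrow> Q s' 2"
  shows "wp (set_arc a b) s Q"
proof -
  let ?s1 = "set_cell (9, cl, 1 + N + (x * N + y), 0, 0) 1 s"
  let ?s2 = "set_cell (9, cl, 1 + N + (y * N + x), 0, 0) 1 ?s1"
  have r: "region H X (insert (y, x) (insert (x, y) A)) ?s2" using region_arc[OF region_arc[OF assms(1)]] .
  have N1: "Suc N < 2 ^ w" using small_bounds(7) by linarith
  have e: "fst s 9 = N" "fst s 24 = cl" using assms(2) by (auto simp: env2_def)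
  have c1: "ev (cellE a b) s = 1 + N + (x * N + y)" "ok (cellE a b) s"
    using a[of s] b[of s] cell_less[OF assms(3,4)] e N1 by (simp_all add: cellE_def)
  have c2: "ev (cellE b a) ?s1 = 1 + N + (y * N + x)" "ok (cellE b a) ?s1"
    using a[of ?s1] b[of ?s1] cell_less[OF assms(4,3)] e N1 by (simp_all add: cellE_def)
  have "Q ?s2 (1 + 1)" using Q[OF r] by (simp add: numeral_2_eq_2)
  show ?thesis unfolding set_arc_def
    apply (rule wp_Seq, rule wp_Write)
      apply (use c1 clZ e cell_less[OF assms(3,4)] Z9 in simp)
     apply simp
    apply (rule wp_Write)
      apply (use c1 c2 clZ e cell_less[OF assms(4,3)] Z9 in simp)
     apply simp
    using \<open>Q ?s2 (1 + 1)\<close> c1 c2 e by simp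
qed

definition outer :: "nat \<Rightarrow> nat \<Rightarrow> nat" where
  "outer \<sigma> i = (if \<sigma> = 0 then i else 3 * n + i)"

definition inner :: "nat \<Rightarrow> nat \<Rightarrow> nat" where
  "inner \<sigma> z = (if \<sigma> = 0 then n + z else 2 * n + z)"

lemma outerE:
  assumes "env2 s" "\<sigma> < 2" "fst s 15 = i" "i < n" "fst s' = fst s"
  shows "ev (outerE \<sigma>) s' = outer \<sigma> i" "ok (outerE \<sigma>) s'"
proof -
  have "fst s 1 = n" using assms by (simp add: env2_def env_def)
  moreover have "3 * n < 2 ^ w" "3 * n + i < 2 ^ w" using small_bounds(7,9) assms(4) by linarith+
  ultimately show "ev (outerE \<sigma>) s' = outer \<sigma> i" "ok (outerE \<sigma>) s'"
    using assms by (auto simp: outerE_def outer_def less_2_cases_iff)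
qed

lemma innerE:
  assumes "env2 s" "\<sigma> < 2" "fst s x = u" "u < m \<sigma>" "fst s 17 = k" "k < D" "fst s' = fst s"
  shows "ev (innerE \<sigma> x) s' = inner \<sigma> (u * D + k)" "ok (innerE \<sigma> x) s'"
proof -
  have "fst s 1 = n" "fst s 2 = D" using assms by (simp_all add: env2_def env_def)
  moreover have "u * D + k < n" using idx_less assms by blast
  moreover from this have "n + (u * D + k) < 2 ^ w" "2 * n + (u * D + k) < 2 ^ w" "2 * n < 2 ^ w" "u * D < 2 ^ w"
     "u * D + k < 2 ^ w" "n < 2 ^ w"
    using small_bounds(7,9) by linarith+
  moreover have "\<sigma> = 0 \<or> \<sigma> = 1" using assms(2) by auto
  ultimately show "ev (innerE \<sigma> x) s' = inner \<sigma> (u * D + k)" "ok (innerE \<sigma> x) s'"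
    using assms by (auto simp: innerE_def inner_def)
qed

lemma node_less: "i < n \<Longrightarrow> outer \<sigma> i < N" "\<sigma> < 2 \<Longrightarrow> u < m \<sigma> \<Longrightarrow> k < D \<Longrightarrow> inner \<sigma> (u * D + k) < N"
  using small_bounds(9) idx_less[of \<sigma> u k] by (auto simp: outer_def inner_def)

lemma node_wt: "i < n \<Longrightarrow> wt (outer \<sigma> i) = M" 
  "\<sigma> < 2 \<Longrightarrow> u < m \<sigma> \<Longrightarrow> k < D \<Longrightarrow> wt (inner \<sigma> (u * D + k)) = M - val \<sigma> u"
  by (auto simp: outer_def inner_def wt_simps less_2_cases_iff)

definition outers :: "nat \<Rightarrow> nat set" where
  "outers \<sigma> = outer \<sigma> ` {..<n}"

definition inners :: "nat \<Rightarrow> nat set" where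
  "inners \<sigma> = {inner \<sigma> (u * D + k) | u k. u < m \<sigma> \<and> k < D}"

definition half_arcs :: "nat \<Rightarrow> (nat \<times> nat) set" where
  "half_arcs \<sigma> = {(outer \<sigma> i, inner \<sigma> (u * D + k)) | i u k. i < n \<and> u < m \<sigma> \<and> k < D \<and> link \<sigma> i u k}"

text \<open>The time is dominated by the scan: each of the \<open>n\<close> outer nodes is compared
  with at most \<open>m \<sigma> * D \<le> n\<close> pairs of a value and a position.\<close>

lemma half_graph_correct:
  assumes env2: "env2 s0" and \<sigma>: "\<sigma> < 2" and reg: "region H X A s0"
  shows "wp (half_graph \<sigma>) s0 (\<lambda>s t. t \<le> 13 * (n * n) + 20 * n + 10 \<and>
    region H (X \<union> outers \<sigma> \<union> inners \<sigma>) (A \<union> half_arcs \<sigma> \<union> (half_arcs \<sigma>)\<inverse>) s)"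
proof -
  let ?s1 = "set_reg 16 (pv \<sigma>) s0" and ?mm = "m \<sigma>"
  have pvr: "fst s0 (25 + \<sigma>) = pv \<sigma>" using env2 \<sigma> by (auto simp: env2_def less_2_cases_iff)
  have w: "n < 2 ^ w" "D < 2 ^ w" "?mm < 2 ^ w" using nZ DZ lessW m_le[OF \<sigma>] by (blast, blast, meson le_less_trans)
  have pvn: "pv \<sigma> < n" "pv \<sigma> < Z" using pv_less[OF \<sigma>] nZ by linarith+
  let ?c1 = "For 15 (Var 1) (set_weight (outerE \<sigma>) (Var 7))"
  let ?c2 = "For 18 (nvE (opp \<sigma>) (Var 16)) (Assign 19 (valE (opp \<sigma>) (Var 16) (Var 18)) ;;
        For 17 (Var 2) (set_weight (innerE \<sigma> 18) (Minus (Var 7) (Var 19))))"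
  let ?c3 = "scan \<sigma> (For 17 (Var 2) (Branch (Eq (Plus (fE \<sigma> (Var 15) (Var 17)) (Var 19)) (Var 20))
          (set_arc (outerE \<sigma>) (innerE \<sigma> 18)) Skip))"
  have 1: "wp ?c1 s (\<lambda>s' t. t \<le> 3 * n + 2 \<and> region H (X \<union> outers \<sigma>) A s')"
    if es: "env2 s" and rs: "region H X A s" for s
  proof (rule wp_For[where N = n and I = "\<lambda>i. region H (X \<union> outer \<sigma> ` {..<i}) A" and T = "\<lambda>_. 1"
        and X = "{15}" and Y = "{9}"])
    fix i s' assume ag: "agree {15} {9} s s'"
    have es': "env2 s'" by (rule env2_agree[OF es ag]) auto
    then show "ok (Var 1) s' \<and> ev (Var 1) s' = n" by (simp add: env2_def env_def)
    assume i: "i < n" "fst s' 15 = i" and R: "region H (X \<union> outer \<sigma> ` {..<i}) A s'"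
    note o = outerE[OF es' \<sigma> i(2,1) refl]
    have lt: "outer \<sigma> i < N" using node_less i by blast
    have "region H (X \<union> outer \<sigma> ` {..<Suc i}) A (set_cell (9, cl, Suc (outer \<sigma> i), 0, 0) M s')"
      using region_weight[OF R lt] node_wt(1)[OF i(1), of \<sigma>] by (simp add: lessThan_Suc)
    then show "wp (set_weight (outerE \<sigma>) (Var 7)) s'
       (\<lambda>s' t. t \<le> 1 \<and> region H (X \<union> outer \<sigma> ` {..<Suc i}) A (set_reg 15 (Suc i) s'))"
      unfolding set_weight_def using o lt es' clZ Z9 NZ small_bounds(7)
      by (intro wp_Write) (auto simp: env2_def)
  qed (use rs w in \<open>auto simp: outers_def\<close>)
  have 2: "wp ?c2 s (\<lambda>s' t. t \<le> 3 * n + 5 * ?mm + 2 \<and> region H (X1 \<union> inners \<sigma>) A s')"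
    if es: "env2 s" and rs: "region H X1 A s" and j: "fst s 16 = pv \<sigma>" for s X1
  proof -
    define J where "J u k = X1 \<union> {inner \<sigma> (u' * D + k') | u' k'. u' < ?mm \<and> k' < D \<and> (u' < u \<or> u' = u \<and> k' < k)}" for u k
    have Jnext: "J u D = J (Suc u) 0" if "u < ?mm" for u using that unfolding J_def by (auto simp: less_Suc_eq)
    have Jfin: "J ?mm 0 = X1 \<union> inners \<sigma>" unfolding J_def inners_def by auto
    show ?thesis
    proof (rule wp_For[where N = ?mm and I = "\<lambda>u. region H (J u 0) A" and T = "\<lambda>_. 3 * D + 3"
          and X = "{17, 18, 19}" and Y = "{9}"])
      show "region H (J 0 0) A (set_reg 18 0 s)" using rs by (simp add: J_def)
      fix u s' assume ag: "agree {17, 18, 19} {9} s s'"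
      have es': "env2 s'" by (rule env2_agree[OF es ag]) auto
      have j': "fst s' 16 = pv \<sigma>" using agree_reg[OF ag] j by simp
      have e: "env s'" using es' by (simp add: env2_def)
      show "ok (nvE (opp \<sigma>) (Var 16)) s' \<and> ev (nvE (opp \<sigma>) (Var 16)) s' = ?mm"
        using e j' pvn \<sigma> es' by (simp add: env2_def)
      assume u: "u < ?mm" "fst s' 18 = u" and R: "region H (J u 0) A s'"
      have uZ: "u < Z" using u m_le[OF \<sigma>] DZ by linarith
      let ?s2 = "set_reg 19 (val \<sigma> u) s'"
      have in17: "wp (For 17 (Var 2) (set_weight (innerE \<sigma> 18) (Minus (Var 7) (Var 19)))) ?s2
         (\<lambda>s' t. t \<le> 3 * D + 2 \<and> region H (J (Suc u) 0) A s')"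
      proof (rule wp_For[where N = D and I = "\<lambda>k. region H (J u k) A" and T = "\<lambda>_. 1" and X = "{17}" and Y = "{9}"])
        fix k s3 assume ag3: "agree {17} {9} ?s2 s3"
        have es2: "env2 ?s2" using es' by (simp add: env2_def)
        have es3: "env2 s3" by (rule env2_agree[OF es2 ag3]) auto
        have r3: "fst s3 18 = u" "fst s3 19 = val \<sigma> u" using agree_reg[OF ag3] u by simp_all
        show "ok (Var 2) s3 \<and> ev (Var 2) s3 = D" using es3 by (simp add: env2_def env_def)
        assume k: "k < D" "fst s3 17 = k" and R: "region H (J u k) A s3"
        note o = innerE[OF es3 \<sigma> r3(1) u(1) k(2,1) refl]
        have lt: "inner \<sigma> (u * D + k) < N" using node_less \<sigma> u k by blast
        have "insert (inner \<sigma> (u * D + k)) (J u k) = J u (Suc k)"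
          using u(1) k(1) unfolding J_def by (auto simp: less_Suc_eq)
        then have "region H (J u (Suc k)) A (set_cell (9, cl, Suc (inner \<sigma> (u * D + k)), 0, 0) (M - val \<sigma> u) s3)"
          using region_weight[OF R lt] node_wt(2)[OF \<sigma> u(1) k(1)] by simp
        moreover have "val \<sigma> u \<le> M" using val_le[OF \<sigma> u(1)] M by linarith
        moreover have "fst s3 7 = M" "fst s3 24 = cl" using es3 by (auto simp: env2_def)
        ultimately show "wp (set_weight (innerE \<sigma> 18) (Minus (Var 7) (Var 19))) s3
         (\<lambda>s' t. t \<le> 1 \<and> region H (J u (Suc k)) A (set_reg 17 (Suc k) s'))"
          unfolding set_weight_def using o lt r3 clZ Z9 NZ small_bounds(7,8)
          by (intro wp_Write) auto
      qed (use R w Jnext[OF u(1)] in auto)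
      have v: "ev (valE (opp \<sigma>) (Var 16) (Var 18)) s' = val \<sigma> u" "ok (valE (opp \<sigma>) (Var 16) (Var 18)) s'"
        using e j' pvn u uZ \<sigma> es' by (simp_all add: env2_def)
      show "wp (Assign 19 (valE (opp \<sigma>) (Var 16) (Var 18)) ;;
        For 17 (Var 2) (set_weight (innerE \<sigma> 18) (Minus (Var 7) (Var 19)))) s'
        (\<lambda>s' t. t \<le> 3 * D + 3 \<and> region H (J (Suc u) 0) A (set_reg 18 (Suc u) s'))"
        by (rule wp_Seq, rule wp_Assign[OF v(2)], unfold v(1), rule wp_conseq[OF in17]) simp
    next
      fix s' t' assume t': "t' \<le> (\<Sum>i<?mm. 3 * D + 3 + 2) + 2" and R: "region H (J ?mm 0) A s'"
      have "(\<Sum>i<?mm. 3 * D + 3 + 2) = 3 * (?mm * D) + 5 * ?mm" by (simp add: algebra_simps)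
      then have "t' \<le> 3 * n + 5 * ?mm + 2" using t' mD[OF \<sigma>] by linarith
      then show "t' \<le> 3 * n + 5 * ?mm + 2 \<and> region H (X1 \<union> inners \<sigma>) A s'" using R Jfin by simp
    qed (use w in auto)
  qed
  have 3: "wp ?c3 s (\<lambda>s' t. t \<le> n * (6 * n + 7 * ?mm + 5) + 2 \<and>
       region H X1 (A \<union> half_arcs \<sigma> \<union> (half_arcs \<sigma>)\<inverse>) s')"
    if es: "env2 s" and rs: "region H X1 A s" and j: "fst s 16 = pv \<sigma>" for s X1
  proof -
    define B where "B i u k = {(outer \<sigma> i', inner \<sigma> (u' * D + k')) | i' u' k'. i' < n \<and> u' < ?mm \<and> k' < D \<and>
       link \<sigma> i' u' k' \<and> (i' < i \<or> i' = i \<and> (u' < u \<or> u' = u \<and> k' < k))}" for i u k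
    define R where "R i u k s = region H X1 (A \<union> B i u k \<union> (B i u k)\<inverse>) s" for i u k s
    have R_reg [simp]: "R i u k (set_reg x a s) = R i u k s" for i u k x a s by (simp add: R_def)
    have B1: "B i u D = B i (Suc u) 0" if "u < ?mm" for i u using that unfolding B_def by (auto simp: less_Suc_eq)
    have B2: "B i ?mm 0 = B (Suc i) 0 0" for i unfolding B_def by (auto simp: less_Suc_eq)
    have B3: "B i u (Suc k) = (if link \<sigma> i u k then insert (outer \<sigma> i, inner \<sigma> (u * D + k)) (B i u k) else B i u k)"
      if "i < n" "u < ?mm" "k < D" for i u k
      using that unfolding B_def by (auto simp: less_Suc_eq)
    have B4: "B n 0 0 = half_arcs \<sigma>" unfolding B_def half_arcs_def by auto
    have B0: "B 0 0 0 = {}" unfolding B_def by auto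
    \<comment> \<open>A value above the target has no link at all, so no arc is lost by skipping
      it.\<close>
    have skp: "B i (Suc u) 0 = B i u 0" if "i < n" "u < ?mm" "\<not> val \<sigma> u \<le> ys \<sigma> i (pv \<sigma>)" for i u
    proof -
      have "\<not> link \<sigma> i u k" for k using that(3) unfolding link by simp
      then show ?thesis unfolding B_def by (auto simp: less_Suc_eq)
    qed
    have tb: "snd s (5, 2 * ph + opp \<sigma>, pv \<sigma>, 0, 0) = ?mm" "\<And>u. u < ?mm \<Longrightarrow> snd s (4, 2 * ph + opp \<sigma>, pv \<sigma>, u, 0) = val \<sigma> u"
      and e: "env s"
      using es \<sigma> by (simp_all add: env2_def)
    show ?thesis
    proof (rule wp_scan[where J = "\<lambda>i u. R i u 0" and T = "\<lambda>_ _. 6 * D + 2" and mm = ?mm and bb = "val \<sigma>" and j = "pv \<sigma>"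
          and X = "{17}" and W = "{9}", OF e \<sigma> j pvn(1) tb(1) m_le[OF \<sigma>] tb(2)])
      show "R 0 0 0 s" using rs by (simp add: R_def B0)
      fix i u s' assume a: "i < n" "u < ?mm" and ag: "agree ({17} \<union> {15, 18, 19, 20}) {9} s s'"
        and e': "env s'" and r: "fst s' 15 = i" "fst s' 18 = u" "fst s' 19 = val \<sigma> u" "fst s' 20 = ys \<sigma> i (pv \<sigma>)"
        and b: "val \<sigma> u \<le> ys \<sigma> i (pv \<sigma>)" and J: "R i u 0 s'"
      have es': "env2 s'" by (rule env2_agree[OF es ag]) auto
      show "wp (For 17 (Var 2) (Branch (Eq (Plus (fE \<sigma> (Var 15) (Var 17)) (Var 19)) (Var 20))
          (set_arc (outerE \<sigma>) (innerE \<sigma> 18)) Skip)) s' (\<lambda>s'' t. t \<le> 6 * D + 2 \<and> R i (Suc u) 0 s'')"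
      proof (rule wp_For[where N = D and I = "R i u" and T = "\<lambda>_. 4" and X = "{17}" and Y = "{9}"])
        show "R i u 0 (set_reg 17 0 s')" using J by simp
        fix k s3 assume ag3: "agree {17} {9} s' s3"
        have es3: "env2 s3" by (rule env2_agree[OF es' ag3]) auto
        have e3: "env s3" using es3 by (simp add: env2_def)
        have r3: "fst s3 15 = i" "fst s3 18 = u" "fst s3 19 = val \<sigma> u" "fst s3 20 = ys \<sigma> i (pv \<sigma>)"
          using agree_reg[OF ag3] r by simp_all
        show "ok (Var 2) s3 \<and> ev (Var 2) s3 = D" using e3 by (simp add: env_def)
        assume k: "k < D" "fst s3 17 = k" and R3: "R i u k s3"
        have "f \<sigma> i k < Z" "val \<sigma> u < Z" using f_less[OF \<sigma> a(1) k(1)] b ys_less[OF a(1) pvn(1), of \<sigma>] by linarith+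
        then have lt: "f \<sigma> i k + val \<sigma> u < 2 ^ w" using lessW by blast
        have fe: "ev (fE \<sigma> (Var 15) (Var 17)) s3 = f \<sigma> i k" "ok (fE \<sigma> (Var 15) (Var 17)) s3"
          using e3 \<sigma> r3 k a by simp_all
        show "wp (Branch (Eq (Plus (fE \<sigma> (Var 15) (Var 17)) (Var 19)) (Var 20))
          (set_arc (outerE \<sigma>) (innerE \<sigma> 18)) Skip) s3 (\<lambda>s' t. t \<le> 4 \<and> R i u (Suc k) (set_reg 17 (Suc k) s'))"
        proof (rule wp_Branch)
          show "ok_cond (Eq (Plus (fE \<sigma> (Var 15) (Var 17)) (Var 19)) (Var 20)) s3" using fe lt r3 by simp
          have cnd: "ev_cond (Eq (Plus (fE \<sigma> (Var 15) (Var 17)) (Var 19)) (Var 20)) s3 \<longleftrightarrow> link \<sigma> i u k"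
            using fe r3 by (simp add: link)
          {
            assume "ev_cond (Eq (Plus (fE \<sigma> (Var 15) (Var 17)) (Var 19)) (Var 20)) s3"
            then have l: "link \<sigma> i u k" using cnd by simp
            let ?x = "outer \<sigma> i" and ?y = "inner \<sigma> (u * D + k)"
            have "A \<union> B i u (Suc k) \<union> (B i u (Suc k))\<inverse> = insert (?y, ?x) (insert (?x, ?y) (A \<union> B i u k \<union> (B i u k)\<inverse>))"
              using l unfolding B3[OF a k(1)] by auto
            then have "R i u (Suc k) s4" if "region H X1 (insert (?y, ?x) (insert (?x, ?y) (A \<union> B i u k \<union> (B i u k)\<inverse>))) s4" for s4
              using that by (simp add: R_def)
            then show "wp (set_arc (outerE \<sigma>) (innerE \<sigma> 18)) s3 (\<lambda>s t. t + 1 \<le> 4 \<and> R i u (Suc k) (set_reg 17 (Suc k) s))"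
              using outerE[OF es3 \<sigma> r3(1) a(1)] innerE[OF es3 \<sigma> r3(2) a(2) k(2,1)]
              by (intro wp_set_arc[OF R3[unfolded R_def] es3 node_less(1)[OF a(1)] node_less(2)[OF \<sigma> a(2) k(1)]]) auto
          next
            assume "\<not> ev_cond (Eq (Plus (fE \<sigma> (Var 15) (Var 17)) (Var 19)) (Var 20)) s3"
            then have l: "\<not> link \<sigma> i u k" using cnd by simp
            then have "R i u (Suc k) s3" using R3 unfolding R_def B3[OF a k(1)] by simp
            then show "wp Skip s3 (\<lambda>s t. t + 1 \<le> 4 \<and> R i u (Suc k) (set_reg 17 (Suc k) s))"
              by (intro wp_Skip) simp
          }
        qed
      qed (use w B1[OF a(2)] in \<open>auto simp: R_def\<close>)
    next
      fix s' t' assume t': "t' \<le> (\<Sum>i<n. (\<Sum>u<?mm. 6 * D + 2 + 5) + 5) + 2" and "R n 0 0 s'"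
      have "(\<Sum>i<n. (\<Sum>u<?mm. 6 * D + 2 + 5) + 5) = n * (6 * (?mm * D) + 7 * ?mm + 5)" by (simp add: algebra_simps)
      also have "\<dots> \<le> n * (6 * n + 7 * ?mm + 5)" using mD[OF \<sigma>] by (intro mult_left_mono) auto
      finally have "t' \<le> n * (6 * n + 7 * ?mm + 5) + 2" using t' by linarith
      then show "t' \<le> n * (6 * n + 7 * ?mm + 5) + 2 \<and> region H X1 (A \<union> half_arcs \<sigma> \<union> (half_arcs \<sigma>)\<inverse>) s'"
        using \<open>R n 0 0 s'\<close> by (simp add: R_def B4)
    qed (use skp B2 in \<open>auto simp: R_def\<close>)
  qed
  have mn: "?mm \<le> n" using mD[OF \<sigma>] D by (metis le_trans mult.right_neutral mult_le_mono2 Suc_leI One_nat_def)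
  have es1: "env2 ?s1" using env2 by (simp add: env2_def)
  have t: "1 + (t1 + (t2 + t3)) \<le> 13 * (n * n) + 20 * n + 10"
    if "t1 \<le> 3 * n + 2" "t2 \<le> 3 * n + 5 * ?mm + 2" "t3 \<le> n * (6 * n + 7 * ?mm + 5) + 2" for t1 t2 t3
  proof -
    have "n * (6 * n + 7 * ?mm + 5) \<le> n * (6 * n + 7 * n + 5)" using mn by (intro mult_left_mono) auto
    also have "\<dots> = 13 * (n * n) + 5 * n" by (simp add: algebra_simps)
    finally show ?thesis using that mn by linarith
  qed
  show ?thesis unfolding half_graph_def
  proof (rule wp_Seq, rule wp_Assign, simp, unfold ev.simps pvr, rule wp_Seq, rule wp_conseq[OF 1[OF es1]])
    show "region H X A ?s1" using reg by simp
    fix s2 t1 assume ag: "agree (modified ?c1) (written ?c1) ?s1 s2"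
      and a1: "t1 \<le> 3 * n + 2 \<and> region H (X \<union> outers \<sigma>) A s2"
    have es2: "env2 s2" by (rule env2_agree[OF es1 ag]) auto
    have j2: "fst s2 16 = pv \<sigma>" using agree_reg[OF ag] by simp
    show "wp (?c2 ;; ?c3) s2 (\<lambda>s2 t2. 1 + (t1 + t2) \<le> 13 * (n * n) + 20 * n + 10 \<and>
      region H (X \<union> outers \<sigma> \<union> inners \<sigma>) (A \<union> half_arcs \<sigma> \<union> (half_arcs \<sigma>)\<inverse>) s2)"
    proof (rule wp_Seq, rule wp_conseq[OF 2[OF es2 conjunct2[OF a1] j2]])
      fix s3 t2 assume ag3: "agree (modified ?c2) (written ?c2) s2 s3"
        and a2: "t2 \<le> 3 * n + 5 * ?mm + 2 \<and> region H (X \<union> outers \<sigma> \<union> inners \<sigma>) A s3"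
      have es3: "env2 s3" by (rule env2_agree[OF es2 ag3]) auto
      have j3: "fst s3 16 = pv \<sigma>" using agree_reg[OF ag3] j2 by simp
      show "wp ?c3 s3 (\<lambda>s2 t3. 1 + (t1 + (t2 + t3)) \<le> 13 * (n * n) + 20 * n + 10 \<and>
        region H (X \<union> outers \<sigma> \<union> inners \<sigma>) (A \<union> half_arcs \<sigma> \<union> (half_arcs \<sigma>)\<inverse>) s2)"
        by (rule wp_conseq[OF 3[OF es3 conjunct2[OF a2] j3]]) (use a1 a2 t in auto)
    qed
  qed
qed

lemma m_le_n: "\<sigma> < 2 \<Longrightarrow> m \<sigma> \<le> n"
  using mD[of \<sigma>] D by (metis le_trans mult.right_neutral mult_le_mono2 Suc_leI One_nat_def)

text \<open>The number of arcs, \<open>m 0 * m 1 * D\<close>, is at most \<open>n * n\<close>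
  because \<open>m 1 * D \<le> n\<close>.\<close>

lemma middle_graph_correct:
  assumes env2: "env2 s0" and reg: "region H X A s0"
  shows "wp middle_graph s0 (\<lambda>s t. t \<le> 8 * (n * n) + 4 * n + 2 \<and> region H X (A \<union> middle \<union> middle\<inverse>) s)"
proof -
  define B where "B u u2 k = {(inner 0 (u' * D + k'), inner 1 (u2' * D + k')) | u' u2' k'.
     u' < m 0 \<and> u2' < m 1 \<and> k' < D \<and> (u' < u \<or> u' = u \<and> (u2' < u2 \<or> u2' = u2 \<and> k' < k))}" for u u2 k
  define R where "R u u2 k s = region H X (A \<union> B u u2 k \<union> (B u u2 k)\<inverse>) s" for u u2 k s
  have R_reg [simp]: "R u u2 k (set_reg x a s) = R u u2 k s" for u u2 k x a s by (simp add: R_def)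
  have B1: "B u u2 D = B u (Suc u2) 0" if "u2 < m 1" for u u2 using that unfolding B_def by (auto simp: less_Suc_eq)
  have B2: "B u (m 1) 0 = B (Suc u) 0 0" for u unfolding B_def by (auto simp: less_Suc_eq)
  have B3: "B u u2 (Suc k) = insert (inner 0 (u * D + k), inner 1 (u2 * D + k)) (B u u2 k)"
    if "u < m 0" "u2 < m 1" "k < D" for u u2 k
    using that unfolding B_def by (auto simp: less_Suc_eq)
  have B4: "B (m 0) 0 0 = middle" unfolding B_def middle_def by (auto simp: inner_def)
  have B0: "B 0 0 0 = {}" unfolding B_def by auto
  have w: "m 0 < 2 ^ w" "m 1 < 2 ^ w" "D < 2 ^ w"
    using lessW(1)[of "m 0"] lessW(1)[of "m 1"] lessW(1)[of D] m_le[of 0] m_le[of 1] DZ by auto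
  have pvZ: "pv 0 < Z" "pv 1 < Z" using pv_less[of 0] pv_less[of 1] nZ by simp_all
  have bnd: "ok (nvE 1 (Var 25)) s \<and> ev (nvE 1 (Var 25)) s = m 0"
    "ok (nvE 0 (Var 26)) s \<and> ev (nvE 0 (Var 26)) s = m 1" if "env2 s" for s
  proof -
    have t: "snd s (5, 2 * ph + opp \<sigma>, pv \<sigma>, 0, 0) = m \<sigma>" if "\<sigma> < 2" for \<sigma>
      using \<open>env2 s\<close> that by (simp add: env2_def)
    have "env s" "fst s 25 = pv 0" "fst s 26 = pv 1" using that by (simp_all add: env2_def)
    then show "ok (nvE 1 (Var 25)) s \<and> ev (nvE 1 (Var 25)) s = m 0"
      "ok (nvE 0 (Var 26)) s \<and> ev (nvE 0 (Var 26)) s = m 1"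
      using pvZ t[of 0] t[of 1] by simp_all
  qed
  show ?thesis unfolding middle_graph_def
  proof (rule wp_For[where N = "m 0" and I = "\<lambda>u. R u 0 0" and T = "\<lambda>_. 8 * n + 2" and X = "{17, 18, 29}" and Y = "{9}"])
    show "R 0 0 0 (set_reg 18 0 s0)" using reg by (simp add: R_def B0)
    fix u s assume ag: "agree {17, 18, 29} {9} s0 s"
    have es: "env2 s" by (rule env2_agree[OF env2 ag]) auto
    then show "ok (nvE 1 (Var 25)) s \<and> ev (nvE 1 (Var 25)) s = m 0" using bnd by blast
    assume u: "u < m 0" "fst s 18 = u" and R: "R u 0 0 s"
    show "wp (For 29 (nvE 0 (Var 26)) (For 17 (Var 2) (set_arc (innerE 0 18) (innerE 1 29)))) s
       (\<lambda>s' t. t \<le> 8 * n + 2 \<and> R (Suc u) 0 0 (set_reg 18 (Suc u) s'))"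
    proof (rule wp_For[where N = "m 1" and I = "\<lambda>u2. R u u2 0" and T = "\<lambda>_. 4 * D + 2" and X = "{17, 29}" and Y = "{9}"])
      show "R u 0 0 (set_reg 29 0 s)" using R by simp
      fix u2 s' assume ag': "agree {17, 29} {9} s s'"
      have es': "env2 s'" by (rule env2_agree[OF es ag']) auto
      then show "ok (nvE 0 (Var 26)) s' \<and> ev (nvE 0 (Var 26)) s' = m 1" using bnd by blast
      have u': "fst s' 18 = u" using agree_reg[OF ag'] u by simp
      assume u2: "u2 < m 1" "fst s' 29 = u2" and R: "R u u2 0 s'"
      show "wp (For 17 (Var 2) (set_arc (innerE 0 18) (innerE 1 29))) s'
        (\<lambda>s' t. t \<le> 4 * D + 2 \<and> R u (Suc u2) 0 (set_reg 29 (Suc u2) s'))"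
      proof (rule wp_For[where N = D and I = "R u u2" and T = "\<lambda>_. 2" and X = "{17}" and Y = "{9}"])
        show "R u u2 0 (set_reg 17 0 s')" using R by simp
        fix k s3 assume ag3: "agree {17} {9} s' s3"
        have es3: "env2 s3" by (rule env2_agree[OF es' ag3]) auto
        then show "ok (Var 2) s3 \<and> ev (Var 2) s3 = D" by (simp add: env2_def env_def)
        have r3: "fst s3 18 = u" "fst s3 29 = u2" using agree_reg[OF ag3] u' u2 by simp_all
        assume k: "k < D" "fst s3 17 = k" and R3: "R u u2 k s3"
        let ?x = "inner 0 (u * D + k)" and ?y = "inner 1 (u2 * D + k)"
        have "A \<union> B u u2 (Suc k) \<union> (B u u2 (Suc k))\<inverse> = insert (?y, ?x) (insert (?x, ?y) (A \<union> B u u2 k \<union> (B u u2 k)\<inverse>))"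
          unfolding B3[OF u(1) u2(1) k(1)] by auto
        then have "R u u2 (Suc k) s4" if "region H X (insert (?y, ?x) (insert (?x, ?y) (A \<union> B u u2 k \<union> (B u u2 k)\<inverse>))) s4" for s4
          using that by (simp add: R_def)
        then show "wp (set_arc (innerE 0 18) (innerE 1 29)) s3 (\<lambda>s t. t \<le> 2 \<and> R u u2 (Suc k) (set_reg 17 (Suc k) s))"
          using innerE[OF es3 _ r3(1) u(1) k(2,1)] innerE[OF es3 _ r3(2) u2(1) k(2,1)]
            node_less(2)[OF _ u(1) k(1)] node_less(2)[OF _ u2(1) k(1)]
          by (intro wp_set_arc[OF R3[unfolded R_def] es3]) auto
      qed (use w B1[OF u2(1)] in \<open>auto simp: R_def\<close>)
    next
      fix s' t' assume t': "t' \<le> (\<Sum>i<m 1. 4 * D + 2 + 2) + 2" and R': "R u (m 1) 0 s'"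
      have "(\<Sum>i<m 1. 4 * D + 2 + 2) = 4 * (m 1 * D) + 4 * m 1" by (simp add: algebra_simps)
      then have "t' \<le> 8 * n + 2" using t' mD[of 1] m_le_n[of 1] by linarith
      then show "t' \<le> 8 * n + 2 \<and> R (Suc u) 0 0 (set_reg 18 (Suc u) s')"
        using R' unfolding R_def B2 region_reg by blast
    qed (use w in auto)
  next
    fix s' t' assume t': "t' \<le> (\<Sum>i<m 0. 8 * n + 2 + 2) + 2" and R': "R (m 0) 0 0 s'"
    have "(\<Sum>i<m 0. 8 * n + 2 + 2) = m 0 * (8 * n + 4)" by (simp add: algebra_simps)
    also have "\<dots> \<le> n * (8 * n + 4)" using m_le_n[of 0] by (intro mult_right_mono) auto
    finally have "(\<Sum>i<m 0. 8 * n + 2 + 2) \<le> n * (8 * n + 4)" .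
    then have "t' \<le> 8 * (n * n) + 4 * n + 2" using t' by (simp add: algebra_simps)
    then show "t' \<le> 8 * (n * n) + 4 * n + 2 \<and> region H X (A \<union> middle \<union> middle\<inverse>) s'"
      using R' by (simp add: R_def B4)
  qed (use w in auto)
qed

text \<open>Side 1 is drawn from the last layer inwards, so its arcs are the converses of
  \<open>right\<close>.\<close>

lemma edges_half: "half_arcs 0 \<union> (half_arcs 0)\<inverse> \<union> half_arcs 1 \<union> (half_arcs 1)\<inverse> \<union> middle \<union> middle\<inverse> = edges"
proof -
  have l: "left = half_arcs 0" unfolding left_def half_arcs_def outer_def inner_def by simp
  have r: "right = (half_arcs 1)\<inverse>" unfolding right_def half_arcs_def outer_def inner_def by auto
  show ?thesis unfolding edges_def arcs_def l r converse_Un converse_converse by (simp only: Un_ac)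
qed

text \<open>Cells that were never written are zero; this agrees with the input because a node
  outside the written sets has weight zero.\<close>

lemma weighted_nodes: "wt x \<noteq> 0 \<Longrightarrow> x \<in> outers 0 \<union> inners 0 \<union> outers 1 \<union> inners 1"
proof -
  assume "wt x \<noteq> 0"
  have dm: "z = (z div D) * D + z mod D" "z mod D < D" for z using D by simp_all
  consider "x < n" | "3 * n \<le> x" "x < 4 * n" | "n \<le> x" "x < n + m 0 * D" | "2 * n \<le> x" "x < 2 * n + m 1 * D"
    using \<open>wt x \<noteq> 0\<close> unfolding wt_def by (auto split: if_splits)
  then show ?thesis
  proof cases
    case 1
    then have "x \<in> outers 0" unfolding outers_def outer_def by auto
    then show ?thesis by blast
  next
    case 2
    then have "x = outer 1 (x - 3 * n)" "x - 3 * n < n" by (auto simp: outer_def)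
    then have "x \<in> outers 1" unfolding outers_def by blast
    then show ?thesis by blast
  next
    case 3
    have "(x - n) div D < m 0" using 3 D by (auto simp: div_less_iff_less_mult)
    moreover have "x = inner 0 ((x - n) div D * D + (x - n) mod D)" using 3 by (simp add: inner_def)
    ultimately have "x \<in> inners 0" unfolding inners_def using dm(2)[of "x - n"] by blast
    then show ?thesis by blast
  next
    case 4
    have "(x - 2 * n) div D < m 1" using 4 D by (auto simp: div_less_iff_less_mult)
    moreover have "x = inner 1 ((x - 2 * n) div D * D + (x - 2 * n) mod D)" using 4 by (simp add: inner_def)
    ultimately have "x \<in> inners 1" unfolding inners_def using dm(2)[of "x - 2 * n"] by blast
    then show ?thesis by blast
  qed
qed

abbreviation iwt :: "nat \<Rightarrow> int" where
  "iwt \<equiv> \<lambda>x. int (wt x)"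

abbreviation final :: state where
  "final \<equiv> (step v P ^^ TT) (initial_state v (apsp_input N edges iwt))"

text \<open>The comparison covers all addresses, since the simulated program may read beyond its
  input; there both sides are zero.\<close>

lemma input_region:
  assumes "region H (outers 0 \<union> inners 0 \<union> outers 1 \<union> inners 1) edges s"
  shows "snd s (9, cl, a, 0, 0) = snd (snd (initial_state v (apsp_input N edges iwt))) a"
proof -
  let ?X = "outers 0 \<union> inners 0 \<union> outers 1 \<union> inners 1"
  have sm: "nat (take_bit v (int q)) = q" if "q < 2 ^ v" for q
    using that by (simp add: of_nat_take_bit[symmetric] take_bit_nat_eq_self)
  have "snd s (9, cl, a, 0, 0) = mem ?X edges a" using assms by (simp add: region_def)
  also have "\<dots> = (if a < 1 + N + N * N then nat (take_bit v (apsp_input N edges iwt ! a)) else 0)"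
  proof -
    consider "a = 0" | x where "x < N" "a = 1 + x" | "N < a" "a < 1 + N + N * N" | "1 + N + N * N \<le> a"
    proof -
      have "a = 0 \<or> (\<exists>x<N. a = 1 + x) \<or> (N < a \<and> a < 1 + N + N * N) \<or> 1 + N + N * N \<le> a"
        by (cases a) (auto simp: not_less)
      then show thesis using that by blast
    qed
    then show ?thesis
    proof cases
      case 1
      then show ?thesis using Nv sm by (simp add: mem_def nth_apsp_input(1))
    next
      case (2 x)
      have "wt x < 2 ^ v" using wt_le[of x] small_bounds(5) by linarith
      then have "nat (take_bit v (apsp_input N edges iwt ! a)) = wt x"
        using 2 nth_apsp_input(2)[of x N edges iwt] sm by simp
      moreover have "mem ?X edges a = wt x" using 2 weighted_nodes[of x] by (auto simp: mem_def)
      ultimately show ?thesis using 2 by simp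
    next
      case 3
      define z where "z = a - 1 - N"
      have z: "a = 1 + N + z" "z < N * N" using 3 by (auto simp: z_def)
      have N0: "0 < N" using small_bounds(9) n by linarith
      define x y where "x = z div N" and "y = z mod N"
      have xy: "z = x * N + y" "y < N" "x < N"
        using z N0 by (auto simp: x_def y_def div_less_iff_less_mult)
      have "(\<exists>x' y'. (x', y') \<in> edges \<and> a = 1 + N + (x' * N + y')) \<longleftrightarrow> (x, y) \<in> edges"
      proof
        assume "\<exists>x' y'. (x', y') \<in> edges \<and> a = 1 + N + (x' * N + y')"
        then obtain x' y' where e: "(x', y') \<in> edges" "a = 1 + N + (x' * N + y')" by blast
        then have "y' < N" using undirected unfolding undirected_graph_def directed_graph_def by auto
        moreover have "x' * N + y' = x * N + y" using e z xy by simp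
        ultimately have "x' = x \<and> y' = y" using xy grid_index_inj by blast
        then show "(x, y) \<in> edges" using e by simp
      qed (use z xy in auto)
      moreover have "apsp_input N edges iwt ! a = of_bool ((x, y) \<in> edges)"
        using nth_apsp_input(3)[OF xy(3,2), of edges iwt] z xy by simp
      moreover have "nat (take_bit v 1) = 1" using sm[of 1] v0 by (simp add: one_less_power)
      ultimately show ?thesis using 3 by (simp add: mem_def)
    next
      case 4
      have "\<not> (\<exists>x' y'. (x', y') \<in> edges \<and> a = 1 + N + (x' * N + y'))"
      proof (intro notI, elim exE conjE)
        fix x' y' assume e: "(x', y') \<in> edges" "a = 1 + N + (x' * N + y')"
        then have "y' < N" "x' < N" using undirected unfolding undirected_graph_def directed_graph_def by auto
        then have "x' * N + y' < N * N" by (intro grid_index_less)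
        then show False using e 4 by simp
      qed
      moreover have "N < a" using 4 by linarith
      ultimately show ?thesis using 4 by (simp add: mem_def)
    qed
  qed
  finally show ?thesis by (simp add: initial_state_def length_apsp_input)
qed

lemma final_correct:
  "halted P final" "i < N * N \<Longrightarrow> decode v (memory final i) = apsp_output N edges iwt ! i"
  using solver[OF undirected wt_le no_negative_cycle] by blast+

text \<open>A word below \<open>2 ^ (v - 1)\<close> decodes to itself and is not the code of
  infinity, and a decoded number determines its word modulo \<open>2 ^ v\<close>. Raw words can
  therefore be compared with \<open>3 * M\<close>.\<close>

lemma decode_distance:
  assumes "i < n" "j < n" "memory final (i * N + (3 * n + j)) = x" "x < 2 ^ v"
  shows "x \<le> 3 * M \<Longrightarrow> distance edges iwt i (3 * n + j) = Some (int x)"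
    and "distance edges iwt i (3 * n + j) = Some (int y) \<Longrightarrow> y \<le> 3 * M \<Longrightarrow> x = y"
proof -
  have lt: "i < N" "3 * n + j < N" using assms small_bounds(9) by linarith+
  have "decode v x = distance edges iwt i (3 * n + j)"
    using final_correct(2)[OF grid_index_less[OF lt]] nth_apsp_output[OF lt] assms(3) by simp
  note d = this[unfolded decode_def]
  { assume "x \<le> 3 * M"
    then have x: "x < 2 ^ (v - 1)" using M3 by linarith
    have "- (2 ^ (v - 1)) \<le> (0::int)" by simp
    then have "- (2 ^ (v - 1)) \<le> int x" by (rule order_trans) simp
    moreover have "int x < 2 ^ (v - 1)" using x by simp
    ultimately have "signed_take_bit (v - 1) (int x) = int x" by (simp add: signed_take_bit_int_eq_self)
    then show "distance edges iwt i (3 * n + j) = Some (int x)" using d x by simp }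
  { assume y: "distance edges iwt i (3 * n + j) = Some (int y)" "y \<le> 3 * M"
    then have "signed_take_bit (v - 1) (int x) = int y" using d by (simp split: if_splits)
    then have "take_bit v (int y) = take_bit v (signed_take_bit (v - 1) (int x))" by simp
    also have "\<dots> = take_bit v (int x)" using v0 by (simp add: take_bit_signed_take_bit)
    finally have "take_bit v y = take_bit v x" by (metis of_nat_eq_iff of_nat_take_bit)
    moreover have "y < 2 ^ v" using y small_bounds(5) by linarith
    ultimately show "x = y" using assms(4) by (simp add: take_bit_nat_eq_self) }
qed

lemma read_back_correct:
  assumes env2: "env2 s0" and sums: "sums_ok s0"
    and cells: "\<And>a. a < Z \<Longrightarrow> snd s0 (9, cl, a, 0, 0) = memory final a \<and> snd s0 (9, cl, a, 0, 0) < 2 ^ v"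
  shows "wp read_back s0 (\<lambda>s t. t \<le> 7 * (n * n) + 4 * n + 2 \<and> sums_ok s \<and> below s s0 \<and>
    (\<forall>i<n. \<forall>j<n. \<forall>k<D. \<forall>u<m 0. \<forall>u'<m 1. link 0 i u k \<longrightarrow> link 1 j u' k \<longrightarrow>
       snd s (10, i, j, 0, 0) \<le> f 0 i k + f 1 j k))"
proof -
  define J where "J i j s \<longleftrightarrow> sums_ok s \<and> below s s0 \<and>
    (\<forall>i'<n. \<forall>j'<n. i' < i \<or> i' = i \<and> j' < j \<longrightarrow> (\<forall>k<D. \<forall>u<m 0. \<forall>u'<m 1. link 0 i' u k \<longrightarrow> link 1 j' u' k \<longrightarrow>
       snd s (10, i', j', 0, 0) \<le> f 0 i' k + f 1 j' k))" for i j and s :: store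
  have J_reg [simp]: "J i j (set_reg x a s) = J i j s" for i j x a s by (simp add: J_def)
  have Jn: "J i n s = J (Suc i) 0 s" for i s unfolding J_def by (auto simp: less_Suc_eq)
  have w: "n < 2 ^ w" using nZ lessW by blast
  show ?thesis unfolding read_back_def
  proof (rule wp_For[where N = n and I = "\<lambda>i. J i 0" and T = "\<lambda>_. 7 * n + 2" and X = "{15, 16, 30, 31}" and Y = "{10}"])
    show "J 0 0 (set_reg 15 0 s0)" using sums by (simp add: J_def below_def)
    fix i s assume ag: "agree {15, 16, 30, 31} {10} s0 s"
    have es: "env2 s" by (rule env2_agree[OF env2 ag]) auto
    then show "ok (Var 1) s \<and> ev (Var 1) s = n" by (simp add: env2_def env_def)
    assume i: "i < n" "fst s 15 = i" and J: "J i 0 s"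
    show "wp (For 16 (Var 1)
     (Assign 30 (Rd 9 (Var 24)
        (Plus (Times (Var 15) (Var 9)) (Plus (Times (Con 3) (Var 1)) (Var 16))) (Con 0) (Con 0)) ;;
      Branch (Lt (Times (Con 3) (Var 7)) (Var 30)) Skip
        (Assign 31 (Minus (Plus (Var 30) (Plus (yE 0 (Var 15) (Var 25)) (yE 0 (Var 26) (Var 16))))
           (Times (Con 3) (Var 7))) ;; improve 0 (Var 15) (Var 16) 31))) s
       (\<lambda>s' t. t \<le> 7 * n + 2 \<and> J (Suc i) 0 (set_reg 15 (Suc i) s'))"
    proof (rule wp_For[where N = n and I = "J i" and T = "\<lambda>_. 5" and X = "{16, 30, 31}" and Y = "{10}"])
      show "J i 0 (set_reg 16 0 s)" using J by simp
      fix j s' assume ag': "agree {16, 30, 31} {10} s s'"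
      have es': "env2 s'" by (rule env2_agree[OF es ag']) auto
      have e': "env s'" "fst s' 1 = n" "fst s' 7 = M" "fst s' 9 = N" "fst s' 24 = cl" "fst s' 25 = pv 0" "fst s' 26 = pv 1"
        using es' by (simp_all add: env2_def env_def)
      then show "ok (Var 1) s' \<and> ev (Var 1) s' = n" by simp
      have i': "fst s' 15 = i" using agree_reg[OF ag'] i by simp
      assume j: "j < n" "fst s' 16 = j" and J: "J i j s'"
      let ?a = "i * N + (3 * n + j)"
      have lt: "i < N" "3 * n + j < N" using i j small_bounds(9) by linarith+
      note cl' = cell_less[OF lt]
      have aZ: "?a < Z" "?a < 2 ^ w" "3 * n + j < 2 ^ w" "3 * n < 2 ^ w" "i * N < 2 ^ w"
        using cl' by linarith+
      define x where "x = memory final ?a"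
      have x: "snd s' (9, cl, ?a, 0, 0) = x" "x < 2 ^ v"
        using cells[OF aZ(1)] agree_cell[OF ag'] agree_cell[OF ag] by (simp_all add: x_def)
      have pvn: "pv 0 < n" "pv 1 < n" using pv_less by simp_all
      let ?y1 = "Y i (pv 0)" and ?y2 = "Y (pv 1) j"
      have y: "?y1 < Z" "?y2 < Z" using Y_less i j pvn by blast+
      have xZ: "x < Z" using x(2) v_Z by linarith
      have "x + (?y1 + ?y2) < 4 * Z" using xZ y by linarith
      also have "4 * Z \<le> Z * Z" using Z100 by (intro mult_right_mono; linarith)
      finally have big: "x + (?y1 + ?y2) < 2 ^ w" "?y1 + ?y2 < 2 ^ w" using Z_le by linarith+
      have M3w: "3 * M < 2 ^ w" using small_bounds(4) lessW(1) by blast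
      let ?s2 = "set_reg 30 x s'"
      let ?R = "Rd 9 (Var 24) (Plus (Times (Var 15) (Var 9)) (Plus (Times (Con 3) (Var 1)) (Var 16))) (Con 0) (Con 0)"
      have R: "ev ?R s' = x" "ok ?R s'" using x aZ e' i' j clZ Z9 by simp_all
      note dist = decode_distance[OF i(1) j(1) x_def[symmetric] x(2)]
      show "wp (Assign 30 ?R ;; Branch (Lt (Times (Con 3) (Var 7)) (Var 30)) Skip
        (Assign 31 (Minus (Plus (Var 30) (Plus (yE 0 (Var 15) (Var 25)) (yE 0 (Var 26) (Var 16))))
           (Times (Con 3) (Var 7))) ;; improve 0 (Var 15) (Var 16) 31)) s'
         (\<lambda>s' t. t \<le> 5 \<and> J i (Suc j) (set_reg 16 (Suc j) s'))"
      proof (rule wp_Seq, rule wp_Assign[OF R(2)], unfold R(1), rule wp_Branch)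
        show "ok_cond (Lt (Times (Con 3) (Var 7)) (Var 30)) ?s2" using e' M3w by simp
        assume "ev_cond (Lt (Times (Con 3) (Var 7)) (Var 30)) ?s2"
        then have far: "3 * M < x" using e' by simp
        \<comment> \<open>Two links at a common \<open>k\<close> would give a distance of at most
          \<open>3 * M\<close>, which would then be the stored word.\<close>
        have "\<not> (link 0 i u k \<and> link 1 j u' k)" if h: "k < D" "u < m 0" "u' < m 1" for k u u'
        proof
          assume l: "link 0 i u k \<and> link 1 j u' k"
          obtain y where "distance edges iwt i (3 * n + j) = Some (int y)" "y + val 0 u + val 1 u' \<le> 3 * M"
            using distance_upper[of i u k j u'] l h i j by blast
          then show False using dist(2)[of y] far by simp
        qed
        then have "J i (Suc j) s'" using J unfolding J_def by (auto simp: less_Suc_eq)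
        then show "wp Skip ?s2 (\<lambda>s t. 1 + (t + 1) \<le> 5 \<and> J i (Suc j) (set_reg 16 (Suc j) s))"
          by (intro wp_Skip) simp
      next
        assume "\<not> ev_cond (Lt (Times (Con 3) (Var 7)) (Var 30)) ?s2"
        then have near: "x \<le> 3 * M" using e' by simp
        obtain k u u' where h: "k < D" "u < m 0" "u' < m 1" "link 0 i u k" "link 1 j u' k"
          "x + val 0 u + val 1 u' = 3 * M"
          using distance_lower[OF dist(1)[OF near] near i(1) j(1)] by blast
        have lk: "f 0 i k + val 0 u = ?y1" "f 1 j k + val 1 u' = ?y2" if "link 0 i u k" "link 1 j u' k" for k u u'
          using that by (simp_all add: link ys_def)
        let ?z = "x + (?y1 + ?y2) - 3 * M"
        \<comment> \<open>The witnesses satisfy \<open>x + val 0 u + val 1 u' = 3 * M\<close>, and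
          the links express the targets at the pivots as entry plus value; the values
          cancel.\<close>
        have z: "?z = f 0 i k + f 1 j k" "3 * M \<le> x + (?y1 + ?y2)" using lk[OF h(4,5)] h(6) by linarith+
        let ?E = "Minus (Plus (Var 30) (Plus (yE 0 (Var 15) (Var 25)) (yE 0 (Var 26) (Var 16)))) (Times (Con 3) (Var 7))"
        have E: "ev ?E ?s2 = ?z" "ok ?E ?s2"
          using e' i' i j pvn z(2) big M3w by (simp_all add: ys_def)
        let ?s3 = "set_reg 31 ?z ?s2"
        have so: "sums_ok (set_cell (cur_index 0 i j) (min (snd ?s3 (cur_index 0 i j)) ?z) ?s3)"
          by (rule sums_ok_improve[OF _ _ i(1) j(1) h(1)]) (use J z in \<open>auto simp: J_def\<close>)
        have be: "below (set_cell (cur_index 0 i j) (min (snd ?s3 (cur_index 0 i j)) ?z) ?s3) s0"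
          by (rule below_improve) (use J in \<open>simp add: J_def\<close>)
        \<comment> \<open>The distance minimises over all positions with links on both sides, so
          this one candidate settles all of them.\<close>
        have opt: "?z \<le> f 0 i k' + f 1 j k'" if h': "k' < D" "u1 < m 0" "u2 < m 1" "link 0 i u1 k'" "link 1 j u2 k'" for k' u1 u2
        proof -
          obtain y where y: "distance edges iwt i (3 * n + j) = Some (int y)" "y + val 0 u1 + val 1 u2 \<le> 3 * M"
            using distance_upper[of i u1 k' j u2] h' i j by blast
          then have "x = y" using dist(2)[of y] by simp
          then show ?thesis using y(2) lk[OF h'(4,5)] z by linarith
        qed
        have "J i (Suc j) (set_cell (cur_index 0 i j) (min (snd ?s3 (cur_index 0 i j)) ?z) ?s3)"
        proof -
          have "snd (set_cell (cur_index 0 i j) (min (snd ?s3 (cur_index 0 i j)) ?z) ?s3) (10, i', j', 0, 0) \<le> f 0 i' k' + f 1 j' k'"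
            if q: "i' < n" "j' < n" "i' < i \<or> i' = i \<and> j' < Suc j" "k' < D" "u1 < m 0" "u2 < m 1" "link 0 i' u1 k'" "link 1 j' u2 k'"
            for i' j' k' u1 u2
          proof (cases "i' = i \<and> j' = j")
            case True
            then show ?thesis using opt[of k' u1 u2] q by (auto simp: cur_index_def)
          next
            case False
            then have "i' < i \<or> i' = i \<and> j' < j" using q by auto
            then have "snd s' (10, i', j', 0, 0) \<le> f 0 i' k' + f 1 j' k'" using J q unfolding J_def by blast
            then show ?thesis using False by (auto simp: cur_index_def)
          qed
          then show ?thesis using so be unfolding J_def by blast
        qed
        then have "J i (Suc j) (set_cell (cur_index 0 i j) (min (snd ?s3 (cur_index 0 i j)) (fst ?s3 31)) ?s3)" by simp
        then have imp: "wp (improve 0 (Var 15) (Var 16) 31) ?s3 (\<lambda>s t. t \<le> 2 \<and> J i (Suc j) s)"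
          by (intro wp_improve[where i = i and j = j]) (use i' j i nZ in auto)
        show "wp (Assign 31 ?E ;; improve 0 (Var 15) (Var 16) 31) ?s2
           (\<lambda>s t. 1 + (t + 1) \<le> 5 \<and> J i (Suc j) (set_reg 16 (Suc j) s))"
          by (rule wp_Seq, rule wp_Assign[OF E(2)], unfold E(1), rule wp_conseq[OF imp]) simp
      qed
    qed (use w Jn in \<open>auto\<close>)
  next
    fix s t assume "J n 0 s" "t \<le> (\<Sum>i<n. 7 * n + 2 + 2) + 2"
    then show "t \<le> 7 * (n * n) + 4 * n + 2 \<and> sums_ok s \<and> below s s0 \<and>
     (\<forall>i<n. \<forall>j<n. \<forall>k<D. \<forall>u<m 0. \<forall>u'<m 1. link 0 i u k \<longrightarrow> link 1 j u' k \<longrightarrow>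
       snd s (10, i, j, 0, 0) \<le> f 0 i k + f 1 j k)"
      by (simp add: J_def algebra_simps)
  qed (use w in auto)
qed

end

section \<open>A whole phase: tables, passes and all calls\<close>

definition call_time :: "nat \<Rightarrow> nat \<Rightarrow> instr list \<Rightarrow> nat \<Rightarrow> nat" where
  "call_time n mr P TT = 41 * (n * n) + 48 * n + 40 + mr + TT * (length P + 3)"

definition phase_time :: "nat \<Rightarrow> nat \<Rightarrow> nat \<Rightarrow> nat \<Rightarrow> nat \<Rightarrow> instr list \<Rightarrow> nat \<Rightarrow> nat" where
  "phase_time n D g d mr P TT =
     2 * (n * (D * 10 + 4) + 2) + 2 * (n * (n * (14 * d + 10) + 6 * (n * D div g) + 12) + 4) +
     (g * (g * (call_time n mr P TT + 2) + 4) + 2)"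

definition phase_com :: "nat \<Rightarrow> instr list \<Rightarrow> com" where
  "phase_com mr P = build 0 ;; build 1 ;; pass 0 ;; pass 1 ;;
     For 27 (Rd 8 (psE 0) (Con 0) (Con 0) (Con 0))
       (For 28 (Rd 8 (psE 1) (Con 0) (Con 0) (Con 0)) (call_com mr P))"

lemma modified_call_com:
  "modified (call_com mr P) \<subseteq> {15, 16, 17, 18, 19, 20, 24, 25, 26, 29, 30, 31} \<union> {40..}"
  using modified_sim[of mr P] by (auto simp: call_com_def)

lemma written_call_com: "written (call_com mr P) \<subseteq> {9, 10}"
  using written_sim[of mr P] by (auto simp: call_com_def)

lemma modified_phase_com:
  "modified (phase_com mr P) \<subseteq> {15..32} \<union> {40..}"
  using modified_call_com[of mr P] by (auto simp: phase_com_def)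

lemma written_phase_com: "written (phase_com mr P) \<subseteq> {2, 3, 4, 5, 7, 8, 9, 10}"
  using written_call_com[of mr P] by (auto simp: phase_com_def)

context phase begin

lemma sums_ok_agree: "sums_ok s \<Longrightarrow> agree X W s s' \<Longrightarrow> 10 \<notin> W \<Longrightarrow> sums_ok s'"
  by (simp add: sums_ok_def agree_cell)

lemma below_agree: "below s s0 \<Longrightarrow> agree X W s s' \<Longrightarrow> 10 \<notin> W \<Longrightarrow> below s' s0"
  by (simp add: below_def agree_cell)

lemma below_trans: "below s s1 \<Longrightarrow> below s1 s0 \<Longrightarrow> below s s0"
  unfolding below_def using order_trans by blast

end

context call begin

lemma call_com_correct:
  assumes env: "env s0" and regs: "fst s0 7 = M" "fst s0 8 = mask v" "fst s0 9 = N" "fst s0 24 = cl"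
    and q: "fst s0 27 = qa" "qa < Z" "fst s0 28 = qb" "qb < Z"
      "snd s0 (7, 2 * ph, qa, 0, 0) = pv 0" "snd s0 (7, 2 * ph + 1, qb, 0, 0) = pv 1"
    and tabs: "\<And>\<sigma>. \<sigma> < 2 \<Longrightarrow> snd s0 (5, 2 * ph + opp \<sigma>, pv \<sigma>, 0, 0) = m \<sigma>"
      "\<And>\<sigma> u. \<sigma> < 2 \<Longrightarrow> u < m \<sigma> \<Longrightarrow> snd s0 (4, 2 * ph + opp \<sigma>, pv \<sigma>, u, 0) = val \<sigma> u"
    and fresh: "\<And>r. snd s0 (9, cl, r) = 0" and sums: "sums_ok s0"
  shows "wp (call_com mr P) s0 (\<lambda>s t. t \<le> 41 * (n * n) + 48 * n + 40 + mr + TT * (length P + 3) \<and>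
     fst s 24 = Suc cl \<and> sums_ok s \<and> below s s0 \<and>
    (\<forall>i<n. \<forall>j<n. \<forall>k<D. \<forall>u<m 0. \<forall>u'<m 1. link 0 i u k \<longrightarrow> link 1 j u' k \<longrightarrow>
       snd s (10, i, j, 0, 0) \<le> f 0 i k + f 1 j k) \<and>
    (\<forall>c r. c \<noteq> cl \<longrightarrow> snd s (9, c, r) = snd s0 (9, c, r)))"
proof -
  let ?s3 = "set_cell (9, cl, 0, 0, 0) N (set_reg 26 (pv 1) (set_reg 25 (pv 0) s0))"
  let ?Q = "\<lambda>s t. t \<le> 41 * (n * n) + 48 * n + 40 + mr + TT * (length P + 3) \<and>
     fst s 24 = Suc cl \<and> sums_ok s \<and> below s s0 \<and>
    (\<forall>i<n. \<forall>j<n. \<forall>k<D. \<forall>u<m 0. \<forall>u'<m 1. link 0 i u k \<longrightarrow> link 1 j u' k \<longrightarrow>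
       snd s (10, i, j, 0, 0) \<le> f 0 i k + f 1 j k) \<and>
    (\<forall>c r. c \<noteq> cl \<longrightarrow> snd s (9, c, r) = snd s0 (9, c, r))"
  have e3: "env2 ?s3" using env regs tabs by (simp add: env2_def)
  have r3: "region (snd s0) {} {} ?s3" using fresh by (simp add: region_def mem_def)
  have so3: "sums_ok ?s3" "below ?s3 s0" using sums by (simp_all add: sums_ok_def below_def)
  have cl1: "Suc cl < 2 ^ w" using clZ lessW(3)[of cl 1] by simp
  have rest: "wp (half_graph 0 ;; half_graph 1 ;; middle_graph ;; sim mr P ;; read_back ;;
     Assign 24 (Plus (Var 24) (Con 1))) ?s3 (\<lambda>s t. ?Q s (1 + (1 + (1 + t))))"
  proof (rule wp_Seq, rule wp_conseq[OF half_graph_correct[OF e3 _ r3]], simp)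
    fix s4 t4 assume ag4: "agree (modified (half_graph 0)) (written (half_graph 0)) ?s3 s4"
      and h4: "t4 \<le> 13 * (n * n) + 20 * n + 10 \<and>
        region (snd s0) ({} \<union> outers 0 \<union> inners 0) ({} \<union> half_arcs 0 \<union> (half_arcs 0)\<inverse>) s4"
    have e4: "env2 s4" by (rule env2_agree[OF e3 ag4]) auto
    note so4 = sums_ok_agree[OF so3(1) ag4, simplified] below_agree[OF so3(2) ag4, simplified]
    show "wp (half_graph 1 ;; middle_graph ;; sim mr P ;; read_back ;;
       Assign 24 (Plus (Var 24) (Con 1))) s4 (\<lambda>s t. ?Q s (1 + (1 + (1 + (t4 + t)))))"
    proof (rule wp_Seq, rule wp_conseq[OF half_graph_correct[OF e4 _ conjunct2[OF h4]]], simp)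
      fix s5 t5 assume ag5: "agree (modified (half_graph 1)) (written (half_graph 1)) s4 s5"
        and h5: "t5 \<le> 13 * (n * n) + 20 * n + 10 \<and>
        region (snd s0) ({} \<union> outers 0 \<union> inners 0 \<union> outers 1 \<union> inners 1)
          ({} \<union> half_arcs 0 \<union> (half_arcs 0)\<inverse> \<union> half_arcs 1 \<union> (half_arcs 1)\<inverse>) s5"
      have e5: "env2 s5" by (rule env2_agree[OF e4 ag5]) auto
      note so5 = sums_ok_agree[OF so4(1) ag5, simplified] below_agree[OF so4(2) ag5, simplified]
      show "wp (middle_graph ;; sim mr P ;; read_back ;;
         Assign 24 (Plus (Var 24) (Con 1))) s5 (\<lambda>s t. ?Q s (1 + (1 + (1 + (t4 + (t5 + t))))))"
      proof (rule wp_Seq, rule wp_conseq[OF middle_graph_correct[OF e5 conjunct2[OF h5]]])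
        fix s6 t6 assume ag6: "agree (modified middle_graph) (written middle_graph) s5 s6"
          and h6: "t6 \<le> 8 * (n * n) + 4 * n + 2 \<and>
            region (snd s0) ({} \<union> outers 0 \<union> inners 0 \<union> outers 1 \<union> inners 1)
             ({} \<union> half_arcs 0 \<union> (half_arcs 0)\<inverse> \<union> half_arcs 1 \<union> (half_arcs 1)\<inverse> \<union> middle \<union> middle\<inverse>) s6"
        have e6: "env2 s6" by (rule env2_agree[OF e5 ag6]) auto
        note so6 = sums_ok_agree[OF so5(1) ag6, simplified] below_agree[OF so5(2) ag6, simplified]
        have reg6: "region (snd s0) (outers 0 \<union> inners 0 \<union> outers 1 \<union> inners 1) edges s6"
          using conjunct2[OF h6] unfolding Un_empty_left edges_half .
        have r6: "fst s6 8 = mask v" "fst s6 24 = cl" using e6 by (simp_all add: env2_def)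
        show "wp (sim mr P ;; read_back ;; Assign 24 (Plus (Var 24) (Con 1))) s6
           (\<lambda>s t. ?Q s (1 + (1 + (1 + (t4 + (t5 + (t6 + t)))))))"
        proof (rule wp_Seq, rule wp_conseq[OF sim_correct[OF input_region[OF reg6] r6 clZ final_correct(1)]], elim conjE)
          fix s7 t7 assume ag7': "agree (modified (sim mr P)) (written (sim mr P)) s6 s7"
            and t7: "t7 \<le> mr + 3 + TT * (length P + 3)"
            and c7: "\<forall>a<Z. snd s7 (9, cl, a, 0, 0) = memory final a \<and> snd s7 (9, cl, a, 0, 0) < 2 ^ v"
            and o7: "\<forall>c i. c \<noteq> cl \<longrightarrow> snd s7 (9, c, i) = snd s6 (9, c, i)"
          have ag7: "agree {40..} {9} s6 s7" by (rule agree_mono[OF ag7' modified_sim written_sim])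
          have e7: "env2 s7" by (rule env2_agree[OF e6 ag7]) auto
          note so7 = sums_ok_agree[OF so6(1) ag7, simplified] below_agree[OF so6(2) ag7, simplified]
          show "wp (read_back ;; Assign 24 (Plus (Var 24) (Con 1))) s7
             (\<lambda>s t. ?Q s (1 + (1 + (1 + (t4 + (t5 + (t6 + (t7 + t))))))))"
          proof (rule wp_Seq, rule wp_conseq[OF read_back_correct[OF e7 so7(1)]])
            show "snd s7 (9, cl, a, 0, 0) = memory final a \<and> snd s7 (9, cl, a, 0, 0) < 2 ^ v" if "a < Z" for a
              using c7 that by blast
            fix s8 t8 assume ag8: "agree (modified read_back) (written read_back) s7 s8"
              and h8: "t8 \<le> 7 * (n * n) + 4 * n + 2 \<and> sums_ok s8 \<and> below s8 s7 \<and>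
                (\<forall>i<n. \<forall>j<n. \<forall>k<D. \<forall>u<m 0. \<forall>u'<m 1. link 0 i u k \<longrightarrow> link 1 j u' k \<longrightarrow>
                   snd s8 (10, i, j, 0, 0) \<le> f 0 i k + f 1 j k)"
            have r8: "fst s8 24 = cl" using agree_reg[OF ag8, of 24] e7 by (simp add: env2_def)
            have b8: "below s8 s0" using h8 so7 below_trans by blast
            have o8: "snd s8 (9, c, r) = snd s0 (9, c, r)" if "c \<noteq> cl" for c r
              using agree_cell[OF ag8, of 9] o7 reg6 that by (simp add: region_def)
            have t: "1 + (1 + (1 + (t4 + (t5 + (t6 + (t7 + (t8 + 1))))))) \<le> 41 * (n * n) + 48 * n + 40 + mr + TT * (length P + 3)"
              using h4 h5 h6 t7 h8 by linarith
            show "wp (Assign 24 (Plus (Var 24) (Con 1))) s8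
               (\<lambda>s t. ?Q s (1 + (1 + (1 + (t4 + (t5 + (t6 + (t7 + (t8 + t)))))))))"
            proof (rule wp_Assign)
              show "ok (Plus (Var 24) (Con 1)) s8" using r8 cl1 by simp
              show "?Q (set_reg 24 (ev (Plus (Var 24) (Con 1)) s8) s8) (1 + (1 + (1 + (t4 + (t5 + (t6 + (t7 + (t8 + 1))))))))"
                using t h8 b8 o8 r8 by simp
            qed
          qed
        qed
      qed
    qed
  qed
  have e25: "ev (Rd 7 (psE 0) (Var 27) (Con 0) (Con 0)) s0 = pv 0" "ok (Rd 7 (psE 0) (Var 27) (Con 0) (Con 0)) s0"
    using env q phZ by simp_all
  let ?s1 = "set_reg 25 (pv 0) s0"
  have e26: "ev (Rd 7 (psE 1) (Var 28) (Con 0) (Con 0)) ?s1 = pv 1" "ok (Rd 7 (psE 1) (Var 28) (Con 0) (Con 0)) ?s1"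
    using env q phZ by simp_all
  let ?s2 = "set_reg 26 (pv 1) ?s1"
  have e9: "ok (Rd 9 (Var 24) (Con 0) (Con 0) (Con 0)) ?s2" using regs clZ Z9 by simp
  have st: "set_cell (9, ev (Var 24) ?s2, ev (Con 0) ?s2, ev (Con 0) ?s2, ev (Con 0) ?s2) (ev (Var 9) ?s2) ?s2 = ?s3"
    using regs by simp
  show ?thesis unfolding call_com_def
    by (rule wp_Seq, rule wp_Assign[OF e25(2)], unfold e25(1), rule wp_Seq, rule wp_Assign[OF e26(2)], unfold e26(1),
        rule wp_Seq, rule wp_Write[OF e9], simp, unfold st, rule rest)
qed

end

locale phase_calls = phase + simulator w Z v mr P for v mr P +
  fixes V M N TT cl0 :: nat
  assumes dD: "d * D \<le> n" and f_le: "\<And>\<sigma> i k. \<sigma> < 2 \<Longrightarrow> i < n \<Longrightarrow> k < D \<Longrightarrow> f \<sigma> i k \<le> V"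
    and VM: "4 * V < M" and nN: "4 * n \<le> N" and cl0: "cl0 + g * g < Z"
    and M3: "3 * M < 2 ^ (v - 1)" and NZ: "1 + N + N * N < Z" and Nv: "N < 2 ^ v" and v0: "0 < v"
    and solver: "\<And>E wt. undirected_graph N E \<Longrightarrow> (\<And>x. wt x \<le> M) \<Longrightarrow> no_negative_cycle E (\<lambda>x. int (wt x)) \<Longrightarrow>
       halted P ((step v P ^^ TT) (initial_state v (apsp_input N E (\<lambda>x. int (wt x))))) \<and>
       (\<forall>i<N * N. decode v (memory ((step v P ^^ TT) (initial_state v (apsp_input N E (\<lambda>x. int (wt x))))) i) =
          apsp_output N E (\<lambda>x. int (wt x)) ! i)"
begin

text \<open>What the call for the pivots \<open>r1\<close> and \<open>r2\<close> achieves. The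
  premises say that the entry \<open>f 0 i k\<close> is covered by \<open>r1\<close> and
  \<open>f 1 j k\<close> by \<open>r2\<close>; the bound is the sum itself, whatever the target
  \<open>Y i j\<close> is.\<close>

definition settled :: "nat \<Rightarrow> nat \<Rightarrow> store \<Rightarrow> bool" where
  "settled r1 r2 s \<longleftrightarrow> (\<forall>i<n. \<forall>j<n. \<forall>k<D. \<forall>b\<in>f 1 r1 ` {..<D}. \<forall>b'\<in>f 0 r2 ` {..<D}.
     f 0 i k + b = Y i r1 \<longrightarrow> f 1 j k + b' = Y r2 j \<longrightarrow> snd s (10, i, j, 0, 0) \<le> f 0 i k + f 1 j k)"

lemma settled_below: "settled r1 r2 s \<Longrightarrow> below s' s \<Longrightarrow> settled r1 r2 s'"
  unfolding settled_def below_def by (meson order_trans)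

lemma one_call:
  assumes env: "env s0" and regs: "fst s0 7 = M" "fst s0 8 = mask v" "fst s0 9 = N" "fst s0 24 = cl" "cl < Z"
    and q: "fst s0 27 = qa" "qa < Z" "fst s0 28 = qb" "qb < Z"
      "snd s0 (7, 2 * ph, qa, 0, 0) = r1" "snd s0 (7, 2 * ph + 1, qb, 0, 0) = r2" "r1 < n" "r2 < n"
    and vals: "vals_ok 0 s0" "vals_ok 1 s0"
    and fresh: "\<And>r. snd s0 (9, cl, r) = 0" and sums: "sums_ok s0"
  shows "wp (call_com mr P) s0 (\<lambda>s t. t \<le> call_time n mr P TT \<and>
     fst s 24 = Suc cl \<and> sums_ok s \<and> below s s0 \<and> settled r1 r2 s \<and>
    (\<forall>c r. c \<noteq> cl \<longrightarrow> snd s (9, c, r) = snd s0 (9, c, r)))"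
proof -
  define pv where "pv \<sigma> = (if \<sigma> = 0 then r1 else r2)" for \<sigma> :: nat
  define mm where "mm \<sigma> = card (f (opp \<sigma>) (pv \<sigma>) ` {..<D})" for \<sigma>
  define vl where "vl \<sigma> u = snd s0 (4, 2 * ph + opp \<sigma>, pv \<sigma>, u, 0)" for \<sigma> u
  define lk where "lk \<sigma> i u k \<longleftrightarrow> f \<sigma> i k + vl \<sigma> u = ys \<sigma> i (pv \<sigma>)" for \<sigma> i u k
  have pvn: "pv \<sigma> < n" for \<sigma> using q by (simp add: pv_def)
  have vals': "vals_ok (opp \<sigma>) s0" for \<sigma> using vals by (simp add: opp_def)
  have tb: "snd s0 (5, 2 * ph + opp \<sigma>, pv \<sigma>, 0, 0) = mm \<sigma>" "vl \<sigma> ` {..<mm \<sigma>} = f (opp \<sigma>) (pv \<sigma>) ` {..<D}" for \<sigma>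
    using vals'[of \<sigma>] pvn[of \<sigma>] by (auto simp: vals_ok_def mm_def vl_def)
  have md: "mm \<sigma> * D \<le> n" for \<sigma>
  proof -
    \<comment> \<open>The row weight bounds the number of values of the pivot, and
      \<open>d * D \<le> n\<close> makes the nodes of an inner layer fit into its block.\<close>
    have "mm \<sigma> \<le> d" using card_f[OF _ pvn[of \<sigma>], of "opp \<sigma>"] by (simp add: mm_def)
    then have "mm \<sigma> * D \<le> d * D" by simp
    then show ?thesis using dD by linarith
  qed
  have vV: "vl \<sigma> u \<le> V" if "u < mm \<sigma>" for \<sigma> u
  proof -
    have "vl \<sigma> u \<in> f (opp \<sigma>) (pv \<sigma>) ` {..<D}" using tb(2)[of \<sigma>] that by blast
    then show ?thesis using f_le[of "opp \<sigma>" "pv \<sigma>"] pvn by auto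
  qed
  interpret C: call w Z n D g d ph sh t f Y v mr P V M N mm vl lk cl TT pv
    by unfold_locales
      (use n0 D0 md vV VM nN regs pvn M3 NZ Nv v0 solver card_f_D in \<open>auto simp: lk_def mm_def\<close>)
  have "wp (call_com mr P) s0 (\<lambda>s t. t \<le> 41 * (n * n) + 48 * n + 40 + mr + TT * (length P + 3) \<and>
     fst s 24 = Suc cl \<and> sums_ok s \<and> below s s0 \<and>
    (\<forall>i<n. \<forall>j<n. \<forall>k<D. \<forall>u<mm 0. \<forall>u'<mm 1. lk 0 i u k \<longrightarrow> lk 1 j u' k \<longrightarrow>
       snd s (10, i, j, 0, 0) \<le> f 0 i k + f 1 j k) \<and>
    (\<forall>c r. c \<noteq> cl \<longrightarrow> snd s (9, c, r) = snd s0 (9, c, r)))"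
    by (rule C.call_com_correct[OF env regs(1-4) q(1-4)])
      (use q tb fresh sums in \<open>auto simp: pv_def vl_def\<close>)
  then show ?thesis
  proof (rule wp_conseq, elim conjE, intro conjI)
    fix s :: store and t :: nat assume c: "\<forall>i<n. \<forall>j<n. \<forall>k<D. \<forall>u<mm 0. \<forall>u'<mm 1. lk 0 i u k \<longrightarrow> lk 1 j u' k \<longrightarrow>
       snd s (10, i, j, 0, 0) \<le> f 0 i k + f 1 j k"
    show "settled r1 r2 s" unfolding settled_def
    proof (intro allI impI ballI)
      fix i j k b b' assume h: "i < n" "j < n" "k < D" "b \<in> f 1 r1 ` {..<D}" "b' \<in> f 0 r2 ` {..<D}"
        "f 0 i k + b = Y i r1" "f 1 j k + b' = Y r2 j"
      have "b \<in> vl 0 ` {..<mm 0}" "b' \<in> vl 1 ` {..<mm 1}" using h tb(2)[of 0] tb(2)[of 1] by (auto simp: pv_def)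
      then obtain u u' where "u < mm 0" "b = vl 0 u" "u' < mm 1" "b' = vl 1 u'" by auto
      moreover from this have "lk 0 i u k" "lk 1 j u' k" using h by (auto simp: lk_def ys_def pv_def)
      ultimately show "snd s (10, i, j, 0, 0) \<le> f 0 i k + f 1 j k" using c h by blast
    qed
  qed (auto simp: call_time_def)
qed

text \<open>Register 24 counts the calls and selects the row of array 9; the rows from there on are
  still zero, as the input of the next call requires. Results of earlier calls persist because
  stored sums only decrease.\<close>

lemma calls_correct:
  assumes env: "env s4" and regs: "fst s4 7 = M" "fst s4 8 = mask v" "fst s4 9 = N" "fst s4 24 = cl0"
    and np: "snd s4 (8, 2 * ph, 0, 0, 0) = np1" "np1 \<le> g" "snd s4 (8, 2 * ph + 1, 0, 0, 0) = np2" "np2 \<le> g"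
      "\<And>q. q < np1 \<Longrightarrow> snd s4 (7, 2 * ph, q, 0, 0) < n" "\<And>q. q < np2 \<Longrightarrow> snd s4 (7, 2 * ph + 1, q, 0, 0) < n"
    and vals: "vals_ok 0 s4" "vals_ok 1 s4"
    and fresh: "\<And>c r. cl0 \<le> c \<Longrightarrow> snd s4 (9, c, r) = 0" and sums: "sums_ok s4"
  shows "wp (For 27 (Rd 8 (psE 0) (Con 0) (Con 0) (Con 0))
       (For 28 (Rd 8 (psE 1) (Con 0) (Con 0) (Con 0)) (call_com mr P))) s4
     (\<lambda>s t. t \<le> g * (g * (call_time n mr P TT + 2) + 4) + 2 \<and> sums_ok s \<and> below s s4 \<and>
       (\<forall>q<np1. \<forall>q'<np2. settled (snd s4 (7, 2 * ph, q, 0, 0)) (snd s4 (7, 2 * ph + 1, q', 0, 0)) s) \<and>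
       fst s 24 \<le> cl0 + g * g \<and> (\<forall>c r. fst s 24 \<le> c \<longrightarrow> snd s (9, c, r) = 0))"
proof -
  let ?p1 = "\<lambda>q. snd s4 (7, 2 * ph, q, 0, 0)" and ?p2 = "\<lambda>q. snd s4 (7, 2 * ph + 1, q, 0, 0)"
  define I where "I qa qb s \<longleftrightarrow> fst s 24 = cl0 + (qa * np2 + qb) \<and> (\<forall>c r. fst s 24 \<le> c \<longrightarrow> snd s (9, c, r) = 0) \<and>
     sums_ok s \<and> below s s4 \<and>
     (\<forall>q<np1. \<forall>q'<np2. q < qa \<or> q = qa \<and> q' < qb \<longrightarrow> settled (?p1 q) (?p2 q') s)" for qa qb and s :: store
  have settled_reg [simp]: "settled r r' (set_reg x a s) = settled r r' s" for r r' x a s by (simp add: settled_def)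
  have I_reg [simp]: "I qa qb (set_reg x a s) = I qa qb s" if "x \<noteq> 24" for qa qb x a s
    using that by (simp add: I_def)
  have I_next: "I qa np2 s \<Longrightarrow> I (Suc qa) 0 s" for qa s unfolding I_def by (auto simp: less_Suc_eq)
  let ?X = "{15, 16, 17, 18, 19, 20, 24, 25, 26, 27, 28, 29, 30, 31} \<union> {40..}"
  have w: "np1 < 2 ^ w" "np2 < 2 ^ w" "np1 < Z" "np2 < Z"
    using np gZ lessW(1)[of np1] lessW(1)[of np2] by linarith+
  have mc: "modified (call_com mr P) \<subseteq> ?X" "28 \<notin> modified (call_com mr P)" "27 \<notin> modified (call_com mr P)"
    using modified_call_com[of mr P] by auto
  have facts: "env s" "fst s 7 = M" "fst s 8 = mask v" "fst s 9 = N" "vals_ok 0 s" "vals_ok 1 s"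
      "\<And>r. snd s (7, r) = snd s4 (7, r)" "\<And>r. snd s (8, r) = snd s4 (8, r)"
    if ag: "agree ?X {9, 10} s4 s" for s
  proof -
    show "env s" by (rule env_agree[OF env ag]) auto
    show "fst s 7 = M" "fst s 8 = mask v" "fst s 9 = N" using agree_reg[OF ag] regs by simp_all
    show "vals_ok 0 s" "vals_ok 1 s" using vals_ok_agree[OF _ ag] vals by auto
    show "snd s (7, r) = snd s4 (7, r)" "snd s (8, r) = snd s4 (8, r)" for r using agree_cell[OF ag] by simp_all
  qed
  show ?thesis
  proof (rule wp_For[where N = np1 and I = "\<lambda>qa. I qa 0" and T = "\<lambda>_. g * (call_time n mr P TT + 2) + 2" and X = ?X and Y = "{9, 10}"])
    show "I 0 0 (set_reg 27 0 s4)" using regs fresh sums by (simp add: I_def below_def)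
    fix qa s assume ag: "agree ?X {9, 10} s4 s"
    note F = facts[OF ag]
    show "ok (Rd 8 (psE 0) (Con 0) (Con 0) (Con 0)) s \<and> ev (Rd 8 (psE 0) (Con 0) (Con 0) (Con 0)) s = np1"
      using F np phZ by simp
    assume qa: "qa < np1" "fst s 27 = qa" and Is: "I qa 0 s"
    show "wp (For 28 (Rd 8 (psE 1) (Con 0) (Con 0) (Con 0)) (call_com mr P)) s
       (\<lambda>s' t. t \<le> g * (call_time n mr P TT + 2) + 2 \<and> I (Suc qa) 0 (set_reg 27 (Suc qa) s'))"
    proof (rule wp_For[where N = np2 and I = "I qa" and T = "\<lambda>_. call_time n mr P TT" and X = "?X - {27}" and Y = "{9, 10}"])
      show "I qa 0 (set_reg 28 0 s)" using Is by simp
      fix qb s' assume ag': "agree (?X - {27}) {9, 10} s s'"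
      have ag2: "agree ?X {9, 10} s4 s'" by (rule agree_mono[OF agree_trans[OF ag ag']]) auto
      note F = facts[OF ag2]
      show "ok (Rd 8 (psE 1) (Con 0) (Con 0) (Con 0)) s' \<and> ev (Rd 8 (psE 1) (Con 0) (Con 0) (Con 0)) s' = np2"
        using F np phZ by simp
      have qa': "fst s' 27 = qa" using agree_reg[OF ag'] qa by simp
      assume qb: "qb < np2" "fst s' 28 = qb" and I: "I qa qb s'"
      define cl where "cl = fst s' 24"
      have cl: "cl = cl0 + (qa * np2 + qb)" "\<And>c r. cl \<le> c \<Longrightarrow> snd s' (9, c, r) = 0" using I by (auto simp: I_def cl_def)
      have "qa * np2 + qb < np1 * np2" using qa qb by (intro grid_index_less)
      also have "\<dots> \<le> g * g" using np by (intro mult_mono) auto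
      finally have clZ: "cl < Z" using cl cl0 by linarith
      have ol: "wp (call_com mr P) s' (\<lambda>s t. t \<le> call_time n mr P TT \<and> fst s 24 = Suc cl \<and> sums_ok s \<and> below s s' \<and>
        settled (?p1 qa) (?p2 qb) s \<and> (\<forall>c r. c \<noteq> cl \<longrightarrow> snd s (9, c, r) = snd s' (9, c, r)))"
        by (rule one_call[OF F(1-4) cl_def[symmetric] clZ qa' _ qb(2)])
          (use w qa qb F np cl I in \<open>auto simp: I_def\<close>)
      show "wp (call_com mr P) s' (\<lambda>s' t. t \<le> call_time n mr P TT \<and> I qa (Suc qb) (set_reg 28 (Suc qb) s'))"
      proof (rule wp_conseq[OF ol], elim conjE, intro conjI)
        fix s5 t5 assume h: "fst s5 24 = Suc cl" "sums_ok s5" "below s5 s'" "settled (?p1 qa) (?p2 qb) s5"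
          "\<forall>c r. c \<noteq> cl \<longrightarrow> snd s5 (9, c, r) = snd s' (9, c, r)"
        have "below s5 s4" using h(3) I below_trans unfolding I_def by blast
        moreover have "settled (?p1 q) (?p2 q') s5"
          if "q < np1" "q' < np2" "q < qa \<or> q = qa \<and> q' < Suc qb" for q q'
        proof (cases "q = qa \<and> q' = qb")
          case True
          then show ?thesis using h by simp
        next
          case False
          then have "q < qa \<or> q = qa \<and> q' < qb" using that by auto
          then have "settled (?p1 q) (?p2 q') s'" using I that unfolding I_def by blast
          then show ?thesis using settled_below h(3) by blast
        qed
        ultimately have "I qa (Suc qb) s5" unfolding I_def using h cl by auto
        then show "I qa (Suc qb) (set_reg 28 (Suc qb) s5)" by simp
      qed
    next
      fix s' t' assume t': "t' \<le> (\<Sum>i<np2. call_time n mr P TT + 2) + 2" and "I qa np2 s'"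
      have "np2 * (call_time n mr P TT + 2) \<le> g * (call_time n mr P TT + 2)" using np by (intro mult_right_mono) auto
      then have "t' \<le> g * (call_time n mr P TT + 2) + 2" using t' by simp
      then show "t' \<le> g * (call_time n mr P TT + 2) + 2 \<and> I (Suc qa) 0 (set_reg 27 (Suc qa) s')"
        using I_next[OF \<open>I qa np2 s'\<close>] by simp
    qed (use mc written_call_com[of mr P] w in auto)
  next
    fix s' t' assume t': "t' \<le> (\<Sum>i<np1. g * (call_time n mr P TT + 2) + 2 + 2) + 2" and I: "I np1 0 s'"
    have "np1 * (g * (call_time n mr P TT + 2) + 4) \<le> g * (g * (call_time n mr P TT + 2) + 4)" using np by (intro mult_right_mono) auto
    moreover have "(\<Sum>i<np1. g * (call_time n mr P TT + 2) + 2 + 2) = np1 * (g * (call_time n mr P TT + 2) + 4)"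
      by (simp add: algebra_simps)
    ultimately have t'': "t' \<le> g * (g * (call_time n mr P TT + 2) + 4) + 2" using t' by linarith
    have "np1 * np2 \<le> g * g" using np by (intro mult_mono) auto
    then show "t' \<le> g * (g * (call_time n mr P TT + 2) + 4) + 2 \<and> sums_ok s' \<and> below s' s4 \<and>
       (\<forall>q<np1. \<forall>q'<np2. settled (?p1 q) (?p2 q') s') \<and>
       fst s' 24 \<le> cl0 + g * g \<and> (\<forall>c r. fst s' 24 \<le> c \<longrightarrow> snd s' (9, c, r) = 0)"
      using t'' I unfolding I_def by auto
  qed (use mc written_call_com[of mr P] w in auto)
qed

text \<open>A sum equal to the target is either matched during a pass or covered on both sides, and
  then the call for its two pivots treats it. The stored value may be smaller than the target, since
  other sums are stored as well.\<close>

theorem phase_correct: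
  assumes env: "env s0" and regs: "fst s0 7 = M" "fst s0 8 = mask v" "fst s0 9 = N" "fst s0 24 = cl0"
    and fresh: "\<And>tg ps r. tg \<in> {2, 5} \<Longrightarrow> ps \<in> {2 * ph, 2 * ph + 1} \<Longrightarrow> snd s0 (tg, ps, r) = 0"
      "\<And>c r. cl0 \<le> c \<Longrightarrow> snd s0 (9, c, r) = 0"
    and sums: "sums_ok s0"
  shows "wp (phase_com mr P) s0 (\<lambda>s t. t \<le> phase_time n D g d mr P TT \<and> sums_ok s \<and> below s s0 \<and>
     (\<forall>i<n. \<forall>j<n. \<forall>k<D. f 0 i k + f 1 j k = Y i j \<longrightarrow> snd s (10, i, j, 0, 0) \<le> Y i j) \<and>
     fst s 24 \<le> cl0 + g * g \<and> (\<forall>c r. fst s 24 \<le> c \<longrightarrow> snd s (9, c, r) = 0) \<and>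
     (\<forall>tg ps r. tg \<in> {2, 5} \<longrightarrow> ps \<notin> {2 * ph, 2 * ph + 1} \<longrightarrow> snd s (tg, ps, r) = snd s0 (tg, ps, r)))"
proof -
  let ?Q = "\<lambda>s t. t \<le> phase_time n D g d mr P TT \<and> sums_ok s \<and> below s s0 \<and>
     (\<forall>i<n. \<forall>j<n. \<forall>k<D. f 0 i k + f 1 j k = Y i j \<longrightarrow> snd s (10, i, j, 0, 0) \<le> Y i j) \<and>
     fst s 24 \<le> cl0 + g * g \<and> (\<forall>c r. fst s 24 \<le> c \<longrightarrow> snd s (9, c, r) = 0) \<and>
     (\<forall>tg ps r. tg \<in> {2, 5} \<longrightarrow> ps \<notin> {2 * ph, 2 * ph + 1} \<longrightarrow> snd s (tg, ps, r) = snd s0 (tg, ps, r))"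
  let ?calls = "For 27 (Rd 8 (psE 0) (Con 0) (Con 0) (Con 0))
       (For 28 (Rd 8 (psE 1) (Con 0) (Con 0) (Con 0)) (call_com mr P))"
  have vals_row: "vals_ok \<tau> s" if "\<forall>i<n. row (snd s) (2 * ph + \<tau>) (f \<tau> i) i D" for \<tau> s
    using that by (simp add: vals_ok_def row_def)
  have pos_row: "pos_ok \<tau> s" if "\<forall>i<n. row (snd s) (2 * ph + \<tau>) (f \<tau> i) i D" for \<tau> s
    using that by (simp add: pos_ok_def row_def)
  show ?thesis unfolding phase_com_def
  proof (rule wp_Seq, rule wp_conseq[OF build_correct[OF env, of 0]], simp, use fresh in simp, use fresh in simp, elim conjE)
    fix s1 t1 assume ag1: "agree (modified (build 0)) (written (build 0)) s0 s1" and t1: "t1 \<le> n * (D * 10 + 4) + 2"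
      and row1: "\<forall>i<n. row (snd s1) (2 * ph + 0) (f 0 i) i D"
      and o1: "\<forall>tg ps r. ps \<noteq> 2 * ph + 0 \<longrightarrow> snd s1 (tg, ps, r) = snd s0 (tg, ps, r)"
    have e1: "env s1" by (rule env_agree[OF env ag1]) auto
    show "wp (build 1 ;; pass 0 ;; pass 1 ;; ?calls) s1 (\<lambda>s t. ?Q s (t1 + t))"
    proof (rule wp_Seq, rule wp_conseq[OF build_correct[OF e1, of 1]], simp, use fresh o1 in simp, use fresh o1 in simp, elim conjE)
      fix s2 t2 assume ag2: "agree (modified (build 1)) (written (build 1)) s1 s2" and t2: "t2 \<le> n * (D * 10 + 4) + 2"
        and row2: "\<forall>i<n. row (snd s2) (2 * ph + 1) (f 1 i) i D"
        and o2: "\<forall>tg ps r. ps \<noteq> 2 * ph + 1 \<longrightarrow> snd s2 (tg, ps, r) = snd s1 (tg, ps, r)"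
      have e2: "env s2" by (rule env_agree[OF e1 ag2]) auto
      have row2': "\<forall>i<n. row (snd s2) (2 * ph + 0) (f 0 i) i D"
        using row1 row_cong[of "snd s2" "2 * ph + 0" _ "snd s1"] o2 by auto
      have v2: "vals_ok (opp 0) s2" "vals_ok (opp 1) s2" "pos_ok 0 s2" "pos_ok 1 s2"
        using vals_row pos_row row2 row2' by simp_all
      have so2: "sums_ok s2" "below s2 s0"
        using sums agree_cell[OF ag1, of 10] agree_cell[OF ag2, of 10] by (simp_all add: sums_ok_def below_def)
      have c2: "cnt \<sigma> s2 i v = full \<sigma> i v" if "i < n" "\<sigma> < 2" for i v \<sigma>
      proof -
        have "\<sigma> = 0 \<or> \<sigma> = 1" using that by auto
        then show ?thesis using row2 row2' that by (auto simp: cnt_def full_def row_def)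
      qed
      show "wp (pass 0 ;; pass 1 ;; ?calls) s2 (\<lambda>s t. ?Q s (t1 + (t2 + t)))"
      proof (rule wp_Seq, rule wp_conseq[OF pass_correct[OF e2 _ v2(1,3) so2(1) c2]], simp, assumption, simp, elim conjE exE)
        fix s3 t3 np1 assume ag3: "agree (modified (pass 0)) (written (pass 0)) s2 s3"
          and t3: "t3 \<le> n * (n * (14 * d + 10) + 6 * (n * D div g) + 12) + 4"
          and so3: "sums_ok s3" "below s3 s2"
          and np1: "np1 \<le> g" "snd s3 (8, 2 * ph + 0, 0, 0, 0) = np1" "\<forall>q<np1. snd s3 (7, 2 * ph + 0, q, 0, 0) < n"
          and comp1: "\<forall>i<n. \<forall>j<n. \<forall>k<D. f 0 i k + f (opp 0) j k = ys 0 i j \<longrightarrow>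
             snd s3 (cur_index 0 i j) \<le> ys 0 i j \<or> covered 0 s3 np1 i (f 0 i k)"
          and o3: "\<forall>tg ps r. tg \<noteq> 10 \<longrightarrow> ps \<noteq> 2 * ph + 0 \<longrightarrow> snd s3 (tg, ps, r) = snd s2 (tg, ps, r)"
        have e3: "env s3" by (rule env_agree[OF e2 ag3]) auto
        have v3: "vals_ok (opp 0) s3" "vals_ok (opp 1) s3" "pos_ok 1 s3"
          using vals_ok_agree[OF v2(1) ag3] vals_ok_agree[OF v2(2) ag3] pos_ok_agree[OF v2(4) ag3] by simp_all
        have c3: "cnt 1 s3 i v = full 1 i v" if "i < n" for i v
          using c2[OF that, of 1 v] o3 by (simp add: cnt_def)
        show "wp (pass 1 ;; ?calls) s3 (\<lambda>s t. ?Q s (t1 + (t2 + (t3 + t))))"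
        proof (rule wp_Seq, rule wp_conseq[OF pass_correct[OF e3 _ v3(2,3) so3(1) c3]], simp, assumption, elim conjE exE)
          fix s4 t4 np2 assume ag4: "agree (modified (pass 1)) (written (pass 1)) s3 s4"
            and t4: "t4 \<le> n * (n * (14 * d + 10) + 6 * (n * D div g) + 12) + 4"
            and so4: "sums_ok s4" "below s4 s3"
            and np2: "np2 \<le> g" "snd s4 (8, 2 * ph + 1, 0, 0, 0) = np2" "\<forall>q<np2. snd s4 (7, 2 * ph + 1, q, 0, 0) < n"
            and comp2: "\<forall>i<n. \<forall>j<n. \<forall>k<D. f 1 i k + f (opp 1) j k = ys 1 i j \<longrightarrow>
               snd s4 (cur_index 1 i j) \<le> ys 1 i j \<or> covered 1 s4 np2 i (f 1 i k)"
            and o4: "\<forall>tg ps r. tg \<noteq> 10 \<longrightarrow> ps \<noteq> 2 * ph + 1 \<longrightarrow> snd s4 (tg, ps, r) = snd s3 (tg, ps, r)"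
          have e4: "env s4" by (rule env_agree[OF e3 ag4]) auto
          have v4: "vals_ok 0 s4" "vals_ok 1 s4"
            using vals_ok_agree[OF v3(2) ag4] vals_ok_agree[OF v3(1) ag4] by simp_all
          have rg: "fst s4 x = fst s0 x" if "x \<in> {7, 8, 9, 24}" for x
            using that agree_reg[OF ag4, of x] agree_reg[OF ag3, of x] agree_reg[OF ag2, of x] agree_reg[OF ag1, of x] by auto
          have f9: "snd s4 (9, r) = snd s0 (9, r)" for r
            using agree_cell[OF ag4, of 9] agree_cell[OF ag3, of 9] agree_cell[OF ag2, of 9] agree_cell[OF ag1, of 9] by simp
          have p1: "snd s4 (7, 2 * ph, r) = snd s3 (7, 2 * ph, r)" "snd s4 (8, 2 * ph, r) = snd s3 (8, 2 * ph, r)" for r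
            using o4 by simp_all
          have cl: "wp ?calls s4 (\<lambda>s t. t \<le> g * (g * (call_time n mr P TT + 2) + 4) + 2 \<and> sums_ok s \<and> below s s4 \<and>
             (\<forall>q<np1. \<forall>q'<np2. settled (snd s4 (7, 2 * ph, q, 0, 0)) (snd s4 (7, 2 * ph + 1, q', 0, 0)) s) \<and>
             fst s 24 \<le> cl0 + g * g \<and> (\<forall>c r. fst s 24 \<le> c \<longrightarrow> snd s (9, c, r) = 0))"
            by (rule calls_correct[OF e4 _ _ _ _ _ np1(1) np2(2,1) _ _ v4 _ so4(1)])
              (use rg regs np1 np2 p1 fresh f9 in auto)
          show "wp ?calls s4 (\<lambda>s t. ?Q s (t1 + (t2 + (t3 + (t4 + t)))))"
          proof (rule wp_conseq[OF cl], elim conjE)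
            fix s5 t5 assume ag5: "agree (modified ?calls) (written ?calls) s4 s5"
              and t5: "t5 \<le> g * (g * (call_time n mr P TT + 2) + 4) + 2" and so5: "sums_ok s5" "below s5 s4"
              and st: "\<forall>q<np1. \<forall>q'<np2. settled (snd s4 (7, 2 * ph, q, 0, 0)) (snd s4 (7, 2 * ph + 1, q', 0, 0)) s5"
              and cl5: "fst s5 24 \<le> cl0 + g * g" "\<forall>c r. fst s5 24 \<le> c \<longrightarrow> snd s5 (9, c, r) = 0"
            have "t1 + (t2 + (t3 + (t4 + t5))) \<le> phase_time n D g d mr P TT"
            proof -
              have "t1 + (t2 + (t3 + (t4 + t5))) \<le> 2 * a + 2 * b + c"
                if "t1 \<le> a" "t2 \<le> a" "t3 \<le> b" "t4 \<le> b" "t5 \<le> c" for a b c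
                using that by linarith
              from this[OF t1 t2 t3 t4 t5] show ?thesis unfolding phase_time_def .
            qed
            moreover have "below s5 s0" using so5 so4 so3 so2 below_trans by blast
            moreover have "snd s5 (10, i, j, 0, 0) \<le> Y i j" if h: "i < n" "j < n" "k < D" "f 0 i k + f 1 j k = Y i j" for i j k
            proof -
              have le: "snd s5 (10, i, j, 0, 0) \<le> snd s4 (10, i, j, 0, 0)" "snd s4 (10, i, j, 0, 0) \<le> snd s3 (10, i, j, 0, 0)"
                using so5 so4 unfolding below_def by blast+
              have 1: "snd s3 (10, i, j, 0, 0) \<le> Y i j \<or> covered 0 s3 np1 i (f 0 i k)"
                using comp1 h by (simp add: ys_def cur_index_def)
              have 2: "snd s4 (10, i, j, 0, 0) \<le> Y i j \<or> covered 1 s4 np2 j (f 1 j k)"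
                using comp2 h by (simp add: ys_def cur_index_def add.commute)
              show ?thesis
              proof (cases "covered 0 s3 np1 i (f 0 i k) \<and> covered 1 s4 np2 j (f 1 j k)")
                case True
                then obtain q b where c1: "q < np1" "b \<in> f (opp 0) (snd s3 (7, 2 * ph + 0, q, 0, 0)) ` {..<D}"
                    "f 0 i k + b = ys 0 i (snd s3 (7, 2 * ph + 0, q, 0, 0))"
                  unfolding covered_def by blast
                from True obtain q' b' where c2: "q' < np2" "b' \<in> f (opp 1) (snd s4 (7, 2 * ph + 1, q', 0, 0)) ` {..<D}"
                    "f 1 j k + b' = ys 1 j (snd s4 (7, 2 * ph + 1, q', 0, 0))"
                  unfolding covered_def by blast
                have c: "q < np1" "b \<in> f 1 (snd s4 (7, 2 * ph, q, 0, 0)) ` {..<D}"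
                    "f 0 i k + b = Y i (snd s4 (7, 2 * ph, q, 0, 0))"
                    "q' < np2" "b' \<in> f 0 (snd s4 (7, 2 * ph + 1, q', 0, 0)) ` {..<D}"
                    "f 1 j k + b' = Y (snd s4 (7, 2 * ph + 1, q', 0, 0)) j"
                  using c1 c2 by (simp_all add: ys_def p1)
                have "settled (snd s4 (7, 2 * ph, q, 0, 0)) (snd s4 (7, 2 * ph + 1, q', 0, 0)) s5"
                  using st c(1,4) by blast
                then have "snd s5 (10, i, j, 0, 0) \<le> f 0 i k + f 1 j k"
                  using h(1-3) c(2,3,5,6) unfolding settled_def by blast
                then show ?thesis using h by simp
              next
                case False
                then show ?thesis using 1 2 le by linarith
              qed
            qed
            moreover have "snd s5 (tg, ps, r) = snd s0 (tg, ps, r)" if tp: "tg \<in> {2, 5}" "ps \<notin> {2 * ph, 2 * ph + 1}" for tg ps r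
            proof -
              have "tg \<notin> written ?calls" using tp written_call_com[of mr P] by auto
              then have "snd s5 (tg, ps, r) = snd s4 (tg, ps, r)" using agree_cell[OF ag5] by blast
              moreover have "tg \<noteq> 10" "ps \<noteq> 2 * ph + 0" "ps \<noteq> 2 * ph + 1" using tp by auto
              ultimately show ?thesis using o4 o3 o2 o1 by simp
            qed
            ultimately show "?Q s5 (t1 + (t2 + (t3 + (t4 + t5))))" using so5 cl5 by blast
          qed
        qed
      qed
    qed
  qed
qed

end

subsection \<open>The complete program\<close>

text \<open>A program is not told its word size; the loop finds it by counting the bits of the word \<open>0 - 1\<close>.\<close>

definition prepare :: "nat \<Rightarrow> nat \<Rightarrow> nat \<Rightarrow> nat \<Rightarrow> com" where
  "prepare c q K k =
     Assign 31 (Bin SUB (Con 0) (Con 1)) ;;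
     Assign 4 (Con 0) ;;
     Loop (Lt (Con 0) (Var 31))
       (Assign 31 (Bin SHR (Var 31) (Con 1)) ;; Assign 4 (Plus (Var 4) (Con 1))) ;;
     Assign 4 (Bin DIV (Var 4) (Con (5 * K))) ;;
     Assign 0 (Bin SHL (Con 1) (Times (Con K) (Var 4))) ;;
     Assign 5 (Plus (Times (Con c) (Var 4)) (Con 2)) ;;
     Assign 6 (Bin SHL (Con 1) (Times (Con c) (Var 4))) ;;
     Assign 7 (Bin SHL (Con 8) (Var 5)) ;;
     Assign 8 (Minus (Bin SHL (Con 1) (Times (Con k) (Plus (Var 4) (Con 2)))) (Con 1)) ;;
     Assign 3 (Bin SHL (Con 1) (Bin DIV (Var 4) (Con q))) ;;
     Assign 24 (Con 0)"

definition inE :: "exp \<Rightarrow> exp" where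
  "inE a = Rd 0 (Con 0) (Con 0) (Con 0) a"

text \<open>Machine addition of the offset maps two's complement words to naturals. The second
  matrix is stored transposed, so that both have \<open>n\<close> rows of length
  \<open>D\<close>.\<close>

definition load :: com where
  "load = Assign 1 (inE (Con 0)) ;; Assign 2 (inE (Con 1)) ;;
     Assign 9 (Plus (Times (Con 4) (Var 1)) (Con 6)) ;;
     For 15 (Var 1) (For 17 (Var 2)
       (Write 1 (Con 0) (Var 15) (Var 17) (Con 0)
          (Bin ADD (inE (Plus (Con 2) (Plus (Times (Var 15) (Var 2)) (Var 17)))) (Var 6)) ;;
        Write 1 (Con 1) (Var 15) (Var 17) (Con 0)
          (Bin ADD (inE (Plus (Plus (Con 2) (Times (Var 1) (Var 2)))
             (Plus (Times (Var 17) (Var 1)) (Var 15)))) (Var 6))))"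

definition grid :: "com \<Rightarrow> com" where
  "grid c = For 15 (Var 1) (For 16 (Var 1) c)"

text \<open>Sums at position 0 serve as first candidates, so every stored value is a genuine sum
  from the outset. The levels are numbered upwards in register 10 while the number of dropped bits
  in register 13 decreases.\<close>

definition level :: "nat \<Rightarrow> instr list \<Rightarrow> com" where
  "level mr P = Assign 13 (Minus (Minus (Var 5) (Con 1)) (Var 10)) ;;
     grid (Write 10 (Var 15) (Var 16) (Con 0) (Con 0) (Plus (fE 0 (Var 15) (Con 0)) (fE 1 (Var 16) (Con 0)))) ;;
     For 11 (Con 3) (Assign 14 (Plus (Times (Con 3) (Var 10)) (Var 11)) ;; phase_com mr P) ;;
     grid (Write 6 (Var 15) (Var 16) (Con 0) (Con 0) (Rd 10 (Var 15) (Var 16) (Con 0) (Con 0)))"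

text \<open>Each entry carries the offset once; machine subtraction of twice the offset yields the
  two's complement of the true minimum.\<close>

definition emit :: com where
  "emit = grid (Write 0 (Con 0) (Con 0) (Con 0) (Plus (Times (Var 15) (Var 1)) (Var 16))
     (Bin SUB (Rd 6 (Var 15) (Var 16) (Con 0) (Con 0)) (Plus (Var 6) (Var 6))))"

definition main :: "nat \<Rightarrow> instr list \<Rightarrow> com" where
  "main mr P = load ;; For 10 (Var 5) (level mr P) ;; emit"

lemma modified_grid [simp]: "modified (grid c) = {15, 16} \<union> modified c"
  and written_grid [simp]: "written (grid c) = written c"
  by (auto simp: grid_def)

lemma modified_main_parts [simp]:
  "modified load = {1, 2, 9, 15, 17}" "modified emit = {15, 16}"
  "written load = {1}" "written emit = {0}"
  by (auto simp: load_def emit_def)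

lemma modified_level: "modified (level mr P) \<subseteq> {11, 13, 14} \<union> {15..32} \<union> {40..}"
  and written_level: "written (level mr P) \<subseteq> {2, 3, 4, 5, 6, 7, 8, 9, 10}"
  using modified_phase_com[of mr P] written_phase_com[of mr P] by (auto simp: level_def)

lemma modified_main: "0 \<notin> modified (main mr P)"
  using modified_level[of mr P] by (auto simp: main_def)

lemma com_vars_For [simp]: "com_vars (For x e c) = insert x (exp_vars e \<union> com_vars c)"
  by (auto simp: For_def)

lemma com_arrays_prepare: "\<not> com_arrays (prepare c q K k)"
  by (simp add: prepare_def)

lemma com_vars_prepare: "com_vars (prepare c q K k) \<subseteq> {..<41}"
  by (auto simp: prepare_def)

lemma com_vars_main:
  assumes "\<forall>i\<in>set P. instr_regs i \<subseteq> {..<mr}"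
  shows "com_vars (main mr P) \<subseteq> {..<41 + mr}"
proof -
  have c: "com_vars (call_com mr P) \<subseteq> {..<41 + mr}"
    using com_vars_sim[OF assms]
    by (auto simp: call_com_def half_graph_def middle_graph_def read_back_def set_arc_def set_weight_def
        scan_def improve_def psE_def fE_def yE_def nvE_def valE_def innerE_def outerE_def cellE_def)
  have p: "com_vars (pass \<sigma>) \<subseteq> {..<41}" for \<sigma>
    by (auto simp: pass_def count_def enumerate_light_def cover_def
        scan_def improve_def psE_def fE_def yE_def nvE_def valE_def cntE_def)
  have b: "com_vars (build \<sigma>) \<subseteq> {..<41}" for \<sigma>
    by (auto simp: build_def psE_def fE_def nvE_def valE_def cntE_def)
  have "com_vars (phase_com mr P) \<subseteq> {..<41 + mr}"
    using c p[of 0] p[of 1] b[of 0] b[of 1] by (auto simp: phase_com_def psE_def)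
  then show ?thesis by (auto simp: main_def load_def level_def emit_def grid_def inE_def fE_def)
qed

section \<open>Recovering the word size and handling signed words\<close>

lemma mod_two_power_pred: "(2 ^ Suc m - 1) div 2 = (2 ^ m - 1 :: nat)"
proof -
  have "(2 * x - 1) div 2 = x - 1" if "1 \<le> x" for x :: nat using that by presburger
  then show ?thesis using one_le_power[of "2::nat" m] by simp
qed

context word_machine begin

lemma eval_SHL: "a * 2 ^ b < 2 ^ w \<Longrightarrow> eval_binop w SHL a b = a * 2 ^ b"
  by (simp add: push_bit_eq_mult take_bit_nat_eq_self)

lemma bit_count:
  assumes "i \<le> w" "fst s 31 = 2 ^ (w - i) - 1" "fst s 4 = i"
  shows "wp (Loop (Lt (Con 0) (Var 31))
       (Assign 31 (Bin SHR (Var 31) (Con 1)) ;; Assign 4 (Plus (Var 4) (Con 1)))) s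
     (\<lambda>s' t. t \<le> 3 * (w - i) + 1 \<and> fst s' 4 = w \<and> snd s' = snd s)"
  using assms
proof (induction "w - i" arbitrary: i s)
  case 0
  have z: "fst s 31 = 0" using 0 by simp
  have "big_step (Loop (Lt (Con 0) (Var 31))
       (Assign 31 (Bin SHR (Var 31) (Con 1)) ;; Assign 4 (Plus (Var 4) (Con 1)))) s 1 s"
    by (rule big_step.Loop_False) (simp_all add: z)
  then show ?case using 0 unfolding wp_def by (intro exI[of _ 1] exI[of _ s]) auto
next
  case (Suc m)
  let ?c = "Assign 31 (Bin SHR (Var 31) (Con 1)) ;; Assign 4 (Plus (Var 4) (Con 1))"
  let ?s1 = "set_reg 31 (2 ^ m - 1) s" let ?s2 = "set_reg 4 (Suc i) ?s1"
  have wi: "w - i = Suc m" "i < w" "w - Suc i = m" using Suc.hyps by auto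
  have iw: "Suc i < 2 ^ w" 
  proof -
    have "Suc i \<le> w" using wi by simp
    also have "w < 2 ^ w" by (rule less_exp)
    finally show ?thesis .
  qed
  have one: "(1::nat) < 2 ^ w" using wi by (intro one_less_power) auto
  have e31: "ev (Bin SHR (Var 31) (Con 1)) s = 2 ^ m - 1"
    using Suc.prems(2) mod_two_power_pred[of m] unfolding wi by (simp add: drop_bit_eq_div)
  have "big_step (Assign 31 (Bin SHR (Var 31) (Con 1))) s 1 ?s1"
    using big_step.Assign[of "Bin SHR (Var 31) (Con 1)" s 31] one unfolding e31 by simp
  moreover have "big_step (Assign 4 (Plus (Var 4) (Con 1))) ?s1 1 ?s2"
    using big_step.Assign[of "Plus (Var 4) (Con 1)" ?s1 4] one iw Suc.prems(3) by simp
  ultimately have b: "big_step ?c s (1 + 1) ?s2" by (rule big_step.Seq)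
  obtain t s' where r: "big_step (Loop (Lt (Con 0) (Var 31)) ?c) ?s2 t s'" "t \<le> 3 * (w - Suc i) + 1"
    "fst s' 4 = w" "snd s' = snd ?s2"
    using Suc.hyps(1)[of "Suc i" ?s2] wi unfolding wp_def by auto
  have "fst s 31 \<noteq> 0"
  proof -
    have "2 \<le> (2::nat) ^ Suc m" using power_increasing[of 1 "Suc m" "2::nat"] by simp
    then show ?thesis unfolding Suc.prems(2) wi(1) by linarith
  qed
  then have "big_step (Loop (Lt (Con 0) (Var 31)) ?c) s (1 + 1 + t + 1) s'"
    by (intro big_step.Loop_True[OF _ _ b r(1)]) auto
  then show ?case unfolding wp_def using r wi by (intro exI[of _ "1 + 1 + t + 1"] exI[of _ s']) auto
qed

end

text \<open>Truncation respects addition, so the offset can be added to the truncated word; the true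
  sum is non-negative and fits.\<close>

lemma take_bit_shifted:
  assumes "0 \<le> a + int b" "a + int b < 2 ^ w"
  shows "take_bit w (nat (take_bit w a) + b) = nat (a + int b)"
proof -
  have "int (take_bit w (nat (take_bit w a) + b)) = take_bit w (take_bit w a + int b)"
    by (simp add: of_nat_take_bit)
  also have "\<dots> = take_bit w (a + int b)"
    by (simp add: take_bit_eq_mod mod_add_left_eq)
  also have "\<dots> = a + int b" using assms by (simp add: take_bit_int_eq_self)
  finally show ?thesis using assms by linarith
qed

text \<open>The bound is strict, which excludes the smallest signed word, the only one that would be
  read as infinity.\<close>

lemma decode_word:
  assumes "\<bar>m\<bar> < 2 ^ (w - 1)" "0 < w"
  shows "decode w (nat (take_bit w m)) = Some m"
proof -
  have "signed_take_bit (w - 1) (take_bit w m) = signed_take_bit (w - 1) m"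
    using assms(2) by (intro signed_take_bit_eq_iff_take_bit_eq[THEN iffD2]) simp
  also have "\<dots> = m" using assms(1) by (intro signed_take_bit_int_eq_self) auto
  finally have s: "signed_take_bit (w - 1) (take_bit w m) = m" .
  have "nat (take_bit w m) \<noteq> 2 ^ (w - 1)"
  proof
    assume "nat (take_bit w m) = 2 ^ (w - 1)"
    then have t: "take_bit w m = 2 ^ (w - 1)" by (metis nat_eq_numeral_power_cancel_iff)
    have w2: "(2::int) ^ w = 2 * 2 ^ (w - 1)" using assms(2) by (cases w) simp_all
    show False
    proof (cases "0 \<le> m")
      case True
      then have "take_bit w m = m" using assms(1) w2 by (intro take_bit_int_eq_self) auto
      then show False using t assms(1) by simp
    next
      case False
      have "take_bit w m = take_bit w (m + 2 ^ w)" by (simp add: take_bit_eq_mod)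
      also have "\<dots> = m + 2 ^ w" using assms(1) w2 False by (intro take_bit_int_eq_self) auto
      finally show False using t assms(1) w2 False by simp
    qed
  qed
  then show ?thesis using s by (simp add: decode_def)
qed

subsection \<open>Scaling\<close>

definition scaled_min :: "(nat \<Rightarrow> nat \<Rightarrow> nat \<Rightarrow> nat) \<Rightarrow> nat \<Rightarrow> nat \<Rightarrow> nat \<Rightarrow> nat \<Rightarrow> nat" where
  "scaled_min F D l i j = Min ((\<lambda>k. F 0 i k div 2 ^ l + F 1 j k div 2 ^ l) ` {..<D})"

lemma scaled_min_attained:
  assumes "0 < D"
  obtains k where "k < D" "scaled_min F D l i j = F 0 i k div 2 ^ l + F 1 j k div 2 ^ l"
proof -
  have "scaled_min F D l i j \<in> (\<lambda>k. F 0 i k div 2 ^ l + F 1 j k div 2 ^ l) ` {..<D}"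
    unfolding scaled_min_def using assms by (intro Min_in) auto
  then show ?thesis using that by auto
qed

lemma scaled_min_le: "k < D \<Longrightarrow> scaled_min F D l i j \<le> F 0 i k div 2 ^ l + F 1 j k div 2 ^ l"
  unfolding scaled_min_def by (intro Min_le) auto

text \<open>Restoring a dropped bit adds at most one to a doubled entry and hence at most two to a
  doubled sum. The minimiser of either level serves as a competitor on the other.\<close>

lemma scaled_min_step:
  assumes "0 < D"
  shows "2 * scaled_min F D (Suc l) i j \<le> scaled_min F D l i j"
    "scaled_min F D l i j \<le> 2 * scaled_min F D (Suc l) i j + 2"
proof -
  have h: "2 * (a div 2 ^ Suc l) \<le> a div 2 ^ l" "a div 2 ^ l \<le> 2 * (a div 2 ^ Suc l) + 1" for a :: nat
  proof -
    have "a div 2 ^ Suc l = a div 2 ^ l div 2" by (simp only: power_Suc2 div_mult2_eq)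
    then show "2 * (a div 2 ^ Suc l) \<le> a div 2 ^ l" "a div 2 ^ l \<le> 2 * (a div 2 ^ Suc l) + 1" by linarith+
  qed
  obtain k where k: "k < D" "scaled_min F D l i j = F 0 i k div 2 ^ l + F 1 j k div 2 ^ l"
    using scaled_min_attained[OF assms] .
  show "2 * scaled_min F D (Suc l) i j \<le> scaled_min F D l i j"
    using scaled_min_le[OF k(1), of F "Suc l" i j] h(1)[of "F 0 i k"] h(1)[of "F 1 j k"] k(2) by linarith
  obtain k' where k': "k' < D" "scaled_min F D (Suc l) i j = F 0 i k' div 2 ^ Suc l + F 1 j k' div 2 ^ Suc l"
    using scaled_min_attained[OF assms] .
  show "scaled_min F D l i j \<le> 2 * scaled_min F D (Suc l) i j + 2"
    using scaled_min_le[OF k'(1), of F l i j] h(2)[of "F 0 i k'"] h(2)[of "F 1 j k'"] k'(2) by linarith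
qed

text \<open>\<open>L\<close> stands for the rounded logarithm of \<open>n + 2\<close> and
  \<open>K\<close> for a constant large enough for all size conditions. The solver has words of
  \<open>k * (L + 2)\<close> bits because \<open>L + 2\<close> is the corresponding logarithm for
  its \<open>4 * n + 6\<close> nodes.\<close>

locale reduction =
  fixes n D c q K k mr L d TT :: nat and P :: "instr list" and A B :: "nat \<Rightarrow> nat \<Rightarrow> int"
  assumes n0: "0 < n" and D0: "0 < D" and Dn: "D \<le> n" and nL: "n + 2 \<le> 2 ^ L" and q0: "0 < q" and K0: "0 < K"
    and L0: "0 < L" and k0: "0 < k"
    and A_le: "\<And>i k. i < n \<Longrightarrow> k < D \<Longrightarrow> \<bar>A i k\<bar> \<le> 2 ^ (c * L)"
    and B_le: "\<And>k j. k < D \<Longrightarrow> j < n \<Longrightarrow> \<bar>B k j\<bar> \<le> 2 ^ (c * L)"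
    and A_card: "\<And>i. i < n \<Longrightarrow> card ((\<lambda>k. A i k) ` {..<D}) \<le> d"
    and B_card: "\<And>j. j < n \<Longrightarrow> card ((\<lambda>k. B k j) ` {..<D}) \<le> d"
    and dD: "d * D \<le> n"
    and regs: "\<And>i. i \<in> set P \<Longrightarrow> instr_regs i \<subseteq> {..<mr}"
    and const_less: "\<And>i. i \<in> set P \<Longrightarrow> instr_const i < 2 ^ (K * L)"
    and len: "length P < 2 ^ (K * L)"
    and params: "5 * K < 2 ^ (K * L)" "c < 2 ^ (K * L)" "q < 2 ^ (K * L)" "k < 2 ^ (K * L)"
    and big: "100 < (2::nat) ^ (K * L)" "k * (L + 2) < K * L" "1 + (4 * n + 6) + (4 * n + 6) * (4 * n + 6) < 2 ^ (K * L)"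
      "64 * 2 ^ (c * L + 2) < (2::nat) ^ (K * L)" "6 * (c * L + 2) + 10 < 2 ^ (K * L)"
      "3 * (c * L + 2) * (2 ^ (L div q) * 2 ^ (L div q)) < (2::nat) ^ (K * L)"
    and M3: "3 * (8 * 2 ^ (c * L + 2)) < (2::nat) ^ (k * (L + 2) - 1)" and Nv: "4 * n + 6 < 2 ^ (k * (L + 2))"
    and solver: "\<And>E wt. undirected_graph (4 * n + 6) E \<Longrightarrow> (\<And>x. wt x \<le> 8 * 2 ^ (c * L + 2)) \<Longrightarrow> no_negative_cycle E (\<lambda>x. int (wt x)) \<Longrightarrow>
       halted P ((step (k * (L + 2)) P ^^ TT) (initial_state (k * (L + 2)) (apsp_input (4 * n + 6) E (\<lambda>x. int (wt x))))) \<and>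
       (\<forall>i<(4 * n + 6) * (4 * n + 6). decode (k * (L + 2)) (memory ((step (k * (L + 2)) P ^^ TT) (initial_state (k * (L + 2)) (apsp_input (4 * n + 6) E (\<lambda>x. int (wt x))))) i) =
          apsp_output (4 * n + 6) E (\<lambda>x. int (wt x)) ! i)"
begin

text \<open>Five index components of \<open>K * L\<close> bits make up one word.\<close>

definition "w = 5 * K * L"
definition "Z = (2::nat) ^ (K * L)"
text \<open>Shifted entries are at most \<open>2 * 2 ^ (c * L)\<close>, so they vanish when
  \<open>p\<close> bits are dropped. This is also the number of levels.\<close>

definition "p = c * L + 2"
definition "off = (2::nat) ^ (c * L)"
text \<open>With \<open>V = 2 ^ p\<close> as the bound on values, this satisfies
  \<open>4 * V < M\<close>, and a power of two is obtained by a shift.\<close>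

definition "M = 8 * (2::nat) ^ p"
definition "v = k * (L + 2)"
definition "g = (2::nat) ^ (L div q)"
definition "N = 4 * n + 6"

definition F :: "nat \<Rightarrow> nat \<Rightarrow> nat \<Rightarrow> nat" where
  "F \<sigma> i x = (if \<sigma> = 0 then nat (A i x + int off) else nat (B x i + int off))"

sublocale word_machine w Z
  by unfold_locales (simp only: w_def Z_def power_mult[symmetric], simp add: ac_simps)

lemma bounds: "100 < Z" "n < Z" "D < Z" "N < Z" "n < 2 ^ w" "Z \<le> 2 ^ w" "4 * n + 6 < Z" "M < Z" "off < Z" "p < Z" "g < Z"
  "L < Z" "0 < v" "v < K * L" "2 ^ v < Z" "1 + N + N * N < Z" "8 * M \<le> Z" "0 < w" "2 + 2 * (n * D) < Z" "w < 2 ^ w"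
proof -
  show "100 < Z" using big(1) by (simp add: Z_def)
  have NN: "1 + N + N * N < Z" using big(3) by (simp add: Z_def N_def)
  then show "1 + N + N * N < Z" .
  show "n < Z" "D < Z" "N < Z" "4 * n + 6 < Z" using NN Dn by (simp_all add: N_def)
  have "n * D \<le> n * n" using Dn by simp
  moreover have "2 * (n * n) + 2 \<le> N * N" by (simp add: N_def algebra_simps)
  ultimately show "2 + 2 * (n * D) < Z" using NN by linarith
  show "Z \<le> 2 ^ w" unfolding Z_def w_def by (intro power_increasing) auto
  then show "n < 2 ^ w" using \<open>n < Z\<close> by linarith
  show "8 * M \<le> Z" using big(4) by (simp add: Z_def M_def p_def)
  moreover have "0 < M" by (simp add: M_def)
  ultimately show "M < Z" by linarith
  have "off \<le> M" unfolding M_def off_def p_def by (simp add: power_add)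
  then show "off < Z" using \<open>M < Z\<close> by linarith
  show "p < Z" using big(5) by (simp add: Z_def p_def)
  have "g \<le> 3 * (c * L + 2) * (g * g)" 
  proof -
    have "1 * g \<le> (3 * (c * L + 2) * g) * g" by (intro mult_right_mono) (auto simp: g_def)
    then show ?thesis by (simp add: mult.assoc)
  qed
  then show "g < Z" using big(6) unfolding Z_def g_def by (rule le_less_trans)
  show "v < K * L" using big(2) by (simp add: v_def)
  then show "2 ^ v < Z" unfolding Z_def by (intro power_strict_increasing) auto
  show "0 < v" using k0 by (simp add: v_def)
  have "L < 2 ^ L" by (rule less_exp)
  also have "\<dots> \<le> Z" unfolding Z_def using K0 by (intro power_increasing) auto
  finally show "L < Z" .
  show "0 < w" using K0 L0 by (simp add: w_def)
  show "w < 2 ^ w" by (rule less_exp)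
qed

lemma lessW': "a < Z \<Longrightarrow> a < 2 ^ w" for a using bounds(6) by linarith

lemma F_less: assumes "\<sigma> < 2" "i < n" "x < D" shows "F \<sigma> i x < 2 ^ p"
proof -
  have "\<bar>A i x\<bar> \<le> int off" "\<bar>B x i\<bar> \<le> int off" using A_le B_le assms by (simp_all add: off_def)
  then have "F \<sigma> i x \<le> 2 * off" unfolding F_def by auto
  also have "2 * off < 2 ^ p" by (simp add: off_def p_def power_add)
  finally show ?thesis .
qed

text \<open>Shifting and dropping bits act on single entries, so values may merge but their number
  does not grow.\<close>

lemma F_card: assumes "\<sigma> < 2" "i < n" shows "card ((\<lambda>k. F \<sigma> i k div 2 ^ l) ` {..<D}) \<le> d"
proof (cases "\<sigma> = 0")
  case True
  have "(\<lambda>k. F \<sigma> i k div 2 ^ l) ` {..<D} = (\<lambda>a. nat (a + int off) div 2 ^ l) ` (\<lambda>k. A i k) ` {..<D}"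
    using True by (simp add: F_def image_image)
  then show ?thesis using card_image_le[of "(\<lambda>k. A i k) ` {..<D}"] A_card[OF assms(2)] by (metis finite_imageI finite_lessThan le_trans)
next
  case False
  have "(\<lambda>k. F \<sigma> i k div 2 ^ l) ` {..<D} = (\<lambda>a. nat (a + int off) div 2 ^ l) ` (\<lambda>k. B k i) ` {..<D}"
    using False by (simp add: F_def image_image)
  then show ?thesis using card_image_le[of "(\<lambda>k. B k i) ` {..<D}"] B_card[OF assms(2)] by (metis finite_imageI finite_lessThan le_trans)
qed

section \<open>Correctness of set-up, levels and output\<close>

lemma prepare_correct:
  assumes "\<And>x. fst s0 x = 0"
  shows "wp (prepare c q K k) s0 (\<lambda>s t. t \<le> 3 * w + 20 \<and> snd s = snd s0 \<and>
    fst s 0 = Z \<and> fst s 3 = g \<and> fst s 5 = p \<and> fst s 6 = off \<and> fst s 7 = M \<and> fst s 8 = mask v \<and> fst s 24 = 0)"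
proof -
  have m1: "nat (take_bit w (- 1 :: int)) = 2 ^ w - 1"
    by (simp add: take_bit_minus_one_eq_mask mask_eq_exp_minus_1 nat_diff_distrib nat_power_eq)
  have one: "(1::nat) < 2 ^ w" "(8::nat) < 2 ^ w" "(2::nat) < 2 ^ w" using bounds(1,6) by linarith+
  have prm: "5 * K < 2 ^ w" "c < 2 ^ w" "q < 2 ^ w" "k < 2 ^ w" "K < 2 ^ w"
    using params bounds(6) unfolding Z_def by linarith+
  \<comment> \<open>The loop counts all \<open>5 * K * L\<close> bits; division by the constant
    \<open>5 * K\<close> recovers \<open>L\<close>.\<close>
  have LK: "w div (5 * K) = L" using K0 by (simp add: w_def)
  have kl: "K * L < 2 ^ w" "c * L < 2 ^ w" "c * L + 2 < 2 ^ w" "L + 2 < 2 ^ w" "k * (L + 2) < 2 ^ w"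
  proof -
    have "K * L \<le> w" by (simp add: w_def)
    then show a: "K * L < 2 ^ w" using bounds(20) by linarith
    show "c * L + 2 < 2 ^ w" using bounds(10) lessW' by (simp add: p_def)
    then show "c * L < 2 ^ w" by linarith
    show b: "k * (L + 2) < 2 ^ w" using big(2) a by linarith
    have "1 * (L + 2) \<le> k * (L + 2)" by (rule mult_right_mono) (use k0 in auto)
    then have "L + 2 \<le> k * (L + 2)" by (simp only: mult_1)
    then show "L + 2 < 2 ^ w" using b by (rule le_less_trans)
  qed
  have sh: "eval_binop w SHL 1 (K * L) = Z" "eval_binop w SHL 1 (c * L) = off" "eval_binop w SHL 8 p = M"
    "eval_binop w SHL 1 (k * (L + 2)) = 2 ^ v" "eval_binop w SHL 1 (L div q) = g"
  proof -
    have "Z < 2 ^ w" unfolding Z_def w_def using K0 L0 by (intro power_strict_increasing) auto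
    then show "eval_binop w SHL 1 (K * L) = Z" using eval_SHL[of 1 "K * L"] by (simp add: Z_def)
    show "eval_binop w SHL 1 (c * L) = off" using eval_SHL[of 1 "c * L"] lessW'[OF bounds(9)] by (simp add: off_def)
    show "eval_binop w SHL 8 p = M" using eval_SHL[of 8 p] lessW'[OF bounds(8)] by (simp add: M_def)
    show "eval_binop w SHL 1 (k * (L + 2)) = 2 ^ v" using eval_SHL[of 1 v] lessW'[OF bounds(15)] by (simp add: v_def)
    show "eval_binop w SHL 1 (L div q) = g" using eval_SHL[of 1 "L div q"] lessW'[OF bounds(11)] by (simp add: g_def)
  qed
  let ?s2 = "set_reg 4 0 (set_reg 31 (2 ^ w - 1) s0)"
  have e1: "ev (Bin SUB (Con 0) (Con 1)) s0 = 2 ^ w - 1" using m1 by simp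
  have loop: "wp (Loop (Lt (Con 0) (Var 31))
       (Assign 31 (Bin SHR (Var 31) (Con 1)) ;; Assign 4 (Plus (Var 4) (Con 1)))) ?s2
     (\<lambda>s' t. t \<le> 3 * (w - 0) + 1 \<and> fst s' 4 = w \<and> snd s' = snd ?s2)"
    by (rule bit_count) auto
  let ?rest = "Assign 4 (Bin DIV (Var 4) (Con (5 * K))) ;;
     Assign 0 (Bin SHL (Con 1) (Times (Con K) (Var 4))) ;;
     Assign 5 (Plus (Times (Con c) (Var 4)) (Con 2)) ;;
     Assign 6 (Bin SHL (Con 1) (Times (Con c) (Var 4))) ;;
     Assign 7 (Bin SHL (Con 8) (Var 5)) ;;
     Assign 8 (Minus (Bin SHL (Con 1) (Times (Con k) (Plus (Var 4) (Con 2)))) (Con 1)) ;;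
     Assign 3 (Bin SHL (Con 1) (Bin DIV (Var 4) (Con q))) ;;
     Assign 24 (Con 0)"
  have rest: "wp ?rest s (\<lambda>s' t. t \<le> 8 \<and> snd s' = snd s \<and>
    fst s' 0 = Z \<and> fst s' 3 = g \<and> fst s' 5 = p \<and> fst s' 6 = off \<and> fst s' 7 = M \<and> fst s' 8 = mask v \<and> fst s' 24 = 0)"
    if "fst s 4 = w" for s
    by (intro wp_Seq wp_Assign)
      (use that one prm kl LK sh lessW'[OF bounds(15)] in
        \<open>simp_all del: eval_binop.simps(9) add: p_def mask_eq_exp_minus_1\<close>)
  show ?thesis unfolding prepare_def
  proof (rule wp_Seq, rule wp_Assign, use one in simp, unfold e1, rule wp_Seq, rule wp_Assign, simp,
      unfold ev.simps, rule wp_Seq, rule wp_conseq[OF loop], elim conjE)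
    fix s :: store and t assume t: "t \<le> 3 * (w - 0) + 1" and s: "fst s 4 = w" "snd s = snd ?s2"
    show "wp ?rest s (\<lambda>s2 t2. 1 + (1 + (t + t2)) \<le> 3 * w + 20 \<and> snd s2 = snd s0 \<and>
    fst s2 0 = Z \<and> fst s2 3 = g \<and> fst s2 5 = p \<and> fst s2 6 = off \<and> fst s2 7 = M \<and> fst s2 8 = mask v \<and> fst s2 24 = 0)"
      by (rule wp_conseq[OF rest[OF s(1)]]) (use t s in auto)
  qed
qed

definition loaded :: "store \<Rightarrow> bool" where
  "loaded s \<longleftrightarrow> fst s 1 = n \<and> fst s 2 = D \<and> fst s 3 = g \<and> fst s 5 = p \<and> fst s 6 = off \<and> fst s 7 = M \<and>
     fst s 8 = mask v \<and> fst s 9 = N \<and> (\<forall>\<sigma><2. \<forall>i<n. \<forall>x<D. snd s (1, \<sigma>, i, x, 0) = F \<sigma> i x)"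

lemma loaded_agree:
  assumes "loaded s" "agree X W s s'" "X \<inter> {1, 2, 3, 5, 6, 7, 8, 9} = {}" "1 \<notin> W"
  shows "loaded s'"
proof -
  have "fst s' x = fst s x" if "x \<in> {1, 2, 3, 5, 6, 7, 8, 9}" for x
    using assms that by (intro agree_reg) auto
  moreover have "snd s' (1, r) = snd s (1, r)" for r using assms by (intro agree_cell) auto
  ultimately show ?thesis using assms(1) by (simp add: loaded_def)
qed

lemma load_correct:
  assumes regs: "fst s0 3 = g" "fst s0 5 = p" "fst s0 6 = off" "fst s0 7 = M" "fst s0 8 = mask v"
    and inp: "\<And>a. a < 2 + 2 * (n * D) \<Longrightarrow> snd s0 (0, 0, 0, 0, a) = nat (take_bit w (min_plus_input n D A B ! a))"
  shows "wp load s0 (\<lambda>s t. t \<le> n * (4 * D + 4) + 5 \<and> loaded s)"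
proof -
  let ?xs = "min_plus_input n D A B"
  have sm: "nat (take_bit w (int a)) = a" if "a < 2 ^ w" for a
    using that by (simp add: of_nat_take_bit[symmetric] take_bit_nat_eq_self)
  have c: "a < 2 ^ w" "a < Z" if "a \<le> 100" for a :: nat using that bounds(1,6) by linarith+
  have i01: "snd s0 (0, 0, 0, 0, 0) = n" "snd s0 (0, 0, 0, 0, 1) = D"
    using inp[of 0, unfolded nth_min_plus_input(1)] inp[of 1, unfolded nth_min_plus_input(2)]
      sm[OF bounds(5)] sm[OF lessW'[OF bounds(3)]] by simp_all
  have iA: "take_bit w (snd s0 (0, 0, 0, 0, 2 + (i * D + x)) + off) = F 0 i x"
    and iB: "take_bit w (snd s0 (0, 0, 0, 0, 2 + n * D + (x * n + i)) + off) = F 1 i x"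
    and ltA: "2 + (i * D + x) < Z" and ltB: "2 + n * D + (x * n + i) < Z"
    if ix: "i < n" "x < D" for i x
  proof -
    have l1: "i * D + x < n * D" using ix by (intro grid_index_less)
    have l2: "x * n + i < n * D" using grid_index_less[OF ix(2,1)] by (simp add: mult.commute)
    show "2 + (i * D + x) < Z" "2 + n * D + (x * n + i) < Z" using l1 l2 bounds(19) by linarith+
    have ab: "\<bar>A i x\<bar> \<le> int off" "\<bar>B x i\<bar> \<le> int off" using A_le B_le ix by (simp_all add: off_def)
    have "2 * off < 2 ^ w" 
    proof -
      have "2 * off \<le> M" by (simp add: M_def off_def p_def power_add)
      then show ?thesis using lessW'[OF bounds(8)] by linarith
    qed
    then have o2: "2 * int off < 2 ^ w" by (metis of_nat_less_numeral_power_cancel_iff of_nat_mult of_nat_numeral)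
    have "snd s0 (0, 0, 0, 0, 2 + (i * D + x)) = nat (take_bit w (A i x))"
      using inp[of "2 + (i * D + x)"] l1 nth_min_plus_input(3)[OF ix] by simp
    then show "take_bit w (snd s0 (0, 0, 0, 0, 2 + (i * D + x)) + off) = F 0 i x"
      using take_bit_shifted[of "A i x" off w] ab o2 by (simp add: F_def)
    have "snd s0 (0, 0, 0, 0, 2 + n * D + (x * n + i)) = nat (take_bit w (B x i))"
    proof -
      have "2 + n * D + (x * n + i) < 2 + 2 * (n * D)" using l2 by linarith
      from inp[OF this] show ?thesis unfolding nth_min_plus_input(4)[OF ix(2,1)] .
    qed
    then show "take_bit w (snd s0 (0, 0, 0, 0, 2 + n * D + (x * n + i)) + off) = F 1 i x"
      using take_bit_shifted[of "B x i" off w] ab o2 by (simp add: F_def)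
  qed
  let ?s1 = "set_reg 9 N (set_reg 2 D (set_reg 1 n s0))"
  let ?body = "Write 1 (Con 0) (Var 15) (Var 17) (Con 0)
          (Bin ADD (inE (Plus (Con 2) (Plus (Times (Var 15) (Var 2)) (Var 17)))) (Var 6)) ;;
        Write 1 (Con 1) (Var 15) (Var 17) (Con 0)
          (Bin ADD (inE (Plus (Plus (Con 2) (Times (Var 1) (Var 2)))
             (Plus (Times (Var 17) (Var 1)) (Var 15)))) (Var 6))"
  define J where "J i x s \<longleftrightarrow> (\<forall>\<sigma><2. \<forall>i'<n. \<forall>x'<D. i' < i \<or> i' = i \<and> x' < x \<longrightarrow> snd s (1, \<sigma>, i', x', 0) = F \<sigma> i' x')"
    for i x and s :: store
  have J_reg [simp]: "J i x (set_reg a b s) = J i x s" for i x a b s by (simp add: J_def)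
  have J_next: "J i D s \<Longrightarrow> J (Suc i) 0 s" for i s unfolding J_def by (auto simp: less_Suc_eq)
  have loops: "wp (For 15 (Var 1) (For 17 (Var 2) ?body)) ?s1 (\<lambda>s t. t \<le> n * (4 * D + 4) + 2 \<and> loaded s)"
  proof (rule wp_For[where N = n and I = "\<lambda>i. J i 0" and T = "\<lambda>_. 4 * D + 2" and X = "{15, 17}" and Y = "{1}"])
    show "J 0 0 (set_reg 15 0 ?s1)" by (simp add: J_def)
    show "n < 2 ^ w" by (rule bounds(5))
    fix i s assume ag: "agree {15, 17} {1} ?s1 s"
    show "ok (Var 1) s \<and> ev (Var 1) s = n" using agree_reg[OF ag] by simp
    assume i: "i < n" "fst s 15 = i" and J: "J i 0 s"
    show "wp (For 17 (Var 2) ?body) s (\<lambda>s' t. t \<le> 4 * D + 2 \<and> J (Suc i) 0 (set_reg 15 (Suc i) s'))"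
    proof (rule wp_For[where N = D and I = "J i" and T = "\<lambda>_. 2" and X = "{17}" and Y = "{1}"])
      show "J i 0 (set_reg 17 0 s)" using J by simp
      show "D < 2 ^ w" by (rule lessW'[OF bounds(3)])
      fix x s' assume ag': "agree {17} {1} s s'"
      have r: "fst s' 1 = n" "fst s' 2 = D" "fst s' 6 = off" "fst s' 15 = i"
        using agree_reg[OF ag'] agree_reg[OF ag] i regs by simp_all
      have cell: "snd s' (0, r) = snd s0 (0, r)" for r using agree_cell[OF ag'] agree_cell[OF ag] by simp
      show "ok (Var 2) s' \<and> ev (Var 2) s' = D" using r by simp
      assume x: "x < D" "fst s' 17 = x" and J: "J i x s'"
      note ixF = iA[OF i(1) x(1)] iB[OF i(1) x(1)]
      have lt: "2 + (i * D + x) < Z" "2 + n * D + (x * n + i) < Z" using ltA ltB i x by blast+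
      have ltw: "2 + (i * D + x) < 2 ^ w" "2 + n * D + (x * n + i) < 2 ^ w" using lt lessW' by blast+
      then have ltw': "i * D + x < 2 ^ w" "i * D < 2 ^ w" "2 + n * D < 2 ^ w" "n * D < 2 ^ w" "x * n + i < 2 ^ w" "x * n < 2 ^ w"
        by linarith+
      have iZ: "i < Z" "x < Z" using i x bounds by linarith+
      let ?s2 = "set_cell (1, 0, i, x, 0) (F 0 i x) s'"
      have e1: "ev (Bin ADD (inE (Plus (Con 2) (Plus (Times (Var 15) (Var 2)) (Var 17)))) (Var 6)) s' = F 0 i x"
         "ok (Bin ADD (inE (Plus (Con 2) (Plus (Times (Var 15) (Var 2)) (Var 17)))) (Var 6)) s'"
        using r x cell ixF lt ltw ltw' c[of 0] c[of 2] by (simp_all add: inE_def)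
      have e2: "ev (Bin ADD (inE (Plus (Plus (Con 2) (Times (Var 1) (Var 2)))
             (Plus (Times (Var 17) (Var 1)) (Var 15)))) (Var 6)) ?s2 = F 1 i x"
         "ok (Bin ADD (inE (Plus (Plus (Con 2) (Times (Var 1) (Var 2)))
             (Plus (Times (Var 17) (Var 1)) (Var 15)))) (Var 6)) ?s2"
        using r x cell ixF lt ltw ltw' c[of 0] c[of 2] by (simp_all add: inE_def)
      let ?s3 = "set_cell (1, 1, i, x, 0) (F 1 i x) ?s2"
      have J3: "J i (Suc x) ?s3" using J unfolding J_def by (auto simp: less_Suc_eq less_2_cases_iff)
      show "wp ?body s' (\<lambda>s' t. t \<le> 2 \<and> J i (Suc x) (set_reg 17 (Suc x) s'))"
        apply (rule wp_Seq, rule wp_Write)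
          apply (use r x iZ c[of 0] c[of 1] in simp)
         apply (rule e1(2))
        apply (unfold e1(1))
        apply (rule wp_Write)
          apply (use r x iZ c[of 0] c[of 1] in simp)
         apply (use e2(2) r x in simp)
        using e2(1) r x J3 by simp
    qed (use J_next in auto)
  next
    fix s t' assume ag: "agree {15, 17} {1} ?s1 s" and J: "J n 0 s" and t': "t' \<le> (\<Sum>i<n. 4 * D + 2 + 2) + 2"
    have "loaded s" unfolding loaded_def using agree_reg[OF ag] regs J unfolding J_def by simp
    then show "t' \<le> n * (4 * D + 4) + 2 \<and> loaded s" using t' by (simp add: algebra_simps)
  qed auto
  have n4: "4 * n + 6 < 2 ^ w" "4 * n < 2 ^ w" using lessW'[OF bounds(7)] by linarith+
  have a1: "ev (inE (Con 0)) s0 = n" "ok (inE (Con 0)) s0" using i01 c[of 0] by (simp_all add: inE_def)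
  let ?t1 = "set_reg 1 n s0"
  have a2: "ev (inE (Con 1)) ?t1 = D" "ok (inE (Con 1)) ?t1" using i01 c[of 0] c[of 1] by (simp_all add: inE_def)
  let ?t2 = "set_reg 2 D ?t1"
  have a3: "ev (Plus (Times (Con 4) (Var 1)) (Con 6)) ?t2 = N" "ok (Plus (Times (Con 4) (Var 1)) (Con 6)) ?t2"
    using n4 c[of 4] c[of 6] by (simp_all add: N_def)
  show ?thesis unfolding load_def
    by (rule wp_Seq, rule wp_Assign[OF a1(2)], unfold a1(1), rule wp_Seq, rule wp_Assign[OF a2(2)], unfold a2(1),
        rule wp_Seq, rule wp_Assign[OF a3(2)], unfold a3(1), rule wp_conseq[OF loops]) simp
qed

lemma wp_grid:
  assumes n1: "fst s0 1 = n" and X: "modified cm \<subseteq> X" "X \<inter> {1, 15, 16} = {}" and W: "written cm \<subseteq> W"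
    and ins: "\<And>i j s x a. x \<in> {15, 16} \<Longrightarrow> J i j (set_reg x a s) = J i j s"
    and init: "J 0 0 s0"
    and body: "\<And>i j s. i < n \<Longrightarrow> j < n \<Longrightarrow> agree (X \<union> {15, 16}) W s0 s \<Longrightarrow> fst s 15 = i \<Longrightarrow> fst s 16 = j \<Longrightarrow>
       J i j s \<Longrightarrow> wp cm s (\<lambda>s' t. t \<le> T \<and> J i (Suc j) s')"
    and nxt: "\<And>i s. J i n s \<Longrightarrow> J (Suc i) 0 s"
    and fin: "\<And>s t. agree (X \<union> {15, 16}) W s0 s \<Longrightarrow> J n 0 s \<Longrightarrow> t \<le> n * (n * (T + 2) + 4) + 2 \<Longrightarrow> Q s t"
  shows "wp (grid cm) s0 Q"
  unfolding grid_def
proof (rule wp_For[where N = n and I = "\<lambda>i. J i 0" and T = "\<lambda>_. n * (T + 2) + 2" and X = "X \<union> {15, 16}" and Y = W])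
  show "n < 2 ^ w" by (rule bounds(5))
  show "J 0 0 (set_reg 15 0 s0)" using init ins by simp
  fix i s assume ag: "agree (X \<union> {15, 16}) W s0 s"
  have s1: "fst s 1 = n" using agree_reg[OF ag, of 1] X n1 by auto
  then show "ok (Var 1) s \<and> ev (Var 1) s = n" by simp
  assume i: "i < n" "fst s 15 = i" and J: "J i 0 s"
  show "wp (For 16 (Var 1) cm) s (\<lambda>s' t. t \<le> n * (T + 2) + 2 \<and> J (Suc i) 0 (set_reg 15 (Suc i) s'))"
  proof (rule wp_For[where N = n and I = "J i" and T = "\<lambda>_. T" and X = "X \<union> {16}" and Y = W])
    show "n < 2 ^ w" by (rule bounds(5))
    show "J i 0 (set_reg 16 0 s)" using J ins by simp
    fix j s' assume ag': "agree (X \<union> {16}) W s s'"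
    have "fst s' 1 = n" using agree_reg[OF ag', of 1] X s1 by auto
    then show "ok (Var 1) s' \<and> ev (Var 1) s' = n" by simp
    assume j: "j < n" "fst s' 16 = j" and J: "J i j s'"
    have ag2: "agree (X \<union> {15, 16}) W s0 s'" by (rule agree_mono[OF agree_trans[OF ag ag']]) auto
    have "fst s' 15 = i" using agree_reg[OF ag', of 15] X i by auto
    then show "wp cm s' (\<lambda>s' t. t \<le> T \<and> J i (Suc j) (set_reg 16 (Suc j) s'))"
      using body[OF i(1) j(1) ag2 _ j(2) J] ins by simp
  qed (use X W ins nxt in auto)
next
  fix s t assume "agree (X \<union> {15, 16}) W s0 s" "J n 0 s" "t \<le> (\<Sum>i<n. n * (T + 2) + 2 + 2) + 2"
  then show "Q s t" by (intro fin) (simp_all add: algebra_simps)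
qed (use X W in auto)

end

context reduction begin

abbreviation cm :: "nat \<Rightarrow> nat \<Rightarrow> nat \<Rightarrow> nat" where
  "cm \<equiv> scaled_min F D"

abbreviation PT :: nat where
  "PT \<equiv> phase_time n D g d mr P TT"

text \<open>Phase \<open>ph\<close> uses the table rows \<open>2 * ph\<close> and
  \<open>2 * ph + 1\<close>. With three phases per level, level \<open>it\<close> begins at row
  \<open>6 * it\<close>.\<close>

definition fresh_from :: "nat \<Rightarrow> store \<Rightarrow> bool" where
  "fresh_from ps0 s \<longleftrightarrow> (\<forall>cl r. fst s 24 \<le> cl \<longrightarrow> snd s (9, cl, r) = 0) \<and>
     (\<forall>tg ps r. tg \<in> {2, 5} \<longrightarrow> ps0 \<le> ps \<longrightarrow> snd s (tg, ps, r) = 0)"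

definition level_inv :: "nat \<Rightarrow> store \<Rightarrow> bool" where
  "level_inv it s \<longleftrightarrow> (\<forall>i<n. \<forall>j<n. snd s (6, i, j, 0, 0) = cm (p - it) i j) \<and>
     fst s 24 \<le> 3 * it * (g * g) \<and> fresh_from (6 * it) s"

lemma cm_less: assumes "i < n" "j < n" shows "cm l i j < 2 * 2 ^ p"
proof -
  have "cm l i j \<le> F 0 i 0 div 2 ^ l + F 1 j 0 div 2 ^ l" using D0 by (rule scaled_min_le)
  also have "\<dots> \<le> F 0 i 0 + F 1 j 0" by (intro add_mono div_le_dividend)
  also have "\<dots> < 2 ^ p + 2 ^ p" using F_less[of 0 i 0] F_less[of 1 j 0] assms D0 by (intro add_strict_mono) auto
  finally show ?thesis by simp
qed

lemma con_less': "a \<le> 100 \<Longrightarrow> a < 2 ^ w" "a \<le> 100 \<Longrightarrow> a < Z" for a :: nat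
  using bounds(1,6) by linarith+

text \<open>Pairs whose minimum is not at offset \<open>tt\<close> are only guaranteed to keep
  genuine sums that do not increase; another offset takes care of them.\<close>

lemma one_phase:
  assumes ld: "loaded s0" and it: "it < p" and tt: "tt < 3" and sh: "sh = p - 1 - it"
    and r: "fst s0 10 = it" "fst s0 11 = tt" "fst s0 13 = sh"
    and prev: "\<And>i j. i < n \<Longrightarrow> j < n \<Longrightarrow> snd s0 (6, i, j, 0, 0) = cm (Suc sh) i j"
    and cl: "fst s0 24 \<le> (3 * it + tt) * (g * g)" and fresh: "fresh_from (6 * it + 2 * tt) s0"
    and sums: "\<And>i j. i < n \<Longrightarrow> j < n \<Longrightarrow> \<exists>x<D. snd s0 (10, i, j, 0, 0) = F 0 i x div 2 ^ sh + F 1 j x div 2 ^ sh"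
  shows "wp (Assign 14 (Plus (Times (Con 3) (Var 10)) (Var 11)) ;; phase_com mr P) s0 (\<lambda>s t. t \<le> PT + 1 \<and>
     (\<forall>i<n. \<forall>j<n. \<exists>x<D. snd s (10, i, j, 0, 0) = F 0 i x div 2 ^ sh + F 1 j x div 2 ^ sh) \<and>
     (\<forall>i<n. \<forall>j<n. snd s (10, i, j, 0, 0) \<le> snd s0 (10, i, j, 0, 0)) \<and>
     (\<forall>i<n. \<forall>j<n. cm sh i j = 2 * cm (Suc sh) i j + tt \<longrightarrow> snd s (10, i, j, 0, 0) \<le> cm sh i j) \<and>
     fst s 24 \<le> (3 * it + Suc tt) * (g * g) \<and> fresh_from (6 * it + 2 * Suc tt) s)"
proof -
  let ?ph = "3 * it + tt" and ?f = "\<lambda>\<sigma> i x. F \<sigma> i x div 2 ^ sh" and ?Y = "\<lambda>i j. 2 * cm (Suc sh) i j + tt"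
  let ?cl0 = "fst s0 24"
  have ph: "?ph < 3 * p" using it tt by linarith
  have phZ: "6 * p + 10 < Z" using big(5) by (simp add: p_def Z_def)
  have phb: "2 * ?ph + 1 < Z"
  proof -
    have "2 * ?ph = 6 * it + 2 * tt" by simp
    moreover have "6 * it + 2 * tt + 1 < Z" using it tt phZ by linarith
    ultimately show ?thesis by linarith
  qed
  \<comment> \<open>There are \<open>3 * p\<close> phases with at most \<open>g * g\<close> calls
    each; one of the size conditions on \<open>K\<close> makes room for that many rows.\<close>
  have clZ: "?cl0 + g * g < Z"
  proof -
    have "?cl0 + g * g \<le> Suc ?ph * (g * g)" using cl by simp
    also have "\<dots> \<le> 3 * p * (g * g)" using ph by (intro mult_right_mono) auto
    also have "\<dots> < Z" using big(6) unfolding p_def g_def Z_def .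
    finally show ?thesis .
  qed
  have MZ: "M = 8 * 2 ^ p" by (simp add: M_def)
  have Yl: "?Y i j < Z" if "i < n" "j < n" for i j
    using cm_less[OF that, of "Suc sh"] tt bounds(17) MZ one_le_power[of "2::nat" p] by linarith
  have fl: "?f \<sigma> i x < Z \<and> ?f \<sigma> i x \<le> 2 ^ p" if "\<sigma> < 2" "i < n" "x < D" for \<sigma> i x
  proof -
    have "?f \<sigma> i x \<le> F \<sigma> i x" by (rule div_le_dividend)
    then show ?thesis using F_less[OF that] bounds(8) MZ by linarith
  qed
  have KW: "2 ^ (K * L) \<le> (2::nat) ^ w" using bounds(6) by (simp add: Z_def)
  interpret PH: phase_calls w Z n D g d ?ph sh tt ?f ?Y v mr P "2 ^ p" M N TT ?cl0
  proof (unfold_locales, goal_cases)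
    case 7
    then show ?case using phb by simp
  next
    case (9 \<sigma> i k)
    then show ?case using fl by blast
  next
    case (10 i j)
    then show ?case using Yl by blast
  next
    case (11 \<sigma> i)
    then show ?case by (rule F_card)
  next
    case 12
    have "v < w" using bounds(14) by (simp add: w_def)
    then show ?case by simp
  next
    case (15 i)
    then show ?case by (rule regs)
  next
    case (16 i)
    then show ?case using const_less KW by (meson less_le_trans)
  next
    case 17
    then show ?case using len KW by (meson less_le_trans)
  next
    case (19 \<sigma> i k)
    then show ?case using fl by blast
  next
    case 23
    then show ?case using M3 by (simp add: M_def p_def v_def)
  next
    case (27 E wt)
    then show ?case using solver[of E wt] unfolding N_def v_def M_def p_def by blast
  qed (use n0 D0 bounds dD clZ Nv in \<open>auto simp: g_def M_def N_def v_def\<close>)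
  let ?s1 = "set_reg 14 ?ph s0"
  have env: "PH.env ?s1" unfolding PH.env_def using ld r prev
    by (auto simp: loaded_def drop_bit_eq_div)
  have rg: "fst ?s1 7 = M" "fst ?s1 8 = mask v" "fst ?s1 9 = N" "fst ?s1 24 = ?cl0" using ld by (auto simp: loaded_def)
  have so: "PH.sums_ok ?s1" using sums by (simp add: PH.sums_ok_def)
  have main: "wp (phase_com mr P) ?s1 (\<lambda>s t. t \<le> PT \<and> PH.sums_ok s \<and> PH.below s ?s1 \<and>
     (\<forall>i<n. \<forall>j<n. \<forall>k<D. ?f 0 i k + ?f 1 j k = ?Y i j \<longrightarrow> snd s (10, i, j, 0, 0) \<le> ?Y i j) \<and>
     fst s 24 \<le> ?cl0 + g * g \<and> (\<forall>c r. fst s 24 \<le> c \<longrightarrow> snd s (9, c, r) = 0) \<and>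
     (\<forall>tg ps r. tg \<in> {2, 5} \<longrightarrow> ps \<notin> {2 * ?ph, 2 * ?ph + 1} \<longrightarrow> snd s (tg, ps, r) = snd ?s1 (tg, ps, r)))"
  proof (rule PH.phase_correct[OF env rg _ _ so])
    fix tg ps r assume "tg \<in> {2, 5::nat}" "ps \<in> {2 * ?ph, 2 * ?ph + 1}"
    then show "snd ?s1 (tg, ps, r) = 0" using fresh unfolding fresh_from_def by auto
  next
    fix c r assume "?cl0 \<le> c"
    then show "snd ?s1 (9, c, r) = 0" using fresh unfolding fresh_from_def by auto
  qed
  have p3: "3 * it < 2 ^ w" "3 * it + tt < 2 ^ w" using ph phZ lessW' bounds(6) by linarith+
  have e: "ev (Plus (Times (Con 3) (Var 10)) (Var 11)) s0 = ?ph" "ok (Plus (Times (Con 3) (Var 10)) (Var 11)) s0"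
    using r p3 con_less'(1)[of 3] by simp_all
  show ?thesis
  proof (rule wp_Seq, rule wp_Assign[OF e(2)], unfold e(1), rule wp_conseq[OF main], elim conjE, intro conjI)
    fix s t assume t: "t \<le> PT" and so: "PH.sums_ok s" and be: "PH.below s ?s1"
      and comp: "\<forall>i<n. \<forall>j<n. \<forall>k<D. ?f 0 i k + ?f 1 j k = ?Y i j \<longrightarrow> snd s (10, i, j, 0, 0) \<le> ?Y i j"
      and cl': "fst s 24 \<le> ?cl0 + g * g" and f9: "\<forall>c r. fst s 24 \<le> c \<longrightarrow> snd s (9, c, r) = 0"
      and f25: "\<forall>tg ps r. tg \<in> {2, 5} \<longrightarrow> ps \<notin> {2 * ?ph, 2 * ?ph + 1} \<longrightarrow> snd s (tg, ps, r) = snd ?s1 (tg, ps, r)"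
    show "1 + t \<le> PT + 1" using t by simp
    show "\<forall>i<n. \<forall>j<n. \<exists>x<D. snd s (10, i, j, 0, 0) = F 0 i x div 2 ^ sh + F 1 j x div 2 ^ sh"
      using so by (simp add: PH.sums_ok_def)
    show "\<forall>i<n. \<forall>j<n. snd s (10, i, j, 0, 0) \<le> snd s0 (10, i, j, 0, 0)"
      using be by (simp add: PH.below_def)
    show "\<forall>i<n. \<forall>j<n. cm sh i j = 2 * cm (Suc sh) i j + tt \<longrightarrow> snd s (10, i, j, 0, 0) \<le> cm sh i j"
    proof (intro allI impI)
      fix i j assume h: "i < n" "j < n" "cm sh i j = ?Y i j"
      \<comment> \<open>If the minimum is equal to the target, its minimiser provides a sum of the
        kind that the phase treats.\<close>
      obtain x where x: "x < D" "cm sh i j = ?f 0 i x + ?f 1 j x" using scaled_min_attained[OF D0] .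
      have "?f 0 i x + ?f 1 j x = ?Y i j" using x(2) h(3) by (rule subst)
      then have "snd s (10, i, j, 0, 0) \<le> ?Y i j" using comp h(1,2) x(1) by blast
      then show "snd s (10, i, j, 0, 0) \<le> cm sh i j" unfolding h(3) .
    qed
    show "fst s 24 \<le> (3 * it + Suc tt) * (g * g)" using cl' cl by simp
    have fr: "snd s (tg, ps, r) = 0" if tp: "tg \<in> {2, 5}" "6 * it + 2 * Suc tt \<le> ps" for tg ps r
    proof -
      have ps: "ps \<notin> {2 * ?ph, 2 * ?ph + 1}" "6 * it + 2 * tt \<le> ps" using tp(2) by auto
      have "snd s (tg, ps, r) = snd ?s1 (tg, ps, r)" using f25 tp(1) ps(1) by blast
      also have "snd ?s1 = snd s0" by simp
      also have "snd s0 (tg, ps, r) = 0" by (rule fresh[unfolded fresh_from_def, THEN conjunct2, rule_format, OF tp(1) ps(2)])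
      finally show ?thesis .
    qed
    show "fresh_from (6 * it + 2 * Suc tt) s" unfolding fresh_from_def
    proof (intro conjI allI impI)
      fix cl r assume "fst s 24 \<le> cl"
      then show "snd s (9, cl, r) = 0" by (rule f9[rule_format])
    next
      fix tg ps :: nat and r assume "tg \<in> {2, 5}" "6 * it + 2 * Suc tt \<le> ps"
      then show "snd s (tg, ps, r) = 0" by (rule fr)
    qed
  qed
qed

lemma level_correct:
  assumes ld: "loaded s0" and it: "it < p" "fst s0 10 = it" and inv: "level_inv it s0"
  shows "wp (level mr P) s0 (\<lambda>s t. t \<le> 3 * PT + 6 * (n * n) + 8 * n + 20 \<and> level_inv (Suc it) s)"
proof -
  define sh where "sh = p - 1 - it"
  have psh: "p - it = Suc sh" "p - Suc it = sh" using it by (simp_all add: sh_def)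
  let ?f = "\<lambda>\<sigma> i x. F \<sigma> i x div 2 ^ sh"
  let ?s1 = "set_reg 13 sh s0"
  let ?c1 = "grid (Write 10 (Var 15) (Var 16) (Con 0) (Con 0) (Plus (fE 0 (Var 15) (Con 0)) (fE 1 (Var 16) (Con 0))))"
  let ?body = "Assign 14 (Plus (Times (Con 3) (Var 10)) (Var 11)) ;; phase_com mr P"
  let ?c2 = "For 11 (Con 3) ?body"
  let ?c3 = "grid (Write 6 (Var 15) (Var 16) (Con 0) (Con 0) (Rd 10 (Var 15) (Var 16) (Con 0) (Con 0)))"
  define csum where "csum s \<longleftrightarrow> (\<forall>i<n. \<forall>j<n. \<exists>x<D. snd s (10, i, j, 0, 0) = ?f 0 i x + ?f 1 j x)" for s :: store
  have ld1: "loaded ?s1" using ld by (simp add: loaded_def)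
  have c1: "wp ?c1 ?s1 (\<lambda>s t. t \<le> n * (3 * n + 4) + 2 \<and> csum s)"
  proof (rule wp_grid[where T = 1 and X = "{}" and W = "{10}" and
        J = "\<lambda>i j s. \<forall>i'<n. \<forall>j'<n. i' < i \<or> i' = i \<and> j' < j \<longrightarrow> snd s (10, i', j', 0, 0) = ?f 0 i' 0 + ?f 1 j' 0"])
    show "fst ?s1 1 = n" using ld1 by (simp add: loaded_def)
    fix i j s assume ij: "i < n" "j < n" and ag: "agree ({} \<union> {15, 16}) {10} ?s1 s" and r: "fst s 15 = i" "fst s 16 = j"
      and J: "\<forall>i'<n. \<forall>j'<n. i' < i \<or> i' = i \<and> j' < j \<longrightarrow> snd s (10, i', j', 0, 0) = ?f 0 i' 0 + ?f 1 j' 0"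
    have l: "loaded s" by (rule loaded_agree[OF ld1 ag]) auto
    have s13: "fst s 13 = sh" using agree_reg[OF ag] by simp
    have z: "i < Z" "j < Z" using ij bounds(2) by linarith+
    have Fv: "snd s (1, 0, i, 0, 0) = F 0 i 0" "snd s (1, Suc 0, j, 0, 0) = F 1 j 0" using l ij D0 by (auto simp: loaded_def)
    have e: "ev (fE 0 (Var 15) (Con 0)) s = ?f 0 i 0" "ok (fE 0 (Var 15) (Con 0)) s"
      "ev (fE 1 (Var 16) (Con 0)) s = ?f 1 j 0" "ok (fE 1 (Var 16) (Con 0)) s"
      using Fv r s13 z con_less'[of 0] con_less'[of 1] by (simp_all add: fE_def drop_bit_eq_div)
    have "?f 0 i 0 \<le> F 0 i 0" "?f 1 j 0 \<le> F 1 j 0" by (rule div_le_dividend)+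
    then have "?f 0 i 0 + ?f 1 j 0 < 2 ^ p + 2 ^ p" using F_less[of 0 i 0] F_less[of 1 j 0] ij D0 by linarith
    then have lt: "?f 0 i 0 + ?f 1 j 0 < 2 ^ w" using lessW'[OF bounds(8)] by (simp add: M_def)
    show "wp (Write 10 (Var 15) (Var 16) (Con 0) (Con 0) (Plus (fE 0 (Var 15) (Con 0)) (fE 1 (Var 16) (Con 0)))) s
      (\<lambda>s' t. t \<le> 1 \<and> (\<forall>i'<n. \<forall>j'<n. i' < i \<or> i' = i \<and> j' < Suc j \<longrightarrow> snd s' (10, i', j', 0, 0) = ?f 0 i' 0 + ?f 1 j' 0))"
    proof (rule wp_Write)
      show "ok (Rd 10 (Var 15) (Var 16) (Con 0) (Con 0)) s" using r z con_less'[of 0] con_less'[of 10] by simp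
      show "ok (Plus (fE 0 (Var 15) (Con 0)) (fE 1 (Var 16) (Con 0))) s" using e lt by simp
    qed (use e r J in \<open>auto simp: less_Suc_eq\<close>)
  next
    fix s :: store and t :: nat assume J: "\<forall>i'<n. \<forall>j'<n. i' < n \<or> i' = n \<and> j' < 0 \<longrightarrow> snd s (10, i', j', 0, 0) = ?f 0 i' 0 + ?f 1 j' 0"
      and t: "t \<le> n * (n * (1 + 2) + 4) + 2"
    show "t \<le> n * (3 * n + 4) + 2 \<and> csum s" unfolding csum_def using J t D0 by auto
  qed (auto simp: less_Suc_eq)
  define I where "I tt s \<longleftrightarrow> csum s \<and> (\<forall>i<n. \<forall>j<n. \<forall>t'<tt. cm sh i j = 2 * cm (Suc sh) i j + t' \<longrightarrow>
      snd s (10, i, j, 0, 0) \<le> cm sh i j) \<and> fst s 24 \<le> (3 * it + tt) * (g * g) \<and> fresh_from (6 * it + 2 * tt) s" for tt s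
  have I_reg [simp]: "I tt (set_reg x a s) = I tt s" if "x \<noteq> 24" for tt x a s
    using that by (simp add: I_def csum_def fresh_from_def)
  let ?X = "{11, 14} \<union> {15..32} \<union> {40..}" and ?W = "{2, 3, 4, 5, 7, 8, 9, 10}"
  have mb: "modified ?body \<subseteq> ?X" "11 \<notin> modified ?body" "written ?body \<subseteq> ?W"
    using modified_phase_com[of mr P] written_phase_com[of mr P] by auto
  have c2: "wp ?c2 s (\<lambda>s' t. t \<le> 3 * (PT + 3) + 2 \<and> I 3 s')"
    if l: "loaded s" and r: "fst s 10 = it" "fst s 13 = sh" and I0: "I 0 s"
      and pv: "\<And>i j. i < n \<Longrightarrow> j < n \<Longrightarrow> snd s (6, i, j, 0, 0) = cm (Suc sh) i j" for s
  proof (rule wp_For[where N = 3 and I = I and T = "\<lambda>_. PT + 1" and X = ?X and Y = ?W])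
    show "I 0 (set_reg 11 0 s)" using I0 by simp
    show "(3::nat) < 2 ^ w" by (rule con_less') simp
    fix tt s' assume ag: "agree ?X ?W s s'"
    show "ok (Con 3) s' \<and> ev (Con 3) s' = 3" using con_less'(1)[of 3] by simp
    assume tt: "tt < 3" "fst s' 11 = tt" and I: "I tt s'"
    have l': "loaded s'" by (rule loaded_agree[OF l ag]) auto
    have r': "fst s' 10 = it" "fst s' 13 = sh" using agree_reg[OF ag] r by simp_all
    have pv': "snd s' (6, i, j, 0, 0) = cm (Suc sh) i j" if "i < n" "j < n" for i j
      using agree_cell[OF ag, of 6] pv[OF that] by simp
    have so': "\<exists>x<D. snd s' (10, i, j, 0, 0) = ?f 0 i x + ?f 1 j x" if "i < n" "j < n" for i j
      using I that by (simp add: I_def csum_def)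
    have I2: "fst s' 24 \<le> (3 * it + tt) * (g * g)" "fresh_from (6 * it + 2 * tt) s'" using I by (simp_all add: I_def)
    show "wp ?body s' (\<lambda>s' t. t \<le> PT + 1 \<and> I (Suc tt) (set_reg 11 (Suc tt) s'))"
    proof (rule wp_conseq[OF one_phase[OF l' it(1) tt(1) sh_def r'(1) tt(2) r'(2) pv' I2 so']], assumption+, elim conjE, intro conjI)
      fix s2 t2 assume h: "\<forall>i<n. \<forall>j<n. \<exists>x<D. snd s2 (10, i, j, 0, 0) = ?f 0 i x + ?f 1 j x"
        "\<forall>i<n. \<forall>j<n. snd s2 (10, i, j, 0, 0) \<le> snd s' (10, i, j, 0, 0)"
        "\<forall>i<n. \<forall>j<n. cm sh i j = 2 * cm (Suc sh) i j + tt \<longrightarrow> snd s2 (10, i, j, 0, 0) \<le> cm sh i j"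
        "fst s2 24 \<le> (3 * it + Suc tt) * (g * g)" "fresh_from (6 * it + 2 * Suc tt) s2"
      have "snd s2 (10, i, j, 0, 0) \<le> cm sh i j"
        if q: "i < n" "j < n" "t' < Suc tt" "cm sh i j = 2 * cm (Suc sh) i j + t'" for i j t'
      proof (cases "t' = tt")
        case True
        then show ?thesis using h(3) q by blast
      next
        case False
        then have "snd s' (10, i, j, 0, 0) \<le> cm sh i j" using I q unfolding I_def by auto
        then show ?thesis using h(2) q order_trans by blast
      qed
      then have "I (Suc tt) s2" unfolding I_def csum_def using h by blast
      then show "I (Suc tt) (set_reg 11 (Suc tt) s2)" by simp
    qed
  next
    fix s' :: store and t :: nat assume "I 3 s'" "t \<le> (\<Sum>i<(3::nat). PT + 1 + 2) + 2"
    then show "t \<le> 3 * (PT + 3) + 2 \<and> I 3 s'" by simp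
  qed (use mb in auto)
  have c3: "wp ?c3 s (\<lambda>s' t. t \<le> n * (3 * n + 4) + 2 \<and> level_inv (Suc it) s')"
    if l: "loaded s" and I3: "I 3 s" for s
  proof (rule wp_grid[where T = 1 and X = "{}" and W = "{6}" and
        J = "\<lambda>i j s. \<forall>i'<n. \<forall>j'<n. i' < i \<or> i' = i \<and> j' < j \<longrightarrow> snd s (6, i', j', 0, 0) = cm sh i' j'"])
    show "fst s 1 = n" using l by (simp add: loaded_def)
    \<comment> \<open>Stored values are genuine sums, which gives one direction. For the other, one
      of the three targets is the minimum itself by \<open>scaled_min_step\<close>.\<close>
    have cur: "snd s (10, i, j, 0, 0) = cm sh i j" if ij: "i < n" "j < n" for i j
    proof (rule antisym)
      obtain x where x: "x < D" "snd s (10, i, j, 0, 0) = ?f 0 i x + ?f 1 j x" using I3 ij unfolding I_def csum_def by blast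
      show "cm sh i j \<le> snd s (10, i, j, 0, 0)" unfolding x(2) by (rule scaled_min_le[OF x(1)])
      have "2 * cm (Suc sh) i j \<le> cm sh i j" "cm sh i j \<le> 2 * cm (Suc sh) i j + 2" by (rule scaled_min_step[OF D0])+
      then have "\<exists>t'<3. cm sh i j = 2 * cm (Suc sh) i j + t'"
        by (intro exI[of _ "cm sh i j - 2 * cm (Suc sh) i j"]) linarith
      then show "snd s (10, i, j, 0, 0) \<le> cm sh i j" using I3 ij unfolding I_def by blast
    qed
    {
      fix i j s' assume ij: "i < n" "j < n" and ag: "agree ({} \<union> {15, 16}) {6} s s'" and r: "fst s' 15 = i" "fst s' 16 = j"
        and J: "\<forall>i'<n. \<forall>j'<n. i' < i \<or> i' = i \<and> j' < j \<longrightarrow> snd s' (6, i', j', 0, 0) = cm sh i' j'"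
      have z: "i < Z" "j < Z" using ij bounds(2) by linarith+
      have v: "snd s' (10, i, j, 0, 0) = cm sh i j" using agree_cell[OF ag, of 10] cur[OF ij] by simp
      show "wp (Write 6 (Var 15) (Var 16) (Con 0) (Con 0) (Rd 10 (Var 15) (Var 16) (Con 0) (Con 0))) s'
        (\<lambda>s' t. t \<le> 1 \<and> (\<forall>i'<n. \<forall>j'<n. i' < i \<or> i' = i \<and> j' < Suc j \<longrightarrow> snd s' (6, i', j', 0, 0) = cm sh i' j'))"
      proof (rule wp_Write)
        show "ok (Rd 6 (Var 15) (Var 16) (Con 0) (Con 0)) s'" using r z con_less'[of 0] con_less'[of 6] by simp
        show "ok (Rd 10 (Var 15) (Var 16) (Con 0) (Con 0)) s'" using r z con_less'[of 0] con_less'[of 10] by simp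
      qed (use v r J in \<open>auto simp: less_Suc_eq\<close>)
    next
      fix s' t assume ag: "agree ({} \<union> {15, 16}) {6} s s'"
        and J: "\<forall>i'<n. \<forall>j'<n. i' < n \<or> i' = n \<and> j' < 0 \<longrightarrow> snd s' (6, i', j', 0, 0) = cm sh i' j'"
        and t: "t \<le> n * (n * (1 + 2) + 4) + 2"
      have e24: "fst s' 24 = fst s 24" using agree_reg[OF ag] by simp
      have "snd s' (tg, r) = snd s (tg, r)" if "tg \<in> {2, 5, 9}" for tg r
        using agree_cell[OF ag, of tg] that by (cases r) auto
      then have "fresh_from (6 * it + 2 * 3) s'" using I3 e24 unfolding I_def fresh_from_def by auto
      moreover have "6 * it + 2 * 3 = 6 * Suc it" "3 * it + 3 = 3 * Suc it" by simp_all
      ultimately have "level_inv (Suc it) s'"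
        using J I3 e24 unfolding level_inv_def I_def psh by (simp only: mult_Suc_right) auto
      then show "t \<le> n * (3 * n + 4) + 2 \<and> level_inv (Suc it) s'" using t by simp
    }
  qed (auto simp: less_Suc_eq)
  have e: "ev (Minus (Minus (Var 5) (Con 1)) (Var 10)) s0 = sh" "ok (Minus (Minus (Var 5) (Con 1)) (Var 10)) s0"
  proof -
    have "fst s0 5 = p" "1 \<le> p" "p < 2 ^ w" using ld lessW'[OF bounds(10)] by (simp_all add: loaded_def p_def)
    then show "ev (Minus (Minus (Var 5) (Con 1)) (Var 10)) s0 = sh" "ok (Minus (Minus (Var 5) (Con 1)) (Var 10)) s0"
      using it con_less'(1)[of 1] by (auto simp: sh_def)
  qed
  show ?thesis unfolding level_def
  proof (rule wp_Seq, rule wp_Assign[OF e(2)], unfold e(1), rule wp_Seq, rule wp_conseq[OF c1])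
    fix s2 t2 assume ag2: "agree (modified ?c1) (written ?c1) ?s1 s2" and h2: "t2 \<le> n * (3 * n + 4) + 2 \<and> csum s2"
    have l2: "loaded s2" by (rule loaded_agree[OF ld1 ag2]) auto
    have r2: "fst s2 10 = it" "fst s2 13 = sh" "fst s2 24 = fst s0 24" using agree_reg[OF ag2] it by simp_all
    have same: "snd s2 (tg, r) = snd s0 (tg, r)" if "tg \<noteq> 10" for tg r using agree_cell[OF ag2, of tg] that by simp
    have fr: "fresh_from (6 * it) s2" using inv r2(3) same unfolding level_inv_def fresh_from_def by auto
    have "fst s0 24 \<le> 3 * it * (g * g)" using inv by (simp add: level_inv_def)
    then have I0: "I 0 s2" using h2 fr r2(3) unfolding I_def by simp
    have pv2: "snd s2 (6, i, j, 0, 0) = cm (Suc sh) i j" if "i < n" "j < n" for i j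
      using same[of 6] inv that unfolding level_inv_def psh by simp
    show "wp (?c2 ;; ?c3) s2 (\<lambda>s t. 1 + (t2 + t) \<le> 3 * PT + 6 * (n * n) + 8 * n + 20 \<and> level_inv (Suc it) s)"
    proof (rule wp_Seq, rule wp_conseq[OF c2[OF l2 r2(1,2) I0 pv2]], assumption+)
      fix s3 t3 assume ag3: "agree (modified ?c2) (written ?c2) s2 s3" and h3: "t3 \<le> 3 * (PT + 3) + 2 \<and> I 3 s3"
      have ag3': "agree ?X ?W s2 s3" by (rule agree_mono[OF ag3]) (use mb in auto)
      have l3: "loaded s3" by (rule loaded_agree[OF l2 ag3']) auto
      show "wp ?c3 s3 (\<lambda>s t. 1 + (t2 + (t3 + t)) \<le> 3 * PT + 6 * (n * n) + 8 * n + 20 \<and> level_inv (Suc it) s)"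
      proof (rule wp_conseq[OF c3[OF l3 conjunct2[OF h3]]], elim conjE, intro conjI)
        fix s4 t4 assume t4: "t4 \<le> n * (3 * n + 4) + 2"
        have nn: "n * (3 * n + 4) = 3 * (n * n) + 4 * n" by (simp add: algebra_simps)
        show "1 + (t2 + (t3 + t4)) \<le> 3 * PT + 6 * (n * n) + 8 * n + 20"
          using t4 conjunct1[OF h3] conjunct1[OF h2] unfolding nn add_mult_distrib2 by linarith
      qed
    qed
  qed
qed

text \<open>The offset enters once through each matrix, at every position alike, so the minimum is
  shifted by twice the offset.\<close>

lemma min_plus_eq: 
  assumes "i < n" "j < n" shows "int (cm 0 i j) = min_plus D A B i j + 2 * int off"
proof -
  have Fv: "int (F 0 i x + F 1 j x) = A i x + B x j + 2 * int off" if "x < D" for x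
  proof -
    have "\<bar>A i x\<bar> \<le> int off" "\<bar>B x j\<bar> \<le> int off"
      using A_le[OF assms(1) that] B_le[OF that assms(2)] by (simp_all add: off_def)
    then have "0 \<le> A i x + int off" "0 \<le> B x j + int off" by linarith+
    then show ?thesis by (simp add: F_def)
  qed
  have fin: "finite ((\<lambda>k. A i k + B k j) ` {..<D})" "(\<lambda>k. A i k + B k j) ` {..<D} \<noteq> {}" using D0 by auto
  obtain x where x: "x < D" "cm 0 i j = F 0 i x div 2 ^ 0 + F 1 j x div 2 ^ 0" using scaled_min_attained[OF D0] .
  have "min_plus D A B i j \<le> A i x + B x j" unfolding min_plus_def using fin x by (intro Min_le) auto
  moreover have "min_plus D A B i j \<in> (\<lambda>k. A i k + B k j) ` {..<D}" unfolding min_plus_def using fin by (intro Min_in)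
  then obtain y where y: "y < D" "min_plus D A B i j = A i y + B y j" by auto
  have "cm 0 i j \<le> F 0 i y div 2 ^ 0 + F 1 j y div 2 ^ 0" by (rule scaled_min_le[OF y(1)])
  then have "int (cm 0 i j) \<le> int (F 0 i y + F 1 j y)" by simp
  ultimately show ?thesis using Fv[OF x(1)] Fv[OF y(1)] x(2) y(2) by simp
qed

lemma emit_correct:
  assumes ld: "loaded s0" and res: "\<And>i j. i < n \<Longrightarrow> j < n \<Longrightarrow> snd s0 (6, i, j, 0, 0) = cm 0 i j"
  shows "wp emit s0 (\<lambda>s t. t \<le> n * (3 * n + 4) + 2 \<and>
    (\<forall>i<n. \<forall>j<n. snd s (0, 0, 0, 0, i * n + j) = nat (take_bit w (min_plus D A B i j))))"
  unfolding emit_def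
proof (rule wp_grid[where T = 1 and X = "{}" and W = "{0}" and
      J = "\<lambda>i j s. \<forall>i'<n. \<forall>j'<n. i' < i \<or> i' = i \<and> j' < j \<longrightarrow>
         snd s (0, 0, 0, 0, i' * n + j') = nat (take_bit w (min_plus D A B i' j'))"])
  show "fst s0 1 = n" using ld by (simp add: loaded_def)
  fix i j s assume ij: "i < n" "j < n" and ag: "agree ({} \<union> {15, 16}) {0} s0 s" and r: "fst s 15 = i" "fst s 16 = j"
    and J: "\<forall>i'<n. \<forall>j'<n. i' < i \<or> i' = i \<and> j' < j \<longrightarrow>
         snd s (0, 0, 0, 0, i' * n + j') = nat (take_bit w (min_plus D A B i' j'))"
  have l: "loaded s" by (rule loaded_agree[OF ld ag]) auto
  have r': "fst s 1 = n" "fst s 6 = off" using l by (simp_all add: loaded_def)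
  have z: "i < Z" "j < Z" using ij bounds(2) by linarith+
  have v: "snd s (6, i, j, 0, 0) = cm 0 i j" using agree_cell[OF ag, of 6] res[OF ij] by simp
  have "i * n + j < n * n" using ij by (intro grid_index_less)
  moreover have "n * n \<le> N * N" by (intro mult_mono) (auto simp: N_def)
  ultimately have aZ: "i * n + j < Z" using bounds(16) by linarith
  then have aw: "i * n + j < 2 ^ w" "i * n < 2 ^ w" using lessW'[OF aZ] by linarith+
  have "off + off \<le> M" by (simp add: M_def off_def p_def power_add)
  then have ow: "off + off < 2 ^ w" using lessW'[OF bounds(8)] by linarith
  let ?E = "Bin SUB (Rd 6 (Var 15) (Var 16) (Con 0) (Con 0)) (Plus (Var 6) (Var 6))"
  have "int (cm 0 i j) - int (off + off) = min_plus D A B i j" using min_plus_eq[OF ij] by simp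
  then have e: "ev ?E s = nat (take_bit w (min_plus D A B i j))" using v r r' by simp
  have ok: "ok ?E s" using r r' z ow con_less'[of 0] con_less'[of 6] by simp
  have idx: "i' = i \<and> j' = j" if "i' * n + j' = i * n + j" "j' < n" for i' j' using grid_index_inj that ij by blast
  show "wp (Write 0 (Con 0) (Con 0) (Con 0) (Plus (Times (Var 15) (Var 1)) (Var 16)) ?E) s
     (\<lambda>s' t. t \<le> 1 \<and> (\<forall>i'<n. \<forall>j'<n. i' < i \<or> i' = i \<and> j' < Suc j \<longrightarrow>
         snd s' (0, 0, 0, 0, i' * n + j') = nat (take_bit w (min_plus D A B i' j'))))"
  proof (rule wp_Write[OF _ ok], unfold e)
    show "ok (Rd 0 (Con 0) (Con 0) (Con 0) (Plus (Times (Var 15) (Var 1)) (Var 16))) s"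
      using r r' aw aZ con_less'[of 0] by simp
  qed (use r r' J idx in \<open>auto simp: less_Suc_eq\<close>)
qed (auto simp: less_Suc_eq)

definition main_time :: nat where
  "main_time = (n * (4 * D + 4) + 5) + ((p * (3 * PT + 6 * (n * n) + 8 * n + 22) + 2) + (n * (3 * n + 4) + 2))"

lemma main_correct:
  assumes regs: "fst s0 3 = g" "fst s0 5 = p" "fst s0 6 = off" "fst s0 7 = M" "fst s0 8 = mask v" "fst s0 24 = 0"
    and inp: "\<And>a. a < 2 + 2 * (n * D) \<Longrightarrow> snd s0 (0, 0, 0, 0, a) = nat (take_bit w (min_plus_input n D A B ! a))"
    and zero: "\<And>tg r. tg \<noteq> 0 \<Longrightarrow> snd s0 (tg, r) = 0"
  shows "wp (main mr P) s0 (\<lambda>s t. t \<le> main_time \<and>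
    (\<forall>i<n. \<forall>j<n. snd s (0, 0, 0, 0, i * n + j) = nat (take_bit w (min_plus D A B i j))))"
proof -
  let ?T = "3 * PT + 6 * (n * n) + 8 * n + 20"
  let ?X = "{10, 11, 13, 14} \<union> {15..32} \<union> {40..}" and ?W = "{2, 3, 4, 5, 6, 7, 8, 9, 10}"
  have ml: "modified (level mr P) \<subseteq> ?X" "10 \<notin> modified (level mr P)" "written (level mr P) \<subseteq> ?W"
    using modified_level[of mr P] written_level[of mr P] by auto
  have lev: "wp (For 10 (Var 5) (level mr P)) s (\<lambda>s' t. t \<le> p * (3 * PT + 6 * (n * n) + 8 * n + 22) + 2 \<and> level_inv p s' \<and> loaded s')"
    if l: "loaded s" and i0: "level_inv 0 s" for s
  proof (rule wp_For[where N = p and I = level_inv and T = "\<lambda>_. ?T" and X = ?X and Y = ?W])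
    have reg: "level_inv it (set_reg 10 a s) = level_inv it s" for it a s by (simp add: level_inv_def fresh_from_def)
    show "level_inv 0 (set_reg 10 0 s)" using i0 reg by simp
    show "p < 2 ^ w" by (rule lessW'[OF bounds(10)])
    fix it s' assume ag: "agree ?X ?W s s'"
    have l': "loaded s'" by (rule loaded_agree[OF l ag]) auto
    then show "ok (Var 5) s' \<and> ev (Var 5) s' = p" by (simp add: loaded_def)
    assume it: "it < p" "fst s' 10 = it" and inv: "level_inv it s'"
    show "wp (level mr P) s' (\<lambda>s' t. t \<le> ?T \<and> level_inv (Suc it) (set_reg 10 (Suc it) s'))"
      unfolding reg by (rule level_correct[OF l' it inv])
  next
    fix s' t assume ag: "agree ?X ?W s s'" and t: "t \<le> (\<Sum>i<p. ?T + 2) + 2" and inv: "level_inv p s'"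
    have "loaded s'" by (rule loaded_agree[OF l ag]) auto
    moreover have "(\<Sum>i<p. ?T + 2) = p * (3 * PT + 6 * (n * n) + 8 * n + 22)" by (simp add: algebra_simps)
    then have "t \<le> p * (3 * PT + 6 * (n * n) + 8 * n + 22) + 2" using t by (simp only:)
    ultimately show "t \<le> p * (3 * PT + 6 * (n * n) + 8 * n + 22) + 2 \<and> level_inv p s' \<and> loaded s'"
      using inv by blast
  qed (use ml in auto)
  show ?thesis unfolding main_def
  proof (rule wp_Seq, rule wp_conseq[OF load_correct[OF regs(1-5) inp]], assumption)
    fix s1 t1 assume ag1: "agree (modified load) (written load) s0 s1" and h1: "t1 \<le> n * (4 * D + 4) + 5 \<and> loaded s1"
    have z1: "snd s1 (tg, r) = 0" if "tg \<noteq> 0" "tg \<noteq> 1" for tg r using agree_cell[OF ag1, of tg] zero that by simp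
    \<comment> \<open>With all \<open>p\<close> bits dropped the product is zero, so the untouched
      array 6 already holds the predecessor of the first level.\<close>
    have "cm p i j = 0" if "i < n" "j < n" for i j
      using scaled_min_le[OF D0, of F p i j] F_less[of 0 i 0] F_less[of 1 j 0] that D0 by simp
    then have inv0: "level_inv 0 s1" unfolding level_inv_def fresh_from_def
      using z1 agree_reg[OF ag1, of 24] regs(6) by auto
    show "wp (For 10 (Var 5) (level mr P) ;; emit) s1 (\<lambda>s t. t1 + t \<le> main_time \<and>
      (\<forall>i<n. \<forall>j<n. snd s (0, 0, 0, 0, i * n + j) = nat (take_bit w (min_plus D A B i j))))"
    proof (rule wp_Seq, rule wp_conseq[OF lev[OF conjunct2[OF h1] inv0]], elim conjE)
      fix s2 t2 assume t2: "t2 \<le> p * (3 * PT + 6 * (n * n) + 8 * n + 22) + 2" and inv: "level_inv p s2" and l2: "loaded s2"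
      have res: "snd s2 (6, i, j, 0, 0) = cm 0 i j" if "i < n" "j < n" for i j
        using inv that by (simp add: level_inv_def)
      show "wp emit s2 (\<lambda>s t. t1 + (t2 + t) \<le> main_time \<and>
        (\<forall>i<n. \<forall>j<n. snd s (0, 0, 0, 0, i * n + j) = nat (take_bit w (min_plus D A B i j))))"
      proof (rule wp_conseq[OF emit_correct[OF l2 res]], assumption+, elim conjE, intro conjI)
        fix s3 t3 assume "t3 \<le> n * (3 * n + 4) + 2"
        then show "t1 + (t2 + t3) \<le> main_time"
          unfolding main_time_def by (intro add_mono conjunct1[OF h1] t2)
      qed
    qed
  qed
qed

text \<open>The two halves of the program are compiled together but analysed under different
  assumptions: \<open>prepare\<close> runs before register 0 holds the base, and \<open>main\<close>
  relies on it. \<open>T\<close> may exceed the actual running time, because a halted machine stays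
  where it is.\<close>

theorem program_correct:
  defines "prog \<equiv> comp_com (41 + mr) 0 (prepare c q K k ;; main mr P)"
  defines "slow \<equiv> slowdown (41 + mr) (prepare c q K k) + slowdown (41 + mr) (main mr P)"
  assumes T: "slow * (3 * w + 20 + main_time) \<le> T"
  shows "halted prog ((step w prog ^^ T) (initial_state w (min_plus_input n D A B)))"
    "i < n * n \<Longrightarrow> decode w (memory ((step w prog ^^ T) (initial_state w (min_plus_input n D A B))) i) =
       min_plus_output n D A B ! i"
proof -
  let ?xs = "min_plus_input n D A B" and ?r = "41 + mr"
  let ?c1 = "prepare c q K k" and ?c2 = "main mr P"
  define H0 where "H0 = (\<lambda>(tg :: nat, a :: nat, b :: nat, c' :: nat, d' :: nat). if tg = 0 \<and> a = 0 \<and> b = 0 \<and> c' = 0 \<and> d' < length ?xs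
     then nat (take_bit w (?xs ! d')) else 0)"
  let ?s0 = "(\<lambda>_. 0, H0) :: store"
  have len: "length ?xs < Z" using bounds(19) by (simp add: length_min_plus_input)
  have rel0: "rel ?r ?s0 (snd (initial_state w ?xs))"
    unfolding rel_def
  proof (intro conjI allI impI)
    fix i assume sm: "small i"
    obtain tg a b c' d' where i: "i = (tg, a, b, c', d')" by (cases i)
    show "snd (snd (initial_state w ?xs)) (enc i) = snd ?s0 i"
    proof (cases "tg = 0 \<and> a = 0 \<and> b = 0 \<and> c' = 0")
      case True
      then show ?thesis by (simp add: i enc_def H0_def initial_state_def)
    next
      case False
      \<comment> \<open>Any other small index has a nonzero digit above the last, hence an address
        of at least \<open>Z\<close>, beyond the input.\<close>
      have Zp: "Z * 1 \<le> Z * x" if "0 < x" for x :: nat using that by (intro mult_left_mono) auto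
      have "0 < ((tg * Z + a) * Z + b) * Z + c'" using False bounds(1) by auto
      from Zp[OF this] have "Z \<le> enc i" by (simp add: i enc_def mult.commute trans_le_add1)
      then have "\<not> enc i < length ?xs" using len by linarith
      then show ?thesis using False by (auto simp: i H0_def initial_state_def)
    qed
  qed (simp add: initial_state_def)
  have P1: "prog = [] @ comp_com ?r (length ([]::instr list)) ?c1 @ comp_com ?r (comp_len ?r ?c1) ?c2"
    by (simp add: prog_def)
  have P2: "prog = comp_com ?r 0 ?c1 @ comp_com ?r (length (comp_com ?r 0 ?c1)) ?c2 @ []"
    by (simp add: prog_def)
  obtain t1 s1 where s1: "big_step ?c1 ?s0 t1 s1" "t1 \<le> 3 * w + 20" "snd s1 = H0"
    "fst s1 0 = Z" "fst s1 3 = g" "fst s1 5 = p" "fst s1 6 = off" "fst s1 7 = M" "fst s1 8 = mask v" "fst s1 24 = 0"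
    using prepare_correct[of ?s0] unfolding wp_def by auto
  have v1: "com_vars ?c1 \<subseteq> {..<?r}" using com_vars_prepare[of c q K k] by auto
  obtain RM1 where R1: "rel ?r s1 RM1"
    "reaches prog (slowdown ?r ?c1 * t1) (0, snd (initial_state w ?xs)) (comp_len ?r ?c1, RM1)"
    using comp_com_correct[OF s1(1) P1 rel0 v1] com_arrays_prepare[of c q K k] by auto
  have inp: "snd s1 (0, 0, 0, 0, a) = nat (take_bit w (?xs ! a))" if "a < 2 + 2 * (n * D)" for a
    using that s1(3) by (simp add: H0_def length_min_plus_input)
  have zero: "snd s1 (tg, r) = 0" if "tg \<noteq> 0" for tg r
    using that s1(3) by (cases r) (simp add: H0_def)
  obtain t2 s2 where s2: "big_step ?c2 s1 t2 s2" "t2 \<le> main_time"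
    "\<forall>i<n. \<forall>j<n. snd s2 (0, 0, 0, 0, i * n + j) = nat (take_bit w (min_plus D A B i j))"
    using main_correct[OF s1(5-10) inp zero] unfolding wp_def by auto
  have v2: "com_vars ?c2 \<subseteq> {..<?r}" using com_vars_main[of P mr] regs by auto
  obtain RM2 where R2: "rel ?r s2 RM2"
    "reaches prog (slowdown ?r ?c2 * t2) (comp_len ?r ?c1, RM1) (comp_len ?r ?c1 + comp_len ?r ?c2, RM2)"
    using comp_com_correct[OF s2(1) P2 R1(1) v2] s1(4) modified_main[of mr P] by auto
  have lenP: "length prog = comp_len ?r ?c1 + comp_len ?r ?c2" by (simp add: prog_def)
  have init: "initial_state w ?xs = (0, snd (initial_state w ?xs))" by (simp add: initial_state_def)
  have "reaches prog (slowdown ?r ?c1 * t1 + slowdown ?r ?c2 * t2) (initial_state w ?xs) (length prog, RM2)"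
    using reaches_trans[OF R1(2) R2(2)] init lenP by simp
  moreover have "slowdown ?r ?c1 * t1 + slowdown ?r ?c2 * t2 \<le> T"
  proof -
    have "slowdown ?r ?c1 * t1 + slowdown ?r ?c2 * t2 \<le>
       slowdown ?r ?c1 * (3 * w + 20 + main_time) + slowdown ?r ?c2 * (3 * w + 20 + main_time)"
      using s1(2) s2(2) by (intro add_mono mult_left_mono) auto
    also have "\<dots> = slow * (3 * w + 20 + main_time)" by (simp add: slow_def algebra_simps)
    finally show ?thesis using T by linarith
  qed
  ultimately have "reaches prog T (initial_state w ?xs) (length prog, RM2)" by (rule reaches_mono)
  then obtain t where t: "t \<le> T" "(step w prog ^^ t) (initial_state w ?xs) = (length prog, RM2)"
    unfolding reaches_def by blast
  have stay: "(step w prog ^^ k) (length prog, RM2) = (length prog, RM2)" for k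
    by (induction k) (auto simp: step_def halted_def)
  have "(step w prog ^^ T) (initial_state w ?xs) = (step w prog ^^ ((T - t) + t)) (initial_state w ?xs)" using t by simp
  also have "\<dots> = (length prog, RM2)" unfolding funpow_add comp_apply t(2) by (rule stay)
  finally have fin: "(step w prog ^^ T) (initial_state w ?xs) = (length prog, RM2)" .
  show "halted prog ((step w prog ^^ T) (initial_state w ?xs))" unfolding fin by (simp add: halted_def)
  assume i: "i < n * n"
  define x y where "x = i div n" and "y = i mod n"
  have xy: "i = x * n + y" "y < n" "x < n" using i n0 by (auto simp: x_def y_def div_less_iff_less_mult)
  have iZ: "i < Z"
  proof -
    have "n * n \<le> N * N" by (intro mult_mono) (auto simp: N_def)
    then show ?thesis using i bounds(16) by linarith
  qed
  have "small (0, 0, 0, 0, i)" using iZ by (simp add: small_def)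
  then have "snd RM2 (enc (0, 0, 0, 0, i)) = snd s2 (0, 0, 0, 0, i)" using R2(1) unfolding rel_def by blast
  then have mem: "memory (length prog, RM2) i = nat (take_bit w (min_plus D A B x y))"
    using s2(3) xy by (simp add: memory_def enc_def)
  have "\<bar>min_plus D A B x y\<bar> < 2 ^ (w - 1)"
  proof -
    have e: "min_plus D A B x y = int (cm 0 x y) - 2 * int off" using min_plus_eq[OF xy(3,2)] by simp
    have "cm 0 x y < 2 * 2 ^ p" using cm_less xy by blast
    moreover have "2 * 2 ^ p \<le> M" "2 * off < M" by (simp_all add: M_def off_def p_def power_add)
    ultimately have "\<bar>min_plus D A B x y\<bar> < int M" using e by linarith
    also have "int M < int Z" using bounds(8) by simp
    also have "int Z \<le> 2 ^ (w - 1)"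
    proof -
      have "K * L \<le> w - 1" using K0 L0 by (simp add: w_def)
      then show ?thesis unfolding Z_def by simp
    qed
    finally show ?thesis .
  qed
  then show "decode w (memory ((step w prog ^^ T) (initial_state w ?xs)) i) = min_plus_output n D A B ! i"
    unfolding fin mem using decode_word[OF _ bounds(18)] nth_min_plus_output[OF xy(3,2)] xy(1) by simp
qed

end

subsection \<open>Word sizes and constants\<close>

definition lg :: "nat \<Rightarrow> nat" where
  "lg n = nat \<lceil>log 2 (real n + 2)\<rceil>"

lemma word_size_eq: "word_size k n = k * lg n"
  by (simp add: word_size_def lg_def)

lemma of_nat_lg: "real (lg n) = of_int \<lceil>log 2 (real n + 2)\<rceil>"
proof -
  have "0 \<le> log 2 (real n + 2)" by simp
  then have "0 \<le> \<lceil>log 2 (real n + 2)\<rceil>" by linarith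
  then show ?thesis by (simp add: lg_def)
qed

lemma log_le_lg: "log 2 (real n + 2) \<le> real (lg n)"
  unfolding of_nat_lg by (rule le_of_int_ceiling)

lemma lg_less_log: "real (lg n) < log 2 (real n + 2) + 1"
  unfolding of_nat_lg using ceiling_correct[of "log 2 (real n + 2)"] by linarith

lemma real_le_two_power_lg: "real n + 2 \<le> 2 ^ lg n"
proof -
  have "real n + 2 = 2 powr log 2 (real n + 2)" by simp
  also have "\<dots> \<le> 2 powr real (lg n)" using log_le_lg by (intro powr_mono) auto
  finally show ?thesis by (simp add: powr_realpow)
qed

lemma le_two_power_lg: "n + 2 \<le> 2 ^ lg n"
proof -
  have "real (n + 2) \<le> real (2 ^ lg n)" using real_le_two_power_lg[of n] by simp
  then show ?thesis by (simp only: of_nat_le_iff)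
qed

lemma two_power_lg_le: "2 ^ lg n \<le> 2 * n + 4"
proof -
  have "(2::real) ^ lg n = 2 powr real (lg n)" by (simp add: powr_realpow)
  also have "\<dots> \<le> 2 powr (log 2 (real n + 2) + 1)" using lg_less_log[of n] by (intro powr_mono) auto
  also have "\<dots> = (real n + 2) * 2" by (simp add: powr_add)
  finally have "real (2 ^ lg n) \<le> real (2 * n + 4)" by simp
  then show ?thesis by (simp only: of_nat_le_iff)
qed

text \<open>This is why the graph has six isolated nodes in addition to its four layers.\<close>

lemma lg_scale: "lg (4 * n + 6) = lg n + 2"
proof -
  have "log 2 (real (4 * n + 6) + 2) = log 2 (4 * (real n + 2))" by (simp add: algebra_simps)
  also have "\<dots> = log 2 (2 ^ 2) + log 2 (real n + 2)" by (subst log_mult) auto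
  also have "\<dots> = log 2 (real n + 2) + of_int 2" by (subst log_nat_power) auto
  finally have "\<lceil>log 2 (real (4 * n + 6) + 2)\<rceil> = \<lceil>log 2 (real n + 2)\<rceil> + 2" by (simp only: ceiling_add_of_int)
  then have "real (lg (4 * n + 6)) = real (lg n + 2)" by (simp only: of_nat_lg) (simp add: of_nat_lg)
  then show ?thesis by (simp only: of_nat_eq_iff)
qed

lemma lg_ge_2: "1 \<le> n \<Longrightarrow> 2 \<le> lg n"
proof (rule ccontr)
  assume n: "1 \<le> n" and "\<not> 2 \<le> lg n"
  then have "(2::nat) ^ lg n \<le> 2 ^ 1" by (intro power_increasing) auto
  then show False using le_two_power_lg[of n] n by simp
qed

text \<open>The estimates compare \<open>K\<close> with 100, \<open>c + 5\<close>,
  \<open>6 * c + 22\<close>, \<open>3 * c + 8\<close> and \<open>2 * k\<close>, and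
  \<open>122 + 6 * c + 2 * k\<close> exceeds them all. The summand \<open>a\<close> makes room for
  the constants of a given program.\<close>

lemma constants_fit:
  fixes n c q k K L a :: nat
  assumes L: "2 \<le> L" "n + 2 \<le> 2 ^ L" and K: "122 + 6 * c + 2 * k + a \<le> K"
  shows "0 < K" "\<And>b. b \<le> K \<Longrightarrow> b < 2 ^ (K * L)" "5 * K < 2 ^ (K * L)" "100 < (2::nat) ^ (K * L)" "k * (L + 2) < K * L"
    "1 + (4 * n + 6) + (4 * n + 6) * (4 * n + 6) < 2 ^ (K * L)"
    "64 * 2 ^ (c * L + 2) < (2::nat) ^ (K * L)" "6 * (c * L + 2) + 10 < 2 ^ (K * L)"
    "3 * (c * L + 2) * (2 ^ (L div q) * 2 ^ (L div q)) < (2::nat) ^ (K * L)"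
proof -
  show "0 < K" using K by simp
  have KL: "b * L \<le> K * L" if "b \<le> K" for b using that by simp
  have exp: "b < (2::nat) ^ e" if "b \<le> e" for b e :: nat using that less_exp[of b] order.strict_trans2 by (metis le_less_trans less_exp)
  show base: "b < 2 ^ (K * L)" if "b \<le> K" for b
  proof (rule exp)
    have "b * 1 \<le> K * L" using that L by (intro mult_mono) auto
    then show "b \<le> K * L" by simp
  qed
  show "100 < (2::nat) ^ (K * L)" using base[of 100] K by simp
  have "(5::nat) \<le> 2 ^ K" using exp[of 5 K] K by simp
  then have "5 * K < 2 ^ K * 2 ^ K" by (intro mult_le_less_imp_less) auto
  also have "\<dots> = 2 ^ (K * 2)" by (simp add: power_add[symmetric] mult_2_right)
  also have "\<dots> \<le> 2 ^ (K * L)" using L by (intro power_increasing mult_left_mono) auto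
  finally show "5 * K < 2 ^ (K * L)" .
  have "k * (L + 2) \<le> k * (2 * L)" using L by (intro mult_left_mono) auto
  also have "\<dots> = (2 * k) * L" by simp
  also have "\<dots> < K * L" using K L by (intro mult_strict_right_mono) auto
  finally show "k * (L + 2) < K * L" .
  have four: "(4::nat) \<le> 2 ^ L" using power_increasing[of 2 L "2::nat"] L by simp
  let ?N = "4 * n + 6"
  have "?N \<le> 4 * 2 ^ L" using L by simp
  also have "\<dots> \<le> 2 ^ L * 2 ^ L" using four by (rule mult_right_mono) simp
  finally have N: "?N \<le> 2 ^ L * 2 ^ L" .
  have "1 + ?N + ?N * ?N < 4 * (?N * ?N)" by (simp add: algebra_simps)
  also have "\<dots> \<le> 2 ^ L * ((2 ^ L * 2 ^ L) * (2 ^ L * 2 ^ L))" using N four by (intro mult_mono) auto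
  also have "\<dots> = 2 ^ (5 * L)" by (simp add: power_add[symmetric])
  also have "\<dots> \<le> 2 ^ (K * L)" using KL[of 5] K by (intro power_increasing) auto
  finally show "1 + ?N + ?N * ?N < 2 ^ (K * L)" .
  have "c * L + 8 < (c + 5) * L" using L by (simp add: algebra_simps)
  also have "\<dots> \<le> K * L" using K by (intro KL) auto
  finally have "(2::nat) ^ (c * L + 8) < 2 ^ (K * L)" by simp
  then show "64 * 2 ^ (c * L + 2) < (2::nat) ^ (K * L)" by (simp add: power_add)
  have "6 * (c * L + 2) + 10 \<le> (6 * c + 22) * L" using L by (simp add: algebra_simps)
  also have "\<dots> \<le> K * L" using K by (intro KL) auto
  finally show "6 * (c * L + 2) + 10 < 2 ^ (K * L)" by (rule exp)
  have g: "(2::nat) ^ (L div q) \<le> 2 ^ L" by (intro power_increasing div_le_dividend) auto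
  have "3 * (c * L + 2) \<le> (3 * c + 6) * L" using L by (simp add: algebra_simps)
  then have "3 * (c * L + 2) < 2 ^ ((3 * c + 6) * L)" by (rule exp)
  then have "3 * (c * L + 2) * (2 ^ (L div q) * 2 ^ (L div q)) < 2 ^ ((3 * c + 6) * L) * (2 ^ L * 2 ^ L)"
    using g by (intro mult_less_le_imp_less mult_mono) auto
  also have "\<dots> = 2 ^ ((3 * c + 8) * L)" by (simp add: power_add[symmetric] algebra_simps)
  also have "\<dots> \<le> 2 ^ (K * L)" using K by (intro power_increasing KL) auto
  finally show "3 * (c * L + 2) * (2 ^ (L div q) * 2 ^ (L div q)) < (2::nat) ^ (K * L)" .
qed

lemma instr_regs_bounded: "\<exists>m. \<forall>i\<in>set P. instr_regs i \<subseteq> {..<m}"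
proof -
  have "finite (instr_regs i)" for i by (cases i) auto
  then have "finite (\<Union>i\<in>set P. instr_regs i)" by simp
  then obtain m where "\<forall>x\<in>(\<Union>i\<in>set P. instr_regs i). x < m" using finite_nat_set_iff_bounded by blast
  then show ?thesis by (intro exI[of _ m]) auto
qed

lemma no_negative_cycle_nonneg: "(\<And>v. 0 \<le> wt v) \<Longrightarrow> no_negative_cycle E wt"
  unfolding no_negative_cycle_def path_weight_def by (auto intro!: sum_list_nonneg)

text \<open>Each path from 0 to 1 has a second node, which already contributes \<open>W\<close>, and
  the single edge contributes nothing more.\<close>

lemma distance_edge:
  fixes W :: int
  assumes "0 \<le> W"
  shows "distance {(0, 1), (1, 0)} (\<lambda>_. W) 0 1 = Some W"
proof -
  let ?P = "paths {(0, 1), (1, 0)} 0 1"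
  have p: "[0, 1] \<in> ?P" by (simp add: paths_def)
  have "W \<le> path_weight (\<lambda>_. W) xs" if P: "xs \<in> ?P" for xs
  proof -
    obtain zs where zs: "xs = 0 # zs" using P by (cases xs) (auto simp: paths_def)
    then obtain y ys where xs: "xs = 0 # y # ys" using P by (cases zs) (auto simp: paths_def)
    have "0 \<le> (\<Sum>v\<leftarrow>ys. W)" using assms by (intro sum_list_nonneg) auto
    then show ?thesis by (simp add: xs path_weight_def)
  qed
  moreover have "W \<in> path_weight (\<lambda>_. W) ` ?P" using p by (intro image_eqI[OF _ p]) (simp add: path_weight_def)
  ultimately have "(INF p\<in>?P. path_weight (\<lambda>_. W) p) = W" by (intro cInf_eq_minimum) auto
  then show ?thesis using p unfolding distance_def by auto
qed

text \<open>An exact solver must be able to write down the largest edge weight, so its word size cannot be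
  too small.\<close>

lemma solver_word_size:
  assumes N: "2 \<le> N"
    and solver: "\<And>E wt. undirected_graph N E \<Longrightarrow> (\<And>v. \<bar>wt v\<bar> \<le> int N ^ c) \<Longrightarrow> no_negative_cycle E wt \<Longrightarrow>
      \<exists>m. \<forall>i<N * N. decode v (m E wt i) = apsp_output N E wt ! i"
  shows "N ^ c < 2 ^ (v - 1)"
proof -
  let ?E = "{(0, 1), (1, 0::nat)}" and ?wt = "\<lambda>_::nat. int N ^ c"
  have "undirected_graph N ?E"
    using N by (auto simp: undirected_graph_def directed_graph_def irrefl_def sym_def)
  moreover have "no_negative_cycle ?E ?wt" by (rule no_negative_cycle_nonneg) simp
  ultimately obtain m :: "(nat \<times> nat) set \<Rightarrow> (nat \<Rightarrow> int) \<Rightarrow> nat \<Rightarrow> nat"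
    where m: "\<forall>i<N * N. decode v (m ?E ?wt i) = apsp_output N ?E ?wt ! i"
    using solver[of ?E ?wt] by auto
  have "2 * 1 \<le> N * N" using N by (intro mult_mono) auto
  then have "decode v (m ?E ?wt 1) = apsp_output N ?E ?wt ! (0 * N + 1)" using m by simp
  also have "\<dots> = Some (int N ^ c)" using N distance_edge[of "int N ^ c"] by (subst nth_apsp_output) auto
  finally have "int N ^ c = signed_take_bit (v - 1) (int (m ?E ?wt 1))" by (auto simp: decode_def split: if_splits)
  also have "\<dots> < 2 ^ (v - 1)" by (rule signed_take_bit_int_less_exp)
  finally have "int (N ^ c) < int (2 ^ (v - 1))" by simp
  then show ?thesis by (simp only: of_nat_less_iff)
qed

subsection \<open>Growth rates\<close>

definition growth :: "(nat \<Rightarrow> nat) \<Rightarrow> real \<Rightarrow> bool" where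
  "growth f a \<longleftrightarrow> (\<lambda>n. real (f n)) \<in> O(\<lambda>n. real n powr a)"

lemma growthI: "(\<And>n. 1 \<le> n \<Longrightarrow> real (f n) \<le> C * real n powr a) \<Longrightarrow> growth f a"
  unfolding growth_def
  by (intro bigoI[where c = C] eventually_mono[OF eventually_ge_at_top[of 1]]) simp

lemma powr_bigo_mono: "a \<le> b \<Longrightarrow> (\<lambda>n::nat. real n powr a) \<in> O(\<lambda>n. real n powr b)"
  by (intro bigoI[where c = 1] eventually_mono[OF eventually_ge_at_top[of 1]]) (auto intro: powr_mono)

lemma growth_mono: "growth f a \<Longrightarrow> a \<le> b \<Longrightarrow> growth f b"
  unfolding growth_def using powr_bigo_mono landau_o.big_trans by blast

lemma growth_add: "growth f e \<Longrightarrow> growth g e \<Longrightarrow> growth (\<lambda>n. f n + g n) e"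
  unfolding growth_def of_nat_add by (rule sum_in_bigo)

lemma growth_mult: "growth f a \<Longrightarrow> growth g b \<Longrightarrow> a + b \<le> e \<Longrightarrow> growth (\<lambda>n. f n * g n) e"
proof -
  assume "growth f a" "growth g b" and e: "a + b \<le> e"
  then have "(\<lambda>n. real (f n) * real (g n)) \<in> O(\<lambda>n. real n powr a * real n powr b)"
    unfolding growth_def by (intro landau_o.big.mult)
  then have "growth (\<lambda>n. f n * g n) (a + b)" by (simp add: growth_def powr_add)
  then show ?thesis using e by (rule growth_mono)
qed

lemma growth_const: "0 \<le> e \<Longrightarrow> growth (\<lambda>_. k) e"
proof (rule growthI[where C = "real k"])
  fix n :: nat assume "0 \<le> e" "1 \<le> n"
  then have "1 \<le> real n powr e" by (intro ge_one_powr_ge_zero) auto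
  then show "real k \<le> real k * real n powr e" using mult_left_mono[of 1 "real n powr e" "real k"] by simp
qed

lemma growth_scale: "growth f e \<Longrightarrow> growth (\<lambda>n. k * f n) e" "growth f e \<Longrightarrow> growth (\<lambda>n. f n * k) e"
  by (rule growth_mult[OF growth_const[OF order_refl]], assumption, simp)
    (rule growth_mult[OF _ growth_const[OF order_refl]], assumption, simp)

lemma growth_id: "1 \<le> e \<Longrightarrow> growth (\<lambda>n. n) e"
  by (rule growth_mono[where a = 1], rule growthI[where C = 1]) auto

lemma growth_lg:
  assumes a: "0 < a"
  shows "growth lg a"
proof (rule growthI)
  fix n :: nat assume n: "1 \<le> n"
  have "real (lg n) \<le> log 2 (real n + 2) + 1" using lg_less_log[of n] by simp
  also have "log 2 (real n + 2) \<le> log 2 (3 * real n)" using n by (intro log_mono) auto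
  also have "\<dots> = ln (3 * real n) / ln 2" by (simp add: log_def)
  also have "\<dots> \<le> ((3 * real n) powr a / a) / ln 2" using n a by (intro divide_right_mono ln_powr_bound) auto
  also have "(3 * real n) powr a = 3 powr a * real n powr a" by (simp add: powr_mult)
  also have "3 powr a * real n powr a / a / ln 2 + 1 \<le> 3 powr a * real n powr a / a / ln 2 + real n powr a"
    using n a by (intro add_left_mono ge_one_powr_ge_zero) auto
  also have "\<dots> = (3 powr a / a / ln 2 + 1) * real n powr a" by (simp add: field_simps)
  finally show "real (lg n) \<le> (3 powr a / a / ln 2 + 1) * real n powr a" by simp
qed

lemma growth_floor: "growth (\<lambda>n. nat \<lfloor>real n powr a\<rfloor>) a"
  by (rule growthI[where C = 1]) (simp add: of_nat_floor)

text \<open>The base grows from \<open>n\<close> to at most \<open>10 * n\<close>, which costs a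
  constant factor; monotonicity of the power in its base uses that the exponent is
  non-negative.\<close>

lemma growth_rescale:
  assumes f: "(\<lambda>n. real (f n)) \<in> O(\<lambda>n. real n powr a)" and a: "0 \<le> a"
  shows "growth (\<lambda>n. f (4 * n + 6)) a"
proof -
  have "filterlim (\<lambda>n::nat. 4 * n + 6) at_top at_top"
    by (rule filterlim_at_top_mono[OF filterlim_ident]) auto
  from landau_o.big.compose[OF f this]
  have "(\<lambda>n. real (f (4 * n + 6))) \<in> O(\<lambda>n. real (4 * n + 6) powr a)" .
  also have "(\<lambda>n::nat. real (4 * n + 6) powr a) \<in> O(\<lambda>n. real n powr a)"
  proof (intro bigoI[where c = "10 powr a"] eventually_mono[OF eventually_ge_at_top[of 1]])
    fix n :: nat assume "1 \<le> n"
    then have "real (4 * n + 6) powr a \<le> (10 * real n) powr a" using a by (intro powr_mono2) auto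
    then show "norm (real (4 * n + 6) powr a) \<le> 10 powr a * norm (real n powr a)" by (simp add: powr_mult)
  qed
  finally show ?thesis by (simp add: growth_def)
qed

lemma real_div_bounds: "real (a div b) \<le> real a / real b" "real a / real b \<le> real (a div b) + 1"
  using floor_correct[of "real a / real b"] floor_divide_of_nat_eq[of a b, where 'a = real]
  by (simp_all add: less_imp_le)

text \<open>\<open>2 ^ (lg n div q)\<close> can be computed by a shift and stays within constant
  factors of the \<open>q\<close>-th root of \<open>n\<close>: rounding the exponent down costs a
  factor 2, and \<open>2 ^ lg n \<le> 6 * n\<close> a factor of at most 6.\<close>

lemma root_lg_bounds:
  assumes q: "0 < q" and n: "1 \<le> n"
  shows "real n powr (1 / real q) \<le> 2 * 2 ^ (lg n div q)" "2 ^ (lg n div q) \<le> 6 * real n powr (1 / real q)"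
proof -
  have u: "real (lg n) / real q \<le> real (lg n div q) + 1" by (rule real_div_bounds(2))
  have "real n powr (1 / real q) \<le> (2 ^ lg n) powr (1 / real q)"
  proof (rule powr_mono2)
    show "real n \<le> 2 ^ lg n" using real_le_two_power_lg[of n] by linarith
  qed auto
  also have "\<dots> = 2 powr (real (lg n) / real q)" by (simp add: powr_realpow[symmetric] powr_powr)
  also have "\<dots> \<le> 2 powr (real (lg n div q) + 1)" using u by (intro powr_mono) auto
  also have "\<dots> = 2 * 2 ^ (lg n div q)" by (simp add: powr_add powr_realpow)
  finally show "real n powr (1 / real q) \<le> 2 * 2 ^ (lg n div q)" .
  have "real (lg n div q) \<le> real (lg n) / real q" by (rule real_div_bounds(1))
  then have "2 powr real (lg n div q) \<le> 2 powr (real (lg n) / real q)" by (intro powr_mono) auto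
  also have "\<dots> = (2 ^ lg n) powr (1 / real q)" by (simp add: powr_realpow[symmetric] powr_powr)
  also have "\<dots> \<le> (6 * real n) powr (1 / real q)"
  proof (intro powr_mono2)
    have "real (2 ^ lg n) \<le> real (2 * n + 4)" using two_power_lg_le by (simp only: of_nat_le_iff)
    then show "(2::real) ^ lg n \<le> 6 * real n" using n by simp
  qed auto
  also have "\<dots> = 6 powr (1 / real q) * real n powr (1 / real q)" by (simp add: powr_mult)
  also have "\<dots> \<le> 6 powr 1 * real n powr (1 / real q)" using q by (intro mult_right_mono powr_mono) auto
  finally show "2 ^ (lg n div q) \<le> 6 * real n powr (1 / real q)" by (simp add: powr_realpow)
qed

lemma growth_root: "0 < q \<Longrightarrow> growth (\<lambda>n. 2 ^ (lg n div q)) (1 / real q)"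
  by (rule growthI[where C = 6]) (use root_lg_bounds(2) in simp)

lemma growth_quotient:
  assumes q: "0 < q"
  shows "growth (\<lambda>n. n * nat \<lfloor>real n powr x\<rfloor> div 2 ^ (lg n div q)) (1 + x - 1 / real q)"
proof (rule growthI[where C = 2])
  fix n :: nat assume n: "1 \<le> n"
  have "real (n * nat \<lfloor>real n powr x\<rfloor> div 2 ^ (lg n div q)) \<le> real (n * nat \<lfloor>real n powr x\<rfloor>) / real (2 ^ (lg n div q))"
    by (rule real_div_bounds(1))
  also have "\<dots> \<le> (real n * real n powr x) / (real n powr (1 / real q) / 2)"
    using n root_lg_bounds(1)[OF q n] by (intro frac_le) (auto simp: of_nat_floor)
  also have "\<dots> = 2 * real n powr (1 + x - 1 / real q)"
    using n by (simp add: powr_diff powr_add)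
  finally show "real (n * nat \<lfloor>real n powr x\<rfloor> div 2 ^ (lg n div q)) \<le> 2 * real n powr (1 + x - 1 / real q)" .
qed

text \<open>Let \<open>r = 1 / q\<close>. The term \<open>n * n * d\<close> has exponent
  \<open>3 - x\<close>, admissible since \<open>r \<le> 2 * x - 1\<close>, and
  \<open>n * (n * D / g)\<close> has exponent \<open>2 + x - r\<close>. A call costs
  \<open>n * n\<close> for the graph plus the time of the solver; \<open>3 * r \<le> x\<close> and
  \<open>3 * r \<le> \<epsilon>\<close> bound its exponent by \<open>2 + x - 3 * r\<close>, which
  leaves \<open>2 * r\<close> for the factor \<open>g * g\<close>.\<close>

lemma growth_phase_time:
  fixes x \<epsilon> :: real
  assumes x: "1 / 2 < x" "x < 1" and \<epsilon>: "0 < \<epsilon>" "\<epsilon> \<le> 1"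
    and q: "0 < q" "3 / real q \<le> \<epsilon>" "3 / real q \<le> x" "1 / real q \<le> 2 * x - 1"
    and T: "(\<lambda>n. real (T n)) \<in> O(\<lambda>n. real n powr (2 + x - \<epsilon>))"
  shows "growth (\<lambda>n. phase_time n (nat \<lfloor>real n powr x\<rfloor>) (2 ^ (lg n div q)) (nat \<lfloor>real n powr (1 - x)\<rfloor>) mr P (T (4 * n + 6)))
    (2 + x - 1 / real q)"
proof -
  let ?D = "\<lambda>n. nat \<lfloor>real n powr x\<rfloor>" and ?d = "\<lambda>n. nat \<lfloor>real n powr (1 - x)\<rfloor>" and ?g = "\<lambda>n. 2 ^ (lg n div q) :: nat"
  define r where "r = 1 / real q"
  have r: "0 < r" "3 * r \<le> \<epsilon>" "3 * r \<le> x" "r \<le> 2 * x - 1" using q by (simp_all add: r_def)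
  let ?e = "2 + x - r"
  have D: "growth ?D x" and d: "growth ?d (1 - x)" by (rule growth_floor)+
  have g: "growth ?g r" and Q: "growth (\<lambda>n. n * ?D n div ?g n) (1 + x - r)"
    unfolding r_def by (rule growth_root[OF q(1)], rule growth_quotient[OF q(1)])
  have TT: "growth (\<lambda>n. T (4 * n + 6)) (2 + x - \<epsilon>)" by (rule growth_rescale[OF T]) (use x \<epsilon> in simp)
  note scale = growth_add growth_const growth_scale
  have id: "growth (\<lambda>n. n) 1" by (rule growth_id) simp
  have sq: "growth (\<lambda>n. n * n) 2" by (rule growth_mult[OF id id]) simp
  have C: "growth (\<lambda>n. call_time n mr P (T (4 * n + 6))) (?e - 2 * r)"
    unfolding call_time_def by (intro scale growth_mono[OF sq] growth_mono[OF id] growth_mono[OF TT]) (use x \<epsilon> r in auto)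
  have "growth (\<lambda>n. ?D n * 10 + 4) x" by (intro scale D) (use x in auto)
  from growth_mult[OF id this] have "growth (\<lambda>n. n * (?D n * 10 + 4)) ?e" using x r by simp
  then have 1: "growth (\<lambda>n. 2 * (n * (?D n * 10 + 4) + 2)) ?e" by (intro scale) (use x r in auto)
  have "growth (\<lambda>n. 14 * ?d n + 10) (1 - x)" by (intro scale d) (use x in auto)
  from growth_mult[OF id this] have "growth (\<lambda>n. n * (14 * ?d n + 10)) (?e - 1)" using x r by simp
  then have "growth (\<lambda>n. n * (14 * ?d n + 10) + 6 * (n * ?D n div ?g n) + 12) (?e - 1)"
    by (intro scale growth_mono[OF Q]) (use x r in auto)
  from growth_mult[OF id this] have "growth (\<lambda>n. n * (n * (14 * ?d n + 10) + 6 * (n * ?D n div ?g n) + 12)) ?e" by simp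
  then have 2: "growth (\<lambda>n. 2 * (n * (n * (14 * ?d n + 10) + 6 * (n * ?D n div ?g n) + 12) + 4)) ?e"
    by (intro scale) (use x r in auto)
  have "growth (\<lambda>n. call_time n mr P (T (4 * n + 6)) + 2) (?e - 2 * r)" by (intro scale C) (use x r in auto)
  from growth_mult[OF g this] have "growth (\<lambda>n. ?g n * (call_time n mr P (T (4 * n + 6)) + 2)) (?e - r)" by simp
  then have "growth (\<lambda>n. ?g n * (call_time n mr P (T (4 * n + 6)) + 2) + 4) (?e - r)" by (intro scale) (use x r in auto)
  from growth_mult[OF g this] have "growth (\<lambda>n. ?g n * (?g n * (call_time n mr P (T (4 * n + 6)) + 2) + 4)) ?e" by simp
  then have 3: "growth (\<lambda>n. ?g n * (?g n * (call_time n mr P (T (4 * n + 6)) + 2) + 4) + 2) ?e" by (intro scale) (use x r in auto)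
  show ?thesis unfolding phase_time_def r_def[symmetric] by (intro growth_add 1 2 3)
qed

text \<open>The \<open>c * lg n + 2\<close> scaling levels cost a factor that the second half of \<open>1 / q\<close> absorbs.\<close>

lemma growth_total_time:
  fixes x \<epsilon> :: real
  assumes x: "1 / 2 < x" "x < 1" and \<epsilon>: "0 < \<epsilon>" "\<epsilon> \<le> 1"
    and q: "0 < q" "3 / real q \<le> \<epsilon>" "3 / real q \<le> x" "1 / real q \<le> 2 * x - 1"
    and T: "(\<lambda>n. real (T n)) \<in> O(\<lambda>n. real n powr (2 + x - \<epsilon>))"
    and D: "D = (\<lambda>n. nat \<lfloor>real n powr x\<rfloor>)" and d: "d = (\<lambda>n. nat \<lfloor>real n powr (1 - x)\<rfloor>)"
  shows "growth (\<lambda>n. sl * (3 * (5 * K * lg n) + 20 + ((n * (4 * D n + 4) + 5) +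
      (((c * lg n + 2) * (3 * phase_time n (D n) (2 ^ (lg n div q)) (d n) mr P (T (4 * n + 6)) + 6 * (n * n) + 8 * n + 22) + 2) +
       (n * (3 * n + 4) + 2))))) (2 + x - 1 / (2 * real q))"
proof -
  define r where "r = 1 / (2 * real q)"
  have r2: "1 / real q = 2 * r" by (simp add: r_def)
  have r: "0 < r" "6 * r \<le> \<epsilon>" "6 * r \<le> x" "2 * r \<le> 2 * x - 1" using q by (simp_all add: r_def field_simps)
  let ?e = "2 + x - r"
  note scale = growth_add growth_const growth_scale
  have id: "growth (\<lambda>n. n) 1" by (rule growth_id) simp
  have sq: "growth (\<lambda>n. n * n) 2" by (rule growth_mult[OF id id]) simp
  have PT: "growth (\<lambda>n. phase_time n (D n) (2 ^ (lg n div q)) (d n) mr P (T (4 * n + 6))) (2 + x - 2 * r)"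
    unfolding D d r2[symmetric] by (rule growth_phase_time[OF x \<epsilon> q T])
  have l: "growth lg r" by (rule growth_lg[OF r(1)])
  have "growth (\<lambda>n. c * lg n + 2) r" by (intro scale l) (use r in auto)
  moreover have "growth (\<lambda>n. 3 * phase_time n (D n) (2 ^ (lg n div q)) (d n) mr P (T (4 * n + 6)) + 6 * (n * n) + 8 * n + 22)
    (2 + x - 2 * r)" by (intro scale PT growth_mono[OF sq] growth_mono[OF id]) (use x r in auto)
  ultimately have 2: "growth (\<lambda>n. (c * lg n + 2) *
     (3 * phase_time n (D n) (2 ^ (lg n div q)) (d n) mr P (T (4 * n + 6)) + 6 * (n * n) + 8 * n + 22)) ?e"
    by (rule growth_mult) simp
  have "growth D x" unfolding D by (rule growth_floor)
  then have "growth (\<lambda>n. 4 * D n + 4) x" by (intro scale) (use x in auto)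
  from growth_mult[OF id this] have 1: "growth (\<lambda>n. n * (4 * D n + 4)) ?e" using x r by simp
  have "growth (\<lambda>n. 3 * n + 4) 1" by (intro scale id) auto
  from growth_mult[OF id this] have 3: "growth (\<lambda>n. n * (3 * n + 4)) ?e" using x r by simp
  show ?thesis unfolding r_def[symmetric]
    by (intro scale 1 2 3 growth_mono[OF l]) (use x r in auto)
qed

subsection \<open>The reduction\<close>

lemma solvable_in_time_subset: "solvable_in_time Q f \<Longrightarrow> Q' \<subseteq> Q \<Longrightarrow> solvable_in_time Q' f"
  unfolding solvable_in_time_def by (metis (no_types, lifting) subsetD)

lemma apsp_undirected_subset: "node_weighted_apsp undirected_graph c \<subseteq> node_weighted_apsp directed_graph c"
  unfolding node_weighted_apsp_def undirected_graph_def by blast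

lemma solvable_in_time_mono:
  assumes "solvable_in_time Q (\<lambda>n. real n powr a)" "a \<le> b"
  shows "solvable_in_time Q (\<lambda>n. real n powr b)"
proof -
  have "g \<in> O(\<lambda>n. real n powr b)" if "g \<in> O(\<lambda>n. real n powr a)" for g :: "nat \<Rightarrow> real"
    using that powr_bigo_mono[OF assms(2)] by (rule landau_o.big_trans)
  then show ?thesis using assms(1) unfolding solvable_in_time_def by meson
qed

text \<open>The solver is used for the exponent \<open>c + 2\<close>: two more powers of the number
  of nodes pay for the constant factor by which node weights exceed the bound on the
  entries.\<close>

lemma reduction_instance:
  fixes x :: real
  assumes n: "1 \<le> n" and x: "0 < x" "x < 1" and q: "0 < q" and k: "1 \<le> k"
    and D: "D = nat \<lfloor>real n powr x\<rfloor>" and d: "d = nat \<lfloor>real n powr (1 - x)\<rfloor>"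
    and A: "\<forall>i<n. \<forall>k<D. \<bar>A i k\<bar> \<le> int n ^ c" "\<forall>i<n. real (card ((\<lambda>k. A i k) ` {..<D})) \<le> real n powr (1 - x)"
    and B: "\<forall>k<D. \<forall>j<n. \<bar>B k j\<bar> \<le> int n ^ c" "\<forall>j<n. real (card ((\<lambda>k. B k j) ` {..<D})) \<le> real n powr (1 - x)"
    and mr: "\<forall>i\<in>set P. instr_regs i \<subseteq> {..<mr}"
    and K: "K = 122 + 6 * c + 2 * k + (q + length P + sum_list (map instr_const P))"
    and solver: "\<And>E wt. undirected_graph (4 * n + 6) E \<Longrightarrow> \<forall>v<4 * n + 6. \<bar>wt v\<bar> \<le> int (4 * n + 6) ^ (c + 2) \<Longrightarrow> no_negative_cycle E wt \<Longrightarrow>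
      halted P ((step (k * (lg n + 2)) P ^^ TT) (initial_state (k * (lg n + 2)) (apsp_input (4 * n + 6) E wt))) \<and>
      (\<forall>i<(4 * n + 6) * (4 * n + 6). decode (k * (lg n + 2)) (memory ((step (k * (lg n + 2)) P ^^ TT)
         (initial_state (k * (lg n + 2)) (apsp_input (4 * n + 6) E wt))) i) = apsp_output (4 * n + 6) E wt ! i)"
  shows "reduction n D c q K k mr (lg n) d TT P A B"
proof -
  let ?L = "lg n" and ?N = "4 * n + 6"
  note cf = constants_fit[of ?L n c k "q + length P + sum_list (map instr_const P)" K, OF lg_ge_2[OF n] le_two_power_lg eq_refl[OF K[symmetric]]]
  have n1: "1 \<le> real n" using n by simp
  have "1 \<le> real n powr x" using n1 x by (intro ge_one_powr_ge_zero) auto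
  then have D0: "0 < D" unfolding D by linarith
  have Dr: "real D \<le> real n powr x" and dr: "real d \<le> real n powr (1 - x)" unfolding D d by (simp_all add: of_nat_floor)
  have "real n powr x \<le> real n powr 1" using n1 x by (intro powr_mono) auto
  then have "real D \<le> real n" using Dr n1 by simp
  then have Dn: "D \<le> n" by simp
  have "real d * real D \<le> real n powr (1 - x) * real n powr x" using Dr dr by (intro mult_mono) auto
  also have "\<dots> = real n" using n1 by (simp add: powr_add[symmetric])
  finally have "real (d * D) \<le> real n" by simp
  then have dD: "d * D \<le> n" by (simp only: of_nat_le_iff)
  have "n \<le> 2 ^ ?L" using le_two_power_lg[of n] by simp
  then have "n ^ c \<le> (2 ^ ?L) ^ c" by (rule power_mono) simp
  then have "int (n ^ c) \<le> int (2 ^ (c * ?L))" by (simp only: of_nat_le_iff power_mult[symmetric] mult.commute)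
  then have nc: "int n ^ c \<le> 2 ^ (c * ?L)" by simp
  have "2 ^ ?L \<le> ?N" using two_power_lg_le[of n] by simp
  then have "(2 ^ ?L) ^ c \<le> ?N ^ c" by (rule power_mono) simp
  moreover have "10 * 10 \<le> ?N * ?N" using n by (intro mult_mono) auto
  then have "96 \<le> ?N ^ 2" by (simp add: power2_eq_square)
  \<comment> \<open>\<open>96 * 2 ^ (c * L)\<close> is \<open>3 * M\<close>, as
    \<open>M = 8 * 2 ^ (c * L + 2)\<close>; the factor 96 is at most the square of the number of
    nodes, which is at least 10.\<close>
  ultimately have "96 * (2 ^ ?L) ^ c \<le> ?N ^ 2 * ?N ^ c" by (intro mult_mono) auto
  then have W: "96 * 2 ^ (c * ?L) \<le> ?N ^ (c + 2)" by (simp only: power_mult[symmetric] power_add mult.commute)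
  \<comment> \<open>The word size constant \<open>k\<close> of the solver is arbitrary; a lower
    bound on its word size is extracted from its exactness on the largest admissible weight.\<close>
  have v: "?N ^ (c + 2) < 2 ^ (k * (?L + 2) - 1)"
  proof (rule solver_word_size)
    fix E :: "(nat \<times> nat) set" and wt :: "nat \<Rightarrow> int"
    assume h: "undirected_graph ?N E" "\<And>v. \<bar>wt v\<bar> \<le> int ?N ^ (c + 2)" "no_negative_cycle E wt"
    have "\<forall>v<?N. \<bar>wt v\<bar> \<le> int ?N ^ (c + 2)" using h(2) by blast
    from solver[OF h(1) this h(3)]
    show "\<exists>m. \<forall>i<?N * ?N. decode (k * (?L + 2)) (m E wt i) = apsp_output ?N E wt ! i"
      by (intro exI[of _ "\<lambda>E wt. memory ((step (k * (?L + 2)) P ^^ TT) (initial_state (k * (?L + 2)) (apsp_input ?N E wt)))"]) blast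
  qed simp
  show ?thesis
  proof
    show "0 < n" "0 < D" "D \<le> n" "n + 2 \<le> 2 ^ ?L" "0 < q" "0 < ?L" "0 < k" "d * D \<le> n"
      using n D0 Dn le_two_power_lg[of n] q k dD lg_ge_2[OF n] by auto
    show "0 < K" by (rule cf(1))
    show "\<bar>A i k\<bar> \<le> 2 ^ (c * ?L)" if "i < n" "k < D" for i k using A(1) nc that order_trans by blast
    show "\<bar>B k j\<bar> \<le> 2 ^ (c * ?L)" if "k < D" "j < n" for k j using B(1) nc that order_trans by blast
    show "card ((\<lambda>k. A i k) ` {..<D}) \<le> d" if "i < n" for i using A(2) that unfolding d by (intro le_nat_floor) auto
    show "card ((\<lambda>k. B k j) ` {..<D}) \<le> d" if "j < n" for j using B(2) that unfolding d by (intro le_nat_floor) auto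
    show "instr_regs i \<subseteq> {..<mr}" if "i \<in> set P" for i using mr that by blast
    show "instr_const i < 2 ^ (K * ?L)" if "i \<in> set P" for i
    proof (rule cf(2))
      have "instr_const i \<le> sum_list (map instr_const P)" using that by (intro member_le_sum_list) auto
      then show "instr_const i \<le> K" unfolding K by linarith
    qed
    show "length P < 2 ^ (K * ?L)" "c < 2 ^ (K * ?L)" "q < 2 ^ (K * ?L)" "k < 2 ^ (K * ?L)"
      by (rule cf(2), simp add: K)+
    show "3 * (8 * 2 ^ (c * ?L + 2)) < (2::nat) ^ (k * (?L + 2) - 1)" using W v by (simp add: power_add)
    have "?N ^ 1 \<le> ?N ^ (c + 2)" by (intro power_increasing) auto
    also have "\<dots> < 2 ^ (k * (?L + 2) - 1)" by (rule v)
    also have "\<dots> \<le> 2 ^ (k * (?L + 2))" by (intro power_increasing) auto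
    finally show "?N < 2 ^ (k * (?L + 2))" by simp
    fix E and wt :: "nat \<Rightarrow> nat"
    assume h: "undirected_graph ?N E" "\<And>x. wt x \<le> 8 * 2 ^ (c * ?L + 2)" "no_negative_cycle E (\<lambda>x. int (wt x))"
    have "wt x \<le> ?N ^ (c + 2)" for x using h(2)[of x] W by (simp add: power_add)
    then have "int (wt x) \<le> int (?N ^ (c + 2))" for x by (simp only: of_nat_le_iff)
    then have "\<forall>x<?N. \<bar>int (wt x)\<bar> \<le> int ?N ^ (c + 2)" by simp
    from solver[OF h(1) this h(3)]
    show "halted P ((step (k * (?L + 2)) P ^^ TT) (initial_state (k * (?L + 2)) (apsp_input ?N E (\<lambda>x. int (wt x))))) \<and>
       (\<forall>i<?N * ?N. decode (k * (?L + 2)) (memory ((step (k * (?L + 2)) P ^^ TT) (initial_state (k * (?L + 2)) (apsp_input ?N E (\<lambda>x. int (wt x))))) i) =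
          apsp_output ?N E (\<lambda>x. int (wt x)) ! i)" .
  qed (rule cf)+
qed

text \<open>The exponent depends on \<open>q\<close> but not on \<open>c\<close>, which enters only
  the constants of the program and of its running time.\<close>

lemma row_weight_min_plus_solvable:
  fixes x \<epsilon> :: real
  assumes x: "1 / 2 < x" "x < 1" and \<epsilon>: "0 < \<epsilon>" "\<epsilon> \<le> 1"
    and q: "0 < q" "3 / real q \<le> \<epsilon>" "3 / real q \<le> x" "1 / real q \<le> 2 * x - 1"
    and apsp: "solvable_in_time (node_weighted_apsp undirected_graph (c + 2)) (\<lambda>n. real n powr (2 + x - \<epsilon>))"
  shows "solvable_in_time (row_weight_min_plus (\<lambda>n. real n powr (1 - x)) (\<lambda>n. real n powr x) c)
    (\<lambda>n. real n powr (2 + x - 1 / (2 * real q)))"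
proof -
  obtain P k T where k: "1 \<le> k" and T: "(\<lambda>n. real (T n)) \<in> O(\<lambda>n. real n powr (2 + x - \<epsilon>))"
    and P: "\<forall>(n, xs, ys) \<in> node_weighted_apsp undirected_graph (c + 2).
       let w = word_size k n; s = (step w P ^^ T n) (initial_state w xs)
       in halted P s \<and> (\<forall>i < length ys. decode w (memory s i) = ys ! i)"
    using apsp unfolding solvable_in_time_def by blast
  obtain mr where mr: "\<forall>i\<in>set P. instr_regs i \<subseteq> {..<mr}" using instr_regs_bounded by blast
  define K where "K = 122 + 6 * c + 2 * k + (q + length P + sum_list (map instr_const P))"
  define D where "D = (\<lambda>n::nat. nat \<lfloor>real n powr x\<rfloor>)"
  define d where "d = (\<lambda>n::nat. nat \<lfloor>real n powr (1 - x)\<rfloor>)"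
  define sl where "sl = word_machine.slowdown (41 + mr) (prepare c q K k) + word_machine.slowdown (41 + mr) (main mr P)"
  define prog where "prog = comp_com (41 + mr) 0 (prepare c q K k ;; main mr P)"
  define T' where "T' n = sl * (3 * (5 * K * lg n) + 20 + ((n * (4 * D n + 4) + 5) +
      (((c * lg n + 2) * (3 * phase_time n (D n) (2 ^ (lg n div q)) (d n) mr P (T (4 * n + 6)) + 6 * (n * n) + 8 * n + 22) + 2) +
       (n * (3 * n + 4) + 2))))" for n
  have "growth T' (2 + x - 1 / (2 * real q))"
    unfolding T'_def by (rule growth_total_time[OF x \<epsilon> q T D_def d_def])
  moreover have "halted prog ((step (word_size (5 * K) n) prog ^^ T' n) (initial_state (word_size (5 * K) n) xs)) \<and>
      (\<forall>i<length ys. decode (word_size (5 * K) n) (memory ((step (word_size (5 * K) n) prog ^^ T' n)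
         (initial_state (word_size (5 * K) n) xs)) i) = ys ! i)"
    if inst: "(n, xs, ys) \<in> row_weight_min_plus (\<lambda>n. real n powr (1 - x)) (\<lambda>n. real n powr x) c" for n xs ys
  proof -
    obtain A B where n: "1 \<le> n" and io: "xs = min_plus_input n (D n) A B" "ys = min_plus_output n (D n) A B"
      and AB: "\<forall>i<n. \<forall>k<D n. \<bar>A i k\<bar> \<le> int n ^ c" "\<forall>k<D n. \<forall>j<n. \<bar>B k j\<bar> \<le> int n ^ c"
        "\<forall>i<n. real (card ((\<lambda>k. A i k) ` {..<D n})) \<le> real n powr (1 - x)"
        "\<forall>j<n. real (card ((\<lambda>k. B k j) ` {..<D n})) \<le> real n powr (1 - x)"
      using inst unfolding row_weight_min_plus_def D_def by blast
    have Nw: "word_size k (4 * n + 6) = k * (lg n + 2)" by (simp only: word_size_eq lg_scale)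
    have red: "reduction n (D n) c q K k mr (lg n) (d n) (T (4 * n + 6)) P A B"
    proof (rule reduction_instance[OF n _ x(2) q(1) k fun_cong[OF D_def] fun_cong[OF d_def] AB(1,3,2,4) mr K_def])
      show "0 < x" using x by simp
      fix E and wt :: "nat \<Rightarrow> int"
      assume "undirected_graph (4 * n + 6) E" "\<forall>v<4 * n + 6. \<bar>wt v\<bar> \<le> int (4 * n + 6) ^ (c + 2)" "no_negative_cycle E wt"
      then have "(4 * n + 6, apsp_input (4 * n + 6) E wt, apsp_output (4 * n + 6) E wt)
          \<in> node_weighted_apsp undirected_graph (c + 2)" unfolding node_weighted_apsp_def by fastforce
      from P[rule_format, OF this]
      show "halted P ((step (k * (lg n + 2)) P ^^ T (4 * n + 6)) (initial_state (k * (lg n + 2)) (apsp_input (4 * n + 6) E wt))) \<and>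
        (\<forall>i<(4 * n + 6) * (4 * n + 6). decode (k * (lg n + 2)) (memory ((step (k * (lg n + 2)) P ^^ T (4 * n + 6))
           (initial_state (k * (lg n + 2)) (apsp_input (4 * n + 6) E wt))) i) = apsp_output (4 * n + 6) E wt ! i)"
        unfolding Let_def case_prod_conv Nw length_apsp_output .
    qed
    interpret reduction n "D n" c q K k mr "lg n" "d n" "T (4 * n + 6)" P A B by (rule red)
    have w: "word_size (5 * K) n = w" by (simp add: word_size_eq w_def)
    have T': "(slowdown (41 + mr) (prepare c q K k) + slowdown (41 + mr) (main mr P)) * (3 * w + 20 + main_time) \<le> T' n"
      unfolding T'_def sl_def main_time_def w_def p_def g_def by (rule order_refl)
    show ?thesis unfolding w io prog_def length_min_plus_output using program_correct[OF T'] by blast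
  qed
  ultimately show ?thesis unfolding solvable_in_time_def growth_def Let_def
    by (intro exI[of _ prog] exI[of _ "5 * K"] exI[of _ T']) (auto simp: K_def)
qed

theorem theorem6p10:
  fixes x :: real
  assumes "1 / 2 < x" and "x < 1"
    and "\<exists>\<epsilon>>0.
           poly_bounded_solvable_in_time (node_weighted_apsp directed_graph)
             (\<lambda>n. real n powr (2 + x - \<epsilon>)) \<or>
           poly_bounded_solvable_in_time (node_weighted_apsp undirected_graph)
             (\<lambda>n. real n powr (2 + x - \<epsilon>))"
  shows "\<exists>\<epsilon>'>0.
           poly_bounded_solvable_in_time
             (row_weight_min_plus (\<lambda>n. real n powr (1 - x)) (\<lambda>n. real n powr x))
             (\<lambda>n. real n powr (2 + x - \<epsilon>'))"
proof -
  from assms(3) obtain e where e: "e > 0"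
    and "\<forall>c. solvable_in_time (node_weighted_apsp undirected_graph c) (\<lambda>n. real n powr (2 + x - e))"
    unfolding poly_bounded_solvable_in_time_def using solvable_in_time_subset[OF _ apsp_undirected_subset] by blast
  \<comment> \<open>Capping the saving at 1 keeps the exponent \<open>2 + x - \<epsilon>\<close>
    non-negative, as the passage from \<open>n\<close> to \<open>4 * n + 6\<close> nodes
    requires.\<close>
  then have apsp: "solvable_in_time (node_weighted_apsp undirected_graph c) (\<lambda>n. real n powr (2 + x - min e 1))" for c
    using solvable_in_time_mono[where a = "2 + x - e" and b = "2 + x - min e 1"] by simp
  \<comment> \<open>The three terms are the requirements that the growth estimate makes on
    \<open>1 / q\<close>; \<open>2 * x - 1\<close> is positive because
    \<open>x > 1 / 2\<close>.\<close>
  define m where "m = min (min e 1 / 3) (min (x / 3) (2 * x - 1))"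
  have m: "0 < m" using e assms(1,2) by (simp add: m_def)
  obtain q :: nat where "1 / m < real q" using reals_Archimedean2 by blast
  moreover have "0 < 1 / m" using m by simp
  ultimately have q0: "0 < real q" by linarith
  then have qm: "1 / real q \<le> m" using m \<open>1 / m < real q\<close> by (simp add: field_simps)
  \<comment> \<open>\<open>q\<close> is fixed before \<open>c\<close>, so one saving serves all
    polynomial bounds on the entries.\<close>
  have "poly_bounded_solvable_in_time (row_weight_min_plus (\<lambda>n. real n powr (1 - x)) (\<lambda>n. real n powr x))
      (\<lambda>n. real n powr (2 + x - 1 / (2 * real q)))"
    unfolding poly_bounded_solvable_in_time_def
  proof
    fix c
    show "solvable_in_time (row_weight_min_plus (\<lambda>n. real n powr (1 - x)) (\<lambda>n. real n powr x) c)
      (\<lambda>n. real n powr (2 + x - 1 / (2 * real q)))"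
      by (rule row_weight_min_plus_solvable[OF assms(1,2) _ _ _ _ _ _ apsp[of "c + 2"]]) (use e q0 qm in \<open>auto simp: m_def\<close>)
  qed
  then show ?thesis using q0 by (intro exI[of _ "1 / (2 * real q)"]) auto
qed

end
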